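(* Let $X$ be an ergodic continuous-time birth-and-death chain on $\{0, \dots, d\}$ with generator $G$ and $X(0)=0$. Let $\nu_0 \ge \nu_1 \ge \dots \ge \nu_{d-1} > \nu_d = 0$ be the eigenvalues of $-G$, and let $\widehat{\Lambda}$ be the $(d+1)\times(d+1)$ matrix whose $k$th row ($0\le k\le d$) is row $0$ of $$Q_k := \nu_0^{-1}\cdots\nu_{k-1}^{-1}(G+\nu_0 I)\cdots(G+\nu_{k-1}I),\qquad Q_0:=I.$$ Construct a process $\widehat{X}$ from $X$ and independent randomness as follows. Set $\widehat{X}(0)=0$, $\tau_0:=0$. For $n\ge1$, suppose $\widehat X$ has been constructed up through the epoch $\tau_{n-1}$ of the $(n-1)$st transition of the bivariate process $(\widehat{X},X)$, and write $(\hat{x},x)=(\widehat{X}(\tau_{n-1}),X(\tau_{n-1}))$. Let $\widehat{V}_n$ be exponentially distributed with rate $r=\nu_{\hat{x}}\,\widehat{\Lambda}(\hat{x}+1,x)/\widehat{\Lambda}(\hat{x},x)$, independent of $\widehat{V}_1,\dots,\widehat{V}_{n-1}$ and of $X$ (if $\hat{x}=d$, then $r=0$ and $\widehat{V}_n=\infty$). (i) If the waiting time from $\tau_{n-1}$ until the next transition of $X$ is smaller than $\widehat{V}_n$, then $\tau_n$ is the epoch of this next transition of $X$, and $\widehat{X}(\tau_n)=\hat{x}$, except that if $X(\tau_n)=\hat{x}+1$ then $\widehat{X}(\tau_n)=\hat{x}+1$. (ii) If $\widehat{V}_n$ is smaller, then $\tau_n=\tau_{n-1}+\widehat{V}_n$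 and $\widehat{X}(\tau_n)=\hat{x}+1$. ($\widehat{X}$ is constant on each $[\tau_{n-1},\tau_n)$.) Then $\widehat{\Lambda}(\widehat{X}(\tau_n),X(\tau_n))>0$ (hence $X(\tau_n)\le\widehat{X}(\tau_n)$) for all $n$; $\widehat{X}$ is a Markov chain with the pure-birth generator $\widehat{G}$ having birth rate $\nu_i$ at state $i$, $0\le i\le d$; its absorption time $\widehat{T}$ in state $d$ is a fastest strong stationary time for $X$; and the waiting times between successive births of $\widehat{X}$ are independent exponential random variables, with rates $\nu_0,\dots,\nu_{d-1}$, whose sum is $\widehat{T}$.
   Context: A continuous-time birth-and-death chain on $\{0,\dots,d\}$ has a tridiagonal generator $G$; ergodic means irreducible. Let $\pi$ be its stationary distribution. Eigenvalues are listed with multiplicity. A strong stationary time for $X$ is an a.s. finite randomized stopping time $T$ for $X$ (that is, a stopping time with respect to some filtration to which $X$ is adapted and with respect to which $X$ is Markov with generator $G$) such that $X(T)$ has distribution $\pi$ and is independent of $T$; it is fastest if it is stochastically minimal among all strong stationary times for the chain with generator $G$ started at $0$. *)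

theory Defs
  imports "HOL-Probability.Probability" "Jordan_Normal_Form.Char_Poly"
begin

section \<open>Generators\<close>

definition bd_generator :: "nat \<Rightarrow> real mat \<Rightarrow> bool" where
  "bd_generator d G \<longleftrightarrow>
     G \<in> carrier_mat (d + 1) (d + 1) \<and>
     (\<forall>i\<le>d. \<forall>j\<le>d. i \<noteq> j \<longrightarrow> 0 \<le> G $$ (i, j)) \<and>
     (\<forall>i\<le>d. (\<Sum>j\<le>d. G $$ (i, j)) = 0) \<and>
     (\<forall>i\<le>d. \<forall>j\<le>d. j > i + 1 \<or> i > j + 1 \<longrightarrow> G $$ (i, j) = 0)"

definition irreducible_generator :: "nat \<Rightarrow> real mat \<Rightarrow> bool" where
  "irreducible_generator d G \<longleftrightarrow>
     (\<forall>i\<le>d. \<forall>j\<le>d. (i, j) \<in> {(k, l). k \<le> d \<and> l \<le> d \<and> 0 < G $$ (k, l)}\<^sup>*)"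

definition stationary_distribution :: "nat \<Rightarrow> real mat \<Rightarrow> nat pmf \<Rightarrow> bool" where
  "stationary_distribution d G \<pi> \<longleftrightarrow>
     set_pmf \<pi> \<subseteq> {..d} \<and> (\<forall>j\<le>d. (\<Sum>i\<le>d. pmf \<pi> i * G $$ (i, j)) = 0)"

text \<open>The eigenvalues of \<open>-G\<close> with algebraic multiplicity,
  \<open>\<nu> 0 \<ge> \<nu> 1 \<ge> \<dots> \<ge> \<nu> (d - 1) > \<nu> d = 0\<close>.\<close>

definition eigenvalue_listing :: "nat \<Rightarrow> real mat \<Rightarrow> (nat \<Rightarrow> real) \<Rightarrow> bool" where
  "eigenvalue_listing d G \<nu> \<longleftrightarrow>
     char_poly (- G) = (\<Prod>i\<le>d. [:- \<nu> i, 1:]) \<and>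
     (\<forall>i<d. \<nu> (i + 1) \<le> \<nu> i) \<and> (0 < d \<longrightarrow> 0 < \<nu> (d - 1)) \<and> \<nu> d = 0"

definition pure_birth_generator :: "nat \<Rightarrow> (nat \<Rightarrow> real) \<Rightarrow> real mat" where
  "pure_birth_generator d \<nu> =
     Matrix.mat (d + 1) (d + 1)
       (\<lambda>(i, j). if j = i then - \<nu> i else if j = i + 1 then \<nu> i else 0)"

primrec Q_mat :: "nat \<Rightarrow> real mat \<Rightarrow> (nat \<Rightarrow> real) \<Rightarrow> nat \<Rightarrow> real mat" where
  "Q_mat d G \<nu> 0 = 1\<^sub>m (d + 1)"
| "Q_mat d G \<nu> (Suc k) =
     inverse (\<nu> k) \<cdot>\<^sub>m (Q_mat d G \<nu> k * (G + \<nu> k \<cdot>\<^sub>m 1\<^sub>m (d + 1)))"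

definition link :: "nat \<Rightarrow> real mat \<Rightarrow> (nat \<Rightarrow> real) \<Rightarrow> real mat" where
  "link d G \<nu> = Matrix.mat (d + 1) (d + 1) (\<lambda>(k, x). Q_mat d G \<nu> k $$ (0, x))"


section \<open>Continuous-time Markov chains\<close>

text \<open>Entry \<open>(i, j)\<close> of \<open>exp (t G)\<close>.\<close>

definition transition_prob :: "real mat \<Rightarrow> real \<Rightarrow> nat \<Rightarrow> nat \<Rightarrow> real" where
  "transition_prob G t i j = (\<Sum>n. t ^ n / fact n * (G ^\<^sub>m n) $$ (i, j))"

text \<open>Processes are functions of a real time parameter of which only \<open>t \<ge> 0\<close> matters.
  Filtrations are indexed by \<^typ>\<open>ennreal\<close> so that the library's \<^const>\<open>stopping_time\<close>
  covers stopping times with the value \<open>\<infinity>\<close>; the \<open>\<sigma>\<close>-algebra at index \<open>\<infinity>\<close> carries no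
  condition beyond monotonicity.  The topology on \<^typ>\<open>nat\<close> is discrete, so the paths below
  are right-continuous step functions with finitely many jumps in bounded time.\<close>

definition markov_chain_wrt ::
  "'a measure \<Rightarrow> (ennreal \<Rightarrow> 'a measure) \<Rightarrow> nat \<Rightarrow> real mat \<Rightarrow> (real \<Rightarrow> 'a \<Rightarrow> nat) \<Rightarrow> bool"
where
  "markov_chain_wrt M F d G X \<longleftrightarrow>
     prob_space M \<and>
     filtration (space M) F \<and> (\<forall>t. subalgebra M (F t)) \<and>
     (\<forall>t\<ge>0. X t \<in> F (ennreal t) \<rightarrow>\<^sub>M count_space UNIV) \<and>
     (\<forall>\<omega>\<in>space M. \<forall>t\<ge>0. X t \<omega> \<le> d) \<and>
     (\<forall>\<omega>\<in>space M. \<forall>t\<ge>0. continuous (at_right t) (\<lambda>s. X s \<omega>)) \<and>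
     (\<forall>\<omega>\<in>space M. \<forall>t>0. \<exists>l. ((\<lambda>s. X s \<omega>) \<longlongrightarrow> l) (at_left t)) \<and>
     (\<forall>s\<ge>0. \<forall>t\<ge>0. \<forall>j\<le>d. AE \<omega> in M.
        real_cond_exp M (F (ennreal s)) (indicator {\<omega> \<in> space M. X (s + t) \<omega> = j}) \<omega>
          = transition_prob G t (X s \<omega>) j)"

definition natural_filtration ::
  "'a measure \<Rightarrow> (real \<Rightarrow> 'a \<Rightarrow> nat) \<Rightarrow> ennreal \<Rightarrow> 'a measure" where
  "natural_filtration M X t =
     sigma (space M) {X s -` A \<inter> space M | s A. 0 \<le> s \<and> ennreal s \<le> t}"

definition markov_chain :: "'a measure \<Rightarrow> nat \<Rightarrow> real mat \<Rightarrow> (real \<Rightarrow> 'a \<Rightarrow> nat) \<Rightarrow> bool" where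
  "markov_chain M d G X \<longleftrightarrow> markov_chain_wrt M (natural_filtration M X) d G X"

definition hitting_time :: "(real \<Rightarrow> 'a \<Rightarrow> nat) \<Rightarrow> nat \<Rightarrow> 'a \<Rightarrow> ennreal" where
  "hitting_time X i \<omega> = (INF t\<in>{t. 0 \<le> t \<and> X t \<omega> = i}. ennreal t)"


section \<open>Strong stationary times\<close>

text \<open>\<open>X (enn2real (T \<omega>)) \<omega>\<close> is \<open>X(T)\<close> where \<open>T < \<infinity>\<close>, hence almost surely.\<close>

definition strong_stationary_time ::
  "'a measure \<Rightarrow> nat \<Rightarrow> real mat \<Rightarrow> nat pmf \<Rightarrow> (real \<Rightarrow> 'a \<Rightarrow> nat) \<Rightarrow> ('a \<Rightarrow> ennreal) \<Rightarrow> bool"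
where
  "strong_stationary_time M d G \<pi> X T \<longleftrightarrow>
     (\<exists>F. markov_chain_wrt M F d G X \<and> stopping_time F T) \<and>
     (AE \<omega> in M. T \<omega> < \<infinity>) \<and>
     distr M (count_space UNIV) (\<lambda>\<omega>. X (enn2real (T \<omega>)) \<omega>) = measure_pmf \<pi> \<and>
     prob_space.indep_var M borel T (count_space UNIV) (\<lambda>\<omega>. X (enn2real (T \<omega>)) \<omega>)"

text \<open>The competing times may live on any probability space; the type argument is the type of
  its sample points and is universally quantified where a theorem leaves it free.\<close>

definition fastest_strong_stationary_time ::
  "'b itself \<Rightarrow> 'a measure \<Rightarrow> nat \<Rightarrow> real mat \<Rightarrow> nat pmf \<Rightarrow> (real \<Rightarrow> 'a \<Rightarrow> nat) \<Rightarrow>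
     ('a \<Rightarrow> ennreal) \<Rightarrow> bool"
where
  "fastest_strong_stationary_time (_ :: 'b itself) M d G \<pi> X T \<longleftrightarrow>
     strong_stationary_time M d G \<pi> X T \<and>
     (\<forall>(M' :: 'b measure) X' T'.
        strong_stationary_time M' d G \<pi> X' T' \<and> (AE \<omega> in M'. X' 0 \<omega> = 0) \<longrightarrow>
        (\<forall>t\<ge>0. measure M {\<omega> \<in> space M. ennreal t < T \<omega>}
              \<le> measure M' {\<omega> \<in> space M'. ennreal t < T' \<omega>}))"


section \<open>The construction of the dual process\<close>

definition waiting_time :: "(real \<Rightarrow> 'a \<Rightarrow> nat) \<Rightarrow> real \<Rightarrow> 'a \<Rightarrow> ennreal" where
  "waiting_time X s \<omega> = (INF u\<in>{u. 0 < u \<and> X (s + u) \<omega> \<noteq> X s \<omega>}. ennreal u)"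

text \<open>The pair \<open>(\<tau>\<^sub>n, X^(\<tau>\<^sub>n))\<close>, as a function of the path of \<open>X\<close> and of the clocks
  \<open>V 1, V 2, \<dots>\<close> (\<open>V 0\<close> is not used).  The pair is frozen once \<open>\<tau>\<^sub>n = \<infinity>\<close>.  The last branch,
  \<open>W = V (Suc n)\<close>, covers the absence of any further transition (\<open>W = \<infinity>\<close>) and otherwise
  has probability zero.\<close>

primrec dual_step ::
  "(real \<Rightarrow> 'a \<Rightarrow> nat) \<Rightarrow> (nat \<Rightarrow> 'a \<Rightarrow> ennreal) \<Rightarrow> nat \<Rightarrow> 'a \<Rightarrow> ennreal \<times> nat"
where
  "dual_step X V 0 \<omega> = (0, 0)"
| "dual_step X V (Suc n) \<omega> =
     (case dual_step X V n \<omega> of (\<tau>, y) \<Rightarrow>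
        if \<tau> = \<infinity> then (\<infinity>, y)
        else let W = waiting_time X (enn2real \<tau>) \<omega> in
          if W < V (Suc n) \<omega>
            then (\<tau> + W, if X (enn2real (\<tau> + W)) \<omega> = y + 1 then y + 1 else y)
          else if V (Suc n) \<omega> < W then (\<tau> + V (Suc n) \<omega>, y + 1)
          else (\<tau> + W, y))"

definition epoch ::
  "(real \<Rightarrow> 'a \<Rightarrow> nat) \<Rightarrow> (nat \<Rightarrow> 'a \<Rightarrow> ennreal) \<Rightarrow> nat \<Rightarrow> 'a \<Rightarrow> ennreal" where
  "epoch X V n \<omega> = fst (dual_step X V n \<omega>)"

definition dual_state ::
  "(real \<Rightarrow> 'a \<Rightarrow> nat) \<Rightarrow> (nat \<Rightarrow> 'a \<Rightarrow> ennreal) \<Rightarrow> nat \<Rightarrow> 'a \<Rightarrow> nat" where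
  "dual_state X V n \<omega> = snd (dual_step X V n \<omega>)"

text \<open>The least \<open>n\<close> with \<open>t < \<tau>\<^sub>n\<^sub>+\<^sub>1\<close> also satisfies \<open>\<tau>\<^sub>n \<le> t\<close>.\<close>

definition dual_process ::
  "(real \<Rightarrow> 'a \<Rightarrow> nat) \<Rightarrow> (nat \<Rightarrow> 'a \<Rightarrow> ennreal) \<Rightarrow> real \<Rightarrow> 'a \<Rightarrow> nat" where
  "dual_process X V t \<omega> = dual_state X V (LEAST n. ennreal t < epoch X V (Suc n) \<omega>) \<omega>"

definition birth_rate :: "nat \<Rightarrow> real mat \<Rightarrow> (nat \<Rightarrow> real) \<Rightarrow> nat \<Rightarrow> nat \<Rightarrow> real" where
  "birth_rate d G \<nu> y x =
     (if y = d then 0 else \<nu> y * link d G \<nu> $$ (y + 1, x) / link d G \<nu> $$ (y, x))"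

text \<open>The \<open>\<sigma>\<close>-algebra generated by the whole process \<open>X\<close> and by \<open>V 1, \<dots>, V n\<close>.\<close>

definition clock_history ::
  "'a measure \<Rightarrow> (real \<Rightarrow> 'a \<Rightarrow> nat) \<Rightarrow> (nat \<Rightarrow> 'a \<Rightarrow> ennreal) \<Rightarrow> nat \<Rightarrow> 'a measure" where
  "clock_history M X V n =
     sigma (space M)
       ({X s -` A \<inter> space M | s A. 0 \<le> s} \<union>
        {V i -` B \<inter> space M | i B. 1 \<le> i \<and> i \<le> n \<and> B \<in> sets borel})"

text \<open>The rate of \<open>V (n + 1)\<close> is itself a function of \<open>X\<close> and \<open>V 1, \<dots>, V n\<close>.  Being
  exponential with that rate and independent of these variables therefore means that the
  conditional distribution given them is the exponential distribution with that rate.\<close>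

definition birth_clocks ::
  "'a measure \<Rightarrow> nat \<Rightarrow> real mat \<Rightarrow> (nat \<Rightarrow> real) \<Rightarrow> (real \<Rightarrow> 'a \<Rightarrow> nat) \<Rightarrow>
     (nat \<Rightarrow> 'a \<Rightarrow> ennreal) \<Rightarrow> bool"
where
  "birth_clocks M d G \<nu> X V \<longleftrightarrow>
     (\<forall>n. V (Suc n) \<in> borel_measurable M \<and>
        (\<forall>\<omega>\<in>space M. epoch X V n \<omega> < \<infinity> \<and> dual_state X V n \<omega> = d \<longrightarrow> V (Suc n) \<omega> = \<infinity>) \<and>
        (\<forall>t\<ge>0. AE \<omega> in M. epoch X V n \<omega> < \<infinity> \<longrightarrow>
           real_cond_exp M (clock_history M X V n)
             (indicator {\<omega> \<in> space M. ennreal t < V (Suc n) \<omega>}) \<omega>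
           = exp (- birth_rate d G \<nu> (dual_state X V n \<omega>)
                      (X (enn2real (epoch X V n \<omega>)) \<omega>) * t)))"

text \<open>Sojourn of \<open>Y\<close> in state \<open>i\<close>, for a process that moves from \<open>i\<close> to \<open>i + 1\<close>.\<close>

definition birth_wait :: "(real \<Rightarrow> 'a \<Rightarrow> nat) \<Rightarrow> nat \<Rightarrow> 'a \<Rightarrow> real" where
  "birth_wait Y i \<omega> = enn2real (hitting_time Y (i + 1) \<omega>) - enn2real (hitting_time Y i \<omega>)"

end

theory Submission
  imports Defs
begin

text \<open>Entry \<open>(k, x)\<close> of the link \<open>\<Lambda>\<close> is, up to a positive factor, the divided difference at
  \<open>-\<nu> k, \<dots>, -\<nu> d\<close> of the characteristic polynomial of the block of \<open>G\<close> on the last \<open>d - x\<close>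
  states.  The roots of these polynomials interlace, which gives the signs of the link.  Its
  rows are defined so that \<open>\<Lambda> G = G^ \<Lambda>\<close>, with \<open>G^\<close> the pure birth generator; therefore
  \<open>P (X^ t = y, X t = x) = P (X^ t = y) \<Lambda> (y, x)\<close>, also conditionally on the past of \<open>X^\<close>,
  and \<open>X^\<close> is Markov with generator \<open>G^\<close>.  The infinitesimal description of the pair is
  obtained from one step of a fine time grid: outside an event whose total probability over the
  grid tends to \<open>0\<close>, at most one transition occurs in a step.

  The last row of the link is \<open>\<pi>\<close>; hence, at the time \<open>T\<close> at which \<open>X^\<close> reaches \<open>d\<close>, the
  chain \<open>X\<close> has law \<open>\<pi>\<close> independently of \<open>T\<close>.  It is fastest because \<open>X \<le> X^\<close> turns
  \<open>P (T' \<le> t) \<pi> d \<le> P (X t = d)\<close>, valid for every strong stationary time \<open>T'\<close>, into an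
  equality for \<open>T\<close>.\<close>

section \<open>Divided differences\<close>

text \<open>The difficulty is that time is counted in two ways: the construction runs over epochs,
  with clocks that are exponential given \<open>X\<close> and the earlier clocks, while the claims
  are about fixed times. The bridge is the memoryless property at the random age of the running
  clock, used on each event that \<open>n\<close> transitions have occurred by time
  \<open>s\<close>. Since the clocks are conditioned on all of \<open>X\<close>, including its
  future, a short cell moves the dual chain by a kernel that sees \<open>X\<close> only at the two
  ends of the cell. This gives immersion: the past of the dual does not disturb the Markov property
  of \<open>X\<close>, and so the law of the pair obeys a closed linear equation. Cells with two
  transitions are negligible in total because the number of transitions up to a fixed time is
  integrable: at most \<open>d\<close> of them are births by a clock, and the jumps of
  \<open>X\<close> have finite mean. The birth rate is a quotient of link entries so that clock
  births produce exactly the states \<open>x \<le> y\<close> of row \<open>y + 1\<close>; the state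
  \<open>y + 1\<close> is supplied by \<open>X\<close> jumping there, hence the exception in the
  rule.\<close>

definition divdiff :: "('i \<Rightarrow> real) \<Rightarrow> (real \<Rightarrow> real) \<Rightarrow> 'i set \<Rightarrow> real" where
  "divdiff p f I = (\<Sum>i\<in>I. f (p i) / (\<Prod>j\<in>I - {i}. p i - p j))"

text \<open>Write \<open>p i - c\<close> as \<open>(p a - c) + (p i - p a)\<close>: in the second
  part the factor of the node \<open>a\<close> cancels from the denominator, which removes
  \<open>a\<close> from the node set.\<close>

lemma divdiff_Leibniz:
  assumes fin: "finite I" and inj: "inj_on p I" and a: "a \<in> I"
  shows "divdiff p (\<lambda>z. (z - c) * f z) I = (p a - c) * divdiff p f I + divdiff p f (I - {a})"
proof -
  have *: "(p i - c) * f (p i) / (\<Prod>j\<in>I - {i}. p i - p j)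
      = (p a - c) * (f (p i) / (\<Prod>j\<in>I - {i}. p i - p j))
        + (if i = a then 0 else f (p i) / (\<Prod>j\<in>I - {a} - {i}. p i - p j))" if i: "i \<in> I" for i
  proof (cases "i = a")
    case False
    have "(\<Prod>j\<in>I - {i}. p i - p j) = (p i - p a) * (\<Prod>j\<in>I - {a} - {i}. p i - p j)"
    proof -
      have "I - {i} = insert a (I - {a} - {i})" using a False by auto
      then show ?thesis using fin by (metis (no_types, lifting) Diff_iff finite_Diff insertI1 prod.insert)
    qed
    moreover have "p i - p a \<noteq> 0" using inj a i False by (auto dest: inj_onD)
    moreover have "(\<Prod>j\<in>I - {a} - {i}. p i - p j) \<noteq> 0"
      using fin inj i by (auto simp: prod_zero_iff dest: inj_onD)
    moreover have "(x - c) * w / ((x - y) * B) = (y - c) * (w / ((x - y) * B)) + w / B"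
      if "x - y \<noteq> 0" "B \<noteq> 0" for x y w B :: real
      using that by (simp add: divide_simps) (simp add: algebra_simps)
    ultimately show ?thesis using False by simp
  qed auto
  have "divdiff p (\<lambda>z. (z - c) * f z) I
      = (\<Sum>i\<in>I. (p a - c) * (f (p i) / (\<Prod>j\<in>I - {i}. p i - p j)))
        + (\<Sum>i\<in>I. if i = a then 0 else f (p i) / (\<Prod>j\<in>I - {a} - {i}. p i - p j))"
    unfolding divdiff_def sum.distrib[symmetric] by (intro sum.cong refl *)
  also have "(\<Sum>i\<in>I. if i = a then 0 else f (p i) / (\<Prod>j\<in>I - {a} - {i}. p i - p j))
      = divdiff p f (I - {a})"
    unfolding divdiff_def using fin a by (subst sum.remove[of _ a]) (auto intro!: sum.cong)
  finally show ?thesis by (simp add: divdiff_def sum_distrib_left)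
qed

text \<open>Expand the divided difference of the function \<open>z\<close> at two nodes
  \<open>a\<close> and \<open>b\<close> by the Leibniz rule. By induction the terms with one node
  removed agree, so \<open>p a - p b\<close> times the value is \<open>0\<close>.\<close>

lemma divdiff_one:
  assumes "finite I" "inj_on p I"
  shows "divdiff p (\<lambda>_. 1) I = (if card I = 1 then 1 else 0)"
  using assms
proof (induction "card I" arbitrary: I rule: less_induct)
  case less
  show ?case
  proof (cases "card I \<le> 1")
    case True
    then consider "I = {}" | a where "I = {a}"
      using less.prems(1) by (metis card_0_eq card_1_singletonE le_less less_one)
    then show ?thesis by cases (auto simp: divdiff_def)
  next
    case False
    then obtain a b where ab: "a \<in> I" "b \<in> I" "a \<noteq> b"
      by (metis card_le_Suc0_iff_eq less.prems(1) One_nat_def)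
    have "divdiff p (\<lambda>_. 1) (I - {a}) = divdiff p (\<lambda>_. 1) (I - {b})"
      using less.hyps[of "I - {a}"] less.hyps[of "I - {b}"] less.prems ab False
      by (auto simp: inj_on_diff card_Diff_singleton)
    moreover have "(p a - 0) * divdiff p (\<lambda>_. 1) I + divdiff p (\<lambda>_. 1) (I - {a})
      = (p b - 0) * divdiff p (\<lambda>_. 1) I + divdiff p (\<lambda>_. 1) (I - {b})"
      using divdiff_Leibniz[of I p a 0 "\<lambda>_. 1"] divdiff_Leibniz[of I p b 0 "\<lambda>_. 1"] less.prems ab
      by simp
    ultimately have "(p a - p b) * divdiff p (\<lambda>_. 1) I = 0" by (simp add: algebra_simps)
    moreover have "p a \<noteq> p b" using less.prems(2) ab by (auto dest: inj_onD)
    ultimately show ?thesis using False by simp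
  qed
qed

text \<open>A divided difference over \<open>m + 1\<close> nodes reads off the coefficient of degree
  \<open>m\<close> and kills lower degrees; the roots are split off one by one with the Leibniz
  rule.\<close>

lemma divdiff_monic:
  assumes "finite I" "inj_on p I" "m + 1 \<le> card I"
  shows "divdiff p (\<lambda>z. \<Prod>j<m. z - r j) I = (if card I = m + 1 then 1 else 0)"
  using assms
proof (induction m arbitrary: I)
  case 0
  then show ?case by (simp add: divdiff_one)
next
  case (Suc m)
  then have "I \<noteq> {}" by auto
  then obtain a where a: "a \<in> I" by blast
  have "(\<lambda>z. \<Prod>j<Suc m. z - r j) = (\<lambda>z. (z - r m) * (\<Prod>j<m. z - r j))" by (simp add: mult.commute)
  with divdiff_Leibniz[of I p a "r m" "\<lambda>z. \<Prod>j<m. z - r j"] Suc.IH[of I] Suc.IH[of "I - {a}"] Suc.prems a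
  show ?case by (cases "card I") (auto simp: inj_on_diff card_Diff_singleton)
qed

text \<open>The comparison is by index: node \<open>j\<close> lies to the right of every root whose
  index is at least \<open>j\<close>. Splitting off the root \<open>r b\<close> at the first node
  gives the positive factor \<open>p a - r b\<close>, and both smaller instances again satisfy
  \<open>a \<le> b\<close>.\<close>

lemma divdiff_pos:
  fixes a b m n :: nat
  assumes "strict_antimono_on {a..<a + n} p" "\<And>j. a \<le> j \<Longrightarrow> j < a + n \<Longrightarrow> \<forall>i. b \<le> i \<and> i < b + m \<longrightarrow> j \<le> i \<longrightarrow> r i < p j"
    and "a \<le> b" "1 \<le> n" "n \<le> m + 1"
  shows "0 < divdiff p (\<lambda>z. \<Prod>j<m. z - r (b + j)) {a..<a + n}"
  using assms
proof (induction m arbitrary: a b n)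
  case 0
  then show ?case by (simp add: divdiff_def)
next
  case (Suc m)
  have inj: "inj_on p {a..<a + n}"
    using Suc.prems(1) by (intro linorder_inj_onI') (fastforce simp: monotone_on_def)
  show ?case
  \<comment> \<open>With this many nodes the induction hypothesis for degree \<open>m\<close> does
    not apply, but the value is the leading coefficient \<open>1\<close>.\<close>
  proof (cases "n = m + 2")
    case True
    then show ?thesis using divdiff_monic[of "{a..<a+n}" p "Suc m" "\<lambda>j. r (b + j)"] inj by simp
  next
    case False
    let ?Q = "\<lambda>z. \<Prod>j<m. z - r (Suc b + j)"
    have eq: "(\<lambda>z. \<Prod>j<Suc m. z - r (b + j)) = (\<lambda>z. (z - r b) * ?Q z)"
      by (simp add: prod.lessThan_Suc_shift del: prod.lessThan_Suc)
    have L: "divdiff p (\<lambda>z. \<Prod>j<Suc m. z - r (b + j)) {a..<a + n}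
        = (p a - r b) * divdiff p ?Q {a..<a + n} + divdiff p ?Q ({a..<a + n} - {a})"
      unfolding eq using Suc.prems by (intro divdiff_Leibniz inj) auto
    have S: "{a..<a + n} - {a} = {Suc a..<Suc a + (n - 1)}" using Suc.prems by auto
    have 1: "0 < divdiff p ?Q {a..<a + n}"
      by (rule Suc.IH) (use Suc.prems False in auto)
    have 2: "0 \<le> divdiff p ?Q {Suc a..<Suc a + (n - 1)}"
    proof (cases "n = 1")
      case False
      have "0 < divdiff p ?Q {Suc a..<Suc a + (n - 1)}"
        by (rule Suc.IH) (use Suc.prems \<open>n \<noteq> m + 2\<close> False in \<open>auto simp: monotone_on_def\<close>)
      then show ?thesis by simp
    qed (simp add: divdiff_def)
    have 3: "0 < p a - r b" using Suc.prems by simp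
    show ?thesis unfolding L S using 1 2 3 by (simp add: add_pos_nonneg)
  qed
qed


section \<open>Interlacing roots\<close>

text \<open>The three-term recurrence for characteristic polynomials of the leading blocks of a
  tridiagonal matrix with diagonal \<open>a\<close>; \<open>b m\<close> is the product of the two
  off-diagonal entries that link rows \<open>m\<close> and \<open>m + 1\<close>.\<close>

fun jacobi_poly :: "(nat \<Rightarrow> real) \<Rightarrow> (nat \<Rightarrow> real) \<Rightarrow> nat \<Rightarrow> real poly" where
  "jacobi_poly a b 0 = 1"
| "jacobi_poly a b (Suc 0) = [:- a 0, 1:]"
| "jacobi_poly a b (Suc (Suc m)) =
     [:- a (Suc m), 1:] * jacobi_poly a b (Suc m) - Polynomial.smult (b m) (jacobi_poly a b m)"

lemma jacobi_poly_monic: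
  "degree (jacobi_poly a b m) = m \<and> lead_coeff (jacobi_poly a b m) = 1"
proof (induction a b m rule: jacobi_poly.induct)
  case (3 a b m)
  let ?p = "[:- a (Suc m), 1:] * jacobi_poly a b (Suc m)" and ?q = "Polynomial.smult (b m) (jacobi_poly a b m)"
  have j: "degree (jacobi_poly a b (Suc m)) = Suc m" "lead_coeff (jacobi_poly a b (Suc m)) = 1"
    using 3 by blast+
  then have "jacobi_poly a b (Suc m) \<noteq> 0" by auto
  then have p: "degree ?p = Suc (Suc m)" by (subst degree_mult_eq) (auto simp: j)
  have lp: "lead_coeff ?p = 1" by (subst lead_coeff_mult) (simp add: j(2))
  have q: "degree ?q < degree ?p" using 3 p by (auto intro: le_less_trans[OF degree_smult_le])
  have "degree (?p - ?q) = degree ?p" using q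
    by (metis degree_add_eq_left degree_minus diff_conv_add_uminus)
  moreover have "coeff (?p - ?q) (degree ?p) = 1"
    using lp coeff_eq_0[OF q] by (simp only: coeff_diff)
  ultimately show ?case using p by (simp del: mult_pCons_left)
qed auto

text \<open>A nonzero difference from the product would have degree below \<open>n\<close> and
  \<open>n\<close> distinct roots.\<close>

lemma monic_poly_eq_prod_roots:
  fixes p :: "real poly"
  assumes "degree p = n" "lead_coeff p = 1" "inj_on t {..<n}" "\<And>j. j < n \<Longrightarrow> poly p (t j) = 0"
  shows "p = (\<Prod>j<n. [:- t j, 1:])"
proof (rule ccontr)
  let ?q = "\<Prod>j<n. [:- t j, 1:]"
  assume ne: "p \<noteq> ?q"
  have dq: "degree ?q = n" by (simp add: degree_prod_sum_eq)
  have lq: "lead_coeff ?q = 1" by (simp add: lead_coeff_prod)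
  have "degree (p - ?q) < n"
  proof -
    have "degree (p - ?q) \<le> n" using assms dq by (intro degree_diff_le) auto
    moreover have "coeff (p - ?q) n = 0" using assms lq dq by simp
    ultimately show ?thesis using ne
      by (metis eq_iff_diff_eq_0 leading_coeff_0_iff le_neq_implies_less)
  qed
  moreover have "n \<le> degree (p - ?q)"
  proof -
    have "t ` {..<n} \<subseteq> {x. poly (p - ?q) x = 0}" using assms by (auto simp: poly_prod)
    then have "card (t ` {..<n}) \<le> card {x. poly (p - ?q) x = 0}"
      using ne by (intro card_mono poly_roots_finite) auto
    also have "\<dots> \<le> degree (p - ?q)" using ne by (intro card_poly_roots_bound) auto
    finally show ?thesis using assms by (simp add: card_image)
  qed
  ultimately show False by simp
qed

text \<open>The polynomial with values \<open>(-1) ^ degree p * poly p (- x)\<close> is again monic,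
  so growth at plus infinity, used twice, covers both ends.\<close>

lemma monic_poly_sign_at_infinity:
  fixes p :: "real poly"
  assumes "lead_coeff p = 1"
  shows "\<exists>R. \<forall>x\<ge>R. 0 < poly p x \<and> 0 < (-1) ^ degree p * poly p (- x)"
proof -
  let ?q = "Polynomial.smult ((-1) ^ degree p) (pcompose p [:0, -1:])"
  have "lead_coeff (pcompose p [:0, -1:]) = (-1) ^ degree p"
    using assms lead_coeff_comp[of "[:0, -1:]" p] by simp
  then have "lead_coeff ?q = 1" by (subst lead_coeff_smult) (simp flip: power_mult_distrib)
  then obtain R1 R2 where "\<forall>x\<ge>R1. lead_coeff p \<le> poly p x" "\<forall>x\<ge>R2. lead_coeff ?q \<le> poly ?q x"
    using poly_pinfty_gt_lc[of p] poly_pinfty_gt_lc[of ?q] assms by auto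
  with assms \<open>lead_coeff ?q = 1\<close> show ?thesis
    by (intro exI[of _ "max R1 R2"]) (force simp: poly_pcompose)
qed

text \<open>At a root \<open>r j\<close> the recurrence leaves \<open>- b m\<close> times the
  polynomial of degree \<open>m\<close>, whose sign there is \<open>(-1) ^ j\<close> because exactly
  \<open>s 0, ..., s (j - 1)\<close> exceed \<open>r j\<close>. With the signs far out on both sides
  this gives \<open>m + 3\<close> points of alternating sign, hence a root in each of the
  \<open>m + 2\<close> gaps.\<close>

lemma jacobi_poly_interlace_step:
  assumes b: "\<And>m. 0 < b m"
    and s: "jacobi_poly a b m = (\<Prod>j<m. [:- s j, 1:])"
    and r: "jacobi_poly a b (Suc m) = (\<Prod>j<Suc m. [:- r j, 1:])"
    and sr: "\<And>j. j < m \<Longrightarrow> s j < r j \<and> r (Suc j) < s j"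
  shows "\<exists>t. jacobi_poly a b (Suc (Suc m)) = (\<Prod>j<Suc (Suc m). [:- t j, 1:]) \<and>
    (\<forall>j<Suc m. r j < t j \<and> t (Suc j) < r j)"
proof -
  let ?p = "jacobi_poly a b (Suc (Suc m))"
  have rdec: "r j < r i" if "i < j" "j \<le> m" for i j
    using that
  proof (induction j)
    case (Suc j)
    then show ?case using sr[of j] by (cases "i = j") force+
  qed simp
  have pr: "poly ?p (r j) = - b m * (\<Prod>i<m. r j - s i)" if "j \<le> m" for j
  proof -
    have "poly (jacobi_poly a b (Suc m)) (r j) = 0"
      unfolding r poly_prod using that by (intro prod_zero) auto
    moreover have "poly (jacobi_poly a b m) (r j) = (\<Prod>i<m. r j - s i)"
      unfolding s poly_prod by simp
    ultimately show ?thesis by simp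
  qed
  have sg: "0 < (-1) ^ j * (\<Prod>i<m. r j - s i)" if j: "j \<le> m" for j
  proof -
    have "(\<Prod>i<m. r j - s i) = (\<Prod>i<j. r j - s i) * (\<Prod>i=j..<m. r j - s i)"
      using j by (metis atLeast0LessThan bot_nat_0.extremum prod.atLeastLessThan_concat)
    moreover have "(-1) ^ j * (\<Prod>i<j. r j - s i) = (\<Prod>i<j. s i - r j)"
    proof -
      have "(\<Prod>i<j. s i - r j) = (\<Prod>i<j. - 1 * (r j - s i))" by (intro prod.cong) auto
      also have "\<dots> = (-1) ^ j * (\<Prod>i<j. r j - s i)" by (subst prod.distrib) simp
      finally show ?thesis by simp
    qed
    moreover have "0 < (\<Prod>i<j. s i - r j)"
    proof (intro prod_pos ballI)
      fix i assume i: "i \<in> {..<j}"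
      then have "r (Suc i) < s i" using sr j by auto
      moreover have "r j \<le> r (Suc i)" using rdec[of "Suc i" j] i j by (cases "Suc i = j") auto
      ultimately show "0 < s i - r j" by simp
    qed
    moreover have "0 < (\<Prod>i=j..<m. r j - s i)"
    proof (intro prod_pos ballI)
      fix i assume i: "i \<in> {j..<m}"
      then have "s i < r i" using sr by auto
      moreover have "r i \<le> r j" using rdec[of j i] i by (cases "i = j") auto
      ultimately show "0 < r j - s i" by simp
    qed
    ultimately show ?thesis by (metis mult.assoc mult_pos_pos)
  qed
  have md: "degree ?p = Suc (Suc m)" "lead_coeff ?p = 1" using jacobi_poly_monic by blast+
  obtain R where R: "\<And>x. x \<ge> R \<Longrightarrow> 0 < poly ?p x \<and> 0 < (-1) ^ Suc (Suc m) * poly ?p (- x)"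
    using monic_poly_sign_at_infinity[OF md(2)] md(1) by metis
  \<comment> \<open>The added bounds put \<open>R'\<close> to the right of the largest root
    \<open>r 0\<close> and \<open>- R'\<close> to the left of the smallest root \<open>r m\<close>,
    so that the test points \<open>q\<close> decrease strictly.\<close>
  define R' where "R' = max R (max (r 0 + 1) (1 - r m))"
  define q where "q j = (if j = 0 then R' else if j = Suc (Suc m) then - R' else r (j - 1))" for j
  have qsg: "0 < (-1) ^ j * poly ?p (q j)" if jm: "j \<le> Suc (Suc m)" for j
  proof -
    consider "j = 0" | "j = Suc (Suc m)" | "0 < j" "j \<le> Suc m" using jm by linarith
    then show ?thesis
    proof cases
      case 3
      then obtain i where i: "j = Suc i" "i \<le> m" by (cases j) auto
      have "(-1) ^ j * poly ?p (q j) = b m * ((-1) ^ i * (\<Prod>k<m. r i - s k))"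
        using i pr[of i] by (simp add: q_def del: jacobi_poly.simps)
      then show ?thesis using sg[of i] i b[of m] by simp
    qed (use R[of R'] in \<open>auto simp: q_def R'_def simp del: jacobi_poly.simps\<close>)
  qed
  have qdec: "q (Suc j) < q j" if jm: "j \<le> Suc m" for j
  proof -
    consider "j = 0" | "j = Suc m" | "0 < j" "j < Suc m" using jm by linarith
    then show ?thesis
    proof cases
      case 3
      then obtain i where "j = Suc i" "i < m" by (cases j) auto
      then show ?thesis using rdec[of i "Suc i"] by (auto simp: q_def)
    qed (auto simp: q_def R'_def)
  qed
  have "\<exists>t. q (Suc j) < t \<and> t < q j \<and> poly ?p t = 0" if j: "j \<le> Suc m" for j
  proof -
    let ?f = "\<lambda>z. (-1) ^ j * poly ?p z"
    have 1: "0 < ?f (q j)" using qsg[of j] j by simp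
    have 2: "?f (q (Suc j)) < 0" using qsg[of "Suc j"] j by simp
    have "\<exists>x. q (Suc j) \<le> x \<and> x \<le> q j \<and> ?f x = 0"
      using 1 2 qdec[OF j] by (intro IVT') (auto intro!: continuous_intros simp del: jacobi_poly.simps)
    then obtain x where x: "q (Suc j) \<le> x" "x \<le> q j" "?f x = 0" by auto
    then have "x \<noteq> q j" "x \<noteq> q (Suc j)" using 1 2 by auto
    with x show ?thesis by (intro exI[of _ x]) (auto simp del: jacobi_poly.simps)
  qed
  then obtain t where t: "\<And>j. j \<le> Suc m \<Longrightarrow> q (Suc j) < t j \<and> t j < q j \<and> poly ?p (t j) = 0"
    by metis
  have il: "r j < t j \<and> t (Suc j) < r j" if "j < Suc m" for j
    using t[of j] t[of "Suc j"] that by (auto simp: q_def split: if_splits)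
  have tdec: "t j < t i" if "i < j" "j \<le> Suc m" for i j
    using that
  proof (induction j)
    case (Suc j)
    then show ?case using il[of j] by (cases "i = j") force+
  qed simp
  have inj: "inj_on t {..<Suc (Suc m)}"
  proof (rule inj_onI)
    fix i j assume "i \<in> {..<Suc (Suc m)}" "j \<in> {..<Suc (Suc m)}" "t i = t j"
    then show "i = j" using tdec[of i j] tdec[of j i] by (cases i j rule: linorder_cases) auto
  qed
  have "?p = (\<Prod>j<Suc (Suc m). [:- t j, 1:])"
    by (rule monic_poly_eq_prod_roots[OF md inj]) (use t in auto)
  with il show ?thesis by blast
qed

text \<open>A step needs the roots of two consecutive polynomials, so dependent choice runs over
  pairs of root lists, and the second list of a pair has to be the first list of the next
  one.\<close>

lemma jacobi_poly_roots_interlace: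
  assumes b: "\<And>m. 0 < b m"
  obtains r where "\<And>m. jacobi_poly a b m = (\<Prod>j<m. [:- r m j, 1:])"
    and "\<And>m j. j < m \<Longrightarrow> r m j < r (Suc m) j \<and> r (Suc m) (Suc j) < r m j"
proof -
  let ?Q = "\<lambda>m (s, r). jacobi_poly a b m = (\<Prod>j<m. [:- s j, 1:]) \<and>
    jacobi_poly a b (Suc m) = (\<Prod>j<Suc m. [:- r j, 1:]) \<and> (\<forall>j<m. s j < r j \<and> r (Suc j) < s j)"
  have "\<exists>f. \<forall>m. ?Q m (f m) \<and> fst (f (Suc m)) = snd (f m)"
  proof (rule dependent_nat_choice)
    show "\<exists>x. ?Q 0 x" by (intro exI[of _ "(\<lambda>_. 0, \<lambda>_. a 0)"]) auto
  next
    fix x m assume Q: "?Q m x"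
    obtain s r where x: "x = (s, r)" by fastforce
    have 1: "jacobi_poly a b m = (\<Prod>j<m. [:- s j, 1:])"
      and 2: "jacobi_poly a b (Suc m) = (\<Prod>j<Suc m. [:- r j, 1:])"
      and 3: "\<And>j. j < m \<Longrightarrow> s j < r j \<and> r (Suc j) < s j"
      using Q unfolding x prod.case by blast+
    obtain t where "jacobi_poly a b (Suc (Suc m)) = (\<Prod>j<Suc (Suc m). [:- t j, 1:])"
      "\<forall>j<Suc m. r j < t j \<and> t (Suc j) < r j"
      using jacobi_poly_interlace_step[OF b 1 2 3] by blast
    with 2 show "\<exists>y. ?Q (Suc m) y \<and> fst y = snd x"
      unfolding x by (intro exI[of _ "(r, t)"]) (simp only: prod.case fst_conv snd_conv simp_thms)
  qed
  then obtain f where "\<forall>m. ?Q m (f m) \<and> fst (f (Suc m)) = snd (f m)" ..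
  then have f: "?Q m (f m)" "fst (f (Suc m)) = snd (f m)" for m by simp_all
  have "jacobi_poly a b m = (\<Prod>j<m. [:- fst (f m) j, 1:])"
    and "j < m \<Longrightarrow> fst (f m) j < fst (f (Suc m)) j \<and> fst (f (Suc m)) (Suc j) < fst (f m) j" for m j
    using f(1)[of m] unfolding case_prod_beta f(2) by blast+
  then show ?thesis by (rule that)
qed

section \<open>The link\<close>

text \<open>The index of a value is the number of smaller values in the image, so the image
  determines the enumeration.\<close>

lemma strict_mono_image_unique:
  fixes f g :: "nat \<Rightarrow> 'a::linorder"
  assumes f: "strict_mono_on {..n} f" and g: "strict_mono_on {..n} g"
    and eq: "f ` {..n} = g ` {..n}" and i: "i \<le> n"
  shows "f i = g i"
proof -
  have card: "card {x \<in> h ` {..n}. x < h k} = k"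
    if h: "strict_mono_on {..n} h" and k: "k \<le> n" for h :: "nat \<Rightarrow> 'a" and k
  proof -
    have "{x \<in> h ` {..n}. x < h k} = h ` {..<k}"
      using h k by (auto simp: strict_mono_on_less)
    moreover have "inj_on h {..<k}"
      using h k by (intro inj_on_subset[OF strict_mono_on_imp_inj_on[OF h]]) auto
    ultimately show ?thesis by (simp add: card_image)
  qed
  have "f i \<in> g ` {..n}" unfolding eq[symmetric] using i by simp
  then obtain k where k: "k \<le> n" "f i = g k" by auto
  have "i = card {x \<in> f ` {..n}. x < f i}" using card[OF f i] by simp
  also have "\<dots> = k" unfolding eq k(2) by (rule card[OF g k(1)])
  finally show ?thesis using k by simp
qed

lemma tridiagonal_col_sum:
  fixes w :: "nat \<Rightarrow> real"
  assumes "\<And>i j. i \<le> d \<Longrightarrow> j \<le> d \<Longrightarrow> j > i + 1 \<or> i > j + 1 \<Longrightarrow> g i j = 0" and x: "x \<le> d"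
  shows "(\<Sum>i\<le>d. w i * g i x) = (if 0 < x then w (x - 1) * g (x - 1) x else 0) + w x * g x x
    + (if x < d then w (x + 1) * g (x + 1) x else 0)"
proof -
  have "(\<Sum>i\<le>d. w i * g i x) = (\<Sum>i\<in>{i. i \<le> d \<and> (i + 1 = x \<or> i = x \<or> i = x + 1)}. w i * g i x)"
  proof (rule sum.mono_neutral_right)
    show "\<forall>i\<in>{..d} - {i. i \<le> d \<and> (i + 1 = x \<or> i = x \<or> i = x + 1)}. w i * g i x = 0"
    proof
      fix i assume "i \<in> {..d} - {i. i \<le> d \<and> (i + 1 = x \<or> i = x \<or> i = x + 1)}"
      then have "i \<le> d" "x > i + 1 \<or> i > x + 1" by auto
      then show "w i * g i x = 0" using assms by simp
    qed
  qed auto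
  also have "{i. i \<le> d \<and> (i + 1 = x \<or> i = x \<or> i = x + 1)}
      = (if 0 < x then {x - 1} else {}) \<union> {x} \<union> (if x < d then {x + 1} else {})"
    using x by auto
  finally show ?thesis by (auto simp: add.commute)
qed

section \<open>Birth-and-death generators and their eigenvalues\<close>

locale birth_death =
  fixes d :: nat and G :: "real mat" and \<nu> :: "nat \<Rightarrow> real" and \<pi> :: "nat pmf"
  assumes gen: "bd_generator d G" and irr: "irreducible_generator d G"
    and stat: "stationary_distribution d G \<pi>" and eig: "eigenvalue_listing d G \<nu>"
begin

abbreviation g :: "nat \<Rightarrow> nat \<Rightarrow> real" where "g i j \<equiv> G $$ (i, j)"

lemma G_carrier: "G \<in> carrier_mat (d + 1) (d + 1)"
  and g_nonneg: "i \<le> d \<Longrightarrow> j \<le> d \<Longrightarrow> i \<noteq> j \<Longrightarrow> 0 \<le> g i j"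
  and g_row_sum: "i \<le> d \<Longrightarrow> (\<Sum>j\<le>d. g i j) = 0"
  and g_band: "i \<le> d \<Longrightarrow> j \<le> d \<Longrightarrow> j > i + 1 \<or> i > j + 1 \<Longrightarrow> g i j = 0"
  using gen unfolding bd_generator_def by blast+

text \<open>If the rate from \<open>i\<close> to \<open>i + 1\<close> vanished, no path could leave
  \<open>{..i}\<close>, against irreducibility.\<close>

lemma g_up_pos: assumes "i < d" shows "0 < g i (i + 1)"
proof (rule ccontr)
  assume "\<not> 0 < g i (i + 1)"
  then have z: "g i (i + 1) = 0" using g_nonneg[of i "i + 1"] assms by simp
  have "l \<le> i" if "(i, l) \<in> {(k, l). k \<le> d \<and> l \<le> d \<and> 0 < G $$ (k, l)}\<^sup>*" for l
    using that
  proof (induction rule: rtrancl_induct)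
    case (step y w)
    show ?case
    proof (rule ccontr)
      assume w: "\<not> w \<le> i"
      with step have "y < i \<or> w > y + 1 \<or> (y = i \<and> w = i + 1)" by auto
      then have "g y w = 0" using g_band[of y w] z step w by auto
      with step show False by simp
    qed
  qed simp
  moreover have "(i, i + 1) \<in> {(k, l). k \<le> d \<and> l \<le> d \<and> 0 < G $$ (k, l)}\<^sup>*"
    using irr assms unfolding irreducible_generator_def by auto
  ultimately show False by fastforce
qed

lemma g_down_pos: assumes "i < d" shows "0 < g (i + 1) i"
proof (rule ccontr)
  assume "\<not> 0 < g (i + 1) i"
  then have z: "g (i + 1) i = 0" using g_nonneg[of "i + 1" i] assms by simp
  have "i + 1 \<le> l" if "(i + 1, l) \<in> {(k, l). k \<le> d \<and> l \<le> d \<and> 0 < G $$ (k, l)}\<^sup>*" for l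
    using that
  proof (induction rule: rtrancl_induct)
    case (step y w)
    show ?case
    proof (rule ccontr)
      assume w: "\<not> i + 1 \<le> w"
      with step have "y > w + 1 \<or> (y = i + 1 \<and> w = i)" by auto
      then have "g y w = 0" using g_band[of y w] z step w by auto
      with step show False by simp
    qed
  qed simp
  moreover have "(i + 1, i) \<in> {(k, l). k \<le> d \<and> l \<le> d \<and> 0 < G $$ (k, l)}\<^sup>*"
    using irr assms unfolding irreducible_generator_def by auto
  ultimately show False by fastforce
qed

text \<open>\<open>tail_poly m\<close> is the characteristic polynomial of the block of \<open>G\<close> on the last \<open>m\<close> states.\<close>

definition tail_poly :: "nat \<Rightarrow> real \<Rightarrow> real" where
  "tail_poly m = poly (jacobi_poly (\<lambda>m. g (d - m) (d - m))
     (\<lambda>m. if m < d then g (d - Suc m) (d - m) * g (d - m) (d - Suc m) else 1) m)"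

definition up_prod :: "nat \<Rightarrow> real" where "up_prod x = (\<Prod>i<x. g i (i + 1))"

text \<open>Row \<open>0\<close> of the adjugate of \<open>z I - G\<close>;
  \<open>tail_row_eq\<close> is its product with \<open>z I - G\<close>. At an eigenvalue of
  \<open>G\<close> it is a left eigenvector.\<close>

definition tail_row :: "real \<Rightarrow> nat \<Rightarrow> real" where
  "tail_row z x = up_prod x * tail_poly (d - x) z"

lemma up_prod_pos: "x \<le> d \<Longrightarrow> 0 < up_prod x"
  unfolding up_prod_def by (intro prod_pos) (use g_up_pos in auto)

lemma tail_row_eq:
  assumes x: "x \<le> d"
  shows "(\<Sum>i\<le>d. tail_row z i * g i x) = z * tail_row z x - (if x = 0 then tail_poly (d + 1) z else 0)"
proof -
  have up: "up_prod (Suc i) = up_prod i * g i (Suc i)" for i by (simp add: up_prod_def)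
  have rec: "tail_poly (d + 1 - x) z = (z - g x x) * tail_poly (d - x) z
      - (if x < d then g x (x + 1) * g (x + 1) x * tail_poly (d - x - 1) z else 0)"
  proof (cases "x < d")
    case True
    then obtain m where m: "d - x = Suc m" by (metis Suc_diff_Suc)
    then have "d + 1 - x = Suc (Suc m)" "d - Suc m = x" "d - m = Suc x" "m < d" using True by auto
    then show ?thesis using True m by (simp add: tail_poly_def algebra_simps)
  next
    case False
    then have "x = d" using x by simp
    then show ?thesis by (simp add: tail_poly_def)
  qed
  show ?thesis
  proof (cases x)
    case 0
    then show ?thesis using x rec
      by (subst tridiagonal_col_sum) (auto simp: g_band tail_row_def up algebra_simps up_prod_def)
  next
    case (Suc y)
    have S: "(\<Sum>i\<le>d. tail_row z i * g i x) = tail_row z y * g y x + tail_row z x * g x x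
       + (if x < d then tail_row z (x + 1) * g (x + 1) x else 0)"
      using x Suc by (subst tridiagonal_col_sum) (auto simp: g_band)
    have y: "d - y = d + 1 - x" using x Suc by simp
    have ux: "up_prod x = up_prod y * g y x" using up[of y] Suc by simp
    have R1: "tail_row z y = up_prod y * tail_poly (d + 1 - x) z" by (simp add: tail_row_def y)
    have R2: "tail_row z x = up_prod y * g y x * tail_poly (d - x) z" by (simp add: tail_row_def ux)
    have R3: "tail_row z (x + 1) = up_prod y * g y x * g x (x + 1) * tail_poly (d - x - 1) z"
      using up[of x] by (simp add: tail_row_def ux)
    have "x \<noteq> 0" using Suc by simp
    then show ?thesis unfolding S R1 R2 R3 rec by (simp add: algebra_simps)
  qed
qed

text \<open>Each root of the top polynomial is, up to sign, an eigenvalue of \<open>-G\<close> with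
  left eigenvector \<open>tail_row\<close>. There are \<open>d + 1\<close> distinct roots, so they
  exhaust the listed eigenvalues, which are therefore simple, and two strictly monotone listings of
  one set agree. The order is reversed because the largest root is
  \<open>- \<nu> d = 0\<close>.\<close>

lemma roots_of_tails:
  obtains r where "\<And>m z. tail_poly m z = (\<Prod>j<m. z - r m j)"
    and "\<And>m j. j < m \<Longrightarrow> r m j < r (Suc m) j \<and> r (Suc m) (Suc j) < r m j"
    and "\<And>j. j \<le> d \<Longrightarrow> r (d + 1) j = - \<nu> (d - j)"
proof -
  \<comment> \<open>The value \<open>1\<close> beyond the matrix keeps these products positive for
    every \<open>m\<close>, as interlacing requires.\<close>
  have "0 < (if m < d then g (d - Suc m) (d - m) * g (d - m) (d - Suc m) else 1)" for m
  proof (cases "m < d")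
    case True
    then have "d - Suc m < d" "d - Suc m + 1 = d - m" by auto
    then show ?thesis using g_up_pos[of "d - Suc m"] g_down_pos[of "d - Suc m"] True by simp
  qed simp
  then obtain r where r1: "\<And>m. jacobi_poly (\<lambda>m. g (d - m) (d - m))
     (\<lambda>m. if m < d then g (d - Suc m) (d - m) * g (d - m) (d - Suc m) else 1) m = (\<Prod>j<m. [:- r m j, 1:])"
    and r2: "\<And>m j. j < m \<Longrightarrow> r m j < r (Suc m) j \<and> r (Suc m) (Suc j) < r m j"
    by (rule jacobi_poly_roots_interlace[where a = "\<lambda>m. g (d - m) (d - m)" and
          b = "\<lambda>m. if m < d then g (d - Suc m) (d - m) * g (d - m) (d - Suc m) else 1"]) blast+
  have tp: "tail_poly m z = (\<Prod>j<m. z - r m j)" for m z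
    unfolding tail_poly_def r1 poly_prod by simp
  let ?t = "r (d + 1)"
  have step: "?t (Suc j) < ?t j" if "j < d" for j
    using r2[of j d] that by (simp add: less_trans)
  have tdec: "?t j < ?t i" if "i < j" "j \<le> d" for i j
    using that
  proof (induction j)
    case (Suc j)
    then show ?case using step[of j] by (cases "i = j") auto
  qed simp
  have ev: "- ?t j \<in> \<nu> ` {..d}" if j: "j \<le> d" for j
  proof -
    have zero: "tail_poly (d + 1) (?t j) = 0"
      unfolding tp using j by (intro prod_zero) auto
    let ?v = "Matrix.vec (d + 1) (tail_row (?t j))"
    have "eigenvector (transpose_mat (- G)) ?v (- ?t j)"
      unfolding eigenvector_def
    proof (intro conjI)
      show "?v \<in> carrier_vec (dim_row (transpose_mat (- G)))" using G_carrier by auto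
      \<comment> \<open>The last entry is a product of upward rates times the constant polynomial
        \<open>1\<close>.\<close>
      have "tail_row (?t j) d \<noteq> 0" using up_prod_pos[of d] by (simp add: tail_row_def tail_poly_def)
      then have "?v \<noteq> 0\<^sub>v (d + 1)" by (metis index_vec index_zero_vec(1) less_add_one)
      then show "?v \<noteq> 0\<^sub>v (dim_row (transpose_mat (- G)))" using G_carrier by auto
      show "transpose_mat (- G) *\<^sub>v ?v = - ?t j \<cdot>\<^sub>v ?v"
      proof (rule eq_vecI)
        fix x assume "x < dim_vec (- ?t j \<cdot>\<^sub>v ?v)"
        then have x: "x \<le> d" by simp
        have "(transpose_mat (- G) *\<^sub>v ?v) $ x = (\<Sum>i<d + 1. (- g i x) * tail_row (?t j) i)"
          using x G_carrier by (simp add: scalar_prod_def atLeast0LessThan)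
        also have "\<dots> = - (\<Sum>i\<le>d. tail_row (?t j) i * g i x)"
          by (simp add: lessThan_Suc_atMost sum_negf mult.commute)
        finally show "(transpose_mat (- G) *\<^sub>v ?v) $ x = (- ?t j \<cdot>\<^sub>v ?v) $ x"
          using x tail_row_eq[OF x, of "?t j"] zero by simp
      qed (use G_carrier in auto)
    qed
    then have "eigenvalue (transpose_mat (- G)) (- ?t j)" by (auto simp: eigenvalue_def)
    then have "poly (char_poly (transpose_mat (- G))) (- ?t j) = 0"
      using G_carrier by (subst eigenvalue_root_char_poly[symmetric, of _ "d + 1"]) auto
    then have "poly (\<Prod>i\<le>d. [:- \<nu> i, 1:]) (- ?t j) = 0"
      using G_carrier eig by (subst (asm) char_poly_transpose_mat[of _ "d + 1"]) (auto simp: eigenvalue_listing_def)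
    then obtain i where "i \<le> d" "- \<nu> i - ?t j = 0" by (auto simp: poly_prod)
    then have "- ?t j = \<nu> i" "i \<in> {..d}" by auto
    then show ?thesis by (rule image_eqI)
  qed
  have smt: "strict_mono_on {..d} (\<lambda>j. - ?t j)" using tdec by (auto simp: strict_mono_on_def)
  have card: "card ((\<lambda>j. - ?t j) ` {..d}) = d + 1"
    using card_image[OF strict_mono_on_imp_inj_on[OF smt]] by simp
  have sub: "(\<lambda>j. - ?t j) ` {..d} \<subseteq> \<nu> ` {..d}" using ev by auto
  have "card (\<nu> ` {..d}) \<le> d + 1" using card_image_le[of "{..d}" \<nu>] by simp
  then have eq: "(\<lambda>j. - ?t j) ` {..d} = \<nu> ` {..d}" using sub card by (intro card_seteq) auto
  then have inj: "inj_on \<nu> {..d}" using card by (intro eq_card_imp_inj_on) auto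
  have ndec: "\<nu> (i + 1) < \<nu> i" if "i < d" for i
    using eig that inj_onD[OF inj, of i "i + 1"] unfolding eigenvalue_listing_def by (metis Suc_leI Suc_n_not_n add.commute atMost_iff less_imp_le_nat less_eq_real_def plus_1_eq_Suc)
  have nlt: "\<nu> j < \<nu> i" if "i < j" "j \<le> d" for i j
    using that
  proof (induction j)
    case (Suc j)
    then show ?case using ndec[of j] by (cases "i = j") auto
  qed simp
  have "strict_mono_on {..d} (\<lambda>j. \<nu> (d - j))" using nlt by (auto simp: strict_mono_on_def)
  moreover have "(\<lambda>j. \<nu> (d - j)) ` {..d} = \<nu> ` {..d}"
  proof -
    have "x \<in> (\<lambda>j. d - j) ` {..d}" if "x \<le> d" for x
      using that by (intro image_eqI[of _ _ "d - x"]) auto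
    then have "(\<lambda>j. d - j) ` {..d} = {..d}" by auto
    then show ?thesis by (metis image_image)
  qed
  ultimately have "- ?t j = \<nu> (d - j)" if "j \<le> d" for j
    using strict_mono_image_unique[OF smt] eq that by blast
  then have "?t j = - \<nu> (d - j)" if "j \<le> d" for j using that by (metis minus_minus)
  with tp r2 show ?thesis by (rule that)
qed

lemma \<nu>_zero: "\<nu> d = 0" and \<nu>_pos: "k < d \<Longrightarrow> 0 < \<nu> k"
proof -
  show "\<nu> d = 0" using eig by (simp add: eigenvalue_listing_def)
  assume k: "k < d"
  have "k \<le> d - 1" using k by simp
  then have "\<nu> (d - 1) \<le> \<nu> k"
  proof (induction rule: inc_induct)
    case (step n)
    then have "\<nu> (n + 1) \<le> \<nu> n" using eig k unfolding eigenvalue_listing_def by simp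
    then show ?case using step by simp
  qed simp
  then show "0 < \<nu> k" using k eig by (simp add: eigenvalue_listing_def)
qed

section \<open>Rows of the link as divided differences\<close>

abbreviation lam :: "nat \<Rightarrow> nat \<Rightarrow> real" where "lam k x \<equiv> link d G \<nu> $$ (k, x)"

lemma lam_0: "x \<le> d \<Longrightarrow> lam 0 x = (if x = 0 then 1 else 0)"
  by (simp add: link_def)

lemma Q_mat_carrier: "Q_mat d G \<nu> k \<in> carrier_mat (d + 1) (d + 1)"
  using G_carrier by (induction k) auto

text \<open>Row \<open>k\<close> of the intertwining of \<open>G\<close> with the pure birth
  generator, solved for the next row of the link.\<close>

lemma lam_rec:
  assumes k: "k < d" and x: "x \<le> d"
  shows "\<nu> k * lam (k + 1) x = (\<Sum>i\<le>d. lam k i * g i x) + \<nu> k * lam k x"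
proof -
  have "lam (k + 1) x = inverse (\<nu> k) * ((Q_mat d G \<nu> k * (G + \<nu> k \<cdot>\<^sub>m 1\<^sub>m (d + 1))) $$ (0, x))"
    using k x Q_mat_carrier[of k] G_carrier by (simp add: link_def)
  also have "(Q_mat d G \<nu> k * (G + \<nu> k \<cdot>\<^sub>m 1\<^sub>m (d + 1))) $$ (0, x)
      = (\<Sum>i\<le>d. lam k i * (g i x + \<nu> k * (if i = x then 1 else 0)))"
    using k x Q_mat_carrier[of k] G_carrier
    by (simp add: times_mat_def scalar_prod_def atLeast0LessThan lessThan_Suc_atMost link_def)
  also have "\<dots> = (\<Sum>i\<le>d. lam k i * g i x) + (\<Sum>i\<le>d. if i = x then lam k i * \<nu> k else 0)"
    unfolding sum.distrib[symmetric] by (intro sum.cong) (auto simp: algebra_simps)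
  also have "(\<Sum>i\<le>d. if i = x then lam k i * \<nu> k else 0) = lam k x * \<nu> k"
    using x by simp
  finally show ?thesis using \<nu>_pos[OF k] by (simp add: field_simps)
qed

text \<open>Row \<open>k\<close> is the divided difference of \<open>tail_row\<close> over the
  \<open>d + 1 - k\<close> largest eigenvalues of \<open>G\<close>. At eigenvalues, \<open>G\<close>
  acts on \<open>tail_row\<close> as multiplication by \<open>z\<close>, so
  \<open>G + \<nu> k I\<close> inserts the factor \<open>z - r (d + 1) (d - k)\<close>, and the
  Leibniz rule then just removes the node \<open>d - k\<close>. Over all nodes only the entry at
  state \<open>0\<close>, of degree \<open>d\<close>, survives.\<close>

lemma lam_divdiff:
  obtains r where "\<And>m z. tail_poly m z = (\<Prod>j<m. z - r m j)"
    and "\<And>m j. j < m \<Longrightarrow> r m j < r (Suc m) j \<and> r (Suc m) (Suc j) < r m j"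
    and "inj_on (r (d + 1)) {..d}"
    and "\<And>k x. k \<le> d \<Longrightarrow> x \<le> d \<Longrightarrow>
       lam k x * (\<Prod>i<k. \<nu> i) = up_prod x * divdiff (r (d + 1)) (tail_poly (d - x)) {..<d + 1 - k}"
    and "\<And>x. x \<le> d \<Longrightarrow> (\<Sum>i\<le>d. lam d i * g i x) = 0"
proof -
  obtain r where r: "\<And>m z. tail_poly m z = (\<Prod>j<m. z - r m j)"
    "\<And>m j. j < m \<Longrightarrow> r m j < r (Suc m) j \<and> r (Suc m) (Suc j) < r m j"
    "\<And>j. j \<le> d \<Longrightarrow> r (d + 1) j = - \<nu> (d - j)"
    by (rule roots_of_tails) blast
  let ?t = "r (d + 1)"
  have step: "?t (Suc j) < ?t j" if "j < d" for j
    using r(2)[of j d] that by (simp add: less_trans)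
  have tdec: "?t j < ?t i" if "i < j" "j \<le> d" for i j
    using that
  proof (induction j)
    case (Suc j)
    then show ?case using step[of j] by (cases "i = j") auto
  qed simp
  then have inj: "inj_on ?t {..d}"
    by (intro linorder_inj_onI') (metis atMost_iff order_less_irrefl)
  define D where "D k x = up_prod x * divdiff ?t (tail_poly (d - x)) {..<d + 1 - k}" for k x
  have DG: "(\<Sum>i\<le>d. D k i * g i x) + \<nu> k * D k x = D (k + 1) x" if k: "k \<le> d" and x: "x \<le> d" for k x
  proof -
    let ?I = "{..<d + 1 - k}"
    have "(\<Sum>i\<le>d. D k i * g i x) = divdiff ?t (\<lambda>z. \<Sum>i\<le>d. tail_row z i * g i x) ?I"
    proof -
      have "D k i * g i x = (\<Sum>j\<in>?I. tail_row (?t j) i * g i x / (\<Prod>l\<in>?I - {j}. ?t j - ?t l))" for i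
        by (simp add: D_def divdiff_def tail_row_def sum_distrib_left sum_distrib_right mult_ac)
      then show ?thesis
        unfolding divdiff_def by (subst sum_divide_distrib, subst sum.swap) simp
    qed
    also have "\<dots> = divdiff ?t (\<lambda>z. z * tail_row z x) ?I"
    proof -
      have "tail_poly (d + 1) (?t j) = 0" if "j \<in> ?I" for j
        unfolding r(1) using that by (intro prod_zero) auto
      then show ?thesis unfolding divdiff_def tail_row_eq[OF x] by (intro sum.cong) auto
    qed
    also have "\<dots> = up_prod x * divdiff ?t (\<lambda>z. (z - 0) * tail_poly (d - x) z) ?I"
      by (simp add: divdiff_def tail_row_def sum_distrib_left mult_ac)
    also have "\<dots> = up_prod x * ((?t (d - k) - 0) * divdiff ?t (tail_poly (d - x)) ?I
        + divdiff ?t (tail_poly (d - x)) (?I - {d - k}))"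
      using k by (subst divdiff_Leibniz[of _ _ "d - k"]) (auto intro!: inj_on_subset[OF inj[simplified]])
    also have "?I - {d - k} = {..<d + 1 - (k + 1)}" using k by auto
    finally show ?thesis using r(3)[of "d - k"] k by (simp add: D_def algebra_simps)
  qed
  have D0: "D 0 x = (if x = 0 then 1 else 0)" if x: "x \<le> d" for x
  proof -
    have "divdiff ?t (tail_poly (d - x)) {..<d + 1} = (if d + 1 = d - x + 1 then 1 else 0)"
      using divdiff_monic[of "{..<d + 1}" ?t "d - x" "r (d - x)"] inj
      unfolding r(1) by (simp add: lessThan_Suc_atMost)
    then show ?thesis using x by (auto simp: D_def up_prod_def)
  qed
  have L: "lam k x * (\<Prod>i<k. \<nu> i) = D k x" if "k \<le> d" "x \<le> d" for k x
    using that
  proof (induction k arbitrary: x)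
    case 0
    then show ?case by (simp add: lam_0 D0)
  next
    case (Suc k)
    have "lam (Suc k) x * (\<Prod>i<Suc k. \<nu> i) = (\<nu> k * lam (k + 1) x) * (\<Prod>i<k. \<nu> i)" by simp
    also have "\<dots> = (\<Sum>i\<le>d. (lam k i * (\<Prod>i<k. \<nu> i)) * g i x) + \<nu> k * (lam k x * (\<Prod>i<k. \<nu> i))"
      using Suc.prems by (subst lam_rec) (auto simp: algebra_simps sum_distrib_left)
    also have "\<dots> = (\<Sum>i\<le>d. D k i * g i x) + \<nu> k * D k x" using Suc by simp
    also have "\<dots> = D (k + 1) x" using Suc.prems by (intro DG) auto
    finally show ?case by simp
  qed
  have "(\<Sum>i\<le>d. lam d i * g i x) = 0" if x: "x \<le> d" for x
  proof -
    have P: "0 < (\<Prod>i<d. \<nu> i)" using \<nu>_pos by (intro prod_pos) auto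
    \<comment> \<open>At \<open>k = d\<close> the last node is removed: \<open>D (d + 1) x\<close>
      is a divided difference over no nodes, and \<open>\<nu> d = 0\<close>.\<close>
    have "(\<Sum>i\<le>d. D d i * g i x) = 0"
      using DG[of d x] x \<nu>_zero by (simp add: D_def divdiff_def)
    moreover have "(\<Sum>i\<le>d. D d i * g i x) = (\<Prod>i<d. \<nu> i) * (\<Sum>i\<le>d. lam d i * g i x)"
      by (simp add: L[symmetric] sum_distrib_left mult_ac)
    ultimately have "(\<Prod>i<d. \<nu> i) * (\<Sum>i\<le>d. lam d i * g i x) = 0" by (simp only:)
    then have "(\<Prod>i<d. \<nu> i) = 0 \<or> (\<Sum>i\<le>d. lam d i * g i x) = 0" by (rule mult_eq_0_iff[THEN iffD1])
    with P show ?thesis by (elim disjE) (simp_all only: less_irrefl)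
  qed
  with r(1,2) inj L show ?thesis unfolding D_def by (rule that)
qed

text \<open>Repeated interlacing puts the \<open>i\<close>-th root of a smaller tail below the
  \<open>i\<close>-th eigenvalue of \<open>G\<close>, which is the comparison that
  \<open>divdiff_pos\<close> asks for; its bound on the number of nodes,
  \<open>d + 1 - k \<le> d - x + 1\<close>, is the condition \<open>x \<le> k\<close>.\<close>

lemma lam_pos:
  assumes "k \<le> d" "x \<le> k" shows "0 < lam k x"
proof -
  obtain r where r: "\<And>m z. tail_poly m z = (\<Prod>j<m. z - r m j)"
    "\<And>m j. j < m \<Longrightarrow> r m j < r (Suc m) j \<and> r (Suc m) (Suc j) < r m j"
    "inj_on (r (d + 1)) {..d}"
    "\<And>k x. k \<le> d \<Longrightarrow> x \<le> d \<Longrightarrow>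
       lam k x * (\<Prod>i<k. \<nu> i) = up_prod x * divdiff (r (d + 1)) (tail_poly (d - x)) {..<d + 1 - k}"
    "\<And>x. x \<le> d \<Longrightarrow> (\<Sum>i\<le>d. lam d i * g i x) = 0"
    by (rule lam_divdiff) blast
  have mono: "r m j < r (m + n + 1) j" if "j < m" for m n j
    using that
  proof (induction n)
    case (Suc n)
    then show ?case using r(2)[of j "m + n + 1"] by simp
  qed (use r(2) in simp)
  have step: "r (d + 1) (Suc j) < r (d + 1) j" if "j < d" for j
    using r(2)[of j d] that by (simp add: less_trans)
  have tdec: "r (d + 1) j < r (d + 1) i" if "i < j" "j \<le> d" for i j
    using that
  proof (induction j)
    case (Suc j)
    then show ?case using step[of j] by (cases "i = j") auto
  qed simp
  have "0 < divdiff (r (d + 1)) (\<lambda>z. \<Prod>j<d - x. z - r (d - x) (0 + j)) {0..<0 + (d + 1 - k)}"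
  proof (rule divdiff_pos)
    show "strict_antimono_on {0..<0 + (d + 1 - k)} (r (d + 1))"
      using tdec by (auto simp: monotone_on_def)
    show "\<forall>i. 0 \<le> i \<and> i < 0 + (d - x) \<longrightarrow> j \<le> i \<longrightarrow> r (d - x) i < r (d + 1) j"
      if "0 \<le> j" "j < 0 + (d + 1 - k)" for j
    proof (intro allI impI)
      fix i assume i: "0 \<le> i \<and> i < 0 + (d - x)" "j \<le> i"
      have "r (d - x) i < r (d - x + x + 1) i" using i by (intro mono) auto
      also have "d - x + x + 1 = d + 1" using assms by simp
      also have "r (d + 1) i \<le> r (d + 1) j"
          using tdec[of j i] i less_imp_diff_less[of i d x] by (cases "i = j") (auto simp: less_diff_conv)
      finally show "r (d - x) i < r (d + 1) j" .
    qed
  qed (use assms in auto)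
  then have "0 < lam k x * (\<Prod>i<k. \<nu> i)"
    using r(4)[of k x] assms up_prod_pos[of x] unfolding r(1) by (simp add: atLeast0LessThan)
  moreover have "0 < (\<Prod>i<k. \<nu> i)" using assms \<nu>_pos by (intro prod_pos) auto
  ultimately show ?thesis by (simp add: zero_less_mult_iff)
qed

text \<open>For \<open>x > k\<close> there are more than \<open>d - x + 1\<close> nodes for a
  polynomial of degree \<open>d - x\<close>.\<close>

lemma lam_zero:
  assumes "k < x" "x \<le> d" shows "lam k x = 0"
proof -
  obtain r where r: "\<And>m z. tail_poly m z = (\<Prod>j<m. z - r m j)"
    "\<And>m j. j < m \<Longrightarrow> r m j < r (Suc m) j \<and> r (Suc m) (Suc j) < r m j"
    "inj_on (r (d + 1)) {..d}"
    "\<And>k x. k \<le> d \<Longrightarrow> x \<le> d \<Longrightarrow>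
       lam k x * (\<Prod>i<k. \<nu> i) = up_prod x * divdiff (r (d + 1)) (tail_poly (d - x)) {..<d + 1 - k}"
    "\<And>x. x \<le> d \<Longrightarrow> (\<Sum>i\<le>d. lam d i * g i x) = 0"
    by (rule lam_divdiff) blast
  have "divdiff (r (d + 1)) (tail_poly (d - x)) {..<d + 1 - k} = 0"
    unfolding r(1) using assms by (subst divdiff_monic) (auto intro!: inj_on_subset[OF r(3)[simplified]])
  moreover have "0 < (\<Prod>i<k. \<nu> i)" using assms \<nu>_pos by (intro prod_pos) auto
  moreover have "lam k x * (\<Prod>i<k. \<nu> i) = up_prod x * divdiff (r (d + 1)) (tail_poly (d - x)) {..<d + 1 - k}"
    using assms by (intro r(4)) auto
  ultimately have "lam k x * (\<Prod>i<k. \<nu> i) = 0" by (simp only: mult_zero_right)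
  then have "lam k x = 0 \<or> (\<Prod>i<k. \<nu> i) = 0" by (rule mult_eq_0_iff[THEN iffD1])
  with \<open>0 < (\<Prod>i<k. \<nu> i)\<close> show ?thesis by (elim disjE) (simp_all only: less_irrefl)
qed

lemma lam_nonneg: "k \<le> d \<Longrightarrow> x \<le> d \<Longrightarrow> 0 \<le> lam k x"
  using lam_pos[of k x] lam_zero[of k x] by (cases "x \<le> k") auto

lemma lam_d_stationary: "x \<le> d \<Longrightarrow> (\<Sum>i\<le>d. lam d i * g i x) = 0"
  by (rule lam_divdiff) blast

lemma lam_sum: "k \<le> d \<Longrightarrow> (\<Sum>x\<le>d. lam k x) = 1"
proof (induction k)
  case 0
  then show ?case by (simp add: lam_0)
next
  case (Suc k)
  have "\<nu> k * (\<Sum>x\<le>d. lam (k + 1) x) = (\<Sum>x\<le>d. \<Sum>i\<le>d. lam k i * g i x) + \<nu> k * (\<Sum>x\<le>d. lam k x)"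
  proof -
    have "\<nu> k * (\<Sum>x\<le>d. lam (k + 1) x) = (\<Sum>x\<le>d. (\<Sum>i\<le>d. lam k i * g i x) + \<nu> k * lam k x)"
      unfolding sum_distrib_left using Suc.prems by (intro sum.cong lam_rec) auto
    then show ?thesis by (simp add: sum.distrib sum_distrib_left)
  qed
  also have "(\<Sum>x\<le>d. \<Sum>i\<le>d. lam k i * g i x) = (\<Sum>i\<le>d. lam k i * (\<Sum>x\<le>d. g i x))"
    by (subst sum.swap) (simp add: sum_distrib_left)
  finally show ?case using Suc \<nu>_pos[of k] by (simp add: g_row_sum)
qed

text \<open>Going down from \<open>d\<close>, the equation of column \<open>x\<close> determines
  \<open>u (x - 1)\<close>, because its coefficient \<open>g (x - 1) x\<close> is positive.\<close>

lemma left_kernel_unique: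
  assumes "\<And>x. x \<le> d \<Longrightarrow> (\<Sum>i\<le>d. u i * g i x) = 0" "u d = 0" "x \<le> d"
  shows "u x = 0"
proof -
  have "\<forall>i. d - n \<le> i \<and> i \<le> d \<longrightarrow> u i = 0" for n
  proof (induction n)
    case (Suc n)
    show ?case
    proof (cases "n < d")
      case True
      define x where "x = d - n"
      have x: "0 < x" "x \<le> d" "d - Suc n = x - 1" using True by (auto simp: x_def)
      have "(\<Sum>i\<le>d. u i * g i x) = u (x - 1) * g (x - 1) x"
        using x Suc by (subst tridiagonal_col_sum) (auto simp: g_band x_def)
      moreover have "0 < g (x - 1) x" using x g_up_pos[of "x - 1"] by simp
      ultimately have "u (x - 1) = 0" using assms(1)[of x] x by simp
      show ?thesis
      proof (intro allI impI)
        fix i assume i: "d - Suc n \<le> i \<and> i \<le> d"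
        then have "i = x - 1 \<or> d - n \<le> i" using x by linarith
        then show "u i = 0" using \<open>u (x - 1) = 0\<close> Suc i by auto
      qed
    qed (use Suc in auto)
  qed (use assms in auto)
  from this[of d] show ?thesis using assms by simp
qed

lemma pmf_\<pi>_sum: "(\<Sum>x\<le>d. pmf \<pi> x) = 1"
  using stat sum_pmf_eq_1[of "{..d}" \<pi>] by (simp add: stationary_distribution_def)

lemma lam_d: assumes "x \<le> d" shows "lam d x = pmf \<pi> x"
proof -
  \<comment> \<open>This constant makes the difference vanish at \<open>d\<close>, so the two left
    null vectors are proportional; both have sum \<open>1\<close>, which forces
    \<open>c = 1\<close>.\<close>
  define c where "c = pmf \<pi> d / lam d d"
  define u where "u i = pmf \<pi> i - c * lam d i" for i
  have "u x = 0" if "x \<le> d" for x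
  proof (rule left_kernel_unique[OF _ _ that])
    fix x assume x: "x \<le> d"
    have "(\<Sum>i\<le>d. u i * g i x) = (\<Sum>i\<le>d. pmf \<pi> i * g i x) - c * (\<Sum>i\<le>d. lam d i * g i x)"
      by (simp add: u_def algebra_simps sum_subtractf sum_distrib_left)
    then show "(\<Sum>i\<le>d. u i * g i x) = 0"
      using x stat lam_d_stationary by (simp add: stationary_distribution_def)
  qed (use lam_pos[of d d] in \<open>simp add: u_def c_def\<close>)
  then have e: "pmf \<pi> x = c * lam d x" if "x \<le> d" for x using that by (simp add: u_def)
  then have "(\<Sum>x\<le>d. pmf \<pi> x) = c * (\<Sum>x\<le>d. lam d x)" by (simp add: sum_distrib_left)
  then have "c = 1" by (simp add: pmf_\<pi>_sum lam_sum)
  then show ?thesis using e assms by simp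
qed

lemma pmf_\<pi>_pos: "0 < pmf \<pi> d"
  using lam_pos[of d d] lam_d[of d] by simp

end

section \<open>Exponential generating functions and transition probabilities\<close>

text \<open>Entries of a matrix exponential have this form, with geometrically bounded coefficients.
  Differentiation in \<open>t\<close> is the shift of the coefficients, so no calculus of matrices
  is needed.\<close>

definition egf :: "(nat \<Rightarrow> real) \<Rightarrow> real \<Rightarrow> real" where
  "egf a t = (\<Sum>n. t ^ n / fact n * a n)"

lemma egf_summable:
  fixes a :: "nat \<Rightarrow> real"
  assumes "\<And>n. \<bar>a n\<bar> \<le> C * c ^ n"
  shows "summable (\<lambda>n. t ^ n / fact n * a n)"
proof -
  have "(\<lambda>n. C * ((c * \<bar>t\<bar>) ^ n /\<^sub>R fact n)) sums (C * exp (c * \<bar>t\<bar>))"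
    by (intro sums_mult exp_converges)
  then have s: "summable (\<lambda>n. \<bar>t\<bar> ^ n / fact n * (C * c ^ n))"
    by (auto simp: power_mult_distrib field_simps dest!: sums_summable)
  have "norm (t ^ n / fact n * a n) \<le> \<bar>t\<bar> ^ n / fact n * (C * c ^ n)" for n
    using assms[of n] by (simp add: abs_mult power_abs) (intro mult_left_mono divide_right_mono, auto)
  then show ?thesis by (intro summable_comparison_test'[OF s, of 0])
qed

lemma egf_bound:
  assumes a: "\<And>n. \<bar>a n\<bar> \<le> C * c ^ n"
  shows "\<bar>egf a t\<bar> \<le> C * exp (c * \<bar>t\<bar>)"
proof -
  have s: "(\<lambda>n. C * ((c * \<bar>t\<bar>) ^ n /\<^sub>R fact n)) sums (C * exp (c * \<bar>t\<bar>))"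
    by (intro sums_mult exp_converges)
  have le: "\<bar>t ^ n / fact n * a n\<bar> \<le> C * ((c * \<bar>t\<bar>) ^ n /\<^sub>R fact n)" for n
  proof -
    have "\<bar>t ^ n / fact n * a n\<bar> \<le> \<bar>t\<bar> ^ n / fact n * (C * c ^ n)"
      using a[of n] by (simp add: abs_mult power_abs) (intro mult_left_mono divide_right_mono, auto)
    then show ?thesis by (simp add: power_mult_distrib field_simps)
  qed
  have sm: "summable (\<lambda>n. \<bar>t ^ n / fact n * a n\<bar>)"
    by (rule summable_comparison_test'[OF sums_summable[OF s], of 0]) (use le in auto)
  have "\<bar>egf a t\<bar> \<le> (\<Sum>n. \<bar>t ^ n / fact n * a n\<bar>)"
    unfolding egf_def by (rule summable_rabs[OF sm])
  also have "\<dots> \<le> (\<Sum>n. C * ((c * \<bar>t\<bar>) ^ n /\<^sub>R fact n))"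
    by (rule suminf_le[OF le sm sums_summable[OF s]])
  finally show ?thesis using sums_unique[OF s] by simp
qed

lemma egf_DERIV:
  assumes a: "\<And>n. \<bar>a n\<bar> \<le> C * c ^ n"
  shows "(egf a has_real_derivative egf (\<lambda>n. a (Suc n)) t) (at t)"
proof -
  have "((\<lambda>x. \<Sum>n. (a n / fact n) * x ^ n) has_real_derivative
      (\<Sum>n. diffs (\<lambda>n. a n / fact n) n * t ^ n)) (at t)"
    by (rule termdiffs_strong_converges_everywhere)
      (use egf_summable[OF a] in \<open>simp add: mult_ac\<close>)
  moreover have "diffs (\<lambda>n. a n / fact n) n = a (Suc n) / fact n" for n
    by (simp add: diffs_def field_simps del: of_nat_Suc)
  ultimately show ?thesis by (simp add: egf_def[abs_def] mult_ac)
qed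

lemma egf_0: "egf a 0 = a 0"
  unfolding egf_def using powser_zero[of "\<lambda>n. a n / fact n"] by (simp add: mult_ac)

lemma egf_sum:
  assumes "finite I" "\<And>i n. i \<in> I \<Longrightarrow> \<bar>a i n\<bar> \<le> C * c ^ n"
  shows "egf (\<lambda>n. \<Sum>i\<in>I. w i * a i n) t = (\<Sum>i\<in>I. w i * egf (a i) t)"
proof -
  have "(\<Sum>i\<in>I. w i * egf (a i) t) = (\<Sum>i\<in>I. \<Sum>n. w i * (t ^ n / fact n * a i n))"
    unfolding egf_def using assms(2)
    by (intro sum.cong refl suminf_mult[symmetric] egf_summable[where C = C and c = c]) auto
  also have "\<dots> = (\<Sum>n. \<Sum>i\<in>I. w i * (t ^ n / fact n * a i n))"
    using assms(2) by (intro suminf_sum[symmetric] summable_mult egf_summable[where C = C and c = c]) auto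
  finally show ?thesis by (simp add: egf_def sum_distrib_left mult_ac)
qed

lemma egf_geometric: "egf (\<lambda>n. c ^ n) t = exp (c * t)"
  using exp_converges[of "c * t"] by (simp add: egf_def sums_iff power_mult_distrib field_simps)

text \<open>The mean value theorem applied twice; the constant bounds the second derivative on all
  of \<open>[0, T]\<close>, so that it serves every cell of a grid.\<close>

lemma egf_Taylor:
  assumes a: "\<And>n. \<bar>a n\<bar> \<le> C * c ^ n" and C: "0 \<le> C" and c: "0 \<le> c"
    and t: "0 \<le> t" and h: "0 \<le> h" and th: "t + h \<le> T"
  shows "\<bar>egf a (t + h) - egf a t - h * egf (\<lambda>n. a (Suc n)) t\<bar> \<le> C * c ^ 2 * exp (c * T) * h ^ 2"
proof -
  let ?a1 = "\<lambda>n. a (Suc n)" and ?a2 = "\<lambda>n. a (Suc (Suc n))"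
  have b1: "\<bar>?a1 n\<bar> \<le> (C * c) * c ^ n" for n using a[of "Suc n"] by (simp add: mult_ac)
  have b2: "\<bar>?a2 n\<bar> \<le> (C * c ^ 2) * c ^ n" for n using a[of "Suc (Suc n)"] by (simp add: mult_ac power2_eq_square)
  let ?B = "C * c ^ 2 * exp (c * T)"
  have B: "\<bar>egf ?a2 x\<bar> \<le> ?B" if "0 \<le> x" "x \<le> T" for x
  proof -
    have "\<bar>egf ?a2 x\<bar> \<le> C * c ^ 2 * exp (c * \<bar>x\<bar>)" by (rule egf_bound[OF b2])
    also have "\<dots> \<le> ?B" using that c C by (intro mult_left_mono) (auto intro!: mult_left_mono)
    finally show ?thesis .
  qed
  have d1: "\<bar>egf ?a1 x - egf ?a1 t\<bar> \<le> ?B * h" if "t \<le> x" "x \<le> t + h" for x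
  proof (cases "x = t")
    case False
    then have "t < x" using that by simp
    then obtain z where z: "t < z" "z < x" "egf ?a1 x - egf ?a1 t = (x - t) * egf ?a2 z"
      using MVT2[of t x "egf ?a1" "egf ?a2"] egf_DERIV[OF b1] by auto
    then have "\<bar>egf ?a1 x - egf ?a1 t\<bar> = (x - t) * \<bar>egf ?a2 z\<bar>" by (simp add: abs_mult)
    also have "\<dots> \<le> h * ?B" using z that t th by (intro mult_mono B) auto
    finally show ?thesis by (simp add: mult_ac)
  qed (use C h in simp)
  show ?thesis
  proof (cases "h = 0")
    case False
    then have "t < t + h" using h by simp
    then obtain z where z: "t < z" "z < t + h" "egf a (t + h) - egf a t = (t + h - t) * egf ?a1 z"
      using MVT2[of t "t + h" "egf a" "egf ?a1"] egf_DERIV[OF a] by auto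
    then have "\<bar>egf a (t + h) - egf a t - h * egf ?a1 t\<bar> = \<bar>h * (egf ?a1 z - egf ?a1 t)\<bar>"
      by (simp add: algebra_simps)
    also have "\<dots> \<le> h * (?B * h)" using z h unfolding abs_mult by (intro mult_mono d1) auto
    finally show ?thesis by (simp add: power2_eq_square mult_ac)
  qed (simp add: C)
qed

section \<open>Powers and exponentials of a matrix\<close>

definition mat_bound :: "nat \<Rightarrow> real mat \<Rightarrow> real" where
  "mat_bound d A = (\<Sum>i\<le>d. \<Sum>j\<le>d. \<bar>A $$ (i, j)\<bar>)"

lemma mat_bound_nonneg: "0 \<le> mat_bound d A"
  unfolding mat_bound_def by (intro sum_nonneg) auto

lemma mat_entry_le_bound:
  assumes "i \<le> d" "j \<le> d" shows "\<bar>A $$ (i, j)\<bar> \<le> mat_bound d A"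
proof -
  have "\<bar>A $$ (i, j)\<bar> \<le> (\<Sum>j\<le>d. \<bar>A $$ (i, j)\<bar>)" using assms by (intro member_le_sum) auto
  also have "\<dots> \<le> mat_bound d A"
    unfolding mat_bound_def using assms
    by (intro member_le_sum[of i _ "\<lambda>i. \<Sum>j\<le>d. \<bar>A $$ (i, j)\<bar>"] sum_nonneg) auto
  finally show ?thesis .
qed

lemma pow_mat_Suc_entry:
  assumes A: "A \<in> carrier_mat (d + 1) (d + 1)" and "i \<le> d" "j \<le> d"
  shows "(A ^\<^sub>m Suc n) $$ (i, j) = (\<Sum>k\<le>d. (A ^\<^sub>m n) $$ (i, k) * A $$ (k, j))"
  using assms pow_carrier_mat[OF A, of n]
  by (simp add: times_mat_def scalar_prod_def atLeast0LessThan lessThan_Suc_atMost)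

text \<open>Row sums are bounded instead of single entries, because they multiply without an extra
  factor \<open>d + 1\<close>.\<close>

lemma pow_mat_row_bound:
  assumes A: "A \<in> carrier_mat (d + 1) (d + 1)" and "i \<le> d"
  shows "(\<Sum>j\<le>d. \<bar>(A ^\<^sub>m n) $$ (i, j)\<bar>) \<le> mat_bound d A ^ n"
proof (induction n)
  case 0
  have "(\<Sum>j\<le>d. \<bar>(A ^\<^sub>m 0) $$ (i, j)\<bar>) = (\<Sum>j\<le>d. if j = i then 1 else 0)"
    using assms by (intro sum.cong) auto
  then show ?case using assms by simp
next
  case (Suc n)
  have "(\<Sum>j\<le>d. \<bar>(A ^\<^sub>m Suc n) $$ (i, j)\<bar>) \<le> (\<Sum>j\<le>d. \<Sum>k\<le>d. \<bar>(A ^\<^sub>m n) $$ (i, k)\<bar> * \<bar>A $$ (k, j)\<bar>)"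
    using assms by (intro sum_mono) (subst pow_mat_Suc_entry, auto intro!: order_trans[OF sum_abs] sum_mono simp: abs_mult)
  also have "\<dots> = (\<Sum>k\<le>d. \<bar>(A ^\<^sub>m n) $$ (i, k)\<bar> * (\<Sum>j\<le>d. \<bar>A $$ (k, j)\<bar>))"
    by (subst sum.swap) (simp add: sum_distrib_left)
  also have "\<dots> \<le> (\<Sum>k\<le>d. \<bar>(A ^\<^sub>m n) $$ (i, k)\<bar> * mat_bound d A)"
    unfolding mat_bound_def
    by (intro sum_mono mult_left_mono member_le_sum[of _ _ "\<lambda>i. \<Sum>j\<le>d. \<bar>A $$ (i, j)\<bar>"] sum_nonneg) auto
  also have "\<dots> \<le> mat_bound d A ^ n * mat_bound d A"
    unfolding sum_distrib_right[symmetric] by (intro mult_right_mono Suc mat_bound_nonneg)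
  finally show ?case by (simp add: mult.commute)
qed

context
  fixes d :: nat and A :: "real mat"
  assumes A: "A \<in> carrier_mat (d + 1) (d + 1)"
begin

lemma pow_mat_entry_bound: "i \<le> d \<Longrightarrow> j \<le> d \<Longrightarrow> \<bar>(A ^\<^sub>m n) $$ (i, j)\<bar> \<le> 1 * mat_bound d A ^ n"
  using pow_mat_row_bound[OF A, of i n] member_le_sum[of j "{..d}" "\<lambda>j. \<bar>(A ^\<^sub>m n) $$ (i, j)\<bar>"] by simp

lemma transition_prob_egf: "transition_prob A t i j = egf (\<lambda>n. (A ^\<^sub>m n) $$ (i, j)) t"
  by (simp add: transition_prob_def egf_def)

lemma transition_prob_0: "i \<le> d \<Longrightarrow> j \<le> d \<Longrightarrow> transition_prob A 0 i j = (if i = j then 1 else 0)"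
  using A by (simp add: transition_prob_egf egf_0)

text \<open>Together with \<open>egf_DERIV\<close> this is the Kolmogorov forward equation.\<close>

lemma transition_prob_forward:
  assumes "i \<le> d" "j \<le> d"
  shows "egf (\<lambda>n. (A ^\<^sub>m Suc n) $$ (i, j)) t = (\<Sum>k\<le>d. transition_prob A t i k * A $$ (k, j))"
proof -
  have "egf (\<lambda>n. (A ^\<^sub>m Suc n) $$ (i, j)) t = egf (\<lambda>n. \<Sum>k\<le>d. A $$ (k, j) * (A ^\<^sub>m n) $$ (i, k)) t"
    using assms by (simp only: pow_mat_Suc_entry[OF A] mult.commute)
  also have "\<dots> = (\<Sum>k\<le>d. A $$ (k, j) * egf (\<lambda>n. (A ^\<^sub>m n) $$ (i, k)) t)"
    using assms by (intro egf_sum[where C = 1 and c = "mat_bound d A"]) (auto intro: order_trans[OF pow_mat_entry_bound])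
  finally show ?thesis by (simp add: transition_prob_egf mult.commute)
qed

lemma transition_prob_Taylor:
  assumes ij: "i \<le> d" "j \<le> d" and "0 \<le> t" "0 \<le> h" "t + h \<le> T"
  shows "\<bar>transition_prob A (t + h) i j - transition_prob A t i j
      - h * (\<Sum>k\<le>d. transition_prob A t i k * A $$ (k, j))\<bar>
    \<le> mat_bound d A ^ 2 * exp (mat_bound d A * T) * h ^ 2"
  using egf_Taylor[of "\<lambda>n. (A ^\<^sub>m n) $$ (i, j)" 1 "mat_bound d A" t h T] pow_mat_entry_bound[OF ij] assms
  unfolding transition_prob_forward[OF ij, symmetric] unfolding transition_prob_egf
  by (simp add: mat_bound_nonneg del: pow_mat.simps)

lemma transition_prob_short_time:
  assumes "i \<le> d" "j \<le> d" "0 \<le> h" "h \<le> 1"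
  shows "\<bar>transition_prob A h i j - (if i = j then 1 else 0) - h * A $$ (i, j)\<bar>
    \<le> mat_bound d A ^ 2 * exp (mat_bound d A) * h ^ 2"
proof -
  have "(\<Sum>k\<le>d. transition_prob A 0 i k * A $$ (k, j)) = (\<Sum>k\<le>d. if k = i then A $$ (k, j) else 0)"
    using assms by (intro sum.cong) (auto simp: transition_prob_0)
  then have "(\<Sum>k\<le>d. transition_prob A 0 i k * A $$ (k, j)) = A $$ (i, j)" using assms by simp
  then show ?thesis using transition_prob_Taylor[of i j 0 h 1] assms by (simp add: transition_prob_0)
qed

lemma transition_prob_bound:
  assumes "i \<le> d" "j \<le> d" shows "\<bar>transition_prob A t i j\<bar> \<le> exp (mat_bound d A * \<bar>t\<bar>)"
  using egf_bound[of "\<lambda>n. (A ^\<^sub>m n) $$ (i, j)" 1 "mat_bound d A" t] pow_mat_entry_bound[OF assms]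
  by (simp add: transition_prob_egf)

lemma transition_prob_invariant:
  assumes p: "\<And>j. j \<le> d \<Longrightarrow> (\<Sum>i\<le>d. p i * A $$ (i, j)) = 0" and j: "j \<le> d"
  shows "(\<Sum>i\<le>d. p i * transition_prob A t i j) = p j"
proof -
  have z: "(\<Sum>i\<le>d. p i * (A ^\<^sub>m n) $$ (i, l)) = (if n = 0 then p l else 0)" if "l \<le> d" for n l
    using that
  proof (induction n arbitrary: l)
    case 0
    have "(\<Sum>i\<le>d. p i * (A ^\<^sub>m 0) $$ (i, l)) = (\<Sum>i\<le>d. if i = l then p i else 0)"
      using 0 A by (intro sum.cong) auto
    then show ?case using 0 by simp
  next
    case (Suc n)
    have "(\<Sum>i\<le>d. p i * (A ^\<^sub>m Suc n) $$ (i, l)) = (\<Sum>i\<le>d. \<Sum>k\<le>d. p i * (A ^\<^sub>m n) $$ (i, k) * A $$ (k, l))"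
      using Suc.prems by (intro sum.cong refl) (subst pow_mat_Suc_entry[OF A], auto simp: sum_distrib_left mult_ac)
    also have "\<dots> = (\<Sum>k\<le>d. (\<Sum>i\<le>d. p i * (A ^\<^sub>m n) $$ (i, k)) * A $$ (k, l))"
      by (subst sum.swap) (simp add: sum_distrib_right)
    also have "\<dots> = (\<Sum>k\<le>d. (if n = 0 then p k else 0) * A $$ (k, l))" by (intro sum.cong) (simp_all add: Suc.IH)
    also have "\<dots> = 0" using p[OF Suc.prems] by (cases n) auto
    finally show ?case by simp
  qed
  have "(\<Sum>i\<le>d. p i * transition_prob A t i j) = egf (\<lambda>n. \<Sum>i\<le>d. p i * (A ^\<^sub>m n) $$ (i, j)) t"
    unfolding transition_prob_egf using j
    by (intro egf_sum[where C = 1 and c = "mat_bound d A", symmetric]) (auto intro: order_trans[OF pow_mat_entry_bound])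
  \<comment> \<open>Only the term \<open>n = 0\<close> survives; writing it with
    \<open>0 ^ n\<close> makes it a geometric sequence of ratio \<open>0\<close>, whose generating
    function is \<open>exp 0\<close>.\<close>
  also have "\<dots> = egf (\<lambda>n. p j * 0 ^ n) t" by (simp add: z[OF j] power_0_left if_distrib cong: if_cong)
  also have "\<dots> = (\<Sum>i\<in>{()}. p j * egf (\<lambda>n. 0 ^ n) t)"
    by (subst egf_sum[where C = 1 and c = 0 and I = "{()}" and w = "\<lambda>_. p j" and a = "\<lambda>_ n. 0 ^ n", symmetric]) auto
  also have "\<dots> = p j" using egf_geometric[of 0 t] by simp
  finally show ?thesis .
qed

text \<open>The diagonal of a power of a triangular matrix is the power of the diagonal. For the
  pure birth generator this is the probability of not having left \<open>i\<close>.\<close>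

lemma transition_prob_triangular_diag:
  assumes tri: "\<And>i j. i \<le> d \<Longrightarrow> j \<le> d \<Longrightarrow> j < i \<Longrightarrow> A $$ (i, j) = 0" and i: "i \<le> d"
  shows "transition_prob A t i i = exp (A $$ (i, i) * t)"
proof -
  have "(\<forall>j<i. (A ^\<^sub>m n) $$ (i, j) = 0) \<and> (A ^\<^sub>m n) $$ (i, i) = (A $$ (i, i)) ^ n" for n
  proof (induction n)
    case 0
    then show ?case using i A by auto
  next
    case (Suc n)
    have *: "(\<Sum>k\<le>d. (A ^\<^sub>m n) $$ (i, k) * A $$ (k, j)) = (if j = i then (A $$ (i, i)) ^ Suc n else 0)" if "j \<le> i" for j
    proof -
      have "(\<Sum>k\<le>d. (A ^\<^sub>m n) $$ (i, k) * A $$ (k, j)) = (\<Sum>k\<le>d. if k = i then (if j = i then (A $$ (i, i)) ^ Suc n else 0) else 0)"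
      proof (intro sum.cong refl)
        fix k assume k: "k \<in> {..d}"
        show "(A ^\<^sub>m n) $$ (i, k) * A $$ (k, j) = (if k = i then (if j = i then (A $$ (i, i)) ^ Suc n else 0) else 0)"
          using k that i Suc tri[of k j] by (cases k i rule: linorder_cases) (auto simp: mult.commute le_less)
      qed
      then show ?thesis using i by simp
    qed
    then show ?case using i by (auto simp: pow_mat_Suc_entry[OF A] simp del: pow_mat.simps)
  qed
  then show ?thesis by (simp add: transition_prob_egf egf_geometric)
qed

end

lemma discrete_Gronwall:
  fixes w :: "nat \<Rightarrow> real"
  assumes "\<And>i. i < m \<Longrightarrow> w (Suc i) \<le> (1 + c) * w i + e i" and "0 \<le> c" "\<And>i. 0 \<le> e i"
  shows "k \<le> m \<Longrightarrow> w k \<le> (1 + c) ^ k * (\<bar>w 0\<bar> + (\<Sum>i<k. e i))"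
proof (induction k)
  case (Suc k)
  have "w (Suc k) \<le> (1 + c) * w k + e k" using assms(1)[of k] Suc.prems by simp
  also have "\<dots> \<le> (1 + c) * ((1 + c) ^ k * (\<bar>w 0\<bar> + (\<Sum>i<k. e i))) + (1 + c) ^ Suc k * e k"
  proof (intro add_mono mult_left_mono)
    show "e k \<le> (1 + c) ^ Suc k * e k"
      using assms(2,3) one_le_power[of "1 + c" "Suc k"] mult_right_mono[of 1 "(1 + c) ^ Suc k" "e k"] by simp
  qed (use Suc assms in auto)
  also have "\<dots> = (1 + c) ^ Suc k * (\<bar>w 0\<bar> + (\<Sum>i<Suc k. e i))" by (simp add: algebra_simps)
  finally show ?case .
qed auto

section \<open>Paths\<close>

lemma epoch_0: "epoch X V 0 \<omega> = 0" and dual_state_0: "dual_state X V 0 \<omega> = 0"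
  by (simp_all add: epoch_def dual_state_def)

text \<open>Every transition of the pair happens at the smaller of the two waiting times, in all three
  branches of \<^const>\<open>dual_step\<close>.\<close>

lemma epoch_Suc:
  "epoch X V (Suc n) \<omega> = (if epoch X V n \<omega> = \<infinity> then \<infinity> else
     epoch X V n \<omega> + min (waiting_time X (enn2real (epoch X V n \<omega>)) \<omega>) (V (Suc n) \<omega>))"
  by (auto simp: epoch_def case_prod_beta Let_def min_def not_less)

lemma dual_state_Suc:
  "dual_state X V (Suc n) \<omega> = (let \<tau> = epoch X V n \<omega>; y = dual_state X V n \<omega>;
       W = waiting_time X (enn2real \<tau>) \<omega> in
     if \<tau> = \<infinity> then y
     else if W < V (Suc n) \<omega> then (if X (enn2real (\<tau> + W)) \<omega> = y + 1 then y + 1 else y)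
     else if V (Suc n) \<omega> < W then y + 1 else y)"
  by (auto simp: epoch_def dual_state_def case_prod_beta Let_def)

primrec jump_time :: "(real \<Rightarrow> 'a \<Rightarrow> nat) \<Rightarrow> nat \<Rightarrow> 'a \<Rightarrow> ennreal" where
  "jump_time X 0 \<omega> = 0"
| "jump_time X (Suc k) \<omega> = (if jump_time X k \<omega> = \<infinity> then \<infinity>
     else jump_time X k \<omega> + waiting_time X (enn2real (jump_time X k \<omega>)) \<omega>)"

definition step_count :: "(real \<Rightarrow> 'a \<Rightarrow> nat) \<Rightarrow> (nat \<Rightarrow> 'a \<Rightarrow> ennreal) \<Rightarrow> real \<Rightarrow> 'a \<Rightarrow> nat" where
  "step_count X V t \<omega> = (LEAST n. ennreal t < epoch X V (Suc n) \<omega>)"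

lemma dual_process_eq: "dual_process X V t \<omega> = dual_state X V (step_count X V t \<omega>) \<omega>"
  by (simp add: dual_process_def step_count_def)

text \<open>The least of finitely many positive gaps, where a gap that ends at infinity imposes no
  bound. Grids finer than it separate the jumps, or the epochs, up to a fixed time.\<close>

lemma positive_uniform_gap:
  fixes f :: "nat \<Rightarrow> ennreal"
  assumes "\<And>n. f n \<noteq> \<infinity> \<Longrightarrow> f n < f (Suc n)" and "\<And>n. f n = \<infinity> \<Longrightarrow> f (Suc n) = \<infinity>"
  shows "\<exists>\<delta>>0. \<forall>n\<le>K. f n + ennreal \<delta> \<le> f (Suc n)"
proof (induction K)
  have one: "\<exists>\<delta>>0. f n + ennreal \<delta> \<le> f (Suc n)" for n
  proof (cases "f n = \<infinity> \<or> f (Suc n) = \<infinity>")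
    case True
    then show ?thesis using assms(2)[of n] by (intro exI[of _ 1]) auto
  next
    case False
    then obtain a b where "f n = ennreal a" "0 \<le> a" "f (Suc n) = ennreal b" "0 \<le> b"
      by (metis ennreal_cases infinity_ennreal_def)
    moreover from this have "a < b" using assms(1)[of n] False by (simp add: ennreal_less_iff)
    ultimately show ?thesis by (intro exI[of _ "b - a"]) (simp flip: ennreal_plus)
  qed
  case 0
  then show ?case using one[of 0] by simp
  case (Suc K)
  then obtain d1 where d1: "0 < d1" "\<forall>n\<le>K. f n + ennreal d1 \<le> f (Suc n)" by blast
  obtain d2 where d2: "0 < d2" "f (Suc K) + ennreal d2 \<le> f (Suc (Suc K))" using one by blast
  show ?case
  proof (intro exI[of _ "min d1 d2"] conjI allI impI)
    show "0 < min d1 d2" using d1 d2 by simp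
    fix n assume "n \<le> Suc K"
    then consider "n \<le> K" | "n = Suc K" by linarith
    then show "f n + ennreal (min d1 d2) \<le> f (Suc n)"
    proof cases
      case 1
      then have "f n + ennreal d1 \<le> f (Suc n)" using d1 by simp
      moreover have "f n + ennreal (min d1 d2) \<le> f n + ennreal d1" by (intro add_left_mono ennreal_leI) simp
      ultimately show ?thesis by order
    next
      case 2
      moreover have "f n + ennreal (min d1 d2) \<le> f n + ennreal d2" by (intro add_left_mono ennreal_leI) simp
      ultimately show ?thesis using d2 by (metis order_trans)
    qed
  qed
qed

section \<open>Jumps along a single path of the chain\<close>

locale step_path =
  fixes X :: "real \<Rightarrow> 'a \<Rightarrow> nat" and \<omega> :: 'a
  assumes rcont: "\<And>t. 0 \<le> t \<Longrightarrow> continuous (at_right t) (\<lambda>s. X s \<omega>)"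
    and llim: "\<And>t. 0 < t \<Longrightarrow> \<exists>l. ((\<lambda>s. X s \<omega>) \<longlongrightarrow> l) (at_left t)"
begin

lemma const_right:
  assumes "0 \<le> t"
  obtains e where "0 < e" "\<And>u. t \<le> u \<Longrightarrow> u < t + e \<Longrightarrow> X u \<omega> = X t \<omega>"
proof -
  have "((\<lambda>s. X s \<omega>) \<longlongrightarrow> X t \<omega>) (at_right t)"
    using rcont[OF assms] by (simp add: continuous_within)
  then have "eventually (\<lambda>s. X s \<omega> = X t \<omega>) (at_right t)" by (simp add: tendsto_discrete)
  then obtain b where b: "t < b" "\<And>u. t < u \<Longrightarrow> u < b \<Longrightarrow> X u \<omega> = X t \<omega>"
    by (auto simp: eventually_at_right_field)
  have "X u \<omega> = X t \<omega>" if "t \<le> u" "u < t + (b - t)" for u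
    using b(2)[of u] that by (cases "u = t") auto
  moreover have "0 < b - t" using b(1) by simp
  ultimately show ?thesis by (rule that[rotated])
qed

lemma const_left:
  assumes "0 < t"
  obtains l e where "0 < e" "\<And>u. t - e < u \<Longrightarrow> u < t \<Longrightarrow> X u \<omega> = l"
proof -
  obtain l where "((\<lambda>s. X s \<omega>) \<longlongrightarrow> l) (at_left t)" using llim[OF assms] by blast
  then have "eventually (\<lambda>s. X s \<omega> = l) (at_left t)" by (simp add: tendsto_discrete)
  then obtain b where b: "b < t" "\<And>u. b < u \<Longrightarrow> u < t \<Longrightarrow> X u \<omega> = l"
    by (auto simp: eventually_at_left_field)
  then have "X u \<omega> = l" if "t - (t - b) < u" "u < t" for u using that by simp
  moreover have "0 < t - b" using b(1) by simp
  ultimately show ?thesis by (rule that[rotated])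
qed

text \<open>Right-continuity makes the infimum in \<open>waiting_time\<close> positive and attained:
  just after \<open>s\<close>, and likewise just after a moment of agreement, the path rests for a
  while.\<close>

lemma wait_cases:
  assumes s: "0 \<le> s"
  obtains (inf) "waiting_time X s \<omega> = \<infinity>" "\<And>u. s \<le> u \<Longrightarrow> X u \<omega> = X s \<omega>"
  | (fin) w where "0 < w" "waiting_time X s \<omega> = ennreal w"
      "\<And>u. s \<le> u \<Longrightarrow> u < s + w \<Longrightarrow> X u \<omega> = X s \<omega>" "X (s + w) \<omega> \<noteq> X s \<omega>"
proof -
  define S where "S = {u. 0 < u \<and> X (s + u) \<omega> \<noteq> X s \<omega>}"
  have W: "waiting_time X s \<omega> = (INF u\<in>S. ennreal u)" by (simp add: waiting_time_def S_def)
  show ?thesis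
  proof (cases "S = {}")
    case True
    have "X u \<omega> = X s \<omega>" if "s \<le> u" for u
    proof (cases "u = s")
      case False
      then have "0 < u - s" using that by simp
      moreover have "u - s \<notin> S" using True by simp
      ultimately show ?thesis by (simp add: S_def)
    qed simp
    moreover have "waiting_time X s \<omega> = \<infinity>" by (simp add: W True)
    ultimately show ?thesis by (rule inf[rotated])
  next
    case False
    define w where "w = Inf S"
    have bdd: "bdd_below S" by (intro bdd_belowI[of _ 0]) (auto simp: S_def)
    have lo: "w \<le> u" if "u \<in> S" for u unfolding w_def using that bdd by (rule cInf_lower)
    \<comment> \<open>If the path agrees with \<open>X s\<close> on an interval that starts at a
      lower bound \<open>v \<ge> w\<close> of \<open>S\<close>, then the infimum exceeds
      \<open>w\<close>. The case \<open>v = 0\<close> gives \<open>0 < w\<close>, the case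
      \<open>v = w\<close> gives the jump at \<open>s + w\<close>.\<close>
    have gap: False if e: "0 < e" and w: "\<And>u. s + v \<le> u \<Longrightarrow> u < s + v + e \<Longrightarrow> X u \<omega> = X s \<omega>"
      and v: "\<And>u. u \<in> S \<Longrightarrow> v \<le> u" "w \<le> v" for e v
    proof -
      have "v + e \<le> u" if "u \<in> S" for u
      proof (rule ccontr)
        assume "\<not> v + e \<le> u"
        then have "X (s + u) \<omega> = X s \<omega>" using v(1)[OF that] by (intro w) auto
        then show False using that by (simp add: S_def)
      qed
      then have "v + e \<le> w" unfolding w_def using False by (intro cInf_greatest) auto
      then show False using e v(2) by simp
    qed
    have "w \<ge> 0" unfolding w_def using False by (intro cInf_greatest) (auto simp: S_def)
    have w0: "0 < w"
    proof (rule ccontr)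
      assume "\<not> 0 < w"
      then have "w = 0" using \<open>w \<ge> 0\<close> by simp
      obtain e where e: "0 < e" "\<And>u. s \<le> u \<Longrightarrow> u < s + e \<Longrightarrow> X u \<omega> = X s \<omega>"
        by (rule const_right[OF s]) blast
      show False
      proof (rule gap[of e 0])
        show "X u \<omega> = X s \<omega>" if "s + 0 \<le> u" "u < s + 0 + e" for u
          using that by (intro e(2)) auto
      qed (use \<open>w = 0\<close> lo e(1) in auto)
    qed
    have jump: "X (s + w) \<omega> \<noteq> X s \<omega>"
    proof
      assume eq: "X (s + w) \<omega> = X s \<omega>"
      have "0 \<le> s + w" using s w0 by simp
      then obtain e where e: "0 < e" "\<And>u. s + w \<le> u \<Longrightarrow> u < s + w + e \<Longrightarrow> X u \<omega> = X (s + w) \<omega>"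
        by (rule const_right) blast
      show False
      proof (rule gap[of e w])
        show "X u \<omega> = X s \<omega>" if "s + w \<le> u" "u < s + w + e" for u
          unfolding eq[symmetric] using that by (intro e(2)) auto
      qed (use lo e(1) in auto)
    qed
    have "w \<in> S" using w0 jump by (simp add: S_def)
    then have "waiting_time X s \<omega> = ennreal w"
      unfolding W by (intro antisym INF_lower INF_greatest ennreal_leI lo) auto
    moreover have "X u \<omega> = X s \<omega>" if "s \<le> u" "u < s + w" for u
    proof (rule ccontr)
      assume ne: "X u \<omega> \<noteq> X s \<omega>"
      then have "u \<noteq> s" by auto
      then have "u - s \<in> S" using that ne by (simp add: S_def)
      then show False using lo[of "u - s"] that by simp
    qed
    ultimately show ?thesis using w0 jump by (intro fin)
  qed
qed

lemma wait_pos: assumes "0 \<le> s" shows "0 < waiting_time X s \<omega>"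
  using assms
proof (cases s rule: wait_cases)
  case (fin w)
  show ?thesis using fin(1,2) by simp
next
  case inf
  show ?thesis using inf(1) by simp
qed

lemma const_before_wait:
  assumes "0 \<le> s" "s \<le> u" "ennreal u < ennreal s + waiting_time X s \<omega>"
  shows "X u \<omega> = X s \<omega>"
  using assms(1)
proof (cases s rule: wait_cases)
  case (fin w)
  have "u < s + w" using assms(1,2,3) fin(1,2) by (simp add: ennreal_less_iff flip: ennreal_plus)
  from assms(2) this show ?thesis by (rule fin(3))
next
  case inf
  show ?thesis by (rule inf(2)[OF assms(2)])
qed

lemma wait_gt:
  assumes s: "0 \<le> s" "s \<le> t" and c: "\<And>u. s \<le> u \<Longrightarrow> u \<le> t \<Longrightarrow> X u \<omega> = X s \<omega>"
  shows "ennreal t < ennreal s + waiting_time X s \<omega>"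
  using s(1)
proof (cases s rule: wait_cases)
  case (fin w)
  have "t < s + w"
  proof (rule ccontr)
    assume "\<not> t < s + w"
    then have "X (s + w) \<omega> = X s \<omega>" using fin(1) by (intro c) auto
    then show False using fin(4) by contradiction
  qed
  show ?thesis using fin(1,2) \<open>t < s + w\<close> s by (simp add: ennreal_less_iff flip: ennreal_plus)
next
  case inf
  show ?thesis unfolding inf(1) by simp
qed

text \<open>Epochs of the pair also occur at births, between jumps of \<open>X\<close>. Restarting
  the wait there does not bring the next jump forward, so epochs can be compared with jump
  times.\<close>

lemma next_jump_mono:
  assumes "0 \<le> s" "s \<le> s'"
  shows "ennreal s + waiting_time X s \<omega> \<le> ennreal s' + waiting_time X s' \<omega>"
  using assms(1)
proof (cases s rule: wait_cases)
  case inf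
  have "0 \<le> s'" using assms by simp
  then have "waiting_time X s' \<omega> = \<infinity>"
  proof (cases s' rule: wait_cases)
    case (fin w)
    have "X (s' + w) \<omega> = X s \<omega>" "X s' \<omega> = X s \<omega>" by (rule inf(2); use fin(1) assms in simp)+
    then show ?thesis using fin(4) by simp
  qed
  then show ?thesis by simp
next
  case (fin w)
  show ?thesis
  proof (cases "s + w \<le> s'")
    case True
    have "ennreal s + waiting_time X s \<omega> = ennreal (s + w)" using fin(1,2) assms by simp
    also have "\<dots> \<le> ennreal s' + 0" using True by (simp add: ennreal_leI)
    also have "\<dots> \<le> ennreal s' + waiting_time X s' \<omega>" by (intro add_left_mono) simp
    finally show ?thesis .
  next
    case F: False
    show ?thesis
    proof (rule ccontr)
      assume "\<not> ?thesis"
      then have *: "ennreal s' + waiting_time X s' \<omega> < ennreal (s + w)" using fin(1,2) assms by (simp add: not_le)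
      have "0 \<le> s'" using assms by simp
      then obtain w' where w': "0 < w'" "waiting_time X s' \<omega> = ennreal w'" "X (s' + w') \<omega> \<noteq> X s' \<omega>"
      proof (cases s' rule: wait_cases)
        case (fin w')
        show ?thesis by (rule that[OF fin(1,2,4)])
      next
        case inf
        then show ?thesis using * by simp
      qed
      then have "s' + w' < s + w" using * assms by (simp add: ennreal_less_iff flip: ennreal_plus)
      then have "X (s' + w') \<omega> = X s \<omega>" "X s' \<omega> = X s \<omega>" using assms w'(1) F by (intro fin(3); simp)+
      then show False using w' by simp
    qed
  qed
qed

lemma jump_time_less: "jump_time X k \<omega> \<noteq> \<infinity> \<Longrightarrow> jump_time X k \<omega> < jump_time X (Suc k) \<omega>"
  using wait_pos[of "enn2real (jump_time X k \<omega>)"]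
  by (auto simp: ennreal_add_left_cancel_less less_top intro!: order.strict_trans1[of _ "jump_time X k \<omega> + 0"])

lemma jump_time_mono: "j \<le> k \<Longrightarrow> jump_time X j \<omega> \<le> jump_time X k \<omega>"
proof (rule lift_Suc_mono_le[of "\<lambda>k. jump_time X k \<omega>"])
  show "jump_time X n \<omega> \<le> jump_time X (Suc n) \<omega>" for n
    using jump_time_less[of n] by (cases "jump_time X n \<omega> = \<infinity>") (auto simp del: jump_time.simps simp: jump_time.simps(2))
qed

lemma jump_time_step:
  assumes "jump_time X k \<omega> = ennreal a" "jump_time X (Suc k) \<omega> = ennreal b" "0 \<le> a" "0 \<le> b"
  shows "a < b" "X b \<omega> \<noteq> X a \<omega>" "\<And>u. a \<le> u \<Longrightarrow> u < b \<Longrightarrow> X u \<omega> = X a \<omega>"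
proof -
  have eq: "ennreal b = ennreal a + waiting_time X a \<omega>" using assms by simp
  from \<open>0 \<le> a\<close> obtain w where w: "0 < w" "waiting_time X a \<omega> = ennreal w"
      "\<And>u. a \<le> u \<Longrightarrow> u < a + w \<Longrightarrow> X u \<omega> = X a \<omega>" "X (a + w) \<omega> \<noteq> X a \<omega>"
  proof (cases a rule: wait_cases)
    case (fin w)
    show ?thesis by (rule that[OF fin])
  next
    case inf
    then show ?thesis using eq by simp
  qed
  have b: "b = a + w" using eq assms(3,4) w(1,2) by (simp flip: ennreal_plus)
  show "a < b" "X b \<omega> \<noteq> X a \<omega>" using w(1,4) b by auto
  show "X u \<omega> = X a \<omega>" if "a \<le> u" "u < b" for u using that b by (intro w(3)) auto
qed

text \<open>Bounded jump times would accumulate at their supremum, but a left limit in a discrete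
  space means that the path is constant just before that time.\<close>

lemma jump_time_unbounded: "\<exists>k. ennreal t < jump_time X k \<omega>"
proof (rule ccontr)
  assume "\<not> ?thesis"
  then have le: "jump_time X k \<omega> \<le> ennreal t" for k by (simp add: not_less)
  define r where "r k = enn2real (jump_time X k \<omega>)" for k
  have fin: "jump_time X k \<omega> = ennreal (r k)" "0 \<le> r k" for k
    using le[of k] by (auto simp: r_def ennreal_enn2real_if top_unique)
  have step: "r k < r (Suc k)" "X (r (Suc k)) \<omega> \<noteq> X (r k) \<omega>" for k
    using jump_time_step[OF fin(1) fin(1) fin(2) fin(2)] by auto
  have "0 \<le> t"
  proof (rule ccontr)
    assume "\<not> 0 \<le> t"
    then have "ennreal (r 1) \<le> 0" using le[of 1] fin(1)[of 1] by (simp add: ennreal_neg)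
    then show False using step(1)[of 0] fin(2)[of 0] by simp
  qed
  then have bdd: "r k \<le> t" for k using le[of k] fin[of k] by (simp add: ennreal_le_iff)
  define L where "L = (SUP k. r k)"
  have bddr: "bdd_above (range r)" using bdd by (auto intro!: bdd_aboveI)
  have lt: "r k < L" for k
    using step(1)[of k] cSUP_upper[OF UNIV_I bddr, of "Suc k"] by (simp add: L_def)
  then have "0 < L" using fin(2)[of 0] by (metis le_less_trans)
  then obtain l e where e: "0 < e" "\<And>u. L - e < u \<Longrightarrow> u < L \<Longrightarrow> X u \<omega> = l"
    by (rule const_left) blast
  have "\<exists>k. L - e < r k" using e less_cSUP_iff[OF _ bddr, of "L - e"] by (auto simp: L_def)
  then obtain k where k: "L - e < r k" by blast
  have "X (r k) \<omega> = l" by (rule e(2)) (use k lt in auto)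
  moreover have "X (r (Suc k)) \<omega> = l" by (rule e(2)) (use k lt step(1)[of k] in auto)
  ultimately show False using step(2)[of k] by simp
qed

text \<open>Once the mesh is below the least gap between the jumps, each jump has a cell of its own,
  whose ends show the values before and after it. Changes over a cell concern two fixed times only,
  so their expected number can be estimated from transition probabilities.\<close>

lemma grid_changes_ge:
  assumes t: "0 < t" and k: "jump_time X k \<omega> \<le> ennreal t"
  shows "\<forall>\<^sub>F m in sequentially.
    k \<le> card {i. i < m \<and> X (t * real i / real m) \<omega> \<noteq> X (t * real (Suc i) / real m) \<omega>}"
proof -
  obtain \<delta> where \<delta>: "0 < \<delta>" "\<And>n. n \<le> k \<Longrightarrow> jump_time X n \<omega> + ennreal \<delta> \<le> jump_time X (Suc n) \<omega>"
    using positive_uniform_gap[of "\<lambda>n. jump_time X n \<omega>" k] jump_time_less by auto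
  define r where "r n = enn2real (jump_time X n \<omega>)" for n
  have le: "jump_time X n \<omega> \<le> ennreal t" if "n \<le> k" for n
    using jump_time_mono[OF that] k by order
  have r: "jump_time X n \<omega> = ennreal (r n)" "0 \<le> r n" "r n \<le> t" if "n \<le> k" for n
    using le[OF that] t by (auto simp: r_def ennreal_enn2real_if top_unique enn2real_leI)
  have gap: "r n + \<delta> \<le> r (Suc n)" if "Suc n \<le> k" for n
    using \<delta>(2)[of n] \<delta>(1) that r[of n] r[of "Suc n"] by (simp add: ennreal_le_iff flip: ennreal_plus del: jump_time.simps)
  have gap': "r i + \<delta> \<le> r j" if "i < j" "j \<le> k" for i j
    using that
  proof (induction j)
    case (Suc j)
    then show ?case using gap[of j] \<delta>(1) by (cases "i = j") force+
  qed simp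
  have r0: "r 0 = 0" by (simp add: r_def)
  have cb: "X u \<omega> = X (r n) \<omega>" if "n \<le> k" "r n \<le> u" "u < r n + \<delta>" for n u
  proof (rule const_before_wait)
    have "ennreal u < ennreal (r n) + ennreal \<delta>" using that r[of n] \<delta>(1)
      by (simp add: ennreal_less_iff flip: ennreal_plus)
    also have "\<dots> \<le> jump_time X (Suc n) \<omega>" using \<delta>(2)[of n] r(1)[of n] that by simp
    also have "\<dots> = ennreal (r n) + waiting_time X (r n) \<omega>" using r[of n] that by simp
    finally show "ennreal u < ennreal (r n) + waiting_time X (r n) \<omega>" .
  qed (use that r in auto)
  obtain m0 :: nat where m0: "t / \<delta> < real m0" using reals_Archimedean2 by blast
  have "k \<le> card {i. i < m \<and> X (t * real i / real m) \<omega> \<noteq> X (t * real (Suc i) / real m) \<omega>}"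
    if m: "m0 \<le> m" for m
  proof -
    have mpos: "0 < real m" using m m0 t \<delta>(1) by (smt (verit) divide_pos_pos of_nat_mono)
    have h: "t / real m < \<delta>"
    proof -
      have "t / \<delta> < real m" using m m0 by linarith
      then show ?thesis using mpos \<delta>(1) by (simp add: field_simps)
    qed
    \<comment> \<open>The cell, open on the left and closed on the right, that contains
      \<open>r j\<close>: at its left end the jump is still to come, at its right end it has
      happened.\<close>
    define c where "c j = nat (\<lceil>r j * real m / t\<rceil> - 1)" for j
    have cell: "t * real (c j) / real m < r j" "r j \<le> t * real (Suc (c j)) / real m" "c j < m"
      if j: "1 \<le> j" "j \<le> k" for j
    proof -
      have "0 < r j" using gap'[of 0 j] j r0 \<delta>(1) by simp
      then have pos: "0 < r j * real m / t" using mpos t by simp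
      then have c1: "real (c j) = of_int \<lceil>r j * real m / t\<rceil> - 1" by (simp add: c_def)
      have "real (c j) < r j * real m / t" "r j * real m / t \<le> real (c j) + 1"
        unfolding c1 by linarith+
      then show "t * real (c j) / real m < r j" "r j \<le> t * real (Suc (c j)) / real m"
        using t mpos by (simp_all add: field_simps)
      have "r j * real m / t \<le> real m" using r(3)[of j] j t mpos by (simp add: field_simps)
      then have "real (c j) < real m" using \<open>real (c j) < r j * real m / t\<close> by simp
      then show "c j < m" by simp
    qed
    have hh: "t * real (Suc i) / real m = t * real i / real m + t / real m" for i
      by (simp add: field_simps add_divide_distrib)
    have "inj_on c {1..k}"
    proof (rule linorder_inj_onI')
      fix i j assume ij: "i \<in> {1..k}" "j \<in> {1..k}" "i < j"
      show "c i \<noteq> c j"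
      proof
        assume eq: "c i = c j"
        then have "r j \<le> t * real (c i) / real m + t / real m" using cell(2)[of j] ij hh[of "c i"] by simp
        also have "\<dots> < r i + \<delta>" using cell(1)[of i] ij h by simp
        finally show False using gap'[of i j] ij by simp
      qed
    qed
    moreover have "c ` {1..k} \<subseteq> {i. i < m \<and> X (t * real i / real m) \<omega> \<noteq> X (t * real (Suc i) / real m) \<omega>}"
    proof safe
      fix j assume "j \<in> {1..k}"
      then have j: "1 \<le> j" "j \<le> k" by auto
      then obtain l where l: "j = Suc l" by (cases j) auto
      show "c j < m" using cell(3)[OF j] .
      have g: "r l + \<delta> \<le> r j" using gap'[of l j] l j by simp
      have "X (t * real (c j) / real m) \<omega> = X (r l) \<omega>"
      proof -
        have eq: "jump_time X l \<omega> = ennreal (r l)" "jump_time X (Suc l) \<omega> = ennreal (r j)" "0 \<le> r l" "0 \<le> r j"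
          using r[of l] r[of j] j l by (auto simp del: jump_time.simps)
        show ?thesis using cell(1,2)[OF j] hh[of "c j"] h g
          by (intro jump_time_step(3)[OF eq]) auto
      qed
      moreover have "X (t * real (Suc (c j)) / real m) \<omega> = X (r j) \<omega>"
        using cell(1,2)[OF j] hh[of "c j"] h j by (intro cb) auto
      moreover have "X (r j) \<omega> \<noteq> X (r l) \<omega>"
        using jump_time_step(2)[of l "r l" "r j"] r[of l] r[of j] j l by (simp del: jump_time.simps)
      moreover assume "X (t * real (c j) / real m) \<omega> = X (t * real (Suc (c j)) / real m) \<omega>"
      ultimately show False by simp
    qed
    ultimately show ?thesis using card_inj_on_le[of c "{1..k}"] by fastforce
  qed
  then show ?thesis by (auto simp: eventually_sequentially)
qed

end


lemma card_increases_le: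
  fixes f :: "nat \<Rightarrow> nat"
  assumes "\<And>i. f i \<le> f (Suc i)"
  shows "card {i. i < m \<and> f i < f (Suc i)} \<le> f m"
proof (induction m)
  case (Suc m)
  have "{i. i < Suc m \<and> f i < f (Suc i)} = {i. i < m \<and> f i < f (Suc i)} \<union> (if f m < f (Suc m) then {m} else {})"
    by (auto simp: less_Suc_eq)
  then have "card {i. i < Suc m \<and> f i < f (Suc i)}
      \<le> card {i. i < m \<and> f i < f (Suc i)} + card (if f m < f (Suc m) then {m} else {})"
    by (simp only: card_Un_le)
  then show ?case using Suc assms[of m] by (auto split: if_splits)
qed simp

section \<open>Transitions of the pair along a single path\<close>

locale driven_path = step_path X \<omega> for X :: "real \<Rightarrow> 'a \<Rightarrow> nat" and \<omega> +
  fixes V :: "nat \<Rightarrow> 'a \<Rightarrow> ennreal" and d :: nat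
  assumes state_le: "\<And>t. 0 \<le> t \<Longrightarrow> X t \<omega> \<le> d"
    and clock_top: "\<And>n. epoch X V n \<omega> < \<infinity> \<Longrightarrow> dual_state X V n \<omega> = d \<Longrightarrow> V (Suc n) \<omega> = \<infinity>"
begin

abbreviation \<tau> :: "nat \<Rightarrow> ennreal" where "\<tau> n \<equiv> epoch X V n \<omega>"
abbreviation Y :: "nat \<Rightarrow> nat" where "Y n \<equiv> dual_state X V n \<omega>"
abbreviation N :: "real \<Rightarrow> nat" where "N t \<equiv> step_count X V t \<omega>"
abbreviation W :: "nat \<Rightarrow> ennreal" where "W n \<equiv> waiting_time X (enn2real (epoch X V n \<omega>)) \<omega>"

lemma epoch_mono: "i \<le> j \<Longrightarrow> \<tau> i \<le> \<tau> j"
proof (rule lift_Suc_mono_le[of \<tau>])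
  fix n
  have "\<tau> n + 0 \<le> \<tau> n + min (W n) (V (Suc n) \<omega>)" by (intro add_left_mono) simp
  then show "\<tau> n \<le> \<tau> (Suc n)" by (simp add: epoch_Suc)
qed

lemma epoch_Suc_le_wait: "\<tau> n \<noteq> \<infinity> \<Longrightarrow> \<tau> (Suc n) \<le> \<tau> n + W n"
  by (simp add: epoch_Suc add_left_mono)

lemma clock_step:
  assumes V: "V (Suc n) \<omega> < W n" and fin: "\<tau> n \<noteq> \<infinity>"
  shows "\<tau> (Suc n) = \<tau> n + V (Suc n) \<omega>" "Y (Suc n) = Y n + 1"
proof -
  have nW: "\<not> W n < V (Suc n) \<omega>" and le: "V (Suc n) \<omega> \<le> W n" using V by simp_all
  show "\<tau> (Suc n) = \<tau> n + V (Suc n) \<omega>" using fin by (simp add: epoch_Suc min_absorb2[OF le])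
  show "Y (Suc n) = Y n + 1" using fin V nW by (simp add: dual_state_Suc Let_def)
qed

lemma dual_state_step: "Y n \<le> Y (Suc n)" "Y (Suc n) \<le> Y n + 1"
  by (auto simp: dual_state_Suc Let_def)

lemma dual_state_mono: "i \<le> j \<Longrightarrow> Y i \<le> Y j"
  by (rule lift_Suc_mono_le[of Y]) (rule dual_state_step)

lemma dual_state_diff: "i \<le> j \<Longrightarrow> Y j \<le> Y i + (j - i)"
proof (induction j rule: dec_induct)
  case (step n)
  then show ?case using dual_state_step(2)[of n] by simp
qed simp

text \<open>In state \<open>d\<close> the clock is infinite and \<open>X\<close> never reaches
  \<open>d + 1\<close>, so neither rule raises the dual.\<close>

lemma dual_state_le: "Y n \<le> d"
proof (induction n)
  case (Suc n)
  show ?case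
  proof (cases "Y n = d \<and> \<tau> n \<noteq> \<infinity>")
    case True
    then have "V (Suc n) \<omega> = \<infinity>" using clock_top[of n] by (simp add: less_top)
    then have nv: "\<not> V (Suc n) \<omega> < W n" by simp
    have nx: "X (enn2real (\<tau> n + W n)) \<omega> \<noteq> d + 1"
      using state_le[of "enn2real (\<tau> n + W n)"] by (auto simp del: enn2real_plus)
    have "Y (Suc n) = Y n" using True nx unfolding dual_state_Suc Let_def if_not_P[OF nv] by auto
    then show ?thesis using True by simp
  next
    case False
    moreover have "Y (Suc n) = Y n" if "\<tau> n = \<infinity>" using that by (simp add: dual_state_Suc)
    ultimately show ?thesis using Suc dual_state_step(2)[of n] by (cases "\<tau> n = \<infinity>") auto
  qed
qed (simp add: dual_state_0)

text \<open>A step before the next jump of \<open>X\<close> is a birth by the clock and raises the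
  dual, so at least \<open>n - Y n\<close> of the first \<open>n\<close> steps have to wait for
  jumps. As \<open>Y n \<le> d\<close>, the pair does not explode, and its steps are bounded by the
  jumps of \<open>X\<close> plus \<open>d\<close>.\<close>

lemma jump_time_le_epoch: "jump_time X (n - Y n) \<omega> \<le> \<tau> n \<and> Y n \<le> n"
proof (induction n)
  case (Suc n)
  show ?case
  proof (cases "\<tau> n = \<infinity>")
    case True
    then show ?thesis using Suc by (simp add: epoch_Suc dual_state_Suc)
  next
    case False
    then obtain r where r: "\<tau> n = ennreal r" "0 \<le> r" by (metis ennreal_cases infinity_ennreal_def)
    then have "jump_time X (n - Y n) \<omega> \<le> ennreal r" using Suc by simp
    then obtain a where a: "jump_time X (n - Y n) \<omega> = ennreal a" "0 \<le> a"
      by (metis ennreal_cases ennreal_neq_top top_unique)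
    then have "a \<le> r" using r Suc by (simp add: ennreal_le_iff)
    have J: "jump_time X (Suc (n - Y n)) \<omega> \<le> \<tau> n + W n"
      using next_jump_mono[OF a(2) \<open>a \<le> r\<close>] a r by simp
    show ?thesis
    proof (cases "V (Suc n) \<omega> < W n")
      case V: True
      then have "Y (Suc n) = Y n + 1" using False by (rule clock_step)
      moreover have "\<tau> n \<le> \<tau> (Suc n)" by (intro epoch_mono) simp
      ultimately show ?thesis using Suc by auto
    next
      case V: False
      then have "\<tau> (Suc n) = \<tau> n + W n" using False by (simp add: epoch_Suc min_def not_less)
      moreover have "jump_time X (Suc n - Y (Suc n)) \<omega> \<le> jump_time X (Suc (n - Y n)) \<omega>"
        using dual_state_step[of n] by (intro jump_time_mono) linarith
      ultimately show ?thesis using J Suc dual_state_step(2)[of n] by (auto simp del: jump_time.simps)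
    qed
  qed
qed (simp add: dual_state_0)

lemma epoch_unbounded: "\<exists>n. ennreal t < \<tau> (Suc n)"
proof -
  obtain k where k: "ennreal t < jump_time X k \<omega>" using jump_time_unbounded by blast
  have "k \<le> Suc (k + d) - Y (Suc (k + d))" using dual_state_le[of "Suc (k + d)"] by simp
  then have "jump_time X k \<omega> \<le> jump_time X (Suc (k + d) - Y (Suc (k + d))) \<omega>" by (rule jump_time_mono)
  also have "\<dots> \<le> \<tau> (Suc (k + d))" using jump_time_le_epoch by blast
  finally show ?thesis using k by (intro exI[of _ "k + d"]) order
qed

lemma less_epoch_step_count: "ennreal t < \<tau> (Suc (N t))"
  unfolding step_count_def by (rule LeastI_ex[OF epoch_unbounded])

lemma epoch_step_count_le: "\<tau> (N t) \<le> ennreal t"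
proof (cases "N t")
  case 0
  then show ?thesis by (simp add: epoch_0)
next
  case (Suc n)
  then have "n < (LEAST n. ennreal t < \<tau> (Suc n))" by (simp add: step_count_def)
  from not_less_Least[OF this] show ?thesis using Suc by (simp add: not_less)
qed

lemma step_count_mono: "t \<le> t' \<Longrightarrow> N t \<le> N t'"
  using less_epoch_step_count[of t'] unfolding step_count_def[of X V t]
  by (intro Least_le) (meson ennreal_leI order.strict_trans1)

lemma step_count_ge: assumes "\<tau> n \<le> ennreal t" shows "n \<le> N t"
proof (rule ccontr)
  assume "\<not> n \<le> N t"
  then have "\<tau> (Suc (N t)) \<le> \<tau> n" by (intro epoch_mono) simp
  then show False using assms less_epoch_step_count[of t] by order
qed

lemma step_count_eq: "\<tau> n \<le> ennreal t \<Longrightarrow> ennreal t < \<tau> (Suc n) \<Longrightarrow> N t = n"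
  using step_count_ge[of n t] unfolding step_count_def by (meson Least_le le_antisym)

lemma epoch_step_count_finite: "\<tau> (N t) \<noteq> \<infinity>"
  using epoch_step_count_le[of t] by (auto simp: top_unique)

lemma dual_process_mono: "t \<le> t' \<Longrightarrow> dual_process X V t \<omega> \<le> dual_process X V t' \<omega>"
  unfolding dual_process_eq by (intro dual_state_mono step_count_mono)

lemma dual_process_le: "dual_process X V t \<omega> \<le> d"
  unfolding dual_process_eq by (rule dual_state_le)

lemma step_count_const_right:
  assumes "0 \<le> t"
  shows "\<exists>b>t. \<forall>u. t \<le> u \<longrightarrow> u < b \<longrightarrow> N u = N t"
proof -
  have "\<exists>b>t. ennreal b \<le> \<tau> (Suc (N t))"
    using less_epoch_step_count[of t] assms
    by (cases "\<tau> (Suc (N t))" rule: ennreal_cases) (auto simp: ennreal_less_iff intro: exI[of _ "t + 1"])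
  then obtain b where b: "t < b" "ennreal b \<le> \<tau> (Suc (N t))" by blast
  have "N u = N t" if "t \<le> u" "u < b" for u
  proof (rule step_count_eq)
    show "\<tau> (N t) \<le> ennreal u" using epoch_step_count_le[of t] ennreal_leI[OF that(1)] by order
    have "ennreal u < ennreal b" using that assms by (simp add: ennreal_less_iff)
    then show "ennreal u < \<tau> (Suc (N t))" using b(2) by order
  qed
  with b(1) show ?thesis by blast
qed

lemma dual_process_rcont:
  assumes "0 \<le> t" shows "continuous (at_right t) (\<lambda>s. dual_process X V s \<omega>)"
proof -
  obtain b where b: "t < b" "\<And>u. t \<le> u \<Longrightarrow> u < b \<Longrightarrow> N u = N t"
    using step_count_const_right[OF assms] by blast
  then have "eventually (\<lambda>u. N u = N t) (at_right t)"
    unfolding eventually_at_right_field by (blast intro: less_imp_le)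
  then have "eventually (\<lambda>u. dual_process X V u \<omega> = dual_process X V t \<omega>) (at_right t)"
    by eventually_elim (simp add: dual_process_eq)
  then show ?thesis by (simp add: continuous_within tendsto_discrete)
qed

lemma dual_process_llim: "\<exists>l. ((\<lambda>s. dual_process X V s \<omega>) \<longlongrightarrow> l) (at_left t)"
proof -
  let ?S = "(\<lambda>u. dual_process X V u \<omega>) ` {u. u < t}"
  have fin: "finite ?S" by (rule finite_subset[of _ "{..d}"]) (use dual_process_le in auto)
  have "t - 1 < t" by simp
  then have "?S \<noteq> {}" by blast
  then have "Max ?S \<in> ?S" using fin by (rule Max_in[rotated])
  then obtain u0 where u0: "u0 < t" "dual_process X V u0 \<omega> = Max ?S" by auto
  have "dual_process X V u \<omega> = Max ?S" if "u0 < u" "u < t" for u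
  proof (rule antisym)
    show "dual_process X V u \<omega> \<le> Max ?S" using that fin by (intro Max_ge) auto
    show "Max ?S \<le> dual_process X V u \<omega>" unfolding u0(2)[symmetric] using that by (intro dual_process_mono) simp
  qed
  then have "eventually (\<lambda>u. dual_process X V u \<omega> = Max ?S) (at_left t)"
    unfolding eventually_at_left_field using u0(1) by blast
  then show ?thesis by (intro exI[of _ "Max ?S"]) (simp add: tendsto_discrete)
qed

lemma const_between_epochs:
  assumes "0 \<le> u" "\<tau> n \<le> ennreal u" "ennreal u < \<tau> (Suc n)"
  shows "X u \<omega> = X (enn2real (\<tau> n)) \<omega>"
proof (rule const_before_wait)
  have fin: "\<tau> n \<noteq> \<infinity>" using assms(2) by (auto simp: top_unique)
  then have r: "ennreal (enn2real (\<tau> n)) = \<tau> n" by (simp add: ennreal_enn2real_if)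
  show "enn2real (\<tau> n) \<le> u" using assms(1,2) by (simp add: enn2real_leI)
  show "ennreal u < ennreal (enn2real (\<tau> n)) + W n"
    unfolding r using assms(3) epoch_Suc_le_wait[OF fin] by order
qed simp

text \<open>While \<open>X\<close> rests, only the clock can cause the next transition of the pair,
  so the dual stays put through the cell exactly if the clock running at \<open>s\<close> outlasts
  the cell.\<close>

lemma cell_const:
  assumes s: "0 \<le> s" "0 \<le> h" and J: "\<And>u. s \<le> u \<Longrightarrow> u \<le> s + h \<Longrightarrow> X u \<omega> = X s \<omega>"
  shows "ennreal (s + h) < \<tau> (N s) + W (N s)"
    and "dual_process X V (s + h) \<omega> = dual_process X V s \<omega> \<longleftrightarrow> ennreal (s + h) < \<tau> (N s) + V (Suc (N s)) \<omega>"
proof -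
  let ?n = "N s" and ?r = "enn2real (\<tau> (N s))"
  have r: "ennreal ?r = \<tau> ?n" using epoch_step_count_finite by (simp add: ennreal_enn2real_if)
  have rs: "?r \<le> s" using epoch_step_count_le[of s] s by (simp add: enn2real_leI)
  have xs: "X s \<omega> = X ?r \<omega>"
    using s epoch_step_count_le less_epoch_step_count by (intro const_between_epochs) auto
  have c: "X u \<omega> = X ?r \<omega>" if "?r \<le> u" "u \<le> s + h" for u
  proof (cases "u \<le> s")
    case True
    have "0 \<le> u" using that(1) enn2real_nonneg order_trans by blast
    moreover have "\<tau> ?n \<le> ennreal u" using ennreal_leI[OF that(1)] r by simp
    moreover have "ennreal u < \<tau> (Suc ?n)" using less_epoch_step_count[of s] ennreal_leI[OF True] by order
    ultimately show ?thesis by (rule const_between_epochs)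
  next
    case False
    then have "X u \<omega> = X s \<omega>" using that by (intro J) auto
    then show ?thesis using xs by (rule trans)
  qed
  have "ennreal (s + h) < ennreal ?r + W ?n"
    by (rule wait_gt[OF enn2real_nonneg _ c]) (use rs s in auto)
  then show gt: "ennreal (s + h) < \<tau> ?n + W ?n" unfolding r .
  show "dual_process X V (s + h) \<omega> = dual_process X V s \<omega> \<longleftrightarrow> ennreal (s + h) < \<tau> ?n + V (Suc ?n) \<omega>"
  proof
    assume L: "ennreal (s + h) < \<tau> ?n + V (Suc ?n) \<omega>"
    have "N (s + h) = ?n"
    proof (rule step_count_eq)
      have "ennreal s \<le> ennreal (s + h)" using s by (intro ennreal_leI) simp
      then show "\<tau> ?n \<le> ennreal (s + h)" using epoch_step_count_le[of s] by order
      show "ennreal (s + h) < \<tau> (Suc ?n)" using L gt epoch_step_count_finite[of s]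
        by (simp add: epoch_Suc min_def)
    qed
    then show "dual_process X V (s + h) \<omega> = dual_process X V s \<omega>" by (simp add: dual_process_eq)
  next
    assume eq: "dual_process X V (s + h) \<omega> = dual_process X V s \<omega>"
    show "ennreal (s + h) < \<tau> ?n + V (Suc ?n) \<omega>"
    proof (rule ccontr)
      assume "\<not> ennreal (s + h) < \<tau> ?n + V (Suc ?n) \<omega>"
      then have le: "\<tau> ?n + V (Suc ?n) \<omega> \<le> ennreal (s + h)" by simp
      then have "\<tau> ?n + V (Suc ?n) \<omega> < \<tau> ?n + W ?n" using gt by order
      then have VW: "V (Suc ?n) \<omega> < W ?n" by (metis add_left_mono leD not_le)
      then have "\<tau> (Suc ?n) = \<tau> ?n + V (Suc ?n) \<omega>" "Y (Suc ?n) = Y ?n + 1"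
        using epoch_step_count_finite[of s] by (rule clock_step)+
      then have "Suc ?n \<le> N (s + h)" using le by (intro step_count_ge) simp
      then have "Y (Suc ?n) \<le> Y (N (s + h))" by (rule dual_state_mono)
      then show False using eq \<open>Y (Suc ?n) = Y ?n + 1\<close> by (simp add: dual_process_eq)
    qed
  qed
qed

lemma dual_process_step_le:
  assumes "0 \<le> h" shows "dual_process X V (s + h) \<omega> \<le> dual_process X V s \<omega> + (N (s + h) - N s)"
  unfolding dual_process_eq by (intro dual_state_diff step_count_mono) (use assms in simp)

text \<open>With at most one step in the cell, a move of \<open>X\<close> inside it uses up that
  step: \<open>X\<close> cannot come back, no clock birth can intervene, and the dual follows the
  rule for jumps of \<open>X\<close>. The hypothesis \<open>tie\<close> excludes the branch of equal
  finite waiting times.\<close>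

lemma cell_jump:
  assumes s: "0 \<le> s" "0 \<le> h" and u: "s \<le> u" "u \<le> s + h" "X u \<omega> \<noteq> X s \<omega>"
    and one: "N (s + h) \<le> N s + 1" and tie: "V (Suc (N s)) \<omega> = W (N s) \<Longrightarrow> W (N s) = \<infinity>"
  shows "X (s + h) \<omega> \<noteq> X s \<omega>"
    and "dual_process X V (s + h) \<omega> =
      (if X (s + h) \<omega> = dual_process X V s \<omega> + 1 then dual_process X V s \<omega> + 1 else dual_process X V s \<omega>)"
proof -
  let ?n = "N s" and ?r = "enn2real (\<tau> (N s))"
  have fin: "\<tau> ?n \<noteq> \<infinity>" by (rule epoch_step_count_finite)
  have r: "ennreal ?r = \<tau> ?n" "0 \<le> ?r" using fin by (simp_all add: ennreal_enn2real_if)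
  have rs: "?r \<le> s" using epoch_step_count_le[of s] s by (simp add: enn2real_leI)
  have xs: "X s \<omega> = X ?r \<omega>"
    using s epoch_step_count_le less_epoch_step_count by (intro const_between_epochs) auto
  obtain w where w: "0 < w" "W ?n = ennreal w" "X (?r + w) \<omega> \<noteq> X ?r \<omega>" "?r + w \<le> u"
    using r(2)
  proof (cases ?r rule: wait_cases)
    case (fin w)
    have "?r + w \<le> u"
    proof (rule ccontr)
      assume "\<not> ?r + w \<le> u"
      then have "X u \<omega> = X ?r \<omega>" using u(1) rs by (intro fin(3)) auto
      then show False using xs u(3) by simp
    qed
    with fin(1,2,4) show ?thesis by (rule that)
  next
    case inf
    have "X u \<omega> = X ?r \<omega>" using u(1) rs by (intro inf(2)) simp
    then show ?thesis using xs u(3) by simp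
  qed
  have tw: "\<tau> ?n + W ?n = ennreal (?r + w)"
    unfolding w(2) ennreal_plus[OF r(2) less_imp_le[OF w(1)]] r(1) by (rule refl)
  have le: "ennreal (?r + w) \<le> ennreal (s + h)" using w(4) u(2) by (intro ennreal_leI) simp
  have "\<tau> (Suc ?n) \<le> ennreal (s + h)" using epoch_Suc_le_wait[OF fin] tw le by simp
  then have Nn: "N (s + h) = Suc ?n" using step_count_ge[of "Suc ?n" "s + h"] one by simp
  have lt: "ennreal (s + h) < \<tau> (Suc (Suc ?n))" using less_epoch_step_count[of "s + h"] Nn by simp
  have x1: "X v \<omega> = X (enn2real (\<tau> (Suc ?n))) \<omega>" if "0 \<le> v" "\<tau> (Suc ?n) \<le> ennreal v" "v \<le> s + h" for v
  proof (rule const_between_epochs[OF that(1,2)])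
    show "ennreal v < \<tau> (Suc (Suc ?n))" using lt ennreal_leI[OF that(3)] by order
  qed
  have rw: "0 \<le> ?r + w" using r w by simp
  have tau1: "\<tau> (Suc ?n) \<le> ennreal (?r + w)" using epoch_Suc_le_wait[OF fin] tw by simp
  have xe: "X (s + h) \<omega> = X (?r + w) \<omega>"
    using x1[OF rw tau1] x1[of "s + h"] w(4) u(2) s \<open>\<tau> (Suc ?n) \<le> ennreal (s + h)\<close> by simp
  then show "X (s + h) \<omega> \<noteq> X s \<omega>" using w(3) xs by simp
  \<comment> \<open>If the clock rang first, the single step allowed in the cell would be that
    birth, and none would remain for the jump of \<open>X\<close>.\<close>
  have "\<not> V (Suc ?n) \<omega> < W ?n"
  proof
    assume V: "V (Suc ?n) \<omega> < W ?n"
    then obtain v where v: "V (Suc ?n) \<omega> = ennreal v" "0 \<le> v" "v < w"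
      using w(2) by (cases "V (Suc ?n) \<omega>" rule: ennreal_cases) (auto simp: ennreal_less_iff)
    have t1: "\<tau> (Suc ?n) = ennreal (?r + v)" 
      unfolding clock_step(1)[OF V fin] v(1) ennreal_plus[OF r(2) v(2)] r(1) by (rule refl)
    then have "X (enn2real (\<tau> (Suc ?n))) \<omega> = X (?r + v) \<omega>" using r(2) v(2) by (subst t1, subst enn2real_ennreal) auto
    also have "\<dots> = X ?r \<omega>"
    proof (rule const_before_wait)
      show "ennreal (?r + v) < ennreal ?r + W ?n"
        unfolding r(1) tw using r(2) v by (simp add: ennreal_less_iff del: ennreal_plus)
    qed (use r v in auto)
    finally show False using x1[OF rw tau1] w(3,4) u(2) by simp
  qed
  then have VW: "W ?n < V (Suc ?n) \<omega>" using tie w(2) by fastforce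
  have "enn2real (\<tau> ?n + W ?n) = ?r + w" unfolding tw using rw by simp
  then have "Y (Suc ?n) = (if X (?r + w) \<omega> = Y ?n + 1 then Y ?n + 1 else Y ?n)"
    using VW fin by (simp add: dual_state_Suc Let_def)
  then show "dual_process X V (s + h) \<omega> =
      (if X (s + h) \<omega> = dual_process X V s \<omega> + 1 then dual_process X V s \<omega> + 1 else dual_process X V s \<omega>)"
    by (simp add: dual_process_eq Nn xe)
qed

lemma epoch_strict:
  assumes "\<And>n. \<tau> n \<noteq> \<infinity> \<Longrightarrow> 0 < V (Suc n) \<omega>" and fin: "\<tau> n \<noteq> \<infinity>"
  shows "\<tau> n < \<tau> (Suc n)"
proof -
  have "0 < min (W n) (V (Suc n) \<omega>)" using assms wait_pos by simp
  then have "\<tau> n + 0 < \<tau> n + min (W n) (V (Suc n) \<omega>)"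
    using fin by (subst ennreal_add_left_cancel_less) auto
  then show ?thesis using fin by (simp add: epoch_Suc)
qed

text \<open>Up to \<open>t\<close> there are finitely many epochs, with a positive least gap, and a
  cell shorter than this gap holds at most one of them.\<close>

lemma grid_no_double_step:
  assumes pos: "\<And>n. \<tau> n \<noteq> \<infinity> \<Longrightarrow> 0 < V (Suc n) \<omega>" and st: "0 \<le> s" "s \<le> t"
  shows "\<forall>\<^sub>F m in sequentially. \<forall>i<m.
    N (s + (t - s) / real m * real (Suc i)) \<le> N (s + (t - s) / real m * real i) + 1"
proof -
  obtain \<delta> where \<delta>: "0 < \<delta>" "\<And>n. n \<le> N t \<Longrightarrow> \<tau> n + ennreal \<delta> \<le> \<tau> (Suc n)"
    using positive_uniform_gap[of \<tau> "N t"] epoch_strict[OF pos] by (auto simp: epoch_Suc)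
  obtain m0 :: nat where m0: "(t - s) / \<delta> < real m0" using reals_Archimedean2 by blast
  have "N (s + (t - s) / real m * real (Suc i)) \<le> N (s + (t - s) / real m * real i) + 1"
    if m: "m0 \<le> m" and i: "i < m" for m i
  proof (rule ccontr)
    define h where "h = (t - s) / real m"
    let ?a = "s + h * real i" and ?b = "s + h * real (Suc i)"
    assume "\<not> ?thesis"
    then have two: "Suc (Suc (N ?a)) \<le> N ?b" by (simp add: h_def)
    have h0: "0 \<le> h" using st by (simp add: h_def)
    have "(t - s) / \<delta> < real m" using m m0 by linarith
    then have h: "h < \<delta>" using \<delta>(1) i by (simp add: h_def field_simps)
    have "h * real (Suc i) \<le> h * real m" using i h0 by (intro mult_left_mono) auto
    also have "\<dots> = t - s" using i by (simp add: h_def)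
    finally have bt: "?b \<le> t" by simp
    have a0: "0 \<le> ?a" using st h0 by simp
    have b: "?b = ?a + h" by (simp add: algebra_simps)
    have "Suc (N ?a) \<le> N t" using two step_count_mono[OF bt] by simp
    have "ennreal (?a + \<delta>) = ennreal ?a + ennreal \<delta>" using a0 \<delta>(1) by simp
    also have "\<dots> \<le> \<tau> (Suc (N ?a)) + ennreal \<delta>"
      using less_epoch_step_count[of ?a] by (intro add_right_mono) simp
    also have "\<dots> \<le> \<tau> (Suc (Suc (N ?a)))" by (rule \<delta>(2)) fact
    also have "\<dots> \<le> \<tau> (N ?b)" by (rule epoch_mono[OF two])
    also have "\<dots> \<le> ennreal ?b" by (rule epoch_step_count_le)
    finally have "?a + \<delta> \<le> ?b" using a0 h0 b by (subst (asm) ennreal_le_iff) auto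
    then show False using h b by simp
  qed
  then show ?thesis by (auto simp: eventually_sequentially)
qed

lemma step_count_le_grid:
  assumes t: "0 < t"
  shows "\<forall>\<^sub>F m in sequentially.
    N t \<le> d + card {i. i < m \<and> X (t * real i / real m) \<omega> \<noteq> X (t * real (Suc i) / real m) \<omega>}"
proof -
  have "jump_time X (N t - Y (N t)) \<omega> \<le> ennreal t"
    using jump_time_le_epoch[of "N t", THEN conjunct1] epoch_step_count_le[of t] by order
  from grid_changes_ge[OF t this] show ?thesis
  proof eventually_elim
    case (elim m)
    then show ?case using dual_state_le[of "N t"] by linarith
  qed
qed

end

section \<open>Measurability\<close>

lemma pred_nat_eq[measurable (raw)]:
  fixes f g :: "'a \<Rightarrow> nat"
  assumes [measurable]: "f \<in> measurable S (count_space UNIV)" "g \<in> measurable S (count_space UNIV)"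
  shows "Measurable.pred S (\<lambda>\<omega>. f \<omega> = g \<omega>)"
proof -
  have "(\<lambda>\<omega>. f \<omega> = g \<omega>) = (\<lambda>\<omega>. \<exists>j. f \<omega> = j \<and> g \<omega> = j)" by auto
  also have "Measurable.pred S \<dots>" by measurable
  finally show ?thesis .
qed

text \<open>The next dyadic point strictly to the right. It takes countably many values and
  decreases to \<open>s\<close>, so a right-continuous path at a random time is a limit of its
  values at discretised times.\<close>

definition dyadic_above :: "nat \<Rightarrow> real \<Rightarrow> real" where
  "dyadic_above k s = (real_of_int \<lfloor>2 ^ k * s\<rfloor> + 1) / 2 ^ k"

lemma dyadic_above_gt: "s < dyadic_above k s"
  and dyadic_above_le: "dyadic_above k s \<le> s + 1 / 2 ^ k"
proof -
  have "2 ^ k * s < real_of_int \<lfloor>2 ^ k * s\<rfloor> + 1" "real_of_int \<lfloor>2 ^ k * s\<rfloor> \<le> 2 ^ k * s" by linarith+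
  then show "s < dyadic_above k s" "dyadic_above k s \<le> s + 1 / 2 ^ k"
    by (simp_all add: dyadic_above_def field_simps)
qed

lemma dyadic_above_decseq: "decseq (\<lambda>k. dyadic_above k s)"
proof (rule decseq_SucI)
  fix k
  have "\<lfloor>2 ^ Suc k * s\<rfloor> + 1 \<le> 2 * (\<lfloor>2 ^ k * s\<rfloor> + 1)"
  proof -
    have "2 ^ k * s < real_of_int \<lfloor>2 ^ k * s\<rfloor> + 1" by linarith
    then have "2 * (2 ^ k * s) < 2 * (real_of_int \<lfloor>2 ^ k * s\<rfloor> + 1)" by (rule mult_strict_left_mono) simp
    then have "2 ^ Suc k * s < real_of_int (2 * (\<lfloor>2 ^ k * s\<rfloor> + 1))"
      by (simp only: power_Suc mult.assoc of_int_mult of_int_add of_int_numeral of_int_1)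
    then show ?thesis by linarith
  qed
  then have "real_of_int (\<lfloor>2 ^ Suc k * s\<rfloor> + 1) \<le> real_of_int (2 * (\<lfloor>2 ^ k * s\<rfloor> + 1))"
    by (rule of_int_le_iff[THEN iffD2])
  then have "real_of_int (\<lfloor>2 ^ Suc k * s\<rfloor> + 1) / 2 ^ Suc k \<le> real_of_int (2 * (\<lfloor>2 ^ k * s\<rfloor> + 1)) / 2 ^ Suc k"
    by (rule divide_right_mono) simp
  also have "\<dots> = (real_of_int \<lfloor>2 ^ k * s\<rfloor> + 1) / 2 ^ k" by (simp add: divide_simps)
  finally show "dyadic_above (Suc k) s \<le> dyadic_above k s"
    by (simp only: dyadic_above_def of_int_add of_int_1)
qed

lemma dyadic_above_LIMSEQ: "(\<lambda>k. dyadic_above k s) \<longlonglongrightarrow> s"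
proof (rule tendsto_sandwich[where f = "\<lambda>_. s" and h = "\<lambda>k. s + 1 / 2 ^ k"])
  show "(\<lambda>k. s + 1 / 2 ^ k) \<longlonglongrightarrow> s"
    using tendsto_add[OF tendsto_const LIMSEQ_inverse_realpow_zero[of 2], of s] by (simp add: inverse_eq_divide)
qed (auto intro!: always_eventually less_imp_le[OF dyadic_above_gt] dyadic_above_le)

lemma eventually_dyadic_above:
  assumes "s < b" shows "\<forall>\<^sub>F k in sequentially. dyadic_above k s < b"
  using order_tendstoD(2)[OF dyadic_above_LIMSEQ assms] .

text \<open>Along the dyadic times from the right the value is eventually constant, and each
  approximation uses \<open>X\<close> at countably many fixed times only.\<close>

lemma measurable_at_random_time:
  fixes X :: "real \<Rightarrow> 'a \<Rightarrow> nat"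
  assumes X: "\<And>t. 0 \<le> t \<Longrightarrow> X t \<in> measurable S (count_space UNIV)"
    and \<sigma>[measurable]: "\<sigma> \<in> borel_measurable S" and \<sigma>0: "\<And>\<omega>. \<omega> \<in> space S \<Longrightarrow> 0 \<le> \<sigma> \<omega>"
    and path: "\<And>\<omega>. \<omega> \<in> space S \<Longrightarrow> step_path X \<omega>"
  shows "(\<lambda>\<omega>. X (\<sigma> \<omega>) \<omega>) \<in> measurable S (count_space UNIV)"
proof -
  \<comment> \<open>The measurability rule for countable case splits asks for all integers in place
    of the floor; \<open>max 0\<close> keeps the time in the range where \<open>X\<close> is known
    to be measurable.\<close>
  define Z where "Z k \<omega> = X (max 0 ((real_of_int \<lfloor>2 ^ k * \<sigma> \<omega>\<rfloor> + 1) / 2 ^ k)) \<omega>" for k :: nat and \<omega>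
  have Z: "Z k \<in> measurable S (count_space UNIV)" for k
    unfolding Z_def
    by (rule measurable_compose_countable[where g = "\<lambda>\<omega>. \<lfloor>2 ^ k * \<sigma> \<omega>\<rfloor>"
          and f = "\<lambda>i \<omega>. X (max 0 ((real_of_int i + 1) / 2 ^ k)) \<omega>"]) (auto intro!: X)
  have lim: "X (\<sigma> \<omega>) \<omega> = j \<longleftrightarrow> (\<exists>k0. \<forall>k\<ge>k0. Z k \<omega> = j)" if \<omega>: "\<omega> \<in> space S" for \<omega> j
  proof -
    interpret step_path X \<omega> using path[OF \<omega>] .
    obtain e where e: "0 < e" "\<And>u. \<sigma> \<omega> \<le> u \<Longrightarrow> u < \<sigma> \<omega> + e \<Longrightarrow> X u \<omega> = X (\<sigma> \<omega>) \<omega>"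
      by (rule const_right[OF \<sigma>0[OF \<omega>]]) blast
    have Zd: "Z k \<omega> = X (dyadic_above k (\<sigma> \<omega>)) \<omega>" for k
      unfolding Z_def dyadic_above_def[symmetric]
      using dyadic_above_gt[of "\<sigma> \<omega>" k] \<sigma>0[OF \<omega>] by (simp add: max_def)
    have "\<forall>\<^sub>F k in sequentially. dyadic_above k (\<sigma> \<omega>) < \<sigma> \<omega> + e"
      using e(1) by (intro eventually_dyadic_above) simp
    then obtain k0 where k0: "\<And>k. k \<ge> k0 \<Longrightarrow> dyadic_above k (\<sigma> \<omega>) < \<sigma> \<omega> + e"
      by (auto simp: eventually_sequentially)
    have eq: "Z k \<omega> = X (\<sigma> \<omega>) \<omega>" if "k \<ge> k0" for k
      unfolding Zd using k0[OF that] dyadic_above_gt[of "\<sigma> \<omega>" k] by (intro e(2)) auto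
    then show ?thesis by (metis nat_le_linear)
  qed
  show ?thesis
    unfolding measurable_count_space_eq2_countable
  proof (intro conjI ballI)
    fix j
    have "(\<lambda>\<omega>. X (\<sigma> \<omega>) \<omega>) -` {j} \<inter> space S = {\<omega> \<in> space S. \<exists>k0. \<forall>k\<ge>k0. Z k \<omega> = j}"
      using lim by auto
    also have "\<dots> \<in> sets S" using Z by measurable
    finally show "(\<lambda>\<omega>. X (\<sigma> \<omega>) \<omega>) -` {j} \<inter> space S \<in> sets S" .
  qed simp
qed

text \<open>After its jump the path rests for a while, so rational times slightly later than the
  jump already detect it.\<close>

lemma (in step_path) waiting_time_rational:
  assumes s: "0 \<le> s"
  shows "waiting_time X s \<omega> = (INF q\<in>{q \<in> \<rat>. 0 < q}. if X (s + q) \<omega> \<noteq> X s \<omega> then ennreal q else \<infinity>)" (is "_ = ?R")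
proof (rule antisym)
  show "waiting_time X s \<omega> \<le> ?R"
    unfolding waiting_time_def by (intro INF_greatest) (auto intro!: INF_lower)
  show "?R \<le> waiting_time X s \<omega>"
    using s
  proof (cases s rule: wait_cases)
    case inf
    show ?thesis unfolding inf(1) by simp
  next
    case (fin w)
    have "0 \<le> s + w" using s fin(1) by simp
    then obtain e where e: "0 < e" "\<And>u. s + w \<le> u \<Longrightarrow> u < s + w + e \<Longrightarrow> X u \<omega> = X (s + w) \<omega>"
      by (rule const_right) blast
    show ?thesis
      unfolding fin(2)
    proof (rule ennreal_le_epsilon)
      fix \<epsilon> :: real assume \<epsilon>: "0 < \<epsilon>"
      have "w < w + min e \<epsilon>" using e(1) \<epsilon> by simp
      then obtain q where q: "q \<in> \<rat>" "w < q" "q < w + min e \<epsilon>" using Rats_dense_in_real by blast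
      have "X (s + q) \<omega> = X (s + w) \<omega>" using q by (intro e(2)) auto
      then have "?R \<le> ennreal q" using q fin(1,4) by (intro INF_lower2[of q]) auto
      also have "\<dots> \<le> ennreal (w + \<epsilon>)" using q by (intro ennreal_leI) simp
      also have "\<dots> = ennreal w + ennreal \<epsilon>" using fin(1) \<epsilon> by simp
      finally show "?R \<le> ennreal w + ennreal \<epsilon>" .
    qed
  qed
qed

lemma borel_measurable_waiting_time:
  fixes X :: "real \<Rightarrow> 'a \<Rightarrow> nat"
  assumes X: "\<And>t. 0 \<le> t \<Longrightarrow> X t \<in> measurable S (count_space UNIV)"
    and \<sigma>[measurable]: "\<sigma> \<in> borel_measurable S" and \<sigma>0: "\<And>\<omega>. \<omega> \<in> space S \<Longrightarrow> 0 \<le> \<sigma> \<omega>"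
    and path: "\<And>\<omega>. \<omega> \<in> space S \<Longrightarrow> step_path X \<omega>"
  shows "(\<lambda>\<omega>. waiting_time X (\<sigma> \<omega>) \<omega>) \<in> borel_measurable S"
proof -
  have Xq: "(\<lambda>\<omega>. X (\<sigma> \<omega> + q) \<omega>) \<in> measurable S (count_space UNIV)" if "0 \<le> q" for q
    by (rule measurable_at_random_time[OF X _ _ path]) (use \<sigma>0 that in auto)
  have X0: "(\<lambda>\<omega>. X (\<sigma> \<omega>) \<omega>) \<in> measurable S (count_space UNIV)"
    by (rule measurable_at_random_time[OF X _ _ path]) (use \<sigma>0 in auto)
  have "countable {q \<in> \<rat>. 0 < (q::real)}" by (rule countable_subset[OF _ countable_rat]) auto
  then have "(\<lambda>\<omega>. INF q\<in>{q \<in> \<rat>. 0 < q}. if X (\<sigma> \<omega> + q) \<omega> \<noteq> X (\<sigma> \<omega>) \<omega> then ennreal q else \<infinity>) \<in> borel_measurable S"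
  proof (rule borel_measurable_INF)
    fix q :: real assume "q \<in> {q \<in> \<rat>. 0 < q}"
    then have "0 \<le> q" by simp
    define f0 f1 where "f0 = (\<lambda>\<omega>. X (\<sigma> \<omega>) \<omega>)" and "f1 = (\<lambda>\<omega>. X (\<sigma> \<omega> + q) \<omega>)"
    have [measurable]: "f0 \<in> measurable S (count_space UNIV)" "f1 \<in> measurable S (count_space UNIV)"
      unfolding f0_def f1_def using X0 Xq[OF \<open>0 \<le> q\<close>] by simp_all
    have "(\<lambda>\<omega>. if f1 \<omega> \<noteq> f0 \<omega> then ennreal q else \<infinity>) \<in> borel_measurable S" by measurable
    then show "(\<lambda>\<omega>. if X (\<sigma> \<omega> + q) \<omega> \<noteq> X (\<sigma> \<omega>) \<omega> then ennreal q else \<infinity>) \<in> borel_measurable S"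
      by (simp add: f0_def f1_def)
  qed
  then show ?thesis
    by (rule measurable_cong[THEN iffD1, rotated])
      (use step_path.waiting_time_rational[OF path \<sigma>0] in auto)
qed

section \<open>Measurability of the construction\<close>

locale dual_construction = birth_death d G \<nu> \<pi>
  for d :: nat and G :: "real mat" and \<nu> :: "nat \<Rightarrow> real" and \<pi> :: "nat pmf" +
  fixes M :: "'a measure" and X :: "real \<Rightarrow> 'a \<Rightarrow> nat" and V :: "nat \<Rightarrow> 'a \<Rightarrow> ennreal"
  assumes chain: "markov_chain M d G X" and start: "AE \<omega> in M. X 0 \<omega> = 0"
    and clocks: "birth_clocks M d G \<nu> X V"
begin

lemma prob_space_M: "prob_space M"
  using chain by (simp add: markov_chain_def markov_chain_wrt_def)

sublocale prob_space M by (rule prob_space_M)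

abbreviation Xh :: "real \<Rightarrow> 'a \<Rightarrow> nat" where "Xh \<equiv> dual_process X V"
abbreviation H :: "nat \<Rightarrow> 'a measure" where "H \<equiv> clock_history M X V"
abbreviation FX :: "real \<Rightarrow> 'a measure" where "FX t \<equiv> natural_filtration M X (ennreal t)"

lemma X_le: "\<omega> \<in> space M \<Longrightarrow> 0 \<le> t \<Longrightarrow> X t \<omega> \<le> d"
  and X_rcont: "\<omega> \<in> space M \<Longrightarrow> 0 \<le> t \<Longrightarrow> continuous (at_right t) (\<lambda>s. X s \<omega>)"
  and X_llim: "\<omega> \<in> space M \<Longrightarrow> 0 < t \<Longrightarrow> \<exists>l. ((\<lambda>s. X s \<omega>) \<longlongrightarrow> l) (at_left t)"
  using chain by (simp_all add: markov_chain_def markov_chain_wrt_def)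

lemma clock_absorbed:
  "\<omega> \<in> space M \<Longrightarrow> epoch X V n \<omega> < \<infinity> \<Longrightarrow> dual_state X V n \<omega> = d \<Longrightarrow> V (Suc n) \<omega> = \<infinity>"
  using clocks by (simp add: birth_clocks_def)

lemma step_path: "\<omega> \<in> space M \<Longrightarrow> step_path X \<omega>"
  by unfold_locales (rule X_rcont X_llim; assumption)+

lemma path: "\<omega> \<in> space M \<Longrightarrow> driven_path X \<omega> V d"
  by (intro driven_path.intro step_path driven_path_axioms.intro; (rule X_le clock_absorbed)?; assumption)

lemma X_FX: "0 \<le> t \<Longrightarrow> X t \<in> measurable (FX t) (count_space UNIV)"
  using chain by (simp add: markov_chain_def markov_chain_wrt_def)

lemma FX_subalgebra: "subalgebra M (FX t)"
  using chain by (simp add: markov_chain_def markov_chain_wrt_def)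

lemma X_M[measurable]: "0 \<le> t \<Longrightarrow> X t \<in> measurable M (count_space UNIV)"
  by (rule measurable_from_subalg[OF FX_subalgebra X_FX])

lemma V_M: "V (Suc n) \<in> borel_measurable M"
  using clocks by (simp add: birth_clocks_def)

lemma V_M'[measurable]: "1 \<le> i \<Longrightarrow> V i \<in> borel_measurable M"
  using V_M[of "i - 1"] by simp

lemma space_H[simp]: "space (H n) = space M"
  unfolding clock_history_def by (rule space_measure_of) auto

lemma sets_H: "sets (H n) = sigma_sets (space M)
       ({X s -` A \<inter> space M | s A. 0 \<le> s} \<union>
        {V i -` B \<inter> space M | i B. 1 \<le> i \<and> i \<le> n \<and> B \<in> sets borel})"
  unfolding clock_history_def by (rule sets_measure_of) auto

lemma sets_H_mono: "n \<le> m \<Longrightarrow> sets (H n) \<subseteq> sets (H m)"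
  unfolding sets_H by (rule sigma_sets_mono', intro Un_mono order_refl) (blast intro: order.trans)

lemma H_subalgebra: "subalgebra M (H n)"
  unfolding subalgebra_def
proof
  show "sets (H n) \<subseteq> sets M"
    unfolding sets_H by (rule sets.sigma_sets_subset) (auto intro!: measurable_sets[OF X_M] measurable_sets[OF V_M'])
qed simp

lemma sets_H_M: "A \<in> sets (H n) \<Longrightarrow> A \<in> sets M"
  using H_subalgebra by (auto simp: subalgebra_def)

lemma X_H[measurable]: "0 \<le> t \<Longrightarrow> X t \<in> measurable (H n) (count_space UNIV)"
  by (rule measurableI) (simp_all add: sets_H, rule sigma_sets.Basic, blast)

lemma V_H[measurable]: "1 \<le> i \<Longrightarrow> i \<le> n \<Longrightarrow> V i \<in> borel_measurable (H n)"
  by (rule measurableI) (simp_all add: sets_H, rule sigma_sets.Basic, auto)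

lemma measurable_H_mono: "f \<in> measurable (H n) S \<Longrightarrow> n \<le> m \<Longrightarrow> f \<in> measurable (H m) S"
  using sets_H_mono[of n m] by (auto simp: measurable_def)

text \<open>The \<open>n\<close>-th epoch and dual state are functions of \<open>X\<close> and the
  first \<open>n\<close> clocks, so the rate of the next clock is known to
  \<open>H n\<close>.\<close>

lemma epoch_dual_state_H:
  "epoch X V n \<in> borel_measurable (H n) \<and> dual_state X V n \<in> measurable (H n) (count_space UNIV)"
proof (induction n)
  case 0
  have "epoch X V 0 = (\<lambda>_. 0)" "dual_state X V 0 = (\<lambda>_. 0)" by (auto simp: epoch_0 dual_state_0)
  then show ?case by simp
next
  case (Suc n)
  have [measurable]: "epoch X V n \<in> borel_measurable (H (Suc n))"
    "dual_state X V n \<in> measurable (H (Suc n)) (count_space UNIV)"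
    using Suc by (auto intro: measurable_H_mono)
  have [measurable]: "V (Suc n) \<in> borel_measurable (H (Suc n))" by (rule V_H) auto
  define W where "W \<omega> = waiting_time X (enn2real (epoch X V n \<omega>)) \<omega>" for \<omega>
  define J where "J \<omega> = X (enn2real (epoch X V n \<omega> + W \<omega>)) \<omega>" for \<omega>
  have W[measurable]: "W \<in> borel_measurable (H (Suc n))"
    unfolding W_def by (rule borel_measurable_waiting_time) (auto intro: step_path)
  have [measurable]: "J \<in> measurable (H (Suc n)) (count_space UNIV)"
    unfolding J_def by (rule measurable_at_random_time) (auto intro: step_path simp del: enn2real_plus)
  have "epoch X V (Suc n) \<in> borel_measurable (H (Suc n))"
    unfolding epoch_Suc[abs_def] W_def[symmetric] by measurable
  moreover have "dual_state X V (Suc n) \<in> measurable (H (Suc n)) (count_space UNIV)"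
    unfolding dual_state_Suc[abs_def] Let_def W_def[symmetric] J_def[symmetric] by measurable
  ultimately show ?case ..
qed

lemma epoch_H[measurable]: "n \<le> m \<Longrightarrow> epoch X V n \<in> borel_measurable (H m)"
  and dual_state_H[measurable]: "n \<le> m \<Longrightarrow> dual_state X V n \<in> measurable (H m) (count_space UNIV)"
  using epoch_dual_state_H by (auto intro: measurable_H_mono)

lemma wait_H[measurable]:
  "n \<le> m \<Longrightarrow> (\<lambda>\<omega>. waiting_time X (enn2real (epoch X V n \<omega>)) \<omega>) \<in> borel_measurable (H m)"
  by (rule borel_measurable_waiting_time) (auto intro: step_path)

lemma X_epoch_H[measurable]:
  "n \<le> m \<Longrightarrow> (\<lambda>\<omega>. X (enn2real (epoch X V n \<omega>)) \<omega>) \<in> measurable (H m) (count_space UNIV)"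
  by (rule measurable_at_random_time) (auto intro: step_path)

lemma measurable_H_M: "f \<in> measurable (H n) S \<Longrightarrow> f \<in> measurable M S"
  by (rule measurable_from_subalg[OF H_subalgebra])

lemma epoch_M[measurable]: "epoch X V n \<in> borel_measurable M"
  by (rule measurable_H_M[OF epoch_H[OF order_refl]])

lemma dual_state_M[measurable]: "dual_state X V n \<in> measurable M (count_space UNIV)"
  by (rule measurable_H_M[OF dual_state_H[OF order_refl]])

lemma step_count_M[measurable]: "step_count X V t \<in> measurable M (count_space UNIV)"
  unfolding step_count_def[abs_def] by measurable

lemma Xh_M[measurable]: "Xh t \<in> measurable M (count_space UNIV)"
proof -
  have "(\<lambda>\<omega>. dual_state X V (step_count X V t \<omega>) \<omega>) \<in> measurable M (count_space UNIV)"
    by (rule measurable_compose_countable[where g = "step_count X V t" and f = "\<lambda>n \<omega>. dual_state X V n \<omega>"]) measurable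
  then show ?thesis by (simp add: dual_process_eq[abs_def])
qed

lemma Xh_le: "\<omega> \<in> space M \<Longrightarrow> Xh t \<omega> \<le> d"
  by (rule driven_path.dual_process_le[OF path])


section \<open>The birth clocks\<close>

abbreviation rate :: "nat \<Rightarrow> nat \<Rightarrow> real" where "rate \<equiv> birth_rate d G \<nu>"

lemma rate_nonneg: "y \<le> d \<Longrightarrow> x \<le> d \<Longrightarrow> 0 \<le> rate y x"
  unfolding birth_rate_def
  using lam_nonneg[of "y + 1" x] lam_nonneg[of y x] \<nu>_pos[of y] by auto

lemma clock_tail:
  assumes B: "B \<in> sets (H n)" and t: "0 \<le> t"
    and on: "\<And>\<omega>. \<omega> \<in> B \<Longrightarrow> epoch X V n \<omega> < \<infinity> \<and> dual_state X V n \<omega> = y \<and> X (enn2real (epoch X V n \<omega>)) \<omega> = x"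
  shows "measure M {\<omega> \<in> B. ennreal t < V (Suc n) \<omega>} = exp (- rate y x * t) * measure M B"
proof -
  interpret S: sigma_finite_subalgebra M "H n"
    by (intro finite_measure_subalgebra_is_sigma_finite)
      (simp add: finite_measure_subalgebra_def finite_measure_subalgebra_axioms_def H_subalgebra finite_measure_axioms)
  let ?E = "{\<omega> \<in> space M. ennreal t < V (Suc n) \<omega>}"
  have E: "?E \<in> sets M" using V_M[of n] by measurable
  have BM: "B \<in> sets M" using B by (rule sets_H_M)
  have "{\<omega> \<in> B. ennreal t < V (Suc n) \<omega>} = B \<inter> ?E" using sets.sets_into_space[OF BM] by auto
  then have "measure M {\<omega> \<in> B. ennreal t < V (Suc n) \<omega>} = (\<integral>\<omega>. indicator B \<omega> * indicator ?E \<omega> \<partial>M)"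
    using E BM by (simp flip: indicator_inter_arith)
  also have "\<dots> = (\<integral>\<omega>. indicator B \<omega> * real_cond_exp M (H n) (indicator ?E) \<omega> \<partial>M)"
    using B BM E by (intro S.real_cond_exp_intg(2)[symmetric])
      (auto simp flip: indicator_inter_arith intro!: integrable_real_indicator simp: emeasure_eq_measure)
  also have "\<dots> = (\<integral>\<omega>. exp (- rate y x * t) * indicator B \<omega> \<partial>M)"
  proof (rule integral_cong_AE)
    have "AE \<omega> in M. epoch X V n \<omega> < \<infinity> \<longrightarrow> real_cond_exp M (H n) (indicator ?E) \<omega>
      = exp (- rate (dual_state X V n \<omega>) (X (enn2real (epoch X V n \<omega>)) \<omega>) * t)"
      using clocks t unfolding birth_clocks_def by blast
    then show "AE \<omega> in M. indicator B \<omega> * real_cond_exp M (H n) (indicator ?E) \<omega> = exp (- rate y x * t) * indicator B \<omega>"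
      by eventually_elim (auto simp: indicator_def dest: on)
  qed (use BM in auto)
  also have "\<dots> = exp (- rate y x * t) * measure M B" using BM by simp
  finally show ?thesis .
qed

text \<open>The age \<open>\<sigma>\<close> of a clock is random but known to \<open>H n\<close>.
  Rounded up to a dyadic number it has countably many values, and on each of them the exponential
  tail is used at two fixed times; the rounded values decrease to \<open>\<sigma>\<close>, so the
  events increase to the wanted ones.\<close>

lemma clock_memoryless_random:
  assumes B: "B \<in> sets (H n)" and h: "0 \<le> h"
    and on: "\<And>\<omega>. \<omega> \<in> B \<Longrightarrow> epoch X V n \<omega> < \<infinity> \<and> dual_state X V n \<omega> = y \<and> X (enn2real (epoch X V n \<omega>)) \<omega> = x"
    and \<sigma>[measurable]: "\<sigma> \<in> borel_measurable (H n)" and \<sigma>0: "\<And>\<omega>. 0 \<le> \<sigma> \<omega>"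
  shows "measure M {\<omega> \<in> B. ennreal (\<sigma> \<omega> + h) < V (Suc n) \<omega>}
       = exp (- rate y x * h) * measure M {\<omega> \<in> B. ennreal (\<sigma> \<omega>) < V (Suc n) \<omega>}"
proof -
  have BM: "B \<in> sets M" using B by (rule sets_H_M)
  have [measurable]: "\<sigma> \<in> borel_measurable M" "V (Suc n) \<in> borel_measurable M"
    by (rule measurable_H_M[OF \<sigma>]) (rule V_M)
  have [measurable]: "dyadic_above k \<in> borel_measurable borel" for k
    unfolding dyadic_above_def[abs_def] by measurable
  have BV: "{\<omega> \<in> B. ennreal (f \<omega>) < V (Suc n) \<omega>} \<in> sets M" if [measurable]: "f \<in> borel_measurable M" for f
  proof -
    have "{\<omega> \<in> B. ennreal (f \<omega>) < V (Suc n) \<omega>} = B \<inter> {\<omega> \<in> space M. ennreal (f \<omega>) < V (Suc n) \<omega>}"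
      using sets.sets_into_space[OF BM] by auto
    also have "\<dots> \<in> sets M" using BM by measurable
    finally show ?thesis .
  qed
  define E where "E k c = {\<omega> \<in> B. ennreal (dyadic_above k (\<sigma> \<omega>) + c) < V (Suc n) \<omega>}" for k c
  have Em: "E k c \<in> sets M" for k c unfolding E_def by (rule BV) measurable
  have disc: "measure M (E k h) = exp (- rate y x * h) * measure M (E k 0)" for k
  proof -
    define A where "A i = {\<omega> \<in> B. \<lfloor>2 ^ k * \<sigma> \<omega>\<rfloor> = int i}" for i
    have A: "A i \<in> sets (H n)" for i
    proof -
      have "A i = B \<inter> {\<omega> \<in> space (H n). \<lfloor>2 ^ k * \<sigma> \<omega>\<rfloor> = int i}"
        using sets.sets_into_space[OF BM] by (auto simp: A_def)
      also have "\<dots> \<in> sets (H n)" using B by measurable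
      finally show ?thesis .
    qed
    let ?t = "\<lambda>i. (real i + 1) / 2 ^ k"
    define C where "C c i = {\<omega> \<in> A i. ennreal (?t i + c) < V (Suc n) \<omega>}" for c i
    have Cm: "C c i \<in> sets M" for c i
    proof -
      have "C c i = A i \<inter> {\<omega> \<in> space M. ennreal (?t i + c) < V (Suc n) \<omega>}"
        using sets.sets_into_space[OF sets_H_M[OF A]] by (auto simp: C_def)
      also have "\<dots> \<in> sets M" using sets_H_M[OF A] by measurable
      finally show ?thesis .
    qed
    have un: "E k c = (\<Union>i. C c i)" for c
    proof -
      have "\<omega> \<in> E k c \<longleftrightarrow> (\<exists>i. \<omega> \<in> C c i)" for \<omega>
      proof -
        have "0 \<le> \<lfloor>2 ^ k * \<sigma> \<omega>\<rfloor>" using \<sigma>0[of \<omega>] by simp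
        then obtain i where i: "\<lfloor>2 ^ k * \<sigma> \<omega>\<rfloor> = int i" by (rule nonneg_int_cases)
        show ?thesis by (auto simp: i E_def C_def A_def dyadic_above_def)
      qed
      then show ?thesis by blast
    qed
    have sums: "(\<lambda>i. measure M (C c i)) sums measure M (E k c)" for c
    proof -
      have "disjoint_family (C c)" unfolding disjoint_family_on_def by (auto simp: C_def A_def)
      moreover have "range (C c) \<subseteq> sets M" using Cm by blast
      ultimately show ?thesis unfolding un by (intro finite_measure_UNION)
    qed
    have "measure M (C h i) = exp (- rate y x * h) * measure M (C 0 i)" for i
    proof -
      have "measure M (C h i) = exp (- rate y x * (?t i + h)) * measure M (A i)"
        unfolding C_def using h on by (intro clock_tail A) (auto simp: A_def)
      moreover have "measure M (C 0 i) = exp (- rate y x * (?t i + 0)) * measure M (A i)"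
        unfolding C_def using on by (intro clock_tail A) (auto simp: A_def)
      moreover have "exp (- rate y x * (?t i + h)) = exp (- rate y x * h) * exp (- rate y x * (?t i + 0))"
        by (simp add: exp_add[symmetric] distrib_left del: exp_add)
      ultimately show ?thesis by simp
    qed
    then have "(\<lambda>i. exp (- rate y x * h) * measure M (C 0 i)) sums measure M (E k h)"
      using sums[of h] by simp
    moreover have "(\<lambda>i. exp (- rate y x * h) * measure M (C 0 i)) sums (exp (- rate y x * h) * measure M (E k 0))"
      by (intro sums_mult sums)
    ultimately show ?thesis by (rule sums_unique2)
  qed
  have lim: "(\<lambda>k. measure M (E k c)) \<longlonglongrightarrow> measure M {\<omega> \<in> B. ennreal (\<sigma> \<omega> + c) < V (Suc n) \<omega>}"
    if c: "0 \<le> c" for c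
  proof -
    have "(\<Union>k. E k c) = {\<omega> \<in> B. ennreal (\<sigma> \<omega> + c) < V (Suc n) \<omega>}"
    proof (rule equalityI; rule subsetI)
      fix \<omega> assume "\<omega> \<in> (\<Union>k. E k c)"
      then obtain k where k: "\<omega> \<in> B" "ennreal (dyadic_above k (\<sigma> \<omega>) + c) < V (Suc n) \<omega>" by (auto simp: E_def)
      have "ennreal (\<sigma> \<omega> + c) \<le> ennreal (dyadic_above k (\<sigma> \<omega>) + c)"
        using dyadic_above_gt[of "\<sigma> \<omega>" k] by (intro ennreal_leI) simp
      with k show "\<omega> \<in> {\<omega> \<in> B. ennreal (\<sigma> \<omega> + c) < V (Suc n) \<omega>}" by auto
    next
      fix \<omega> assume \<omega>: "\<omega> \<in> {\<omega> \<in> B. ennreal (\<sigma> \<omega> + c) < V (Suc n) \<omega>}"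
      have "(\<lambda>k. ennreal (dyadic_above k (\<sigma> \<omega>) + c)) \<longlonglongrightarrow> ennreal (\<sigma> \<omega> + c)"
        by (intro tendsto_ennrealI tendsto_add dyadic_above_LIMSEQ tendsto_const)
      then have "\<forall>\<^sub>F k in sequentially. ennreal (dyadic_above k (\<sigma> \<omega>) + c) < V (Suc n) \<omega>"
        using \<omega> by (intro order_tendstoD(2)) auto
      then obtain k where "ennreal (dyadic_above k (\<sigma> \<omega>) + c) < V (Suc n) \<omega>"
        by (auto simp: eventually_sequentially)
      then show "\<omega> \<in> (\<Union>k. E k c)" using \<omega> by (auto simp: E_def)
    qed
    moreover have "incseq (\<lambda>k. E k c)"
    proof (rule monoI)
      fix k l :: nat assume kl: "k \<le> l"
      have "ennreal (dyadic_above l (\<sigma> \<omega>) + c) \<le> ennreal (dyadic_above k (\<sigma> \<omega>) + c)" for \<omega>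
        using decseqD[OF dyadic_above_decseq kl] by (intro ennreal_leI) simp
      then show "E k c \<le> E l c" unfolding E_def by (auto intro: order.strict_trans1)
    qed
    ultimately show ?thesis using finite_Lim_measure_incseq[of "\<lambda>k. E k c"] Em by auto
  qed
  have "(\<lambda>k. measure M (E k h)) \<longlonglongrightarrow> exp (- rate y x * h) * measure M {\<omega> \<in> B. ennreal (\<sigma> \<omega> + 0) < V (Suc n) \<omega>}"
    unfolding disc by (intro tendsto_mult_left lim) simp
  from LIMSEQ_unique[OF lim[OF h] this] show ?thesis by simp
qed

lemma sum_over_states:
  fixes f :: "'a \<Rightarrow> nat"
  assumes "A \<in> sets M" "f \<in> measurable M (count_space UNIV)" "\<And>\<omega>. \<omega> \<in> A \<Longrightarrow> f \<omega> \<le> d"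
  shows "measure M A = (\<Sum>y\<le>d. measure M (A \<inter> {\<omega> \<in> space M. f \<omega> = y}))"
proof -
  have "A = (\<Union>y\<in>{..d}. A \<inter> {\<omega> \<in> space M. f \<omega> = y})"
    using assms sets.sets_into_space[OF assms(1)] by auto
  moreover have "measure M (\<Union>y\<in>{..d}. A \<inter> {\<omega> \<in> space M. f \<omega> = y}) = (\<Sum>y\<le>d. measure M (A \<inter> {\<omega> \<in> space M. f \<omega> = y}))"
    using assms by (intro finite_measure_finite_Union) (auto simp: disjoint_family_on_def)
  ultimately show ?thesis by simp
qed

text \<open>The tail formula at \<open>t = 0\<close> has factor \<open>1\<close>, so positivity of
  the clock loses no mass. States are treated separately because the rate depends on them.\<close>

lemma AE_clock_pos: "AE \<omega> in M. \<forall>n. epoch X V n \<omega> \<noteq> \<infinity> \<longrightarrow> 0 < V (Suc n) \<omega>"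
proof (subst AE_all_countable, rule allI)
  fix n
  define B where "B y x = {\<omega> \<in> space (H n). epoch X V n \<omega> < \<infinity> \<and> dual_state X V n \<omega> = y
     \<and> X (enn2real (epoch X V n \<omega>)) \<omega> = x}" for y x
  have B: "B y x \<in> sets (H n)" for y x unfolding B_def by measurable
  have "AE \<omega> in M. \<not> (\<omega> \<in> B y x \<and> V (Suc n) \<omega> \<le> 0)" for y x
  proof -
    have BM: "B y x \<in> sets M" by (rule sets_H_M[OF B])
    have E: "{\<omega> \<in> B y x. ennreal 0 < V (Suc n) \<omega>} \<in> sets M"
    proof -
      have "{\<omega> \<in> B y x. ennreal 0 < V (Suc n) \<omega>} = B y x \<inter> {\<omega> \<in> space M. ennreal 0 < V (Suc n) \<omega>}"
        using sets.sets_into_space[OF BM] by auto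
      also have "\<dots> \<in> sets M" using BM V_M[of n] by measurable
      finally show ?thesis .
    qed
    have "measure M {\<omega> \<in> B y x. ennreal 0 < V (Suc n) \<omega>} = exp (- rate y x * 0) * measure M (B y x)"
      by (rule clock_tail[OF B]) (auto simp: B_def)
    then have "measure M (B y x - {\<omega> \<in> B y x. ennreal 0 < V (Suc n) \<omega>}) = 0"
      using BM E by (subst finite_measure_Diff) auto
    then have "B y x - {\<omega> \<in> B y x. ennreal 0 < V (Suc n) \<omega>} \<in> null_sets M"
      using BM E by (auto simp: null_sets_def emeasure_eq_measure)
    then show ?thesis by (rule AE_I') (auto simp: not_less)
  qed
  then have "AE \<omega> in M. \<forall>y x. \<not> (\<omega> \<in> B y x \<and> V (Suc n) \<omega> \<le> 0)"
    by (intro AE_all_countable[THEN iffD2] allI)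
  moreover have "AE \<omega> in M. \<omega> \<in> space M" by simp
  ultimately show "AE \<omega> in M. epoch X V n \<omega> \<noteq> \<infinity> \<longrightarrow> 0 < V (Suc n) \<omega>"
    by eventually_elim (auto simp: B_def less_top not_le zero_less_iff_neq_zero)
qed

text \<open>At a tie the clock outlives a time \<open>\<sigma>\<close> shortly before the jump, but
  not \<open>\<sigma> + h\<close>. By the memoryless property this has probability at most
  \<open>1 - exp (- rate y x * h)\<close>, which tends to \<open>0\<close> with
  \<open>h\<close>.\<close>

lemma AE_no_tie:
  "AE \<omega> in M. \<forall>n. epoch X V n \<omega> \<noteq> \<infinity> \<longrightarrow> V (Suc n) \<omega> = waiting_time X (enn2real (epoch X V n \<omega>)) \<omega>
     \<longrightarrow> V (Suc n) \<omega> = \<infinity>"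
proof (subst AE_all_countable, rule allI)
  fix n
  let ?W = "\<lambda>\<omega>. waiting_time X (enn2real (epoch X V n \<omega>)) \<omega>"
  define B where "B y x = {\<omega> \<in> space (H n). epoch X V n \<omega> < \<infinity> \<and> dual_state X V n \<omega> = y
     \<and> X (enn2real (epoch X V n \<omega>)) \<omega> = x \<and> ?W \<omega> < \<infinity>}" for y x
  have [measurable]: "(\<lambda>\<omega>. enn2real (?W \<omega>)) \<in> borel_measurable (H n)" by measurable
  have B: "B y x \<in> sets (H n)" for y x unfolding B_def by measurable
  have "AE \<omega> in M. \<not> (\<omega> \<in> B y x \<and> V (Suc n) \<omega> = ?W \<omega>)" for y x
  proof -
    have BM: "B y x \<in> sets M" by (rule sets_H_M[OF B])
    have [measurable]: "?W \<in> borel_measurable M" "V (Suc n) \<in> borel_measurable M"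
      by (rule measurable_H_M[OF wait_H[OF order_refl]]) (rule V_M)
    define T where "T = {\<omega> \<in> B y x. V (Suc n) \<omega> = ?W \<omega>}"
    have T: "T \<in> sets M"
    proof -
      have "T = B y x \<inter> {\<omega> \<in> space M. V (Suc n) \<omega> = ?W \<omega>}"
        using sets.sets_into_space[OF BM] by (auto simp: T_def)
      also have "\<dots> \<in> sets M" using BM by measurable
      finally show ?thesis .
    qed
    have bound: "measure M T \<le> 1 - exp (- rate y x * h)" if h: "0 < h" and yx: "y \<le> d" "x \<le> d" for h
    proof -
      \<comment> \<open>Since the wait \<open>w\<close> is positive, the truncated value still
        satisfies \<open>\<sigma> < w\<close> and \<open>w \<le> \<sigma> + h\<close>.\<close>
      define \<sigma> where "\<sigma> \<omega> = max 0 (enn2real (?W \<omega>) - h)" for \<omega>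
      have \<sigma>[measurable]: "\<sigma> \<in> borel_measurable (H n)" unfolding \<sigma>_def by measurable
      have [measurable]: "\<sigma> \<in> borel_measurable M" by (rule measurable_H_M[OF \<sigma>])
      let ?E = "\<lambda>c. {\<omega> \<in> B y x. ennreal (\<sigma> \<omega> + c) < V (Suc n) \<omega>}"
      have E: "?E c \<in> sets M" for c
      proof -
        have "?E c = B y x \<inter> {\<omega> \<in> space M. ennreal (\<sigma> \<omega> + c) < V (Suc n) \<omega>}"
          using sets.sets_into_space[OF BM] by auto
        also have "\<dots> \<in> sets M" using BM by measurable
        finally show ?thesis .
      qed
      have eq: "measure M (?E h) = exp (- rate y x * h) * measure M {\<omega> \<in> B y x. ennreal (\<sigma> \<omega>) < V (Suc n) \<omega>}"
        using h by (intro clock_memoryless_random[OF B _ _ \<sigma>]) (auto simp: B_def \<sigma>_def)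
      have "T \<subseteq> ?E 0 - ?E h"
      proof
        fix \<omega> assume \<omega>: "\<omega> \<in> T"
        then have "\<omega> \<in> space M" using sets.sets_into_space[OF T] by auto
        then interpret step_path X \<omega> by (rule step_path)
        have "0 < ?W \<omega>" by (rule wait_pos) simp
        moreover have "?W \<omega> < \<infinity>" using \<omega> by (auto simp: T_def B_def)
        ultimately obtain w where w: "?W \<omega> = ennreal w" "0 < w"
          by (cases "?W \<omega>" rule: ennreal_cases) auto
        have "\<sigma> \<omega> < w" "w \<le> \<sigma> \<omega> + h" "0 \<le> \<sigma> \<omega>" using w h by (auto simp: \<sigma>_def)
        then show "\<omega> \<in> ?E 0 - ?E h" using \<omega> w by (auto simp: T_def ennreal_less_iff not_less intro: ennreal_leI simp del: ennreal_plus)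
      qed
      then have "measure M T \<le> measure M (?E 0 - ?E h)" by (rule finite_measure_mono) (rule sets.Diff[OF E E])
      also have "\<dots> = measure M (?E 0) - measure M (?E h)"
      proof (rule finite_measure_Diff[OF E E])
        have "ennreal (\<sigma> \<omega> + 0) \<le> ennreal (\<sigma> \<omega> + h)" for \<omega> using h by (intro ennreal_leI) simp
        then show "?E h \<subseteq> ?E 0" by (auto intro: order.strict_trans1)
      qed
      also have "\<dots> = (1 - exp (- rate y x * h)) * measure M (?E 0)"
        unfolding eq by (simp add: algebra_simps)
      also have "\<dots> \<le> 1 - exp (- rate y x * h)"
        using mult_left_mono[OF prob_le_1[of "?E 0"], of "1 - exp (- rate y x * h)"]
          rate_nonneg[OF yx] h by simp
      finally show ?thesis .
    qed
    have "((\<lambda>h. 1 - exp (- rate y x * h)) \<longlongrightarrow> 1 - exp (- rate y x * 0)) (at_right 0)"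
      by (intro tendsto_intros)
    then have "((\<lambda>h. 1 - exp (- rate y x * h)) \<longlongrightarrow> 0) (at_right 0)" by simp
    then have "measure M T \<le> 0" if "y \<le> d" "x \<le> d"
    proof (rule tendsto_lowerbound)
      show "\<forall>\<^sub>F h in at_right 0. measure M T \<le> 1 - exp (- rate y x * h)"
        using bound[OF _ that] by (auto simp: eventually_at_right_field intro!: exI[of _ 1])
    qed simp
    moreover have "T = {}" if "\<not> (y \<le> d \<and> x \<le> d)"
      using that driven_path.dual_state_le[OF path] X_le by (auto simp: T_def B_def)
    ultimately have "measure M T \<le> 0" by fastforce
    then have "T \<in> null_sets M" using T by (auto simp: null_sets_def emeasure_eq_measure measure_le_0_iff)
    then show ?thesis by (rule AE_I') (auto simp: T_def)
  qed
  then have "AE \<omega> in M. \<forall>y x. \<not> (\<omega> \<in> B y x \<and> V (Suc n) \<omega> = ?W \<omega>)"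
    by (intro AE_all_countable[THEN iffD2] allI)
  moreover have "AE \<omega> in M. \<omega> \<in> space M" by simp
  ultimately show "AE \<omega> in M. epoch X V n \<omega> \<noteq> \<infinity> \<longrightarrow> V (Suc n) \<omega> = ?W \<omega> \<longrightarrow> V (Suc n) \<omega> = \<infinity>"
    by eventually_elim (auto simp: B_def less_top not_less top_unique)
qed

end

section \<open>Short time increments of the pair\<close>

text \<open>The form in which the Markov property is used below: identities between probabilities of
  events. \<open>markov_cond_exp\<close> leads back to conditional expectations.\<close>

lemma markov_chain_wrt_step:
  assumes mc: "markov_chain_wrt M F d G X" and A: "A \<in> sets (F (ennreal s))"
    and st: "0 \<le> s" "0 \<le> t" and j: "j \<le> d"
  shows "measure M (A \<inter> {\<omega> \<in> space M. X (s + t) \<omega> = j})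
    = (\<Sum>i\<le>d. measure M (A \<inter> {\<omega> \<in> space M. X s \<omega> = i}) * transition_prob G t i j)"
proof -
  interpret prob_space M using mc by (simp add: markov_chain_wrt_def)
  have sub: "subalgebra M (F u)" for u using mc by (simp add: markov_chain_wrt_def)
  interpret S: sigma_finite_subalgebra M "F (ennreal s)"
    by (intro finite_measure_subalgebra_is_sigma_finite)
      (simp add: finite_measure_subalgebra_def finite_measure_subalgebra_axioms_def sub finite_measure_axioms)
  have AM: "A \<in> sets M" using A sub[of "ennreal s"] by (auto simp: subalgebra_def)
  have Xm: "X u \<in> measurable M (count_space UNIV)" if "0 \<le> u" for u
    using mc that by (intro measurable_from_subalg[OF sub[of "ennreal u"]]) (simp add: markov_chain_wrt_def)
  let ?E = "{\<omega> \<in> space M. X (s + t) \<omega> = j}" and ?L = "\<lambda>i. {\<omega> \<in> space M. X s \<omega> = i}"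
  have [measurable]: "X (s + t) \<in> measurable M (count_space UNIV)" "X s \<in> measurable M (count_space UNIV)"
    using st by (auto intro!: Xm)
  have E: "?E \<in> sets M" by measurable
  have L: "?L i \<in> sets M" for i by measurable
  have le: "X s \<omega> \<le> d" if "\<omega> \<in> space M" for \<omega> using mc st that by (simp add: markov_chain_wrt_def)
  have "measure M (A \<inter> ?E) = (\<integral>\<omega>. indicator A \<omega> * indicator ?E \<omega> \<partial>M)"
    using E AM by (simp flip: indicator_inter_arith)
  also have "\<dots> = (\<integral>\<omega>. indicator A \<omega> * real_cond_exp M (F (ennreal s)) (indicator ?E) \<omega> \<partial>M)"
    using A AM E by (intro S.real_cond_exp_intg(2)[symmetric])
      (auto simp flip: indicator_inter_arith intro!: integrable_real_indicator simp: emeasure_eq_measure)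
  also have "\<dots> = (\<integral>\<omega>. (\<Sum>i\<le>d. transition_prob G t i j * indicator (A \<inter> ?L i) \<omega>) \<partial>M)"
  proof (rule integral_cong_AE)
    have "AE \<omega> in M. real_cond_exp M (F (ennreal s)) (indicator ?E) \<omega> = transition_prob G t (X s \<omega>) j"
      using mc st j by (simp add: markov_chain_wrt_def)
    moreover have "AE \<omega> in M. \<omega> \<in> space M" by simp
    ultimately show "AE \<omega> in M. indicator A \<omega> * real_cond_exp M (F (ennreal s)) (indicator ?E) \<omega>
        = (\<Sum>i\<le>d. transition_prob G t i j * indicator (A \<inter> ?L i) \<omega>)"
    proof eventually_elim
      case (elim \<omega>)
      have "(\<Sum>i\<le>d. transition_prob G t i j * indicator (A \<inter> ?L i) \<omega>)
          = (\<Sum>i\<le>d. if i = X s \<omega> then transition_prob G t i j * indicator A \<omega> else 0)"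
        using elim(2) by (intro sum.cong) (auto simp: indicator_def)
      then show ?case using elim le by simp
    qed
  qed (use AM L in auto)
  also have "\<dots> = (\<Sum>i\<le>d. transition_prob G t i j * measure M (A \<inter> ?L i))"
    using AM L by (subst Bochner_Integration.integral_sum) (auto simp: emeasure_eq_measure)
  finally show ?thesis by (simp add: mult.commute)
qed

definition birth_move :: "nat \<Rightarrow> nat \<Rightarrow> nat" where
  "birth_move x y = (if x = y + 1 then y + 1 else y)"

section \<open>The dual chain over one cell of a time grid\<close>

context dual_construction
begin

abbreviation lev :: "('a \<Rightarrow> nat) \<Rightarrow> nat \<Rightarrow> 'a set" where "lev f y \<equiv> {\<omega> \<in> space M. f \<omega> = y}"
abbreviation step_at :: "real \<Rightarrow> 'a \<Rightarrow> nat" where "step_at \<equiv> step_count X V"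

text \<open>All of \<open>X\<close>, with its future, is included: the clocks are exponential given
  the whole of \<open>X\<close>, so births in a cell can be computed on events that also fix
  \<open>X\<close> at later times. Immersion rests on this.\<close>

definition GG :: "real \<Rightarrow> 'a measure" where
  "GG s = sigma (space M) ({X t -` A \<inter> space M | t A. 0 \<le> t} \<union> {Xh u -` A \<inter> space M | u A. 0 \<le> u \<and> u \<le> s})"

lemma space_GG[simp]: "space (GG s) = space M"
  unfolding GG_def by (rule space_measure_of) auto

lemma sets_GG: "sets (GG s) = sigma_sets (space M)
    ({X t -` A \<inter> space M | t A. 0 \<le> t} \<union> {Xh u -` A \<inter> space M | u A. 0 \<le> u \<and> u \<le> s})"
  unfolding GG_def by (rule sets_measure_of) auto

lemma GG_M: "A \<in> sets (GG s) \<Longrightarrow> A \<in> sets M"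
proof -
  have "sets (GG s) \<subseteq> sets M"
    unfolding sets_GG by (rule sets.sigma_sets_subset) (auto intro!: measurable_sets[OF X_M] measurable_sets[OF Xh_M])
  then show "A \<in> sets (GG s) \<Longrightarrow> A \<in> sets M" by blast
qed

lemma GG_mono: "s \<le> t \<Longrightarrow> A \<in> sets (GG s) \<Longrightarrow> A \<in> sets (GG t)"
proof -
  assume "s \<le> t"
  then have "sets (GG s) \<subseteq> sets (GG t)"
    unfolding sets_GG by (intro sigma_sets_mono' Un_mono order_refl) (blast intro: order.trans)
  then show "A \<in> sets (GG s) \<Longrightarrow> A \<in> sets (GG t)" by blast
qed

lemma X_GG[measurable]: "0 \<le> t \<Longrightarrow> X t \<in> measurable (GG s) (count_space UNIV)"
  by (rule measurableI) (simp_all add: sets_GG, rule sigma_sets.Basic, blast)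

lemma Xh_GG[measurable]: "0 \<le> u \<Longrightarrow> u \<le> s \<Longrightarrow> Xh u \<in> measurable (GG s) (count_space UNIV)"
  by (rule measurableI) (simp_all add: sets_GG, rule sigma_sets.Basic, blast)

lemma step_at_iff:
  assumes "\<omega> \<in> space M"
  shows "step_at s \<omega> = n \<longleftrightarrow> epoch X V n \<omega> \<le> ennreal s \<and> ennreal s < epoch X V (Suc n) \<omega>"
proof -
  interpret driven_path X \<omega> V d using path[OF assms] .
  show ?thesis using step_count_eq epoch_step_count_le less_epoch_step_count by blast
qed

text \<open>Here fixed times and epochs meet: if exactly \<open>n\<close> transitions occur by time
  \<open>s\<close>, an event of time \<open>s\<close> depends on \<open>X\<close> and the first
  \<open>n\<close> clocks only, so the conditional law of \<open>V (Suc n)\<close> applies to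
  it.\<close>

lemma GG_adapted:
  assumes A: "A \<in> sets (GG s)"
  shows "\<exists>B\<in>sets (H n). A \<inter> lev (step_at s) n = B \<inter> lev (step_at s) n"
  using A unfolding sets_GG
proof (induction rule: sigma_sets.induct)
  case (Basic a)
  then consider t A where "0 \<le> t" "a = X t -` A \<inter> space M"
    | u A where "0 \<le> u" "u \<le> s" "a = Xh u -` A \<inter> space M" by blast
  then show ?case
  proof cases
    case 1
    then have "a \<in> sets (H n)" using measurable_sets[OF X_H[of t n], of A] by simp
    then show ?thesis by blast
  next
    case 2
    \<comment> \<open>The index \<open>k\<close> is the number of transitions up to
      \<open>u\<close>. For \<open>k = n\<close> the upper condition is left out, because epoch
      \<open>n + 1\<close> involves the clock \<open>V (Suc n)\<close>; on the level set of
      \<open>step_at s\<close> it holds by \<open>u \<le> s\<close>.\<close>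
    define B where "B = {\<omega> \<in> space (H n). \<exists>k\<in>{..n}. epoch X V k \<omega> \<le> ennreal u
      \<and> (k = n \<or> ennreal u < epoch X V (Suc k) \<omega>) \<and> dual_state X V k \<omega> \<in> A}"
    have "B = (\<Union>k\<in>{..n}. {\<omega> \<in> space (H n). epoch X V k \<omega> \<le> ennreal u \<and> dual_state X V k \<omega> \<in> A}
       \<inter> (if k = n then space (H n) else {\<omega> \<in> space (H n). ennreal u < epoch X V (Suc k) \<omega>}))"
      unfolding B_def by (auto split: if_splits)
    also have "\<dots> \<in> sets (H n)"
    proof (intro sets.finite_UN sets.Int)
      fix k assume k: "k \<in> {..n}"
      then have [measurable]: "epoch X V k \<in> borel_measurable (H n)" "dual_state X V k \<in> measurable (H n) (count_space UNIV)"
        by auto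
      show "{\<omega> \<in> space (H n). epoch X V k \<omega> \<le> ennreal u \<and> dual_state X V k \<omega> \<in> A} \<in> sets (H n)"
        by measurable
      show "(if k = n then space (H n) else {\<omega> \<in> space (H n). ennreal u < epoch X V (Suc k) \<omega>}) \<in> sets (H n)"
      proof (cases "k = n")
        case False
        then have [measurable]: "epoch X V (Suc k) \<in> borel_measurable (H n)" using k by (intro epoch_H) auto
        have "{\<omega> \<in> space (H n). ennreal u < epoch X V (Suc k) \<omega>} \<in> sets (H n)" by measurable
        then show ?thesis using False by simp
      qed (simp del: space_H)
    qed simp
    finally have B: "B \<in> sets (H n)" .
    have "\<omega> \<in> a \<longleftrightarrow> \<omega> \<in> B" if \<omega>: "\<omega> \<in> space M" "step_at s \<omega> = n" for \<omega>
    proof -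
      interpret driven_path X \<omega> V d using path[OF \<omega>(1)] .
      have un: "step_at u \<omega> \<le> n" using step_count_mono[OF 2(2)] \<omega>(2) by simp
      have key: "(epoch X V k \<omega> \<le> ennreal u \<and> (k = n \<or> ennreal u < epoch X V (Suc k) \<omega>)) \<longleftrightarrow> k = step_at u \<omega>"
        if "k \<le> n" for k
      proof
        assume L: "epoch X V k \<omega> \<le> ennreal u \<and> (k = n \<or> ennreal u < epoch X V (Suc k) \<omega>)"
        show "k = step_at u \<omega>"
        proof (cases "k = n")
          case True
          then show ?thesis using L step_count_ge[of k u] un by simp
        next
          case False
          then show ?thesis using L step_count_eq[of k u] by simp
        qed
      next
        assume k: "k = step_at u \<omega>"
        show "epoch X V k \<omega> \<le> ennreal u \<and> (k = n \<or> ennreal u < epoch X V (Suc k) \<omega>)"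
          using epoch_step_count_le[of u] less_epoch_step_count[of u] k by simp
      qed
      have "\<omega> \<in> B \<longleftrightarrow> (\<exists>k\<in>{..n}. k = step_at u \<omega> \<and> dual_state X V k \<omega> \<in> A)"
        using \<omega>(1) key by (auto simp: B_def)
      also have "\<dots> \<longleftrightarrow> Xh u \<omega> \<in> A" using un by (auto simp: dual_process_eq)
      also have "\<dots> \<longleftrightarrow> \<omega> \<in> a" using 2 \<omega>(1) by simp
      finally show ?thesis by simp
    qed
    then have "a \<inter> lev (step_at s) n = B \<inter> lev (step_at s) n" by blast
    with B show ?thesis by blast
  qed
next
  case Empty
  then show ?case by (intro bexI[of _ "{}"]) auto
next
  case (Compl a)
  then obtain B where "B \<in> sets (H n)" "a \<inter> lev (step_at s) n = B \<inter> lev (step_at s) n" by blast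
  moreover from this have "space (H n) - B \<in> sets (H n)" by blast
  ultimately show ?case by (intro bexI[of _ "space (H n) - B"]) auto
next
  case (Union a)
  then have "\<forall>i. \<exists>B. B \<in> sets (H n) \<and> a i \<inter> lev (step_at s) n = B \<inter> lev (step_at s) n" by blast
  then obtain B where B: "\<And>i. B i \<in> sets (H n)" "\<And>i. a i \<inter> lev (step_at s) n = B i \<inter> lev (step_at s) n" by metis
  have "(\<Union>i. a i) \<inter> lev (step_at s) n = (\<Union>i. B i) \<inter> lev (step_at s) n" using B(2) by blast
  with B(1) show ?case by (intro bexI[of _ "\<Union>i. B i"]) auto
qed

definition const_on :: "real \<Rightarrow> real \<Rightarrow> 'a set" where
  "const_on s h = {\<omega> \<in> space M. \<forall>u. s \<le> u \<longrightarrow> u \<le> s + h \<longrightarrow> X u \<omega> = X s \<omega>}"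

text \<open>Right-continuity carries agreement from the rational points to every point of the cell
  except its right end, which is therefore tested separately.\<close>

lemma const_on_sets:
  assumes sp: "space S = space M" and Xm: "\<And>t. 0 \<le> t \<Longrightarrow> X t \<in> measurable S (count_space UNIV)"
    and s: "0 \<le> s" "0 \<le> h"
  shows "const_on s h \<in> sets S"
proof -
  let ?Q = "{q \<in> \<rat>. s \<le> q \<and> q \<le> s + h}"
  have "const_on s h = {\<omega> \<in> space S. X (s + h) \<omega> = X s \<omega>} \<inter> {\<omega> \<in> space S. \<forall>q\<in>?Q. X q \<omega> = X s \<omega>}" (is "_ = ?R")
  proof
    show "const_on s h \<subseteq> ?R"
    proof
      fix \<omega> assume "\<omega> \<in> const_on s h"
      then have sM: "\<omega> \<in> space S" and c: "\<And>u. s \<le> u \<Longrightarrow> u \<le> s + h \<Longrightarrow> X u \<omega> = X s \<omega>"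
        unfolding const_on_def sp by blast+
      have "X (s + h) \<omega> = X s \<omega>" by (rule c) (use s in auto)
      moreover have "\<forall>q\<in>?Q. X q \<omega> = X s \<omega>" using c by blast
      ultimately show "\<omega> \<in> ?R" using sM by blast
    qed
    show "?R \<subseteq> const_on s h"
    proof
      fix \<omega> assume \<omega>: "\<omega> \<in> ?R"
      then have sM: "\<omega> \<in> space M" and e: "X (s + h) \<omega> = X s \<omega>"
        and q: "\<And>q. q \<in> \<rat> \<Longrightarrow> s \<le> q \<Longrightarrow> q \<le> s + h \<Longrightarrow> X q \<omega> = X s \<omega>" using sp by auto
      interpret step_path X \<omega> using step_path[OF sM] .
      have "X u \<omega> = X s \<omega>" if u: "s \<le> u" "u \<le> s + h" for u
      proof (cases "u = s + h")
        case False
        have "0 \<le> u" using s u by simp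
        then obtain e where e: "0 < e" "\<And>v. u \<le> v \<Longrightarrow> v < u + e \<Longrightarrow> X v \<omega> = X u \<omega>"
          by (rule const_right) blast
        have "u < min (u + e) (s + h)" using e(1) False u by simp
        then obtain r where r: "r \<in> \<rat>" "u < r" "r < min (u + e) (s + h)" using Rats_dense_in_real by blast
        have "X r \<omega> = X u \<omega>" by (rule e(2)) (use r in auto)
        moreover have "X r \<omega> = X s \<omega>" by (rule q) (use r u in auto)
        ultimately show ?thesis by simp
      qed (simp add: e)
      then show "\<omega> \<in> const_on s h" unfolding const_on_def using sM by blast
    qed
  qed
  also have "\<dots> \<in> sets S"
  proof (rule sets.Int)
    have [measurable]: "X s \<in> measurable S (count_space UNIV)" "X (s + h) \<in> measurable S (count_space UNIV)"
      using s by (auto intro!: Xm)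
    show "{\<omega> \<in> space S. X (s + h) \<omega> = X s \<omega>} \<in> sets S" by measurable
    have "countable ?Q" by (rule countable_subset[OF _ countable_rat]) auto
    then show "{\<omega> \<in> space S. \<forall>q\<in>?Q. X q \<omega> = X s \<omega>} \<in> sets S"
    proof (rule sets.sets_Collect_countable_All'[rotated])
      fix q assume "q \<in> ?Q"
      then have [measurable]: "X q \<in> measurable S (count_space UNIV)" using s by (intro Xm) auto
      show "{\<omega> \<in> space S. X q \<omega> = X s \<omega>} \<in> sets S" by measurable
    qed
  qed
  finally show ?thesis .
qed

text \<open>After exactly \<open>n\<close> transitions by time \<open>s\<close> the running clock is
  \<open>V (Suc n)\<close>, and its age at \<open>s\<close> is known to \<open>H n\<close>. A cell
  without birth means that it survives for a further time \<open>h\<close>, so the memoryless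
  property applies for each \<open>n\<close>, and the cases are summed.\<close>

lemma cell_no_birth:
  assumes A: "A \<in> sets (GG s)" and s: "0 \<le> s" "0 \<le> h"
  shows "measure M (A \<inter> const_on s h \<inter> lev (Xh s) y \<inter> lev (X s) x \<inter> lev (Xh (s + h)) y)
    = exp (- rate y x * h) * measure M (A \<inter> const_on s h \<inter> lev (Xh s) y \<inter> lev (X s) x)"
proof -
  define C where "C = A \<inter> const_on s h \<inter> lev (Xh s) y \<inter> lev (X s) x"
  have J: "const_on s h \<in> sets (GG s)" by (rule const_on_sets) (use s in auto)
  have "lev (Xh s) y \<in> sets (GG s)" "lev (X s) x \<in> sets (GG s)"
    using measurable_sets[OF Xh_GG[of s s], of "{y}"] measurable_sets[OF X_GG[of s s], of "{x}"] s
    by (simp_all add: vimage_def Int_def conj_commute)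
  then have C: "C \<in> sets (GG s)" unfolding C_def using A J by (intro sets.Int)
  have CM: "C \<in> sets M" by (rule GG_M[OF C])
  have step: "measure M (C \<inter> lev (step_at s) n \<inter> lev (Xh (s + h)) y)
      = exp (- rate y x * h) * measure M (C \<inter> lev (step_at s) n)" for n
  proof -
    obtain B where B: "B \<in> sets (H n)" "C \<inter> lev (step_at s) n = B \<inter> lev (step_at s) n"
      using GG_adapted[OF C] by blast
    define W where "W \<omega> = waiting_time X (enn2real (epoch X V n \<omega>)) \<omega>" for \<omega>
    define X1 where "X1 \<omega> = X (enn2real (epoch X V n \<omega>)) \<omega>" for \<omega>
    have [measurable]: "W \<in> borel_measurable (H n)" "X1 \<in> measurable (H n) (count_space UNIV)"
      "epoch X V n \<in> borel_measurable (H n)" "dual_state X V n \<in> measurable (H n) (count_space UNIV)"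
      unfolding W_def X1_def by auto
    \<comment> \<open>\<open>D\<close> keeps what \<open>H n\<close> knows about having
      \<open>n\<close> transitions by \<open>s\<close>: the \<open>n\<close>-th epoch has come, and
      \<open>X\<close> makes no jump up to the end of the cell. The rest, that the clock is still
      running at \<open>s\<close>, is the event
      \<open>ennreal (\<sigma> \<omega>) < V (Suc n) \<omega>\<close> in
      \<open>char\<close>.\<close>
    define D where "D = B \<inter> const_on s h \<inter> {\<omega> \<in> space (H n). epoch X V n \<omega> \<le> ennreal s \<and>
       ennreal (s + h) < epoch X V n \<omega> + W \<omega> \<and> dual_state X V n \<omega> = y \<and> X1 \<omega> = x}"
    have D: "D \<in> sets (H n)"
      unfolding D_def
    proof (intro sets.Int B)
      show "const_on s h \<in> sets (H n)" by (rule const_on_sets) (use s in auto)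
    qed measurable
    define \<sigma> where "\<sigma> \<omega> = max 0 (s - enn2real (epoch X V n \<omega>))" for \<omega>
    have \<sigma>: "\<sigma> \<in> borel_measurable (H n)" unfolding \<sigma>_def by measurable
    have char: "(\<omega> \<in> C \<inter> lev (step_at s) n \<longleftrightarrow> \<omega> \<in> D \<and> ennreal (\<sigma> \<omega>) < V (Suc n) \<omega>) \<and>
       (\<omega> \<in> C \<inter> lev (step_at s) n \<inter> lev (Xh (s + h)) y \<longleftrightarrow> \<omega> \<in> D \<and> ennreal (\<sigma> \<omega> + h) < V (Suc n) \<omega>)" for \<omega>
    proof (cases "\<omega> \<in> space M \<and> \<omega> \<in> const_on s h \<and> epoch X V n \<omega> \<le> ennreal s")
      case False
      then show ?thesis using sets.sets_into_space[OF CM] step_at_iff[of \<omega> s n]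
        by (auto simp: C_def D_def)
    next
      case True
      then have \<omega>: "\<omega> \<in> space M" and co: "\<And>u. s \<le> u \<Longrightarrow> u \<le> s + h \<Longrightarrow> X u \<omega> = X s \<omega>"
        and le: "epoch X V n \<omega> \<le> ennreal s" unfolding const_on_def by blast+
      interpret driven_path X \<omega> V d using path[OF \<omega>] .
      have fin: "epoch X V n \<omega> \<noteq> \<infinity>" using le by (auto simp: top_unique)
      define r where "r = enn2real (epoch X V n \<omega>)"
      have r: "epoch X V n \<omega> = ennreal r" "0 \<le> r" using fin by (simp_all add: r_def ennreal_enn2real_if)
      have rs: "r \<le> s" using le r s by (simp add: ennreal_le_iff)
      have \<sigma>r: "\<sigma> \<omega> = s - r" using rs by (simp add: \<sigma>_def r_def)
      have lt: "ennreal (s + c) < epoch X V n \<omega> + V (Suc n) \<omega> \<longleftrightarrow> ennreal (\<sigma> \<omega> + c) < V (Suc n) \<omega>" if "0 \<le> c" for c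
      proof -
        have "ennreal (s + c) = ennreal r + ennreal (\<sigma> \<omega> + c)"
          using r rs that by (subst ennreal_plus[symmetric]) (auto simp: \<sigma>r)
        then show ?thesis by (simp add: r(1) ennreal_add_left_cancel_less del: ennreal_plus)
      qed
      have co': "epoch X V n \<omega> + W \<omega> > ennreal (s + h)" "dual_state X V n \<omega> = Xh s \<omega>" "X1 \<omega> = X s \<omega>"
        if st: "step_at s \<omega> = n"
      proof -
        show "epoch X V n \<omega> + W \<omega> > ennreal (s + h)" using cell_const(1)[OF s co] st by (simp add: W_def)
        show "dual_state X V n \<omega> = Xh s \<omega>" using st by (simp add: dual_process_eq)
        have "ennreal s < epoch X V (Suc n) \<omega>" using less_epoch_step_count[of s] st by simp
        then show "X1 \<omega> = X s \<omega>" using const_between_epochs[OF s(1) le] by (simp add: X1_def)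
      qed
      have 1: "\<omega> \<in> C \<inter> lev (step_at s) n \<longleftrightarrow> \<omega> \<in> D \<and> ennreal (\<sigma> \<omega>) < V (Suc n) \<omega>"
      proof
        assume L: "\<omega> \<in> C \<inter> lev (step_at s) n"
        then have st: "step_at s \<omega> = n" by simp
        have "\<omega> \<in> B" using L B(2) by blast
        moreover have "ennreal s < epoch X V n \<omega> + V (Suc n) \<omega>"
        proof -
          have "ennreal s < epoch X V (Suc n) \<omega>" using less_epoch_step_count[of s] st by simp
          also have "\<dots> \<le> epoch X V n \<omega> + V (Suc n) \<omega>" using fin by (simp add: epoch_Suc add_left_mono)
          finally show ?thesis .
        qed
        ultimately show "\<omega> \<in> D \<and> ennreal (\<sigma> \<omega>) < V (Suc n) \<omega>"
          using L True co'[OF st] lt[of 0] by (auto simp: D_def C_def)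
      next
        assume R: "\<omega> \<in> D \<and> ennreal (\<sigma> \<omega>) < V (Suc n) \<omega>"
        have "ennreal s \<le> ennreal (s + h)" using s by (intro ennreal_leI) simp
        then have "ennreal s < epoch X V n \<omega> + W \<omega>" using R by (auto simp: D_def)
        moreover have "ennreal s < epoch X V n \<omega> + V (Suc n) \<omega>" using R lt[of 0] by simp
        ultimately have "ennreal s < epoch X V (Suc n) \<omega>"
          using fin by (simp add: epoch_Suc W_def min_def)
        then have "step_at s \<omega> = n" using le step_at_iff[OF \<omega>] by simp
        then show "\<omega> \<in> C \<inter> lev (step_at s) n" using R B(2) \<omega> by (auto simp: D_def)
      qed
      have 2: "Xh (s + h) \<omega> = y \<longleftrightarrow> ennreal (\<sigma> \<omega> + h) < V (Suc n) \<omega>" if L: "\<omega> \<in> C \<inter> lev (step_at s) n"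
      proof -
        have "Xh s \<omega> = y" "step_at s \<omega> = n" using L by (auto simp: C_def)
        then show ?thesis using cell_const(2)[OF s co] lt[OF s(2)] by simp
      qed
      have 3: "ennreal (\<sigma> \<omega>) < V (Suc n) \<omega>" if "ennreal (\<sigma> \<omega> + h) < V (Suc n) \<omega>"
      proof -
        have "ennreal (\<sigma> \<omega>) \<le> ennreal (\<sigma> \<omega> + h)" using s by (intro ennreal_leI) simp
        then show ?thesis using that by order
      qed
      show ?thesis using 1 2 3 \<omega> by blast
    qed
    have e1: "C \<inter> lev (step_at s) n = {\<omega> \<in> D. ennreal (\<sigma> \<omega>) < V (Suc n) \<omega>}"
      and e2: "C \<inter> lev (step_at s) n \<inter> lev (Xh (s + h)) y = {\<omega> \<in> D. ennreal (\<sigma> \<omega> + h) < V (Suc n) \<omega>}"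
      using char by blast+
    show ?thesis
      unfolding e2 unfolding e1
    proof (rule clock_memoryless_random[OF D s(2) _ \<sigma>])
      show "epoch X V n \<omega> < \<infinity> \<and> dual_state X V n \<omega> = y \<and> X (enn2real (epoch X V n \<omega>)) \<omega> = x" if "\<omega> \<in> D" for \<omega>
        using that by (auto simp: D_def X1_def intro: order.strict_trans1)
    qed (simp add: \<sigma>_def)
  qed
  have split: "(\<lambda>n. measure M (E \<inter> lev (step_at s) n)) sums measure M E" if E: "E \<in> sets M" for E
  proof -
    have "(\<lambda>n. measure M (E \<inter> lev (step_at s) n)) sums measure M (\<Union>n. E \<inter> lev (step_at s) n)"
      using E by (intro finite_measure_UNION) (auto simp: disjoint_family_on_def)
    moreover have "(\<Union>n. E \<inter> lev (step_at s) n) = E" using sets.sets_into_space[OF E] by auto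
    ultimately show ?thesis by simp
  qed
  have "C \<inter> lev (Xh (s + h)) y \<in> sets M" using CM by measurable
  from split[OF this] have "(\<lambda>n. measure M (C \<inter> lev (step_at s) n \<inter> lev (Xh (s + h)) y)) sums measure M (C \<inter> lev (Xh (s + h)) y)"
    by (simp add: Int_ac)
  then have "(\<lambda>n. exp (- rate y x * h) * measure M (C \<inter> lev (step_at s) n)) sums measure M (C \<inter> lev (Xh (s + h)) y)"
    unfolding step .
  then show ?thesis using sums_mult[OF split[OF CM], of "exp (- rate y x * h)"]
    unfolding C_def[symmetric] by (rule sums_unique2)
qed

definition bad :: "real \<Rightarrow> real \<Rightarrow> 'a set" where
  "bad s h = {\<omega> \<in> space M. step_at s \<omega> + 2 \<le> step_at (s + h) \<omega>}"

lemma bad_M[measurable]: "bad s h \<in> sets M"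
proof -
  have "bad s h = (\<Union>i. \<Union>j\<in>{i + 2..}. lev (step_at s) i \<inter> lev (step_at (s + h)) j)"
    by (auto simp: bad_def)
  also have "\<dots> \<in> sets M" by (intro sets.countable_UN'' sets.Int) auto
  finally show ?thesis .
qed

text \<open>Ties have probability zero, so the pathwise description of a cell with one jump holds
  almost surely outside \<open>bad\<close>.\<close>

lemma AE_cell:
  assumes s: "0 \<le> s" "0 \<le> h"
  shows "AE \<omega> in M. \<omega> \<in> space M \<and> (\<omega> \<notin> bad s h \<longrightarrow>
    (X (s + h) \<omega> \<noteq> X s \<omega> \<longrightarrow> Xh (s + h) \<omega> = birth_move (X (s + h) \<omega>) (Xh s \<omega>)) \<and>
    (X (s + h) \<omega> = X s \<omega> \<longrightarrow> \<omega> \<in> const_on s h \<and> (Xh (s + h) \<omega> = Xh s \<omega> \<or> Xh (s + h) \<omega> = Xh s \<omega> + 1)))"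
proof -
  have "AE \<omega> in M. \<omega> \<in> space M" by simp
  with AE_no_tie show ?thesis
  proof eventually_elim
    case (elim \<omega>)
    then have \<omega>: "\<omega> \<in> space M" by simp
    interpret driven_path X \<omega> V d using path[OF \<omega>] .
    have tie: "W (step_at s \<omega>) = \<infinity>" if "V (Suc (step_at s \<omega>)) \<omega> = W (step_at s \<omega>)"
      using elim epoch_step_count_finite[of s] that by fastforce
    show ?case
    proof (intro conjI impI \<omega>)
      assume nb: "\<omega> \<notin> bad s h"
      then have one: "step_at (s + h) \<omega> \<le> step_at s \<omega> + 1" using \<omega> by (simp add: bad_def not_le)
      {
        assume ne: "X (s + h) \<omega> \<noteq> X s \<omega>"
        show "Xh (s + h) \<omega> = birth_move (X (s + h) \<omega>) (Xh s \<omega>)"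
          using cell_jump(2)[OF s _ _ ne one tie] s by (simp add: birth_move_def)
      next
        assume eq: "X (s + h) \<omega> = X s \<omega>"
        show "\<omega> \<in> const_on s h"
        proof (rule ccontr)
          assume "\<omega> \<notin> const_on s h"
          then obtain u where "s \<le> u" "u \<le> s + h" "X u \<omega> \<noteq> X s \<omega>" using \<omega> by (auto simp: const_on_def)
          from cell_jump(1)[OF s this one tie] eq show False by simp
        qed
        show "Xh (s + h) \<omega> = Xh s \<omega> \<or> Xh (s + h) \<omega> = Xh s \<omega> + 1"
          using dual_process_step_le[OF s(2), of s] dual_process_mono[of s "s + h"] one s by auto
      }
    qed
  qed
qed

text \<open>The law of the dual at the end of a cell, given its value at the start and
  \<open>X\<close> at both ends, as it would be if the cell held at most one transition.\<close>

definition cell_kernel :: "real \<Rightarrow> nat \<Rightarrow> nat \<Rightarrow> nat \<Rightarrow> nat \<Rightarrow> real" where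
  "cell_kernel h x x' y y' =
    (if x' = x then (if y' = y then exp (- rate y x * h) else if y' = y + 1 then 1 - exp (- rate y x * h) else 0)
     else if y' = birth_move x' y then 1 else 0)"

lemma lev_GG:
  assumes "0 \<le> t" "0 \<le> u" "u \<le> s"
  shows "lev (X t) x \<in> sets (GG s)" "lev (Xh u) x \<in> sets (GG s)"
  using measurable_sets[OF Xh_GG[of u s], of "{x}"] measurable_sets[OF X_GG[of t s], of "{x}"] assms
  by (simp_all add: vimage_def Int_def conj_commute)

lemma lev_M: "0 \<le> t \<Longrightarrow> lev (X t) x \<in> sets M" "lev (Xh u) x \<in> sets M"
  by measurable

text \<open>If \<open>X\<close> differs at the two ends, the dual is determined outside
  \<open>bad\<close>. If it agrees, \<open>cell_no_birth\<close> is exact where \<open>X\<close>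
  rests, and everything else is bad. The error is kept inside \<open>A\<close>, so that the errors
  over a partition add up to a single probability.\<close>

lemma cell_estimate_aux:
  assumes A: "A \<in> sets (GG s)" and s: "0 \<le> s" "0 \<le> h"
    and sub: "A \<subseteq> lev (X s) x" "A \<subseteq> lev (X (s + h)) x'" "A \<subseteq> lev (Xh s) y" and y: "y \<le> d" and x: "x \<le> d"
  shows "\<bar>measure M (A \<inter> lev (Xh (s + h)) y') - cell_kernel h x x' y y' * measure M A\<bar> \<le> measure M (A \<inter> bad s h)"
proof -
  have AM[measurable]: "A \<in> sets M" by (rule GG_M[OF A])
  let ?E = "lev (Xh (s + h)) y'"
  have E[measurable]: "?E \<in> sets M" by measurable
  have mono: "measure M B \<le> measure M B'" if "B' \<in> sets M" "AE \<omega> in M. \<omega> \<in> B \<longrightarrow> \<omega> \<in> B'" for B B'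
    using that by (intro finite_measure_mono_AE) auto
  have all: "measure M A \<le> measure M (A \<inter> ?E) + measure M (A \<inter> bad s h)"
    if "AE \<omega> in M. \<omega> \<in> A \<longrightarrow> \<omega> \<in> bad s h \<or> \<omega> \<in> ?E"
  proof -
    have "measure M A \<le> measure M ((A \<inter> ?E) \<union> (A \<inter> bad s h))" using that by (intro mono) auto
    also have "\<dots> \<le> measure M (A \<inter> ?E) + measure M (A \<inter> bad s h)" by (rule measure_Un_le) auto
    finally show ?thesis .
  qed
  have none: "measure M (A \<inter> ?E) \<le> measure M (A \<inter> bad s h)" if "AE \<omega> in M. \<omega> \<in> A \<longrightarrow> \<omega> \<in> ?E \<longrightarrow> \<omega> \<in> bad s h"
    using that by (intro mono) auto
  have leA: "measure M (A \<inter> ?E) \<le> measure M A" by (intro finite_measure_mono) auto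
  show ?thesis
  proof (cases "x' = x")
    case False
    show ?thesis
    proof (cases "y' = birth_move x' y")
      case True
      have "AE \<omega> in M. \<omega> \<in> A \<longrightarrow> \<omega> \<in> bad s h \<or> \<omega> \<in> ?E"
        using AE_cell[OF s] by eventually_elim (use sub True \<open>x' \<noteq> x\<close> in fastforce)
      from all[OF this] show ?thesis using leA True False by (simp add: cell_kernel_def)
    next
      case 2: False
      have "AE \<omega> in M. \<omega> \<in> A \<longrightarrow> \<omega> \<in> ?E \<longrightarrow> \<omega> \<in> bad s h"
        using AE_cell[OF s] by eventually_elim (use sub 2 \<open>x' \<noteq> x\<close> in fastforce)
      from none[OF this] show ?thesis using 2 False by (simp add: cell_kernel_def)
    qed
  next
    case eq: True
    let ?J = "const_on s h" and ?e = "exp (- rate y x * h)"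
    have J[measurable]: "?J \<in> sets M" by (rule const_on_sets) (use s in auto)
    have e: "0 \<le> ?e" "?e \<le> 1" using rate_nonneg[OF y x] s by auto
    define p where "p B = measure M (A \<inter> B)" for B
    have spl: "measure M (A \<inter> B) = p (B \<inter> ?J) + p (B - ?J)" if [measurable]: "B \<in> sets M" for B
    proof -
      have "A \<inter> B = (A \<inter> (B \<inter> ?J)) \<union> (A \<inter> (B - ?J))" by auto
      then show ?thesis unfolding p_def by (elim ssubst) (rule finite_measure_Union, auto)
    qed
    \<comment> \<open>Equal values at both ends without constancy mean that \<open>X\<close> has
      left and come back, which takes two transitions.\<close>
    have J0: "p (space M - ?J) \<le> p (bad s h - ?J)"
      unfolding p_def
    proof (rule mono)
      show "A \<inter> (bad s h - ?J) \<in> sets M" by (intro sets.Int sets.Diff AM J bad_M)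
      show "AE \<omega> in M. \<omega> \<in> A \<inter> (space M - ?J) \<longrightarrow> \<omega> \<in> A \<inter> (bad s h - ?J)"
        using AE_cell[OF s] by eventually_elim (use sub eq in fastforce)
    qed
    have Jy: "p (lev (Xh (s + h)) y \<inter> ?J) = ?e * p (space M \<inter> ?J)"
    proof -
      have "A \<inter> ?J \<inter> lev (Xh s) y \<inter> lev (X s) x = A \<inter> (space M \<inter> ?J)" using sub by auto
      then show ?thesis using cell_no_birth[OF A s, of y x] unfolding p_def by (simp add: Int_ac)
    qed
    have pb: "measure M (A \<inter> bad s h) = p (bad s h \<inter> ?J) + p (bad s h - ?J)" by (rule spl) measurable
    have pA: "measure M A = p (space M \<inter> ?J) + p (space M - ?J)"
      using spl[of "space M"] sets.sets_into_space[OF AM] by (simp add: Int_absorb2)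
    have pE: "measure M (A \<inter> ?E) = p (?E \<inter> ?J) + p (?E - ?J)" by (rule spl) measurable
    have p0: "0 \<le> p B" for B by (simp add: p_def)
    have pE2: "p (?E - ?J) \<le> p (space M - ?J)"
      unfolding p_def by (rule finite_measure_mono) (auto intro!: sets.Int AM sets.Diff J)
    consider "y' = y" | "y' = y + 1" | "y' \<noteq> y" "y' \<noteq> y + 1" by blast
    then show ?thesis
    proof cases
      case 1
      have "measure M (A \<inter> ?E) - ?e * measure M A = p (?E - ?J) - ?e * p (space M - ?J)"
        unfolding pE pA using Jy 1 by (simp add: algebra_simps)
      moreover have "0 \<le> ?e * p (space M - ?J)" "?e * p (space M - ?J) \<le> p (space M - ?J)"
        using e p0[of "space M - ?J"] by (auto simp: mult_left_le_one_le)
      ultimately have "\<bar>measure M (A \<inter> ?E) - ?e * measure M A\<bar> \<le> p (space M - ?J)"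
        using pE2 p0[of "?E - ?J"] by linarith
      then show ?thesis unfolding pb using J0 p0[of "bad s h \<inter> ?J"] 1 eq by (simp add: cell_kernel_def)
    next
      case 2
      \<comment> \<open>Where \<open>X\<close> rests and the cell is not bad, the dual ends in
        \<open>y\<close> or \<open>y + 1\<close>, so the mass at \<open>y + 1\<close> is found as a
        complement.\<close>
      have JJ: "p (space M \<inter> ?J) \<le> p (lev (Xh (s + h)) y \<inter> ?J) + p (?E \<inter> ?J) + p (bad s h \<inter> ?J)"
      proof -
        have "p (space M \<inter> ?J) \<le> measure M ((A \<inter> (lev (Xh (s + h)) y \<inter> ?J) \<union> A \<inter> (?E \<inter> ?J)) \<union> A \<inter> (bad s h \<inter> ?J))"
          unfolding p_def
        proof (rule mono)
          show "(A \<inter> (lev (Xh (s + h)) y \<inter> ?J) \<union> A \<inter> (?E \<inter> ?J)) \<union> A \<inter> (bad s h \<inter> ?J) \<in> sets M"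
            by (intro sets.Un sets.Int AM J bad_M E lev_M)
          show "AE \<omega> in M. \<omega> \<in> A \<inter> (space M \<inter> ?J) \<longrightarrow>
              \<omega> \<in> (A \<inter> (lev (Xh (s + h)) y \<inter> ?J) \<union> A \<inter> (?E \<inter> ?J)) \<union> A \<inter> (bad s h \<inter> ?J)"
            using AE_cell[OF s] by eventually_elim (use sub eq 2 in fastforce)
        qed
        also have "\<dots> \<le> measure M (A \<inter> (lev (Xh (s + h)) y \<inter> ?J) \<union> A \<inter> (?E \<inter> ?J)) + measure M (A \<inter> (bad s h \<inter> ?J))"
          by (rule measure_Un_le) measurable
        also have "\<dots> \<le> (measure M (A \<inter> (lev (Xh (s + h)) y \<inter> ?J)) + measure M (A \<inter> (?E \<inter> ?J))) + measure M (A \<inter> (bad s h \<inter> ?J))"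
          by (intro add_right_mono measure_Un_le) measurable
        finally show ?thesis by (simp add: p_def)
      qed
      have JJ2: "p (lev (Xh (s + h)) y \<inter> ?J) + p (?E \<inter> ?J) \<le> p (space M \<inter> ?J)"
      proof -
        have "p (lev (Xh (s + h)) y \<inter> ?J) + p (?E \<inter> ?J) = measure M (A \<inter> (lev (Xh (s + h)) y \<inter> ?J) \<union> A \<inter> (?E \<inter> ?J))"
          unfolding p_def using 2 by (intro finite_measure_Union[symmetric]) (measurable, auto)
        also have "\<dots> \<le> p (space M \<inter> ?J)" unfolding p_def by (rule finite_measure_mono) (auto, measurable)
        finally show ?thesis .
      qed
      define a b where "a = p (space M \<inter> ?J)" and "b = p (space M - ?J)"
      have "measure M (A \<inter> ?E) - (1 - ?e) * measure M A = (p (?E \<inter> ?J) - (1 - ?e) * a) + (p (?E - ?J) - (1 - ?e) * b)"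
        unfolding pE pA a_def b_def by (simp add: algebra_simps)
      moreover have "p (?E \<inter> ?J) - (1 - ?e) * a \<le> 0" "- p (bad s h \<inter> ?J) \<le> p (?E \<inter> ?J) - (1 - ?e) * a"
        using JJ JJ2 Jy unfolding a_def by (simp_all add: algebra_simps)
      moreover have "0 \<le> (1 - ?e) * b" "(1 - ?e) * b \<le> b"
        using e p0[of "space M - ?J"] unfolding b_def by (auto intro: mult_left_le_one_le)
      ultimately have "\<bar>measure M (A \<inter> ?E) - (1 - ?e) * measure M A\<bar> \<le> p (bad s h \<inter> ?J) + b"
        using pE2 p0[of "?E - ?J"] p0[of "bad s h \<inter> ?J"] unfolding b_def by linarith
      then show ?thesis unfolding pb using J0 2 eq by (simp add: cell_kernel_def b_def)
    next
      case 3
      have "AE \<omega> in M. \<omega> \<in> A \<longrightarrow> \<omega> \<in> ?E \<longrightarrow> \<omega> \<in> bad s h"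
        using AE_cell[OF s] by eventually_elim (use sub 3 eq in fastforce)
      from none[OF this] show ?thesis using 3 eq by (simp add: cell_kernel_def)
    qed
  qed
qed

lemma cell_estimate:
  assumes A: "A \<in> sets (GG s)" and s: "0 \<le> s" "0 \<le> h"
    and sub: "A \<subseteq> lev (X s) x" "A \<subseteq> lev (X (s + h)) x'" and x: "x \<le> d"
  shows "\<bar>measure M (A \<inter> lev (Xh (s + h)) y') - (\<Sum>y\<le>d. measure M (A \<inter> lev (Xh s) y) * cell_kernel h x x' y y')\<bar>
    \<le> measure M (A \<inter> bad s h)"
proof -
  have AM[measurable]: "A \<in> sets M" by (rule GG_M[OF A])
  have 1: "measure M (A \<inter> lev (Xh (s + h)) y') = (\<Sum>y\<le>d. measure M (A \<inter> lev (Xh s) y \<inter> lev (Xh (s + h)) y'))"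
    by (subst sum_over_states[of _ "Xh s"]) (use Xh_le in \<open>auto intro!: sum.cong simp: Int_ac\<close>)
  have 2: "measure M (A \<inter> bad s h) = (\<Sum>y\<le>d. measure M (A \<inter> lev (Xh s) y \<inter> bad s h))"
    by (subst sum_over_states[of _ "Xh s"])
      (use Xh_le sets.sets_into_space[OF AM] in \<open>auto intro!: sum.cong simp: Int_ac\<close>)
  have "\<bar>measure M (A \<inter> lev (Xh (s + h)) y') - (\<Sum>y\<le>d. measure M (A \<inter> lev (Xh s) y) * cell_kernel h x x' y y')\<bar>
     = \<bar>\<Sum>y\<le>d. measure M (A \<inter> lev (Xh s) y \<inter> lev (Xh (s + h)) y') - cell_kernel h x x' y y' * measure M (A \<inter> lev (Xh s) y)\<bar>"
    unfolding 1 by (simp add: sum_subtractf mult.commute)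
  also have "\<dots> \<le> (\<Sum>y\<le>d. \<bar>measure M (A \<inter> lev (Xh s) y \<inter> lev (Xh (s + h)) y') - cell_kernel h x x' y y' * measure M (A \<inter> lev (Xh s) y)\<bar>)"
    by (rule sum_abs)
  also have "\<dots> \<le> (\<Sum>y\<le>d. measure M (A \<inter> lev (Xh s) y \<inter> bad s h))"
    using s sub x by (intro sum_mono cell_estimate_aux sets.Int A lev_GG) auto
  finally show ?thesis unfolding 2 .
qed


section \<open>The number of transitions\<close>

lemma markov_step:
  assumes "C \<in> sets (FX s)" "0 \<le> s" "0 \<le> t" "j \<le> d"
  shows "measure M (C \<inter> lev (X (s + t)) j) = (\<Sum>i\<le>d. measure M (C \<inter> lev (X s) i) * transition_prob G t i j)"
  using chain assms unfolding markov_chain_def by (rule markov_chain_wrt_step)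

lemma X_change_prob:
  obtains C where "0 \<le> C" "\<And>s h. 0 \<le> s \<Longrightarrow> 0 \<le> h \<Longrightarrow> h \<le> 1 \<Longrightarrow>
    measure M {\<omega> \<in> space M. X (s + h) \<omega> \<noteq> X s \<omega>} \<le> C * h"
proof -
  \<comment> \<open>For \<open>h \<le> 1\<close> the quadratic error of the short-time expansion is
    at most linear in \<open>h\<close>; it is added to the bound on the rates.\<close>
  define c where "c = mat_bound d G ^ 2 * exp (mat_bound d G) + mat_bound d G"
  have c: "0 \<le> c" by (simp add: c_def mat_bound_nonneg)
  have tp: "\<bar>transition_prob G h i j\<bar> \<le> c * h" if "i \<le> d" "j \<le> d" "i \<noteq> j" "0 \<le> h" "h \<le> 1" for i j h
  proof -
    have "\<bar>transition_prob G h i j - h * g i j\<bar> \<le> mat_bound d G ^ 2 * exp (mat_bound d G) * h ^ 2"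
      using transition_prob_short_time[OF G_carrier, of i j h] that by simp
    also have "\<dots> \<le> mat_bound d G ^ 2 * exp (mat_bound d G) * h"
      using that by (intro mult_left_mono) (auto simp: power2_eq_square mult_left_le_one_le)
    finally have "\<bar>transition_prob G h i j - h * g i j\<bar> \<le> mat_bound d G ^ 2 * exp (mat_bound d G) * h" .
    moreover have "\<bar>h * g i j\<bar> \<le> h * mat_bound d G"
      unfolding abs_mult using that by (intro mult_mono mat_entry_le_bound) auto
    ultimately have "\<bar>transition_prob G h i j\<bar> \<le> mat_bound d G ^ 2 * exp (mat_bound d G) * h + h * mat_bound d G"
      by linarith
    then show ?thesis by (simp add: c_def algebra_simps)
  qed
  have "measure M {\<omega> \<in> space M. X (s + h) \<omega> \<noteq> X s \<omega>} \<le> (real (d + 1) * real (d + 1) * c) * h"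
    if s: "0 \<le> s" and h: "0 \<le> h" "h \<le> 1" for s h
  proof -
    have [measurable]: "X s \<in> measurable M (count_space UNIV)" "X (s + h) \<in> measurable M (count_space UNIV)"
      using s h by auto
    let ?I = "{(i, j). i \<le> d \<and> j \<le> d \<and> i \<noteq> j}"
    have fin: "finite ?I" by (rule finite_subset[of _ "{..d} \<times> {..d}"]) auto
    have cardI: "card ?I \<le> (d + 1) * (d + 1)"
      using card_mono[of "{..d} \<times> {..d}" ?I] by (auto simp: card_cartesian_product)
    have "{\<omega> \<in> space M. X (s + h) \<omega> \<noteq> X s \<omega>} \<subseteq> (\<Union>(i, j)\<in>?I. lev (X s) i \<inter> lev (X (s + h)) j)"
      using X_le s h by auto
    then have "measure M {\<omega> \<in> space M. X (s + h) \<omega> \<noteq> X s \<omega>} \<le> measure M (\<Union>(i, j)\<in>?I. lev (X s) i \<inter> lev (X (s + h)) j)"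
      by (rule finite_measure_mono) (auto intro!: sets.finite_UN fin)
    also have "\<dots> \<le> (\<Sum>p\<in>?I. measure M (case p of (i, j) \<Rightarrow> lev (X s) i \<inter> lev (X (s + h)) j))"
      by (rule finite_measure_subadditive_finite[OF fin]) auto
    also have "\<dots> \<le> (\<Sum>p\<in>?I. c * h)"
    proof (rule sum_mono)
      fix p assume "p \<in> ?I"
      then obtain i j where p: "p = (i, j)" "i \<le> d" "j \<le> d" "i \<noteq> j" by auto
      have "lev (X s) i \<in> sets (FX s)"
        using measurable_sets[OF X_FX[OF s], of "{i}"] FX_subalgebra[of s] by (simp add: vimage_def Int_def conj_commute subalgebra_def)
      then have "measure M (lev (X s) i \<inter> lev (X (s + h)) j)
          = (\<Sum>k\<le>d. measure M (lev (X s) i \<inter> lev (X s) k) * transition_prob G h k j)"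
        using s h p by (intro markov_step) auto
      also have "\<dots> = (\<Sum>k\<le>d. if k = i then measure M (lev (X s) i) * transition_prob G h i j else 0)"
      proof (intro sum.cong refl)
        fix k
        have "lev (X s) i \<inter> lev (X s) k = (if k = i then lev (X s) i else {})" by auto
        then show "measure M (lev (X s) i \<inter> lev (X s) k) * transition_prob G h k j
          = (if k = i then measure M (lev (X s) i) * transition_prob G h i j else 0)" by simp
      qed
      also have "\<dots> = measure M (lev (X s) i) * transition_prob G h i j" using p by simp
      also have "\<dots> \<le> measure M (lev (X s) i) * (c * h)"
        using tp[of i j h] p h by (intro mult_left_mono) auto
      also have "\<dots> \<le> 1 * (c * h)" using c h by (intro mult_right_mono) auto
      finally show "measure M (case p of (i, j) \<Rightarrow> lev (X s) i \<inter> lev (X (s + h)) j) \<le> c * h" using p by simp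
    qed
    also have "\<dots> = real (card ?I) * (c * h)" by simp
    also have "\<dots> \<le> real ((d + 1) * (d + 1)) * (c * h)"
      using cardI c h by (intro mult_right_mono) (simp_all only: of_nat_le_iff, auto)
    finally show ?thesis by (simp add: algebra_simps)
  qed
  with c show ?thesis by (intro that[of "real (d + 1) * real (d + 1) * c"]) auto
qed

text \<open>By Fatou the mean is at most \<open>d\<close> plus the lower limit of the mean number of
  grid changes of \<open>X\<close>, and a grid with \<open>m\<close> cells has mean at most
  \<open>m * (C * (t / m)) = C * t\<close>.\<close>

lemma integrable_step_count:
  assumes t: "0 \<le> t" shows "integrable M (\<lambda>\<omega>. real (step_at t \<omega>))"
proof -
  \<comment> \<open>The grid needs a positive length; the general case follows by monotonicity from
    time \<open>t + 1\<close>.\<close>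
  have pos: "integrable M (\<lambda>\<omega>. real (step_at t \<omega>))" if t: "0 < t" for t
  proof -
    obtain C where C: "0 \<le> C" "\<And>s h. 0 \<le> s \<Longrightarrow> 0 \<le> h \<Longrightarrow> h \<le> 1 \<Longrightarrow>
        measure M {\<omega> \<in> space M. X (s + h) \<omega> \<noteq> X s \<omega>} \<le> C * h"
      using X_change_prob by blast
    define E where "E m i = {\<omega> \<in> space M. X (t * real i / real m) \<omega> \<noteq> X (t * real (Suc i) / real m) \<omega>}" for m i :: nat
    have E[measurable]: "E m i \<in> sets M" for m i
    proof -
      have "0 \<le> t * real i / real m" "0 \<le> t * real (Suc i) / real m" using t by (auto intro!: divide_nonneg_nonneg mult_nonneg_nonneg)
      then have [measurable]: "X (t * real i / real m) \<in> measurable M (count_space UNIV)"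
        "X (t * real (Suc i) / real m) \<in> measurable M (count_space UNIV)" by (auto intro!: X_M)
      show ?thesis unfolding E_def by measurable
    qed
    define S where "S m \<omega> = ennreal (real d) + (\<Sum>i<m. indicator (E m i) \<omega>)" for m \<omega>
    have S: "S m \<in> borel_measurable M" for m unfolding S_def by measurable
    have le: "ennreal (real (step_at t \<omega>)) \<le> liminf (\<lambda>m. S m \<omega>)" if \<omega>: "\<omega> \<in> space M" for \<omega>
    proof -
      interpret driven_path X \<omega> V d using path[OF \<omega>] .
      have "\<forall>\<^sub>F m in sequentially. ennreal (real (step_at t \<omega>)) \<le> S m \<omega>"
        using step_count_le_grid[OF t]
      proof eventually_elim
        case (elim m)
        have "(\<Sum>i<m. indicator (E m i) \<omega>) = (\<Sum>i\<in>{i. i < m \<and> \<omega> \<in> E m i}. 1::ennreal)"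
          by (rule sum.mono_neutral_cong_right) (auto simp: indicator_def)
        also have "{i. i < m \<and> \<omega> \<in> E m i} = {i. i < m \<and> X (t * real i / real m) \<omega> \<noteq> X (t * real (Suc i) / real m) \<omega>}"
          using \<omega> by (auto simp: E_def)
        finally have "S m \<omega> = of_nat (d + card {i. i < m \<and> X (t * real i / real m) \<omega> \<noteq> X (t * real (Suc i) / real m) \<omega>})"
          by (simp add: S_def ennreal_of_nat_eq_real_of_nat)
        then show ?case using elim by (simp only: ennreal_of_nat_eq_real_of_nat[symmetric] of_nat_le_iff)
      qed
      then show ?thesis by (rule Liminf_bounded)
    qed
    have bound: "(\<integral>\<^sup>+ \<omega>. S m \<omega> \<partial>M) \<le> ennreal (real d + C * t)" if m: "t < real m" for m
    proof -
      have mpos: "0 < real m" using t m by simp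
      have "(\<integral>\<^sup>+ \<omega>. S m \<omega> \<partial>M) = ennreal (real d) + (\<Sum>i<m. emeasure M (E m i))"
        unfolding S_def by (simp add: nn_integral_add nn_integral_sum emeasure_space_1)
      also have "\<dots> \<le> ennreal (real d) + (\<Sum>i<m. ennreal (C * (t / real m)))"
      proof (intro add_left_mono sum_mono)
        fix i
        have eq: "t * real i / real m + t / real m = t * real (Suc i) / real m" by (simp add: add_divide_distrib algebra_simps)
        have "E m i = {\<omega> \<in> space M. X (t * real i / real m + t / real m) \<omega> \<noteq> X (t * real i / real m) \<omega>}"
          unfolding eq E_def by auto
        moreover have "measure M {\<omega> \<in> space M. X (t * real i / real m + t / real m) \<omega> \<noteq> X (t * real i / real m) \<omega>} \<le> C * (t / real m)"
          using t m mpos by (intro C(2)) (auto simp: field_simps)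
        ultimately show "emeasure M (E m i) \<le> ennreal (C * (t / real m))"
          unfolding emeasure_eq_measure by (intro ennreal_leI) simp
      qed
      also have "\<dots> = ennreal (real d + C * t)"
        using C(1) t mpos by (simp add: ennreal_of_nat_eq_real_of_nat flip: ennreal_mult ennreal_plus)
      finally show ?thesis .
    qed
    have "(\<integral>\<^sup>+ \<omega>. ennreal (real (step_at t \<omega>)) \<partial>M) \<le> (\<integral>\<^sup>+ \<omega>. liminf (\<lambda>m. S m \<omega>) \<partial>M)"
      by (rule nn_integral_mono) (use le in auto)
    also have "\<dots> \<le> liminf (\<lambda>m. \<integral>\<^sup>+ \<omega>. S m \<omega> \<partial>M)" by (rule nn_integral_liminf[OF S])
    also have "\<dots> \<le> ennreal (real d + C * t)"
    proof (rule Liminf_le)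
      have "\<forall>\<^sub>F m in sequentially. t < real m"
        using reals_Archimedean2[of t] by (metis eventually_sequentiallyI less_le_trans of_nat_le_iff)
      then show "\<forall>\<^sub>F m in sequentially. (\<integral>\<^sup>+ \<omega>. S m \<omega> \<partial>M) \<le> ennreal (real d + C * t)"
        by eventually_elim (rule bound)
    qed simp
    finally show ?thesis
      by (intro integrableI_bounded) (auto intro: le_less_trans)
  qed
  show ?thesis
  proof (rule Bochner_Integration.integrable_bound[OF pos[of "t + 1"]])
    show "AE \<omega> in M. norm (real (step_at t \<omega>)) \<le> norm (real (step_at (t + 1) \<omega>))"
      using driven_path.step_count_mono[OF path, of _ t "t + 1"] by (intro AE_I2) simp
  qed (use t in auto)
qed

text \<open>On almost every path no cell is bad once the mesh is below the least gap between epochs.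
  The number of bad cells is dominated by the number of transitions up to \<open>t\<close>, because
  each of them contains transitions of its own.\<close>

lemma sum_bad_tendsto:
  assumes st: "0 \<le> s" "s \<le> t"
  shows "(\<lambda>m. \<Sum>i<m. measure M (bad (s + (t - s) / real m * real i) ((t - s) / real m))) \<longlonglongrightarrow> 0"
proof -
  define c where "c m \<omega> = (\<Sum>i<m. indicator (bad (s + (t - s) / real m * real i) ((t - s) / real m)) \<omega> :: real)" for m \<omega>
  have c[measurable]: "c m \<in> borel_measurable M" for m unfolding c_def by measurable
  have cm: "(\<Sum>i<m. measure M (bad (s + (t - s) / real m * real i) ((t - s) / real m))) = (\<integral>\<omega>. c m \<omega> \<partial>M)" for m
    unfolding c_def by (subst Bochner_Integration.integral_sum) (auto simp: emeasure_eq_measure)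
  have "s + c * real i + c = s + c * real (Suc i)" for i :: nat and c by (simp add: algebra_simps)
  then have grid: "s + (t - s) / real m * real i + (t - s) / real m = s + (t - s) / real m * real (Suc i)" for m i :: nat .
  have "(\<lambda>m. \<integral>\<omega>. c m \<omega> \<partial>M) \<longlonglongrightarrow> (\<integral>\<omega>. 0 \<partial>M)"
  proof (rule integral_dominated_convergence[where w = "\<lambda>\<omega>. real (step_at t \<omega>)"])
    show "integrable M (\<lambda>\<omega>. real (step_at t \<omega>))" using st by (intro integrable_step_count) simp
    have "AE \<omega> in M. \<omega> \<in> space M" by simp
    with AE_clock_pos show "AE \<omega> in M. (\<lambda>m. c m \<omega>) \<longlonglongrightarrow> 0"
    proof eventually_elim
      case (elim \<omega>)
      interpret driven_path X \<omega> V d using path elim by blast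
      have "\<forall>\<^sub>F m in sequentially. \<forall>i<m. step_at (s + (t - s) / real m * real (Suc i)) \<omega>
          \<le> step_at (s + (t - s) / real m * real i) \<omega> + 1"
        by (rule grid_no_double_step[OF _ st]) (use elim(1) in blast)
      then have "\<forall>\<^sub>F m in sequentially. c m \<omega> = 0"
      proof eventually_elim
        case (elim m)
        have "\<omega> \<notin> bad (s + (t - s) / real m * real i) ((t - s) / real m)" if "i < m" for i
          using elim that unfolding bad_def grid by fastforce
        then show ?case by (simp add: c_def)
      qed
      then show ?case by (rule tendsto_eventually)
    qed
    fix m
    have "norm (c m \<omega>) \<le> real (step_at t \<omega>)" if \<omega>: "\<omega> \<in> space M" for \<omega>
    proof -
      interpret driven_path X \<omega> V d using path[OF \<omega>] .
      let ?f = "\<lambda>i. step_at (s + (t - s) / real m * real i) \<omega>"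
      have mono: "?f i \<le> ?f (Suc i)" for i by (intro step_count_mono add_left_mono mult_left_mono) (use st in auto)
      have "c m \<omega> \<le> (\<Sum>i<m. if ?f i < ?f (Suc i) then 1 else 0)"
        unfolding c_def
      proof (intro sum_mono)
        fix i
        show "indicator (bad (s + (t - s) / real m * real i) ((t - s) / real m)) \<omega> \<le> (if ?f i < ?f (Suc i) then 1 else 0 :: real)"
        proof (cases "\<omega> \<in> bad (s + (t - s) / real m * real i) ((t - s) / real m)")
          case True
          then have "?f i + 2 \<le> ?f (Suc i)" unfolding bad_def grid by blast
          then have "?f i < ?f (Suc i)" by linarith
          then show ?thesis using True by (simp only: indicator_simps if_True order_refl)
        qed simp
      qed
      also have "\<dots> = real (card {i. i < m \<and> ?f i < ?f (Suc i)})"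
        by (subst sum.If_cases) (auto intro!: arg_cong[where f = card])
      also have "\<dots> \<le> real (?f m)" using card_increases_le[of ?f m] mono by simp
      also have "\<dots> \<le> real (step_at t \<omega>)" using st step_count_mono[of "s + (t - s) / real m * real m" t] by (cases "m = 0") auto
      finally show ?thesis by (auto simp: c_def sum_nonneg)
    qed
    then show "AE \<omega> in M. norm (c m \<omega>) \<le> real (step_at t \<omega>)" by (intro AE_I2) auto
  qed auto
  then show ?thesis unfolding cm by simp
qed

end

section \<open>The Markov property of the chain is not affected by the dual process\<close>

context dual_construction
begin

lemma sets_FX: "sets (FX t) = sigma_sets (space M) {X s -` A \<inter> space M | s A. 0 \<le> s \<and> ennreal s \<le> ennreal t}"
  unfolding natural_filtration_def by (rule sets_measure_of) auto

lemma lev_FX: assumes "0 \<le> u" "u \<le> t" shows "lev (X u) x \<in> sets (FX t)"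
proof -
  have "X u -` {x} \<inter> space M \<in> sets (FX t)"
    unfolding sets_FX using assms ennreal_leI[OF assms(2)] by (intro sigma_sets.Basic) blast
  then show ?thesis by (simp add: vimage_def Int_def conj_commute)
qed

lemma FX_GG: assumes "C \<in> sets (FX t)" shows "C \<in> sets (GG s)"
proof -
  have "sets (FX t) \<subseteq> sets (GG s)"
    unfolding sets_GG sets_FX by (rule sigma_sets_mono') blast
  then show ?thesis using assms by blast
qed

text \<open>Adding \<open>A\<close> to the past of \<open>X\<close> does not affect the Markov property from time \<open>s\<close> on.\<close>

definition immersed :: "'a set \<Rightarrow> real \<Rightarrow> bool" where
  "immersed A s \<longleftrightarrow> (\<forall>t\<ge>s. \<forall>C\<in>sets (FX t). \<forall>u\<ge>0. \<forall>j\<le>d.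
     measure M (A \<inter> C \<inter> lev (X (t + u)) j)
       = (\<Sum>k\<le>d. measure M (A \<inter> C \<inter> lev (X t) k) * transition_prob G u k j))"

lemma sum_over_two_states:
  assumes E: "E \<in> sets M" and ab: "0 \<le> a" "0 \<le> b"
  shows "measure M E = (\<Sum>x\<le>d. \<Sum>x'\<le>d. measure M (E \<inter> (lev (X a) x \<inter> lev (X b) x')))"
proof -
  have [measurable]: "X a \<in> measurable M (count_space UNIV)" "X b \<in> measurable M (count_space UNIV)"
    using ab by auto
  have le: "X a \<omega> \<le> d" "X b \<omega> \<le> d" if "\<omega> \<in> F" "F \<in> sets M" for \<omega> F
    using that sets.sets_into_space X_le ab by blast+
  have "measure M E = (\<Sum>x\<le>d. measure M (E \<inter> lev (X a) x))"
    using E le by (intro sum_over_states) auto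
  also have "\<dots> = (\<Sum>x\<le>d. \<Sum>x'\<le>d. measure M (E \<inter> lev (X a) x \<inter> lev (X b) x'))"
    using E le(2) by (intro sum.cong refl sum_over_states) (auto, measurable)
  finally show ?thesis by (simp add: Int_assoc)
qed

lemma cell_kernel_nonneg: "y \<le> d \<Longrightarrow> x \<le> d \<Longrightarrow> 0 \<le> h \<Longrightarrow> 0 \<le> cell_kernel h x x' y y'"
  using rate_nonneg[of y x] by (auto simp: cell_kernel_def)

lemma cell_kernel_sum_le:
  assumes "y \<le> d" "x \<le> d" "0 \<le> h" shows "(\<Sum>y'\<le>d. cell_kernel h x x' y y') \<le> 1"
proof (cases "x' = x")
  case True
  have "(\<Sum>y'\<le>d. cell_kernel h x x' y y')
      = (\<Sum>y'\<le>d. (if y' = y then exp (- rate y x * h) else 0) + (if y' = y + 1 then 1 - exp (- rate y x * h) else 0))"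
    using True by (intro sum.cong) (auto simp: cell_kernel_def)
  also have "\<dots> \<le> 1" using assms rate_nonneg[of y x] by (simp add: sum.distrib)
  finally show ?thesis .
next
  case False
  then have "(\<Sum>y'\<le>d. cell_kernel h x x' y y') = (\<Sum>y'\<le>d. if y' = birth_move x' y then 1 else 0)"
    by (intro sum.cong) (auto simp: cell_kernel_def)
  then show ?thesis by simp
qed

text \<open>Up to the cells with two transitions, the dual process moves through a cell by a kernel
  that only depends on the two values of \<open>X\<close> at the ends of the cell.\<close>

lemma immersed_step:
  assumes A: "A \<in> sets (GG s)" and st: "0 \<le> s" "s \<le> t"
    and imm: "\<And>y. y \<le> d \<Longrightarrow> immersed (A \<inter> lev (Xh s) y) s" and y0: "y0 \<le> d"
  shows "immersed (A \<inter> lev (Xh t) y0) t"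
  unfolding immersed_def
proof (intro allI impI ballI)
  fix t' C and u :: real and j assume t': "t \<le> t'" and C: "C \<in> sets (FX t')" and u: "0 \<le> u" and j: "j \<le> d"
  define tp where "tp k = transition_prob G u k j" for k
  define T where "T = exp (mat_bound d G * \<bar>u\<bar>)"
  have tpT: "\<bar>tp k\<bar> \<le> T" if "k \<le> d" for k
    unfolding tp_def T_def by (rule transition_prob_bound[OF G_carrier that j])
  have T0: "0 \<le> T" by (simp add: T_def)
  \<comment> \<open>The defect in the identity of \<open>immersed\<close> when the dual is in
    \<open>y\<close> at time \<open>v\<close>. The time \<open>v\<close> runs through the grid from
    \<open>s\<close> to \<open>t\<close>, while the later times \<open>t'\<close> and
    \<open>t' + u\<close> stay fixed.\<close>
  define \<delta> where "\<delta> v y C = measure M (A \<inter> lev (Xh v) y \<inter> C \<inter> lev (X (t' + u)) j)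
      - (\<Sum>k\<le>d. measure M (A \<inter> lev (Xh v) y \<inter> C \<inter> lev (X t') k) * tp k)" for v y C
  have t'0: "0 \<le> t'" "0 \<le> t' + u" using st t' u by auto
  have AM: "A \<in> sets M" by (rule GG_M[OF A])
  have FM: "C \<in> sets M" if "C \<in> sets (FX t')" for C using that FX_GG GG_M by blast
  \<comment> \<open>The defect is carried through a cell by the kernel, since the kernel is the same
    whatever \<open>X\<close> does after the cell. The error has weight \<open>1\<close> from the
    event at \<open>t' + u\<close> and at most \<open>T\<close> from the states at
    \<open>t'\<close>.\<close>
  have cell: "\<bar>\<delta> (v + h) y' C - (\<Sum>y\<le>d. \<delta> v y C * cell_kernel h x x' y y')\<bar> \<le> (1 + T) * measure M (A \<inter> C \<inter> bad v h)"
    if C: "C \<in> sets (FX t')" and v: "s \<le> v" "0 \<le> h" and sub: "C \<subseteq> lev (X v) x" "C \<subseteq> lev (X (v + h)) x'" and x: "x \<le> d"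
    for v h y' C x x'
  proof -
    define B where "B E = A \<inter> C \<inter> E" for E
    define r where "r E = measure M (B E \<inter> lev (Xh (v + h)) y') - (\<Sum>y\<le>d. measure M (B E \<inter> lev (Xh v) y) * cell_kernel h x x' y y')" for E
    have r: "\<bar>r E\<bar> \<le> measure M (B E \<inter> bad v h)" if E: "E \<in> sets (GG v)" for E
      unfolding r_def
    proof (rule cell_estimate)
      show "B E \<in> sets (GG v)" unfolding B_def by (intro sets.Int GG_mono[OF v(1) A] FX_GG[OF C] E)
    qed (use v sub x st in \<open>auto simp: B_def\<close>)
    have L: "lev (X t') k \<in> sets (GG v)" "lev (X (t' + u)) j \<in> sets (GG v)" for k
      using lev_GG[of t' v v k] lev_GG[of "t' + u" v v j] t'0 v st by auto
    have eq: "\<delta> (v + h) y' C - (\<Sum>y\<le>d. \<delta> v y C * cell_kernel h x x' y y')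
        = r (lev (X (t' + u)) j) - (\<Sum>k\<le>d. r (lev (X t') k) * tp k)"
    proof -
      have c: "A \<inter> lev (Xh w) y \<inter> C \<inter> E = B E \<inter> lev (Xh w) y" for w y E by (auto simp: B_def)
      have "(\<Sum>y\<le>d. (\<Sum>k\<le>d. measure M (B (lev (X t') k) \<inter> lev (Xh v) y) * tp k) * cell_kernel h x x' y y')
          = (\<Sum>k\<le>d. (\<Sum>y\<le>d. measure M (B (lev (X t') k) \<inter> lev (Xh v) y) * cell_kernel h x x' y y') * tp k)"
        unfolding sum_distrib_right by (subst sum.swap) (simp add: mult_ac)
      then show ?thesis
        unfolding \<delta>_def r_def c by (simp add: left_diff_distrib sum_subtractf)
    qed
    have "\<bar>r (lev (X (t' + u)) j)\<bar> \<le> measure M (A \<inter> C \<inter> bad v h)"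
      using r[OF L(2)] finite_measure_mono[of "B (lev (X (t' + u)) j) \<inter> bad v h" "A \<inter> C \<inter> bad v h"] AM FM[OF C]
      by (force simp: B_def)
    moreover have "\<bar>\<Sum>k\<le>d. r (lev (X t') k) * tp k\<bar> \<le> T * measure M (A \<inter> C \<inter> bad v h)"
    proof -
      have "\<bar>\<Sum>k\<le>d. r (lev (X t') k) * tp k\<bar> \<le> (\<Sum>k\<le>d. measure M (B (lev (X t') k) \<inter> bad v h) * T)"
        by (rule order.trans[OF sum_abs]) (auto simp: abs_mult intro!: sum_mono mult_mono r L tpT)
      also have "\<dots> = (\<Sum>k\<le>d. measure M (A \<inter> C \<inter> bad v h \<inter> lev (X t') k)) * T"
        unfolding sum_distrib_right by (intro sum.cong refl) (simp add: B_def Int_ac)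
      also have "(\<Sum>k\<le>d. measure M (A \<inter> C \<inter> bad v h \<inter> lev (X t') k)) = measure M (A \<inter> C \<inter> bad v h)"
        using AM FM[OF C] X_le t'0 sets.sets_into_space[OF AM] by (intro sum_over_states[symmetric]) auto
      finally show ?thesis by (simp add: mult.commute)
    qed
    ultimately show ?thesis unfolding eq by (simp add: algebra_simps)
  qed
  \<comment> \<open>The error of a cell is counted once for each of the \<open>d + 1\<close> end
    states of the dual.\<close>
  define K where "K = (real d + 1) * (1 + T)"
  have zero: "\<bar>\<delta> t y0 C\<bar> \<le> K * (\<Sum>i<m. measure M (bad (s + (t - s) / real m * real i) ((t - s) / real m)))"
    if m: "0 < m" for m :: nat
  proof -
    define h where "h = (t - s) / real m"
    have h: "0 \<le> h" using st by (simp add: h_def)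
    define v where "v i = s + h * real i" for i
    have vS: "v (Suc i) = v i + h" for i by (simp add: v_def algebra_simps)
    have vm: "v m = t" using m by (simp add: v_def h_def)
    have vs: "s \<le> v i" for i using h by (simp add: v_def)
    have vt: "v i \<le> t'" if "i \<le> m" for i
    proof -
      have "h * real i \<le> h * real m" using that h by (intro mult_left_mono) auto
      then show ?thesis using vm t' by (simp add: v_def)
    qed
    \<comment> \<open>The claim is for all \<open>C\<close> at once because each step refines
      \<open>C\<close> by the values of \<open>X\<close> at the ends of the next cell. The
      refinement stays in \<open>FX t'\<close>, as the grid ends at
      \<open>t \<le> t'\<close>.\<close>
    have "\<forall>C\<in>sets (FX t'). (\<Sum>y\<le>d. \<bar>\<delta> (v i) y C\<bar>) \<le> K * (\<Sum>i'<i. measure M (A \<inter> C \<inter> bad (v i') h))"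
      if "i \<le> m" for i
      using that
    proof (induction i)
      case 0
      have "\<delta> s y C = 0" if "C \<in> sets (FX t')" "y \<le> d" for y C
        using imm[OF that(2)] that(1) st t' u j unfolding immersed_def \<delta>_def tp_def by force
      then show ?case by (simp add: v_def)
    next
      case (Suc i)
      show ?case
      proof
        fix C assume C: "C \<in> sets (FX t')"
        define D where "D x x' = C \<inter> (lev (X (v i)) x \<inter> lev (X (v (Suc i))) x')" for x x'
        have v0: "0 \<le> v i" "0 \<le> v (Suc i)" using vs[of i] vs[of "Suc i"] st by auto
        have vt': "v i \<le> t'" "v (Suc i) \<le> t'" using vt[of i] vt[of "Suc i"] Suc.prems by auto
        have D: "D x x' \<in> sets (FX t')" for x x'
          unfolding D_def using C v0 vt' by (intro sets.Int lev_FX) auto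
        have split: "\<delta> w y C = (\<Sum>x\<le>d. \<Sum>x'\<le>d. \<delta> w y (D x x'))" for w y
        proof -
          have s2: "measure M (A \<inter> lev (Xh w) y \<inter> C \<inter> E) = (\<Sum>x\<le>d. \<Sum>x'\<le>d. measure M (A \<inter> lev (Xh w) y \<inter> D x x' \<inter> E))"
            if "E \<in> sets M" for E
            using AM FM[OF C] that lev_M v0
            by (subst sum_over_two_states[of _ "v i" "v (Suc i)"]) (auto simp: D_def Int_ac intro!: sum.cong)
          have "\<delta> w y C = (\<Sum>x\<le>d. \<Sum>x'\<le>d. measure M (A \<inter> lev (Xh w) y \<inter> D x x' \<inter> lev (X (t' + u)) j))
             - (\<Sum>k\<le>d. (\<Sum>x\<le>d. \<Sum>x'\<le>d. measure M (A \<inter> lev (Xh w) y \<inter> D x x' \<inter> lev (X t') k)) * tp k)"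
            unfolding \<delta>_def using t'0 by (simp add: s2 lev_M)
          also have "(\<Sum>k\<le>d. (\<Sum>x\<le>d. \<Sum>x'\<le>d. measure M (A \<inter> lev (Xh w) y \<inter> D x x' \<inter> lev (X t') k)) * tp k)
             = (\<Sum>x\<le>d. \<Sum>x'\<le>d. \<Sum>k\<le>d. measure M (A \<inter> lev (Xh w) y \<inter> D x x' \<inter> lev (X t') k) * tp k)"
            unfolding sum_distrib_right by (subst sum.swap) (intro sum.cong refl sum.swap)
          finally show ?thesis by (simp add: \<delta>_def sum_subtractf)
        qed
        have one: "(\<Sum>y'\<le>d. \<bar>\<delta> (v (Suc i)) y' (D x x')\<bar>) \<le> K * (\<Sum>i'<Suc i. measure M (A \<inter> D x x' \<inter> bad (v i') h))"
          if x: "x \<le> d" for x x'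
        proof -
          have "(\<Sum>y'\<le>d. \<bar>\<delta> (v (Suc i)) y' (D x x')\<bar>)
             \<le> (\<Sum>y'\<le>d. (\<Sum>y\<le>d. \<bar>\<delta> (v i) y (D x x')\<bar> * cell_kernel h x x' y y') + (1 + T) * measure M (A \<inter> D x x' \<inter> bad (v i) h))"
          proof (rule sum_mono)
            fix y'
            have "\<bar>\<delta> (v i + h) y' (D x x') - (\<Sum>y\<le>d. \<delta> (v i) y (D x x') * cell_kernel h x x' y y')\<bar> \<le> (1 + T) * measure M (A \<inter> D x x' \<inter> bad (v i) h)"
              by (rule cell[OF D vs h _ _ x]) (auto simp: D_def vS)
            moreover have "\<bar>\<Sum>y\<le>d. \<delta> (v i) y (D x x') * cell_kernel h x x' y y'\<bar> \<le> (\<Sum>y\<le>d. \<bar>\<delta> (v i) y (D x x')\<bar> * cell_kernel h x x' y y')"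
              by (rule order.trans[OF sum_abs]) (use cell_kernel_nonneg x h in \<open>auto simp: abs_mult intro!: sum_mono\<close>)
            ultimately show "\<bar>\<delta> (v (Suc i)) y' (D x x')\<bar> \<le> (\<Sum>y\<le>d. \<bar>\<delta> (v i) y (D x x')\<bar> * cell_kernel h x x' y y') + (1 + T) * measure M (A \<inter> D x x' \<inter> bad (v i) h)"
              unfolding vS by linarith
          qed
          also have "\<dots> = (\<Sum>y\<le>d. \<bar>\<delta> (v i) y (D x x')\<bar> * (\<Sum>y'\<le>d. cell_kernel h x x' y y')) + K * measure M (A \<inter> D x x' \<inter> bad (v i) h)"
            unfolding sum.distrib sum_distrib_left by (subst sum.swap) (simp add: K_def algebra_simps)
          also have "\<dots> \<le> (\<Sum>y\<le>d. \<bar>\<delta> (v i) y (D x x')\<bar> * 1) + K * measure M (A \<inter> D x x' \<inter> bad (v i) h)"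
            using x h by (intro add_right_mono sum_mono mult_left_mono cell_kernel_sum_le) auto
          also have "\<dots> \<le> K * (\<Sum>i'<i. measure M (A \<inter> D x x' \<inter> bad (v i') h)) + K * measure M (A \<inter> D x x' \<inter> bad (v i) h)"
            using Suc.IH D Suc.prems by (simp add: Suc_leD)
          finally show ?thesis by (simp add: algebra_simps)
        qed
        have "(\<Sum>y\<le>d. \<bar>\<delta> (v (Suc i)) y C\<bar>) \<le> (\<Sum>y\<le>d. \<Sum>x\<le>d. \<Sum>x'\<le>d. \<bar>\<delta> (v (Suc i)) y (D x x')\<bar>)"
          unfolding split by (intro sum_mono order.trans[OF sum_abs] sum_mono order.trans[OF sum_abs] order_refl)
        also have "\<dots> = (\<Sum>x\<le>d. \<Sum>x'\<le>d. \<Sum>y\<le>d. \<bar>\<delta> (v (Suc i)) y (D x x')\<bar>)"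
          by (subst sum.swap) (intro sum.cong refl sum.swap)
        also have "\<dots> \<le> (\<Sum>x\<le>d. \<Sum>x'\<le>d. K * (\<Sum>i'<Suc i. measure M (A \<inter> D x x' \<inter> bad (v i') h)))"
          by (intro sum_mono one) auto
        also have "\<dots> = K * (\<Sum>i'<Suc i. \<Sum>x\<le>d. \<Sum>x'\<le>d. measure M (A \<inter> D x x' \<inter> bad (v i') h))"
          unfolding sum_distrib_left[symmetric]
          by (intro arg_cong[where f = "\<lambda>x. K * x"]) (simp only: sum.swap[where B = "{..<Suc i}"])
        also have "(\<Sum>i'<Suc i. \<Sum>x\<le>d. \<Sum>x'\<le>d. measure M (A \<inter> D x x' \<inter> bad (v i') h)) = (\<Sum>i'<Suc i. measure M (A \<inter> C \<inter> bad (v i') h))"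
          using AM FM[OF C] v0
          by (intro sum.cong refl, subst sum_over_two_states[of "A \<inter> C \<inter> bad (v _) h" "v i" "v (Suc i)"]) (auto simp: D_def Int_ac)
        finally show "(\<Sum>y\<le>d. \<bar>\<delta> (v (Suc i)) y C\<bar>) \<le> K * (\<Sum>i'<Suc i. measure M (A \<inter> C \<inter> bad (v i') h))" .
      qed
    qed
    from this[OF order_refl] C have "(\<Sum>y\<le>d. \<bar>\<delta> t y C\<bar>) \<le> K * (\<Sum>i'<m. measure M (A \<inter> C \<inter> bad (v i') h))"
      unfolding vm by blast
    moreover have "\<bar>\<delta> t y0 C\<bar> \<le> (\<Sum>y\<le>d. \<bar>\<delta> t y C\<bar>)" using y0 by (intro member_le_sum) auto
    moreover have "K * (\<Sum>i'<m. measure M (A \<inter> C \<inter> bad (v i') h)) \<le> K * (\<Sum>i'<m. measure M (bad (v i') h))"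
      using T0 by (intro mult_left_mono sum_mono finite_measure_mono) (auto simp: K_def)
    ultimately show ?thesis unfolding v_def h_def by linarith
  qed
  have "(\<lambda>m. K * (\<Sum>i<m. measure M (bad (s + (t - s) / real m * real i) ((t - s) / real m)))) \<longlonglongrightarrow> K * 0"
    by (intro tendsto_mult_left sum_bad_tendsto st)
  moreover have "\<forall>\<^sub>F m in sequentially. \<bar>\<delta> t y0 C\<bar> \<le> K * (\<Sum>i<m. measure M (bad (s + (t - s) / real m * real i) ((t - s) / real m)))"
    using eventually_gt_at_top[of 0] by eventually_elim (rule zero)
  ultimately have "\<bar>\<delta> t y0 C\<bar> \<le> K * 0" by (rule tendsto_lowerbound) simp
  then show "measure M (A \<inter> lev (Xh t) y0 \<inter> C \<inter> lev (X (t' + u)) j)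
       = (\<Sum>k\<le>d. measure M (A \<inter> lev (Xh t) y0 \<inter> C \<inter> lev (X t') k) * transition_prob G u k j)"
    by (simp add: \<delta>_def tp_def)
qed

lemma AE_Xh_0: "AE \<omega> in M. Xh 0 \<omega> = 0"
proof -
  have "AE \<omega> in M. \<omega> \<in> space M" by simp
  with AE_clock_pos show ?thesis
  proof eventually_elim
    case (elim \<omega>)
    then interpret driven_path X \<omega> V d using path by blast
    have "\<tau> 0 < \<tau> (Suc 0)" using elim(1) by (intro epoch_strict) (auto simp: epoch_0)
    then have "step_at 0 \<omega> = 0" by (intro step_count_eq) (auto simp: epoch_0)
    then show ?case by (simp add: dual_process_eq dual_state_0)
  qed
qed

lemma immersed_empty: "immersed {} s"
  by (simp add: immersed_def)

text \<open>The dual starts in \<open>0\<close> almost surely, so its level sets at time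
  \<open>0\<close> are null or of full measure, and the Markov property of \<open>X\<close> itself
  is left.\<close>

lemma immersed_start: "immersed (space M \<inter> lev (Xh 0) y) 0"
  unfolding immersed_def
proof (intro allI impI ballI)
  fix t C and u :: real and j assume t: "0 \<le> t" and C: "C \<in> sets (FX t)" and u: "0 \<le> u" and j: "j \<le> d"
  have CM: "C \<in> sets M" using C FX_GG GG_M by blast
  have eq: "measure M (space M \<inter> lev (Xh 0) y \<inter> C \<inter> E) = (if y = 0 then measure M (C \<inter> E) else 0)"
    if E: "E \<in> sets M" for E
  proof (cases "y = 0")
    case True
    have "measure M (space M \<inter> lev (Xh 0) y \<inter> C \<inter> E) = measure M (C \<inter> E)"
    proof (rule measure_eq_AE)
      show "AE \<omega> in M. (\<omega> \<in> space M \<inter> lev (Xh 0) y \<inter> C \<inter> E) = (\<omega> \<in> C \<inter> E)"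
        using AE_Xh_0 AE_space by eventually_elim (use True in auto)
    qed (use CM E in auto)
    then show ?thesis using True by simp
  next
    case False
    have "measure M (space M \<inter> lev (Xh 0) y \<inter> C \<inter> E) = measure M {}"
    proof (rule measure_eq_AE)
      show "AE \<omega> in M. (\<omega> \<in> space M \<inter> lev (Xh 0) y \<inter> C \<inter> E) = (\<omega> \<in> {})"
        using AE_Xh_0 by eventually_elim (use False in auto)
    qed (use CM E in auto)
    then show ?thesis using False by simp
  qed
  show "measure M (space M \<inter> lev (Xh 0) y \<inter> C \<inter> lev (X (t + u)) j)
      = (\<Sum>k\<le>d. measure M (space M \<inter> lev (Xh 0) y \<inter> C \<inter> lev (X t) k) * transition_prob G u k j)"
  proof -
    have a: "lev (X (t + u)) j \<in> sets M" and b: "lev (X t) k \<in> sets M" for k using lev_M t u by auto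
    show ?thesis unfolding eq[OF a] eq[OF b] using markov_step[OF C t u j] by simp
  qed
qed

section \<open>Cylinder events of the dual chain\<close>

definition cyl :: "real set \<Rightarrow> (real \<Rightarrow> nat set) \<Rightarrow> 'a set" where
  "cyl J S = {\<omega> \<in> space M. \<forall>u\<in>J. Xh u \<omega> \<in> S u}"

lemma cyl_insert: "cyl (insert b J) S = cyl J S \<inter> {\<omega> \<in> space M. Xh b \<omega> \<in> S b}"
  by (auto simp: cyl_def)

lemma cyl_GG:
  assumes "finite J" "J \<subseteq> {0..s}" shows "cyl J S \<in> sets (GG s)"
  using assms
proof (induction J)
  case empty
  have "cyl {} S = space (GG s)" by (simp add: cyl_def)
  then show ?case by (simp del: space_GG)
next
  case (insert b J)
  have "Xh b -` S b \<inter> space (GG s) \<in> sets (GG s)" using insert by (intro measurable_sets[OF Xh_GG]) auto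
  then have "{\<omega> \<in> space M. Xh b \<omega> \<in> S b} \<in> sets (GG s)" by (simp add: vimage_def Int_def conj_commute)
  then show ?case using insert unfolding cyl_insert by (intro sets.Int) auto
qed

text \<open>The time points are added in increasing order; \<open>immersed_step\<close> bridges the
  interval up to the next one, and a condition on the dual there only selects some of its level
  sets.\<close>

lemma immersed_cyl:
  assumes "finite J"
  shows "J \<subseteq> {0..s} \<Longrightarrow> 0 \<le> s \<Longrightarrow> y \<le> d \<Longrightarrow> immersed (cyl J S \<inter> lev (Xh s) y) s"
  using assms
proof (induction J arbitrary: s y rule: finite_linorder_max_induct)
  case empty
  have "space M \<in> sets (GG 0)" using sets.top[of "GG 0"] by simp
  then have "immersed (space M \<inter> lev (Xh s) y) s"
    by (rule immersed_step[OF _ order_refl _ immersed_start]) (rule empty)+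
  then show ?case by (simp add: cyl_def)
next
  case (insert b J)
  have b: "0 \<le> b" "b \<le> s" using insert.prems by auto
  have J: "J \<subseteq> {0..b}" 
  proof
    fix x assume x: "x \<in> J"
    then have "x < b" using insert.hyps(2) by blast
    moreover have "x \<in> {0..s}" using insert.prems(1) x by blast
    ultimately show "x \<in> {0..b}" by simp
  qed
  show ?case
  proof (rule immersed_step[OF _ b])
    show "cyl (insert b J) S \<in> sets (GG b)" using insert.hyps J b by (intro cyl_GG) auto
    show "immersed (cyl (insert b J) S \<inter> lev (Xh b) y) b" if y: "y \<le> d" for y
    proof (cases "y \<in> S b")
      case True
      then have "cyl (insert b J) S \<inter> lev (Xh b) y = cyl J S \<inter> lev (Xh b) y" by (auto simp: cyl_def)
      then show ?thesis using insert.IH[OF J b(1) y] by simp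
    next
      case False
      then have "cyl (insert b J) S \<inter> lev (Xh b) y = {}" by (auto simp: cyl_def)
      then show ?thesis by (simp add: immersed_empty)
    qed
  qed (use insert.prems in auto)
qed

end

section \<open>The joint law of the pair\<close>

text \<open>Expansions \<open>a + h * b\<close> with quadratic error on \<open>[0, 1]\<close>; they
  read off the generator of the pair from one cell.\<close>

definition first_order :: "(real \<Rightarrow> real) \<Rightarrow> real \<Rightarrow> real \<Rightarrow> bool" where
  "first_order f a b \<longleftrightarrow> (\<exists>C\<ge>0. \<forall>h. 0 \<le> h \<longrightarrow> h \<le> 1 \<longrightarrow> \<bar>f h - a - h * b\<bar> \<le> C * h ^ 2)"

lemma first_order_const: "first_order (\<lambda>_. a) a 0"
  unfolding first_order_def by (intro exI[of _ 0]) auto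

lemma first_order_diff:
  assumes "first_order f a b" "first_order f' a' b'"
  shows "first_order (\<lambda>h. f h - f' h) (a - a') (b - b')"
proof -
  obtain C where C: "0 \<le> C" "\<And>h. 0 \<le> h \<Longrightarrow> h \<le> 1 \<Longrightarrow> \<bar>f h - a - h * b\<bar> \<le> C * h ^ 2"
    using assms(1) unfolding first_order_def by blast
  obtain C' where C': "0 \<le> C'" "\<And>h. 0 \<le> h \<Longrightarrow> h \<le> 1 \<Longrightarrow> \<bar>f' h - a' - h * b'\<bar> \<le> C' * h ^ 2"
    using assms(2) unfolding first_order_def by blast
  have "\<bar>f h - f' h - (a - a') - h * (b - b')\<bar> \<le> (C + C') * h ^ 2" if "0 \<le> h" "h \<le> 1" for h
  proof -
    have "f h - f' h - (a - a') - h * (b - b') = (f h - a - h * b) - (f' h - a' - h * b')"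
      by (simp add: algebra_simps)
    then show ?thesis using C(2)[OF that] C'(2)[OF that] unfolding distrib_right by linarith
  qed
  then show ?thesis unfolding first_order_def using C(1) C'(1) by (intro exI[of _ "C + C'"]) auto
qed

lemma first_order_mult:
  assumes "first_order f a b" "first_order f' a' b'"
  shows "first_order (\<lambda>h. f h * f' h) (a * a') (a * b' + b * a')"
proof -
  obtain C where C: "0 \<le> C" "\<And>h. 0 \<le> h \<Longrightarrow> h \<le> 1 \<Longrightarrow> \<bar>f h - a - h * b\<bar> \<le> C * h ^ 2"
    using assms(1) unfolding first_order_def by blast
  obtain C' where C': "0 \<le> C'" "\<And>h. 0 \<le> h \<Longrightarrow> h \<le> 1 \<Longrightarrow> \<bar>f' h - a' - h * b'\<bar> \<le> C' * h ^ 2"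
    using assms(2) unfolding first_order_def by blast
  define D where "D = (\<bar>a\<bar> + \<bar>b\<bar>) * C' + C * (\<bar>a'\<bar> + \<bar>b'\<bar> + C') + \<bar>b\<bar> * \<bar>b'\<bar>"
  have "\<bar>f h * f' h - a * a' - h * (a * b' + b * a')\<bar> \<le> D * h ^ 2" if h: "0 \<le> h" "h \<le> 1" for h
  proof -
    define \<alpha> \<beta> where "\<alpha> = f h - a - h * b" and "\<beta> = f' h - a' - h * b'"
    have \<alpha>: "\<bar>\<alpha>\<bar> \<le> C * h ^ 2" and \<beta>: "\<bar>\<beta>\<bar> \<le> C' * h ^ 2"
      using C(2)[OF h] C'(2)[OF h] by (simp_all add: \<alpha>_def \<beta>_def)
    have h2: "h ^ 2 \<le> 1" using h by (simp add: power_le_one)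
    have "f h * f' h - a * a' - h * (a * b' + b * a') = (a + h * b) * \<beta> + \<alpha> * (a' + h * b' + \<beta>) + (b * b') * h ^ 2"
      by (simp add: \<alpha>_def \<beta>_def algebra_simps power2_eq_square)
    then have "\<bar>f h * f' h - a * a' - h * (a * b' + b * a')\<bar>
        \<le> \<bar>a + h * b\<bar> * \<bar>\<beta>\<bar> + \<bar>\<alpha>\<bar> * \<bar>a' + h * b' + \<beta>\<bar> + (\<bar>b\<bar> * \<bar>b'\<bar>) * h ^ 2"
      by (simp only: abs_mult[symmetric]) (rule order.trans[OF abs_triangle_ineq] add_mono; simp add: abs_mult)+
    also have "\<dots> \<le> (\<bar>a\<bar> + \<bar>b\<bar>) * (C' * h ^ 2) + (C * h ^ 2) * (\<bar>a'\<bar> + \<bar>b'\<bar> + C') + (\<bar>b\<bar> * \<bar>b'\<bar>) * h ^ 2"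
    proof (intro add_mono mult_mono order_refl)
      have hb: "\<bar>h * c\<bar> \<le> \<bar>c\<bar>" for c using h by (simp add: abs_mult mult_left_le_one_le)
      show "\<bar>a + h * b\<bar> \<le> \<bar>a\<bar> + \<bar>b\<bar>" using hb[of b] by linarith
      have "C' * h ^ 2 \<le> C'" using h2 C'(1) by (simp add: mult_left_le)
      then show "\<bar>a' + h * b' + \<beta>\<bar> \<le> \<bar>a'\<bar> + \<bar>b'\<bar> + C'" using hb[of b'] \<beta> by linarith
    qed (use \<alpha> \<beta> C C' in auto)
    also have "\<dots> = D * h ^ 2" by (simp add: D_def algebra_simps)
    finally show ?thesis .
  qed
  then show ?thesis unfolding first_order_def using C(1) C'(1) by (intro exI[of _ D]) (auto simp: D_def)
qed

lemma first_order_exp: "first_order (\<lambda>h. exp (r * h)) 1 r"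
  unfolding first_order_def
proof (intro exI[of _ "\<bar>r\<bar> ^ 2 * exp \<bar>r\<bar>"] conjI allI impI)
  fix h :: real assume h: "0 \<le> h" "h \<le> 1"
  have "\<bar>egf (\<lambda>n. r ^ n) (0 + h) - egf (\<lambda>n. r ^ n) 0 - h * egf (\<lambda>n. r ^ Suc n) 0\<bar> \<le> 1 * \<bar>r\<bar> ^ 2 * exp (\<bar>r\<bar> * 1) * h ^ 2"
    by (rule egf_Taylor) (use h in \<open>auto simp: power_abs\<close>)
  then show "\<bar>exp (r * h) - 1 - h * r\<bar> \<le> \<bar>r\<bar> ^ 2 * exp \<bar>r\<bar> * h ^ 2"
    by (simp add: egf_geometric egf_0)
qed auto

lemma first_order_uniform:
  assumes "finite I" "\<And>i. i \<in> I \<Longrightarrow> first_order (f i) (a i) (b i)"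
  obtains C where "0 \<le> C" "\<And>i h. i \<in> I \<Longrightarrow> 0 \<le> h \<Longrightarrow> h \<le> 1 \<Longrightarrow> \<bar>f i h - a i - h * b i\<bar> \<le> C * h ^ 2"
proof -
  have "\<exists>C\<ge>0. \<forall>i\<in>I. \<forall>h. 0 \<le> h \<longrightarrow> h \<le> 1 \<longrightarrow> \<bar>f i h - a i - h * b i\<bar> \<le> C * h ^ 2"
    using assms
  proof (induction I)
    case (insert i I)
    then obtain C where C: "0 \<le> C" "\<And>j h. j \<in> I \<Longrightarrow> 0 \<le> h \<Longrightarrow> h \<le> 1 \<Longrightarrow> \<bar>f j h - a j - h * b j\<bar> \<le> C * h ^ 2"
      by auto
    obtain C' where C': "0 \<le> C'" "\<And>h. 0 \<le> h \<Longrightarrow> h \<le> 1 \<Longrightarrow> \<bar>f i h - a i - h * b i\<bar> \<le> C' * h ^ 2"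
      using insert.prems unfolding first_order_def by blast
    have "\<bar>f j h - a j - h * b j\<bar> \<le> (C + C') * h ^ 2" if "j \<in> insert i I" "0 \<le> h" "h \<le> 1" for j h
    proof (cases "j = i")
      case True
      then show ?thesis using C'(2)[OF that(2,3)] mult_nonneg_nonneg[OF C(1) zero_le_power2[of h]]
        by (simp add: distrib_right)
    next
      case False
      then show ?thesis using C(2)[OF _ that(2,3), of j] that(1) mult_nonneg_nonneg[OF C'(1) zero_le_power2[of h]]
        by (simp add: distrib_right)
    qed
    then show ?case using C(1) C'(1) by (intro exI[of _ "C + C'"]) auto
  qed (auto intro: exI[of _ 0])
  then show ?thesis using that by blast
qed

text \<open>Two sequences that nearly follow the same Euler scheme from the same start stay close.
  It takes the place of uniqueness for the linear differential equation of the law of the pair;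
  \<open>\<kappa>\<close> bounds the norm of the generator \<open>K\<close>.\<close>

lemma linear_evolution_stability:
  fixes u w :: "nat \<Rightarrow> 'z \<Rightarrow> real"
  assumes Z: "finite Z" and h: "0 \<le> h"
    and u: "\<And>i z. i < m \<Longrightarrow> z \<in> Z \<Longrightarrow> \<bar>u (Suc i) z - (u i z + h * (\<Sum>z'\<in>Z. u i z' * K z' z))\<bar> \<le> e i z"
    and w: "\<And>i z. i < m \<Longrightarrow> z \<in> Z \<Longrightarrow> \<bar>w (Suc i) z - (w i z + h * (\<Sum>z'\<in>Z. w i z' * K z' z))\<bar> \<le> f i z"
    and init: "\<And>z. z \<in> Z \<Longrightarrow> u 0 z = w 0 z" and pos: "\<And>i z. 0 \<le> e i z" "\<And>i z. 0 \<le> f i z"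
  defines "\<kappa> \<equiv> (\<Sum>z\<in>Z. \<Sum>z'\<in>Z. \<bar>K z z'\<bar>)"
  shows "(\<Sum>z\<in>Z. \<bar>u m z - w m z\<bar>) \<le> exp (\<kappa> * (h * real m)) * (\<Sum>i<m. \<Sum>z\<in>Z. e i z + f i z)"
proof -
  define D where "D i z = u i z - w i z" for i z
  have \<kappa>: "0 \<le> \<kappa>" unfolding \<kappa>_def by (intro sum_nonneg) auto
  have step: "(\<Sum>z\<in>Z. \<bar>D (Suc i) z\<bar>) \<le> (1 + h * \<kappa>) * (\<Sum>z\<in>Z. \<bar>D i z\<bar>) + (\<Sum>z\<in>Z. e i z + f i z)" if i: "i < m" for i
  proof -
    have "\<bar>D (Suc i) z\<bar> \<le> \<bar>D i z\<bar> + h * (\<Sum>z'\<in>Z. \<bar>D i z'\<bar> * \<bar>K z' z\<bar>) + (e i z + f i z)" if z: "z \<in> Z" for z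
    proof -
      have "(\<Sum>z'\<in>Z. D i z' * K z' z) = (\<Sum>z'\<in>Z. u i z' * K z' z) - (\<Sum>z'\<in>Z. w i z' * K z' z)"
        by (simp add: D_def left_diff_distrib sum_subtractf)
      then have "D i z + h * (\<Sum>z'\<in>Z. D i z' * K z' z) = (u i z + h * (\<Sum>z'\<in>Z. u i z' * K z' z)) - (w i z + h * (\<Sum>z'\<in>Z. w i z' * K z' z))"
        by (simp add: D_def right_diff_distrib)
      then have "\<bar>D (Suc i) z - (D i z + h * (\<Sum>z'\<in>Z. D i z' * K z' z))\<bar> \<le> e i z + f i z"
        using u[OF i z] w[OF i z] unfolding D_def by linarith
      moreover have "\<bar>h * (\<Sum>z'\<in>Z. D i z' * K z' z)\<bar> \<le> h * (\<Sum>z'\<in>Z. \<bar>D i z'\<bar> * \<bar>K z' z\<bar>)"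
        unfolding abs_mult using h by (auto intro!: mult_left_mono order.trans[OF sum_abs] simp: abs_mult)
      ultimately show ?thesis by linarith
    qed
    then have "(\<Sum>z\<in>Z. \<bar>D (Suc i) z\<bar>) \<le> (\<Sum>z\<in>Z. \<bar>D i z\<bar> + h * (\<Sum>z'\<in>Z. \<bar>D i z'\<bar> * \<bar>K z' z\<bar>) + (e i z + f i z))"
      by (rule sum_mono)
    also have "\<dots> = (\<Sum>z\<in>Z. \<bar>D i z\<bar>) + h * (\<Sum>z'\<in>Z. \<bar>D i z'\<bar> * (\<Sum>z\<in>Z. \<bar>K z' z\<bar>)) + (\<Sum>z\<in>Z. e i z + f i z)"
      unfolding sum.distrib sum_distrib_left by (subst (2) sum.swap) simp
    also have "\<dots> \<le> (\<Sum>z\<in>Z. \<bar>D i z\<bar>) + h * (\<kappa> * (\<Sum>z\<in>Z. \<bar>D i z\<bar>)) + (\<Sum>z\<in>Z. e i z + f i z)"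
    proof (intro add_mono order_refl mult_left_mono h)
      have "(\<Sum>z'\<in>Z. \<bar>D i z'\<bar> * (\<Sum>z\<in>Z. \<bar>K z' z\<bar>)) \<le> (\<Sum>z'\<in>Z. \<bar>D i z'\<bar> * \<kappa>)"
        unfolding \<kappa>_def using Z
        by (intro sum_mono mult_left_mono member_le_sum[of _ Z "\<lambda>z. \<Sum>z'\<in>Z. \<bar>K z z'\<bar>"] sum_nonneg) auto
      then show "(\<Sum>z'\<in>Z. \<bar>D i z'\<bar> * (\<Sum>z\<in>Z. \<bar>K z' z\<bar>)) \<le> \<kappa> * (\<Sum>z\<in>Z. \<bar>D i z\<bar>)"
        by (simp add: sum_distrib_left mult.commute)
    qed
    finally show ?thesis by (simp add: algebra_simps)
  qed
  have "(\<Sum>z\<in>Z. \<bar>D m z\<bar>) \<le> (1 + h * \<kappa>) ^ m * (\<bar>\<Sum>z\<in>Z. \<bar>D 0 z\<bar>\<bar> + (\<Sum>i<m. \<Sum>z\<in>Z. e i z + f i z))"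
    by (rule discrete_Gronwall[where w = "\<lambda>i. \<Sum>z\<in>Z. \<bar>D i z\<bar>" and m = m]) (use step h \<kappa> pos in \<open>auto intro!: sum_nonneg add_nonneg_nonneg\<close>)
  also have "(\<Sum>z\<in>Z. \<bar>D 0 z\<bar>) = 0" using init by (intro sum.neutral) (auto simp: D_def)
  also have "(1 + h * \<kappa>) ^ m * (\<bar>0\<bar> + (\<Sum>i<m. \<Sum>z\<in>Z. e i z + f i z)) \<le> exp (\<kappa> * (h * real m)) * (\<Sum>i<m. \<Sum>z\<in>Z. e i z + f i z)"
  proof -
    have "(1 + h * \<kappa>) ^ m \<le> exp (h * \<kappa>) ^ m" using h \<kappa> by (intro power_mono exp_ge_add_one_self) auto
    also have "\<dots> = exp (\<kappa> * (h * real m))" by (simp add: exp_of_nat_mult[symmetric] mult_ac)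
    finally show ?thesis using pos by (auto intro!: mult_right_mono sum_nonneg add_nonneg_nonneg)
  qed
  finally show ?thesis by (simp add: D_def)
qed

section \<open>The generator of the pair and its intertwining with the link\<close>

context birth_death
begin

text \<open>The generator of the bivariate chain, dual state first: a jump of \<open>X\<close>
  carries the dual along by \<open>birth_move\<close>, and only the clock acts while
  \<open>X\<close> rests.\<close>

definition joint_gen :: "nat \<Rightarrow> nat \<Rightarrow> nat \<Rightarrow> nat \<Rightarrow> real" where
  "joint_gen y x y' x' =
    (if x' = x then (if y' = y then g x x - birth_rate d G \<nu> y x else if y' = y + 1 then birth_rate d G \<nu> y x else 0)
     else if y' = birth_move x' y then g x x' else 0)"

abbreviation Gh :: "real mat" where "Gh \<equiv> pure_birth_generator d \<nu>"

lemma Gh_carrier: "Gh \<in> carrier_mat (d + 1) (d + 1)"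
  by (simp add: pure_birth_generator_def)

lemma Gh_entry: "i \<le> d \<Longrightarrow> j \<le> d \<Longrightarrow> Gh $$ (i, j) = (if j = i then - \<nu> i else if j = i + 1 then \<nu> i else 0)"
  by (simp add: pure_birth_generator_def)

lemma lam_birth_rate:
  assumes "y \<le> d" "x \<le> d"
  shows "lam y x * birth_rate d G \<nu> y x = (if y < d \<and> x \<le> y then \<nu> y * lam (y + 1) x else 0)"
  using assms lam_pos[of y x] lam_zero[of y x] by (auto simp: birth_rate_def)

text \<open>For \<open>x \<le> y < d\<close> the birth rate times \<open>lam y x\<close> is
  \<open>\<nu> y * lam (y + 1) x\<close>, so clock births fill row \<open>y + 1\<close> at these
  states. At \<open>y + 1\<close>, where row \<open>y\<close> vanishes, the mass of row
  \<open>y + 1\<close> comes from \<open>X\<close> jumping there. What stays in row \<open>y\<close>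
  is balanced by \<open>lam_rec\<close>.\<close>

theorem link_intertwines:
  assumes y: "y \<le> d" "y' \<le> d" and x': "x' \<le> d"
  shows "(\<Sum>x\<le>d. lam y x * joint_gen y x y' x') = Gh $$ (y, y') * lam y' x'"
proof -
  define S where "S = (\<Sum>x\<le>d. lam y x * g x x')"
  have S: "S = (if y < d then \<nu> y * lam (y + 1) x' - \<nu> y * lam y x' else 0)"
    using lam_rec[of y x'] lam_d_stationary[of x'] y x' by (auto simp: S_def)
  let ?mv = "y' = birth_move x' y"
  let ?D = "if y' = y then g x' x' - birth_rate d G \<nu> y x' else if y' = y + 1 then birth_rate d G \<nu> y x' else 0"
  have "(\<Sum>x\<le>d. lam y x * joint_gen y x y' x')
      = lam y x' * joint_gen y x' y' x' + (\<Sum>x\<in>{..d} - {x'}. lam y x * joint_gen y x y' x')"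
    using x' by (intro sum.remove) auto
  also have "(\<Sum>x\<in>{..d} - {x'}. lam y x * joint_gen y x y' x') = (\<Sum>x\<in>{..d} - {x'}. if ?mv then lam y x * g x x' else 0)"
    by (intro sum.cong) (auto simp: joint_gen_def)
  also have "\<dots> = (if ?mv then S - lam y x' * g x' x' else 0)"
    using x' by (simp add: S_def sum.remove[of "{..d}" x'])
  also have "lam y x' * joint_gen y x' y' x' = lam y x' * ?D" by (simp add: joint_gen_def)
  finally have L: "(\<Sum>x\<le>d. lam y x * joint_gen y x y' x') = lam y x' * ?D + (if ?mv then S - lam y x' * g x' x' else 0)" .
  have R: "lam y x' * birth_rate d G \<nu> y x' = (if y < d \<and> x' \<le> y then \<nu> y * lam (y + 1) x' else 0)"
    by (rule lam_birth_rate) fact+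
  have z1: "lam y x' = 0" if "y < x'" using lam_zero that x' by simp
  have z2: "lam (y + 1) x' = 0" if "y + 1 < x'" using lam_zero that x' by simp
  have \<nu>d: "\<nu> y = 0" if "\<not> y < d" using that y \<nu>_zero by (metis le_neq_implies_less)
  consider "y' = y" "x' = y + 1" | "y' = y" "x' \<noteq> y + 1" | "y' = y + 1" "x' = y + 1"
    | "y' = y + 1" "x' \<noteq> y + 1" | "y' \<noteq> y" "y' \<noteq> y + 1" by blast
  then show ?thesis
  proof cases
    case 1
    then show ?thesis using L z1 y x' by (simp add: birth_move_def Gh_entry)
  next
    case 2
    then have "(\<Sum>x\<le>d. lam y x * joint_gen y x y' x') = S - lam y x' * birth_rate d G \<nu> y x'"
      unfolding L by (simp add: birth_move_def right_diff_distrib)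
    moreover have "x' \<le> y \<or> y + 1 < x'" using 2 by linarith
    ultimately show ?thesis using 2 R S z1 z2 \<nu>d y by (auto simp: Gh_entry)
  next
    case 3
    then have "(\<Sum>x\<le>d. lam y x * joint_gen y x y' x') = S" unfolding L using z1 by (simp add: birth_move_def)
    then show ?thesis using 3 S z1 y by (simp add: Gh_entry)
  next
    case 4
    then have "(\<Sum>x\<le>d. lam y x * joint_gen y x y' x') = lam y x' * birth_rate d G \<nu> y x'"
      unfolding L by (simp add: birth_move_def)
    moreover have "x' \<le> y \<or> y + 1 < x'" using 4 by linarith
    ultimately show ?thesis using 4 R z2 y by (auto simp: Gh_entry)
  next
    case 5
    then show ?thesis unfolding L using y by (simp add: birth_move_def Gh_entry)
  qed
qed

lemma lam_le_1: "k \<le> d \<Longrightarrow> x \<le> d \<Longrightarrow> lam k x \<le> 1"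
  using member_le_sum[of x "{..d}" "lam k"] lam_nonneg lam_sum[of k] by simp

end

section \<open>Convergence of the grid approximation to the law of the pair\<close>

context dual_construction
begin

lemma cell_first_order:
  assumes "x \<le> d" "x' \<le> d"
  shows "first_order (\<lambda>h. transition_prob G h x x' * cell_kernel h x x' y y')
    (if x' = x \<and> y' = y then 1 else 0) (joint_gen y x y' x')"
proof -
  have tp: "first_order (\<lambda>h. transition_prob G h x x') (if x = x' then 1 else 0) (g x x')"
    unfolding first_order_def
    using transition_prob_short_time[OF G_carrier assms]
    by (intro exI[of _ "mat_bound d G ^ 2 * exp (mat_bound d G)"]) (auto simp: mat_bound_nonneg)
  consider "x' = x" "y' = y" | "x' = x" "y' = y + 1" | "x' = x" "y' \<noteq> y" "y' \<noteq> y + 1"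
    | "x' \<noteq> x" "y' = birth_move x' y" | "x' \<noteq> x" "y' \<noteq> birth_move x' y" by blast
  then show ?thesis
  proof cases
    case 1
    then show ?thesis using first_order_mult[OF tp first_order_exp[of "- rate y x"]]
      by (simp add: cell_kernel_def joint_gen_def)
  next
    case 2
    then show ?thesis
      using first_order_mult[OF tp first_order_diff[OF first_order_const[of 1] first_order_exp[of "- rate y x"]]]
      by (simp add: cell_kernel_def joint_gen_def)
  next
    case 3
    then show ?thesis using first_order_const[of 0] by (simp add: cell_kernel_def joint_gen_def)
  next
    case 4
    then show ?thesis using tp by (simp add: cell_kernel_def joint_gen_def)
  next
    case 5
    then show ?thesis using first_order_const[of 0] by (simp add: cell_kernel_def joint_gen_def)
  qed
qed

lemma immersed_transition:
  assumes "immersed (A \<inter> lev (Xh v) y) v" "0 \<le> v" "0 \<le> h" "x \<le> d" "x' \<le> d"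
  shows "measure M (A \<inter> lev (X v) x \<inter> lev (X (v + h)) x' \<inter> lev (Xh v) y)
    = measure M (A \<inter> lev (Xh v) y \<inter> lev (X v) x) * transition_prob G h x x'"
proof -
  have "measure M (A \<inter> lev (Xh v) y \<inter> lev (X v) x \<inter> lev (X (v + h)) x')
      = (\<Sum>k\<le>d. measure M (A \<inter> lev (Xh v) y \<inter> lev (X v) x \<inter> lev (X v) k) * transition_prob G h k x')"
    using assms lev_FX[of v v x] unfolding immersed_def by blast
  also have "\<dots> = (\<Sum>k\<le>d. if k = x then measure M (A \<inter> lev (Xh v) y \<inter> lev (X v) x) * transition_prob G h x x' else 0)"
  proof (intro sum.cong refl)
    fix k
    have "A \<inter> lev (Xh v) y \<inter> lev (X v) x \<inter> lev (X v) k = (if k = x then A \<inter> lev (Xh v) y \<inter> lev (X v) x else {})" by auto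
    then show "measure M (A \<inter> lev (Xh v) y \<inter> lev (X v) x \<inter> lev (X v) k) * transition_prob G h k x'
        = (if k = x then measure M (A \<inter> lev (Xh v) y \<inter> lev (X v) x) * transition_prob G h x x' else 0)" by simp
  qed
  also have "\<dots> = measure M (A \<inter> lev (Xh v) y \<inter> lev (X v) x) * transition_prob G h x x'" using assms by simp
  finally show ?thesis by (simp add: Int_ac)
qed

text \<open>Immersion lets \<open>X\<close> cross the cell by its own transition probabilities,
  whatever the past of the dual; given both ends, the dual then moves by
  \<open>cell_kernel\<close>.\<close>

lemma joint_cell:
  assumes A: "A \<in> sets (GG v)" and v: "0 \<le> v" "0 \<le> h"
    and imm: "\<And>y. y \<le> d \<Longrightarrow> immersed (A \<inter> lev (Xh v) y) v" and x': "x' \<le> d"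
  shows "\<bar>measure M (A \<inter> lev (Xh (v + h)) y' \<inter> lev (X (v + h)) x')
      - (\<Sum>x\<le>d. \<Sum>y\<le>d. measure M (A \<inter> lev (Xh v) y \<inter> lev (X v) x) * (transition_prob G h x x' * cell_kernel h x x' y y'))\<bar>
    \<le> measure M (bad v h \<inter> lev (X (v + h)) x')"
proof -
  have AM: "A \<in> sets M" by (rule GG_M[OF A])
  define B where "B x = A \<inter> lev (X v) x \<inter> lev (X (v + h)) x'" for x
  have BG: "B x \<in> sets (GG v)" for x unfolding B_def using v by (intro sets.Int A lev_GG) auto
  have BM: "B x \<in> sets M" for x by (rule GG_M[OF BG])
  have cell: "\<bar>measure M (B x \<inter> lev (Xh (v + h)) y') - (\<Sum>y\<le>d. measure M (B x \<inter> lev (Xh v) y) * cell_kernel h x x' y y')\<bar>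
      \<le> measure M (B x \<inter> bad v h)" if "x \<le> d" for x
    by (rule cell_estimate[OF BG v]) (use that in \<open>auto simp: B_def\<close>)
  have split: "measure M (A \<inter> lev (X (v + h)) x' \<inter> E) = (\<Sum>x\<le>d. measure M (B x \<inter> E))" if "E \<in> sets M" for E
  proof -
    have "measure M (A \<inter> lev (X (v + h)) x' \<inter> E) = (\<Sum>x\<le>d. measure M (A \<inter> lev (X (v + h)) x' \<inter> E \<inter> lev (X v) x))"
      using that AM v X_le lev_M by (intro sum_over_states) auto
    then show ?thesis by (simp add: B_def Int_ac)
  qed
  have main: "measure M (A \<inter> lev (Xh (v + h)) y' \<inter> lev (X (v + h)) x') = (\<Sum>x\<le>d. measure M (B x \<inter> lev (Xh (v + h)) y'))"
    using split[of "lev (Xh (v + h)) y'"] by (simp add: Int_ac)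
  have kern: "(\<Sum>x\<le>d. \<Sum>y\<le>d. measure M (A \<inter> lev (Xh v) y \<inter> lev (X v) x) * (transition_prob G h x x' * cell_kernel h x x' y y'))
      = (\<Sum>x\<le>d. \<Sum>y\<le>d. measure M (B x \<inter> lev (Xh v) y) * cell_kernel h x x' y y')"
    unfolding B_def using v x' by (intro sum.cong refl) (simp add: immersed_transition[OF imm] mult.assoc)
  have "\<bar>measure M (A \<inter> lev (Xh (v + h)) y' \<inter> lev (X (v + h)) x')
      - (\<Sum>x\<le>d. \<Sum>y\<le>d. measure M (A \<inter> lev (Xh v) y \<inter> lev (X v) x) * (transition_prob G h x x' * cell_kernel h x x' y y'))\<bar>
     \<le> (\<Sum>x\<le>d. measure M (B x \<inter> bad v h))"
    unfolding main kern sum_subtractf[symmetric] by (rule order.trans[OF sum_abs]) (intro sum_mono cell, simp)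
  also have "\<dots> = measure M (A \<inter> lev (X (v + h)) x' \<inter> bad v h)" by (rule split[symmetric]) simp
  also have "\<dots> \<le> measure M (bad v h \<inter> lev (X (v + h)) x')"
    using v lev_M by (intro finite_measure_mono) auto
  finally show ?thesis .
qed

text \<open>Compared are \<open>U\<close>, the true masses of the pair on \<open>A\<close>, and
  \<open>Q\<close>, the masses of a pure birth chain started from \<open>a\<close> and spread over
  the states of \<open>X\<close> by the link. By \<open>link_intertwines\<close> both follow the
  Euler scheme of \<open>joint_gen\<close>, with errors whose total tends to
  \<open>0\<close>.\<close>

lemma joint_law:
  assumes A: "A \<in> sets (GG b)" and bt: "0 \<le> b" "b \<le> t"
    and imm: "\<And>y. y \<le> d \<Longrightarrow> immersed (A \<inter> lev (Xh b) y) b"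
    and init: "\<And>y x. y \<le> d \<Longrightarrow> x \<le> d \<Longrightarrow>
      measure M (A \<inter> lev (Xh b) y \<inter> lev (X b) x) = measure M (A \<inter> lev (Xh b) y) * lam y x"
    and z: "y1 \<le> d" "x1 \<le> d"
  shows "measure M (A \<inter> lev (Xh t) y1 \<inter> lev (X t) x1)
    = (\<Sum>y\<le>d. measure M (A \<inter> lev (Xh b) y) * transition_prob Gh (t - b) y y1) * lam y1 x1"
proof -
  have AM: "A \<in> sets M" by (rule GG_M[OF A])
  let ?Z = "{..d} \<times> {..d}"
  define a where "a y = measure M (A \<inter> lev (Xh b) y)" for y
  have a: "0 \<le> a y" "a y \<le> 1" for y by (auto simp: a_def)
  define K where "K z z' = joint_gen (fst z) (snd z) (fst z') (snd z')" for z z'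
  define \<kappa> where "\<kappa> = (\<Sum>z\<in>?Z. \<Sum>z'\<in>?Z. \<bar>K z z'\<bar>)"
  define U where "U v z = measure M (A \<inter> lev (Xh v) (fst z) \<inter> lev (X v) (snd z))" for v z
  define q where "q v y' = (\<Sum>y\<le>d. a y * transition_prob Gh v y y')" for v y'
  define Q where "Q v z = q v (fst z) * lam (fst z) (snd z)" for v z
  define F where "F p h = transition_prob G h (snd (fst p)) (snd (snd p))
      * cell_kernel h (snd (fst p)) (snd (snd p)) (fst (fst p)) (fst (snd p))" for p h
  define I where "I p = (if snd (snd p) = snd (fst p) \<and> fst (snd p) = fst (fst p) then 1 else 0 :: real)" for p :: "(nat \<times> nat) \<times> (nat \<times> nat)"
  have fo: "first_order (F p) (I p) (K (fst p) (snd p))" if "p \<in> ?Z \<times> ?Z" for p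
    unfolding F_def I_def K_def using that by (intro cell_first_order) auto
  have "finite (?Z \<times> ?Z)" by simp
  from this fo obtain C1 where C1: "0 \<le> C1" "\<And>p h. p \<in> ?Z \<times> ?Z \<Longrightarrow> 0 \<le> h \<Longrightarrow> h \<le> 1 \<Longrightarrow>
      \<bar>F p h - I p - h * K (fst p) (snd p)\<bar> \<le> C1 * h ^ 2"
    by (rule first_order_uniform[where f = F and a = I and b = "\<lambda>p. K (fst p) (snd p)"]) blast+
  \<comment> \<open>One Taylor error for each of the \<open>d + 1\<close> starting states, whose
    masses are at most \<open>1\<close>.\<close>
  define C2 where "C2 = real (d + 1) * (mat_bound d Gh ^ 2 * exp (mat_bound d Gh * (t - b)))"
  have C2: "0 \<le> C2" by (simp add: C2_def)
  have Ucell: "\<bar>U (v + h) z' - (U v z' + h * (\<Sum>z\<in>?Z. U v z * K z z'))\<bar>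
      \<le> measure M (bad v h \<inter> lev (X (v + h)) (snd z')) + C1 * h ^ 2"
    if v: "b \<le> v" and h: "0 \<le> h" "h \<le> 1" and z': "z' \<in> ?Z" for v h z'
  proof -
    have v0: "0 \<le> v" using v bt by simp
    define k where "k z = transition_prob G h (snd z) (snd z') * cell_kernel h (snd z) (snd z') (fst z) (fst z')" for z
    have AG: "A \<in> sets (GG v)" by (rule GG_mono[OF v A])
    have "immersed (A \<inter> lev (Xh v) y) v" if "y \<le> d" for y
      by (rule immersed_step[OF A bt(1) v imm that])
    note jc = joint_cell[OF AG v0 h(1) this, of "snd z'" "fst z'"]
    have "(\<Sum>x\<le>d. \<Sum>y\<le>d. measure M (A \<inter> lev (Xh v) y \<inter> lev (X v) x)
          * (transition_prob G h x (snd z') * cell_kernel h x (snd z') y (fst z'))) = (\<Sum>z\<in>?Z. U v z * k z)"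
      by (subst sum.swap) (simp add: U_def k_def sum.cartesian_product case_prod_beta)
    then have 1: "\<bar>U (v + h) z' - (\<Sum>z\<in>?Z. U v z * k z)\<bar> \<le> measure M (bad v h \<inter> lev (X (v + h)) (snd z'))"
      using jc z' by (simp only: U_def) (simp add: mem_Times_iff)
    have "U v z' + h * (\<Sum>z\<in>?Z. U v z * K z z') = (\<Sum>z\<in>?Z. U v z * ((if z = z' then 1 else 0) + h * K z z'))"
    proof -
      have "(\<Sum>z\<in>?Z. U v z * (if z = z' then 1 else 0)) = (\<Sum>z\<in>?Z. if z = z' then U v z else 0)" by (intro sum.cong) auto
      also have "\<dots> = U v z'" using z' by (subst sum.delta) auto
      finally show ?thesis by (simp only: distrib_left sum.distrib) (simp add: sum_distrib_left mult_ac)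
    qed
    then have "\<bar>(\<Sum>z\<in>?Z. U v z * k z) - (U v z' + h * (\<Sum>z\<in>?Z. U v z * K z z'))\<bar>
       = \<bar>\<Sum>z\<in>?Z. U v z * (k z - (if z = z' then 1 else 0) - h * K z z')\<bar>"
      by (simp only: sum_subtractf[symmetric]) (simp add: algebra_simps)
    also have "\<dots> \<le> (\<Sum>z\<in>?Z. U v z * (C1 * h ^ 2))"
    proof (rule order.trans[OF sum_abs], rule sum_mono)
      fix z assume z: "z \<in> ?Z"
      have "\<bar>k z - (if z = z' then 1 else 0) - h * K z z'\<bar> \<le> C1 * h ^ 2"
      proof -
        have Iz: "I (z, z') = (if z = z' then 1 else 0)" by (cases z; cases z') (auto simp: I_def)
        have Fz: "F (z, z') h = k z" by (simp add: F_def k_def)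
        have "(z, z') \<in> ?Z \<times> ?Z" using z z' by blast
        from C1(2)[OF this h] show ?thesis unfolding Iz Fz fst_conv snd_conv .
      qed
      then show "\<bar>U v z * (k z - (if z = z' then 1 else 0) - h * K z z')\<bar> \<le> U v z * (C1 * h ^ 2)"
        unfolding abs_mult by (intro mult_mono) (auto simp: U_def)
    qed
    also have "\<dots> = (\<Sum>z\<in>?Z. U v z) * (C1 * h ^ 2)" by (simp add: sum_distrib_right)
    also have "\<dots> \<le> 1 * (C1 * h ^ 2)"
    proof (rule mult_right_mono)
      have "(\<Sum>z\<in>?Z. U v z) = (\<Sum>y\<le>d. \<Sum>x\<le>d. measure M (A \<inter> lev (Xh v) y \<inter> lev (X v) x))"
        by (simp add: U_def sum.cartesian_product case_prod_beta)
      also have "\<dots> = (\<Sum>y\<le>d. measure M (A \<inter> lev (Xh v) y))"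
        using AM v0 X_le by (intro sum.cong refl sum_over_states[symmetric]) auto
      also have "\<dots> = measure M A"
        using AM Xh_le sets.sets_into_space[OF AM] by (intro sum_over_states[symmetric]) auto
      finally show "(\<Sum>z\<in>?Z. U v z) \<le> 1" by simp
    qed (use C1(1) in simp)
    finally show ?thesis using 1 by linarith
  qed
  have Qcell: "\<bar>Q (v + h) z' - (Q v z' + h * (\<Sum>z\<in>?Z. Q v z * K z z'))\<bar> \<le> C2 * h ^ 2"
    if v: "0 \<le> v" "0 \<le> h" "v + h \<le> t - b" and z': "z' \<in> ?Z" for v h z'
  proof -
    obtain y' x' where zz: "z' = (y', x')" "y' \<le> d" "x' \<le> d" using z' by auto
    have "(\<Sum>z\<in>?Z. Q v z * K z z') = (\<Sum>y\<le>d. \<Sum>x\<le>d. q v y * (lam y x * joint_gen y x y' x'))"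
      by (simp add: Q_def K_def zz sum.cartesian_product case_prod_beta mult.assoc)
    also have "\<dots> = (\<Sum>y\<le>d. q v y * (Gh $$ (y, y') * lam y' x'))"
      unfolding sum_distrib_left[symmetric] using zz by (intro sum.cong refl) (simp add: link_intertwines)
    finally have K: "(\<Sum>z\<in>?Z. Q v z * K z z') = (\<Sum>y\<le>d. q v y * Gh $$ (y, y')) * lam y' x'"
      by (simp add: sum_distrib_right mult.assoc)
    define B where "B = mat_bound d Gh ^ 2 * exp (mat_bound d Gh * (t - b))"
    define T where "T y0 = transition_prob Gh (v + h) y0 y' - transition_prob Gh v y0 y' - h * (\<Sum>y\<le>d. transition_prob Gh v y0 y * Gh $$ (y, y'))" for y0
    have e1: "q (v + h) y' - q v y' - h * (\<Sum>y\<le>d. q v y * Gh $$ (y, y')) = (\<Sum>y0\<le>d. a y0 * T y0)"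
    proof -
      have "(\<Sum>y\<le>d. q v y * Gh $$ (y, y')) = (\<Sum>y0\<le>d. a y0 * (\<Sum>y\<le>d. transition_prob Gh v y0 y * Gh $$ (y, y')))"
        unfolding q_def sum_distrib_right sum_distrib_left by (subst sum.swap) (simp add: mult.assoc)
      then show ?thesis by (simp add: q_def T_def right_diff_distrib sum_subtractf sum_distrib_left mult_ac)
    qed
    have "\<bar>\<Sum>y0\<le>d. a y0 * T y0\<bar> \<le> (\<Sum>y0\<le>d. 1 * (B * h ^ 2))"
    proof (rule order.trans[OF sum_abs], rule sum_mono)
      fix y0 assume "y0 \<in> {..d}"
      then have "\<bar>T y0\<bar> \<le> B * h ^ 2"
        unfolding T_def B_def using v zz by (intro transition_prob_Taylor[OF Gh_carrier]) auto
      then show "\<bar>a y0 * T y0\<bar> \<le> 1 * (B * h ^ 2)"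
        unfolding abs_mult using a[of y0] by (intro mult_mono) auto
    qed
    also have "\<dots> = C2 * h ^ 2" by (simp add: C2_def B_def algebra_simps)
    finally have "\<bar>\<Sum>y0\<le>d. a y0 * T y0\<bar> \<le> C2 * h ^ 2" .
    then have "\<bar>q (v + h) y' - q v y' - h * (\<Sum>y\<le>d. q v y * Gh $$ (y, y'))\<bar> * \<bar>lam y' x'\<bar> \<le> C2 * h ^ 2 * 1"
      unfolding e1 using lam_le_1[OF zz(2,3)] lam_nonneg[OF zz(2,3)] C2 by (intro mult_mono) auto
    then show ?thesis unfolding K abs_mult[symmetric] by (simp add: Q_def zz algebra_simps)
  qed
  \<comment> \<open>The first error term comes from the bad cells; the second collects
    \<open>m\<close> quadratic errors over cells of length \<open>(t - b) / m\<close>.\<close>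
  have bound: "(\<Sum>z\<in>?Z. \<bar>U t z - Q (t - b) z\<bar>)
     \<le> exp (\<kappa> * (t - b)) * (real (d + 1) * (\<Sum>i<m. measure M (bad (b + (t - b) / real m * real i) ((t - b) / real m)))
          + real (d + 1) ^ 2 * (C1 + C2) * (t - b) ^ 2 / real m)"
    if m: "0 < m" "t - b \<le> real m" for m :: nat
  proof -
    define h where "h = (t - b) / real m"
    have h: "0 \<le> h" "h \<le> 1" using m bt by (auto simp: h_def field_simps)
    have hm: "h * real m = t - b" using m by (simp add: h_def)
    define v where "v i = b + h * real i" for i
    have vS: "v (Suc i) = v i + h" for i by (simp add: v_def algebra_simps)
    have vb: "b \<le> v i" for i using h by (simp add: v_def)
    have vS': "h * real (Suc i) = h * real i + h" for i by (simp add: algebra_simps)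
    \<comment> \<open>Restricting the bad event to a level set of \<open>X\<close> makes the sum
      over the states of \<open>X\<close> give its probability just once; the sum over the dual
      states then contributes the factor \<open>d + 1\<close>.\<close>
    define e where "e i z = measure M (bad (v i) h \<inter> lev (X (v (Suc i))) (snd z)) + C1 * h ^ 2" for i and z :: "nat \<times> nat"
    have "(\<Sum>z\<in>?Z. \<bar>U (v m) z - Q (h * real m) z\<bar>)
      \<le> exp ((\<Sum>z\<in>?Z. \<Sum>z'\<in>?Z. \<bar>K z z'\<bar>) * (h * real m)) * (\<Sum>i<m. \<Sum>z\<in>?Z. e i z + C2 * h ^ 2)"
    proof (rule linear_evolution_stability[where u = "\<lambda>i. U (v i)" and w = "\<lambda>i. Q (h * real i)" and e = e and f = "\<lambda>_ _. C2 * h ^ 2"])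
      show "\<bar>U (v (Suc i)) z - (U (v i) z + h * (\<Sum>z'\<in>?Z. U (v i) z' * K z' z))\<bar> \<le> e i z" if "z \<in> ?Z" for i z
        unfolding e_def vS using Ucell[OF vb h that] .
      show "\<bar>Q (h * real (Suc i)) z - (Q (h * real i) z + h * (\<Sum>z'\<in>?Z. Q (h * real i) z' * K z' z))\<bar> \<le> C2 * h ^ 2"
        if "i < m" "z \<in> ?Z" for i z
      proof -
        have "h * real (Suc i) \<le> h * real m" using that h by (intro mult_left_mono) auto
        then have "h * real i + h \<le> t - b" using hm vS' by simp
        then show ?thesis unfolding vS' using h that by (intro Qcell) auto
      qed
      show "U (v 0) z = Q (h * real 0) z" if zZ: "z \<in> ?Z" for z
      proof -
        obtain y x where zz: "z = (y, x)" "y \<le> d" "x \<le> d" using zZ by auto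
        have "q 0 y = (\<Sum>y0\<le>d. if y0 = y then a y0 else 0)"
          unfolding q_def using zz by (intro sum.cong) (auto simp: transition_prob_0[OF Gh_carrier])
        then have "q 0 y = a y" using zz by simp
        then show ?thesis using init[OF zz(2,3)] by (simp add: U_def Q_def v_def zz a_def)
      qed
    qed (use h C1 C2 in \<open>auto simp: e_def\<close>)
    also have "\<dots> \<le> exp (\<kappa> * (t - b)) * (\<Sum>i<m. real (d + 1) * measure M (bad (v i) h) + real (d + 1) ^ 2 * (C1 + C2) * h ^ 2)"
      unfolding hm \<kappa>_def[symmetric]
    proof (intro mult_left_mono sum_mono)
      fix i
      have vS0: "0 \<le> v (Suc i)" using vb[of "Suc i"] bt by simp
      have "(\<Sum>z\<in>?Z. e i z + C2 * h ^ 2) = (\<Sum>y\<le>d. \<Sum>x\<le>d. measure M (bad (v i) h \<inter> lev (X (v (Suc i))) x)) + (\<Sum>z\<in>?Z. (C1 + C2) * h ^ 2)"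
      proof -
        have "(\<Sum>z\<in>?Z. f (snd z)) = (\<Sum>y\<le>d. \<Sum>x\<le>d. f x)" for f :: "nat \<Rightarrow> real"
          unfolding sum.cartesian_product case_prod_beta ..
        from this[of "\<lambda>x. measure M (bad (v i) h \<inter> lev (X (v (Suc i))) x)"]
        show ?thesis by (simp only: e_def sum.distrib distrib_right add.assoc)
      qed
      also have "(\<Sum>x\<le>d. measure M (bad (v i) h \<inter> lev (X (v (Suc i))) x)) = measure M (bad (v i) h)"
        using X_le vS0 sets.sets_into_space[OF bad_M[of "v i" h]] by (intro sum_over_states[symmetric]) auto
      finally show "(\<Sum>z\<in>?Z. e i z + C2 * h ^ 2) \<le> real (d + 1) * measure M (bad (v i) h) + real (d + 1) ^ 2 * (C1 + C2) * h ^ 2"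
        by (simp add: power2_eq_square card_cartesian_product algebra_simps)
    qed simp
    also have "(\<Sum>i<m. real (d + 1) * measure M (bad (v i) h) + real (d + 1) ^ 2 * (C1 + C2) * h ^ 2)
      = real (d + 1) * (\<Sum>i<m. measure M (bad (v i) h)) + real (d + 1) ^ 2 * (C1 + C2) * (real m * h ^ 2)"
      by (simp add: sum.distrib sum_distrib_left)
    also have "real m * h ^ 2 = (t - b) ^ 2 / real m"
      using m by (simp add: h_def power2_eq_square)
    also have "v m = t" using hm by (simp add: v_def)
    finally show ?thesis unfolding hm unfolding v_def h_def by (simp only: times_divide_eq_right)
  qed
  have "(\<lambda>m. exp (\<kappa> * (t - b)) * (real (d + 1) * (\<Sum>i<m. measure M (bad (b + (t - b) / real m * real i) ((t - b) / real m)))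
          + real (d + 1) ^ 2 * (C1 + C2) * (t - b) ^ 2 / real m)) \<longlonglongrightarrow> exp (\<kappa> * (t - b)) * (real (d + 1) * 0 + 0)"
    by (intro tendsto_mult_left tendsto_add sum_bad_tendsto bt lim_const_over_n)
  moreover have "\<forall>\<^sub>F m in sequentially. (\<Sum>z\<in>?Z. \<bar>U t z - Q (t - b) z\<bar>)
     \<le> exp (\<kappa> * (t - b)) * (real (d + 1) * (\<Sum>i<m. measure M (bad (b + (t - b) / real m * real i) ((t - b) / real m)))
          + real (d + 1) ^ 2 * (C1 + C2) * (t - b) ^ 2 / real m)"
  proof -
    obtain m0 :: nat where m0: "t - b \<le> real m0" using real_arch_simple by blast
    show ?thesis
      using eventually_ge_at_top[of m0] eventually_gt_at_top[of 0]
      by eventually_elim (rule bound, use m0 in auto)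
  qed
  ultimately have "(\<Sum>z\<in>?Z. \<bar>U t z - Q (t - b) z\<bar>) \<le> exp (\<kappa> * (t - b)) * (real (d + 1) * 0 + 0)"
    by (rule tendsto_lowerbound) simp
  moreover have "\<bar>U t (y1, x1) - Q (t - b) (y1, x1)\<bar> \<le> (\<Sum>z\<in>?Z. \<bar>U t z - Q (t - b) z\<bar>)"
    using z by (intro member_le_sum) auto
  ultimately have "U t (y1, x1) = Q (t - b) (y1, x1)" by simp
  then show ?thesis by (simp add: U_def Q_def q_def a_def)
qed

text \<open>The rows of the link sum to \<open>1\<close>, so summing out \<open>X\<close> leaves the
  law of the dual alone. The second claim renews at time \<open>t\<close> the hypothesis on time
  \<open>b\<close>, which allows iteration.\<close>

lemma dual_law:
  assumes A: "A \<in> sets (GG b)" and bt: "0 \<le> b" "b \<le> t"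
    and imm: "\<And>y. y \<le> d \<Longrightarrow> immersed (A \<inter> lev (Xh b) y) b"
    and init: "\<And>y x. y \<le> d \<Longrightarrow> x \<le> d \<Longrightarrow>
      measure M (A \<inter> lev (Xh b) y \<inter> lev (X b) x) = measure M (A \<inter> lev (Xh b) y) * lam y x"
    and y1: "y1 \<le> d"
  shows "measure M (A \<inter> lev (Xh t) y1) = (\<Sum>y\<le>d. measure M (A \<inter> lev (Xh b) y) * transition_prob Gh (t - b) y y1)"
    and "x1 \<le> d \<Longrightarrow> measure M (A \<inter> lev (Xh t) y1 \<inter> lev (X t) x1) = measure M (A \<inter> lev (Xh t) y1) * lam y1 x1"
proof -
  have AM: "A \<in> sets M" by (rule GG_M[OF A])
  have "measure M (A \<inter> lev (Xh t) y1) = (\<Sum>x\<le>d. measure M (A \<inter> lev (Xh t) y1 \<inter> lev (X t) x))"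
    using AM bt X_le by (intro sum_over_states) auto
  also have "\<dots> = (\<Sum>x\<le>d. (\<Sum>y\<le>d. measure M (A \<inter> lev (Xh b) y) * transition_prob Gh (t - b) y y1) * lam y1 x)"
    by (intro sum.cong refl joint_law[OF A bt imm init y1]) auto
  finally show law: "measure M (A \<inter> lev (Xh t) y1) = (\<Sum>y\<le>d. measure M (A \<inter> lev (Xh b) y) * transition_prob Gh (t - b) y y1)"
    using lam_sum[OF y1] by (simp add: sum_distrib_left[symmetric])
  show "measure M (A \<inter> lev (Xh t) y1 \<inter> lev (X t) x1) = measure M (A \<inter> lev (Xh t) y1) * lam y1 x1" if "x1 \<le> d"
    unfolding law by (rule joint_law[OF A bt imm init y1 that])
qed

end

section \<open>The dual chain\<close>

text \<open>Both sides are finite signed measures in \<open>A\<close>, so agreement on an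
  intersection-stable generator and on the whole space extends; \<open>top\<close> is the whole
  space, which complements need.\<close>

lemma (in prob_space) pi_lambda_mixture:
  assumes P: "Int_stable P" "P \<subseteq> sets M" and I: "finite I" "\<And>k. k \<in> I \<Longrightarrow> E k \<in> sets M" and E0: "E0 \<in> sets M"
    and base: "\<And>A. A \<in> P \<Longrightarrow> measure M (A \<inter> E0) = (\<Sum>k\<in>I. measure M (A \<inter> E k) * c k)"
    and top: "measure M E0 = (\<Sum>k\<in>I. measure M (E k) * c k)"
    and A: "A \<in> sigma_sets (space M) P"
  shows "measure M (A \<inter> E0) = (\<Sum>k\<in>I. measure M (A \<inter> E k) * c k)"
proof -
  have PP: "P \<subseteq> Pow (space M)" using P(2) sets.sets_into_space by blast
  have PM: "sigma_sets (space M) P \<subseteq> sets M" using P(2) by (rule sets.sigma_sets_subset)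
  show ?thesis
    using P(1) PP A
  proof (induction rule: sigma_sets_induct_disjoint)
    case (compl A)
    then have AM: "A \<in> sets M" using PM by blast
    have *: "measure M ((space M - A) \<inter> F) = measure M F - measure M (A \<inter> F)" if "F \<in> sets M" for F
    proof -
      have "(space M - A) \<inter> F = F - A \<inter> F" using sets.sets_into_space[OF that] by auto
      then show ?thesis using that AM by (simp add: finite_measure_Diff)
    qed
    have "(\<Sum>k\<in>I. measure M ((space M - A) \<inter> E k) * c k) = (\<Sum>k\<in>I. measure M (E k) * c k) - (\<Sum>k\<in>I. measure M (A \<inter> E k) * c k)"
      unfolding sum_subtractf[symmetric] by (intro sum.cong refl) (simp add: * I(2) left_diff_distrib)
    then show ?case using compl top E0 by (simp add: *)
  next
    case (union A)
    then have AM: "range A \<subseteq> sets M" using PM by blast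
    have *: "(\<lambda>i. measure M (A i \<inter> F)) sums measure M ((\<Union>i. A i) \<inter> F)" if "F \<in> sets M" for F
    proof -
      have "(\<lambda>i. measure M (A i \<inter> F)) sums measure M (\<Union>i. A i \<inter> F)"
        using AM that union(1) by (intro finite_measure_UNION) (auto simp: disjoint_family_on_def)
      then show ?thesis by simp
    qed
    have "(\<lambda>i. \<Sum>k\<in>I. measure M (A i \<inter> E k) * c k) sums (\<Sum>k\<in>I. measure M ((\<Union>i. A i) \<inter> E k) * c k)"
      by (intro sums_sum sums_mult2 * I(2))
    moreover have "(\<lambda>i. \<Sum>k\<in>I. measure M (A i \<inter> E k) * c k) sums measure M ((\<Union>i. A i) \<inter> E0)"
      using *[OF E0] union(3) by simp
    ultimately show ?case by (rule sums_unique2[rotated])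
  qed (use base in auto)
qed

text \<open>The way back from identities on events to the conditional expectation in the definition
  of a Markov chain.\<close>

lemma (in prob_space) markov_cond_exp:
  fixes Y Z :: "'a \<Rightarrow> nat"
  assumes F: "subalgebra M F" and Y: "Y \<in> measurable F (count_space UNIV)" "\<And>\<omega>. \<omega> \<in> space M \<Longrightarrow> Y \<omega> \<le> d"
    and Z: "Z \<in> measurable M (count_space UNIV)"
    and eq: "\<And>A. A \<in> sets F \<Longrightarrow> measure M (A \<inter> {\<omega> \<in> space M. Z \<omega> = j})
       = (\<Sum>i\<le>d. measure M (A \<inter> {\<omega> \<in> space M. Y \<omega> = i}) * p i)"
  shows "AE \<omega> in M. real_cond_exp M F (indicator {\<omega> \<in> space M. Z \<omega> = j}) \<omega> = p (Y \<omega>)"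
proof -
  interpret S: sigma_finite_subalgebra M F
    by (intro finite_measure_subalgebra_is_sigma_finite)
      (simp add: finite_measure_subalgebra_def finite_measure_subalgebra_axioms_def F finite_measure_axioms)
  let ?E = "{\<omega> \<in> space M. Z \<omega> = j}" and ?L = "\<lambda>i. {\<omega> \<in> space M. Y \<omega> = i}"
  have YM[measurable]: "Y \<in> measurable M (count_space UNIV)" by (rule measurable_from_subalg[OF F Y(1)])
  have E[measurable]: "?E \<in> sets M" using Z by measurable
  have L[measurable]: "?L i \<in> sets M" for i by measurable
  have gF: "(\<lambda>\<omega>. p (Y \<omega>)) \<in> borel_measurable F" by (rule measurable_compose[OF Y(1)]) simp
  have pi: "p (Y \<omega>) = (\<Sum>i\<le>d. p i * indicator (?L i) \<omega>)" if "\<omega> \<in> space M" for \<omega>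
  proof -
    have "(\<Sum>i\<le>d. p i * indicator (?L i) \<omega>) = (\<Sum>i\<le>d. if i = Y \<omega> then p i else 0)"
      using that by (intro sum.cong) (auto simp: indicator_def)
    then show ?thesis using Y(2)[OF that] by simp
  qed
  have int: "integrable M (\<lambda>\<omega>. \<Sum>i\<le>d. p i * indicator (?L i) \<omega>)"
    by (intro Bochner_Integration.integrable_sum) (auto simp: emeasure_eq_measure)
  show ?thesis
  proof (rule S.real_cond_exp_charact)
    show "integrable M (\<lambda>\<omega>. p (Y \<omega>))"
      using int by (rule Bochner_Integration.integrable_cong[THEN iffD2, rotated -1]) (auto simp: pi)
    fix A assume A: "A \<in> sets F"
    then have AM[measurable]: "A \<in> sets M" using F by (auto simp: subalgebra_def)
    have "(\<integral>\<omega>\<in>A. indicator ?E \<omega> \<partial>M) = measure M (A \<inter> ?E)"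
      by (simp add: set_lebesgue_integral_def indicator_inter_arith[symmetric])
    also have "\<dots> = (\<Sum>i\<le>d. measure M (A \<inter> ?L i) * p i)" by (rule eq[OF A])
    also have "\<dots> = (\<integral>\<omega>. (\<Sum>i\<le>d. p i * indicator (A \<inter> ?L i) \<omega>) \<partial>M)"
      by (subst Bochner_Integration.integral_sum) (auto simp: emeasure_eq_measure mult.commute)
    also have "\<dots> = (\<integral>\<omega>\<in>A. p (Y \<omega>) \<partial>M)"
      unfolding set_lebesgue_integral_def
    proof (intro Bochner_Integration.integral_cong refl)
      fix \<omega> assume "\<omega> \<in> space M"
      then show "(\<Sum>i\<le>d. p i * indicator (A \<inter> ?L i) \<omega>) = indicator A \<omega> *\<^sub>R p (Y \<omega>)"
        by (simp only: pi real_scaleR_def sum_distrib_left indicator_inter_arith mult.left_commute)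
    qed
    finally show "(\<integral>\<omega>\<in>A. indicator ?E \<omega> \<partial>M) = (\<integral>\<omega>\<in>A. p (Y \<omega>) \<partial>M)" .
  qed (use gF in \<open>auto simp: emeasure_eq_measure\<close>)
qed

section \<open>From cylinders to the natural filtration of the dual chain\<close>

context dual_construction
begin

lemma cyl_Int: "cyl J S \<inter> cyl J' S' = cyl (J \<union> J') (\<lambda>u. {n. (u \<in> J \<longrightarrow> n \<in> S u) \<and> (u \<in> J' \<longrightarrow> n \<in> S' u)})"
  by (auto simp: cyl_def)

lemma cyl_M: "finite J \<Longrightarrow> J \<subseteq> {0..s} \<Longrightarrow> cyl J S \<in> sets M"
  using cyl_GG GG_M by blast

lemma cyl_insert_lev:
  "cyl (insert b J) S \<inter> lev (Xh b) y = (if y \<in> S b then cyl J S \<inter> lev (Xh b) y else {})"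
  by (auto simp: cyl_def)

lemma start_link:
  assumes "y \<le> d" "x \<le> d"
  shows "measure M (lev (Xh 0) y \<inter> lev (X 0) x) = measure M (lev (Xh 0) y) * lam y x"
proof -
  have ae: "AE \<omega> in M. Xh 0 \<omega> = 0 \<and> X 0 \<omega> = 0 \<and> \<omega> \<in> space M"
    using AE_Xh_0 start AE_space by eventually_elim simp
  have [measurable]: "X 0 \<in> measurable M (count_space UNIV)" by simp
  have "measure M (lev (Xh 0) y) = measure M (if y = 0 then space M else {})"
    by (rule measure_eq_AE) (use ae in auto)
  moreover have "measure M (lev (Xh 0) y \<inter> lev (X 0) x) = measure M (if y = 0 \<and> x = 0 then space M else {})"
    by (rule measure_eq_AE) (use ae in auto)
  ultimately show ?thesis using assms by (simp add: prob_space lam_0)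
qed

text \<open>The induction of \<open>immersed_cyl\<close> again: conditions on the dual up to time
  \<open>b\<close> leave the conditional law of \<open>X\<close> given the dual state unchanged, so
  \<open>dual_law\<close> can be restarted at \<open>b\<close>.\<close>

lemma link_cyl:
  assumes "finite J"
  shows "J \<subseteq> {0..s} \<Longrightarrow> 0 \<le> s \<Longrightarrow> y \<le> d \<Longrightarrow> x \<le> d \<Longrightarrow>
    measure M (cyl J S \<inter> lev (Xh s) y \<inter> lev (X s) x) = measure M (cyl J S \<inter> lev (Xh s) y) * lam y x"
  using assms
proof (induction J arbitrary: s y x rule: finite_linorder_max_induct)
  case empty
  have A: "space M \<in> sets (GG 0)" using sets.top[of "GG 0"] by simp
  have e: "space M \<inter> lev f y = lev f y" for f y by auto
  have "measure M (space M \<inter> lev (Xh 0) y \<inter> lev (X 0) x) = measure M (space M \<inter> lev (Xh 0) y) * lam y x"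
    if "y \<le> d" "x \<le> d" for y x unfolding e by (rule start_link[OF that])
  from dual_law(2)[OF A order_refl empty(2) immersed_start this empty(3,4)]
  show ?case by (simp add: cyl_def)
next
  case (insert b J)
  have b: "0 \<le> b" "b \<le> s" using insert.prems by auto
  have J: "J \<subseteq> {0..b}"
  proof
    fix x assume x: "x \<in> J"
    then have "x < b" using insert.hyps(2) by blast
    moreover have "x \<in> {0..s}" using insert.prems(1) x by blast
    ultimately show "x \<in> {0..b}" by simp
  qed
  have J': "insert b J \<subseteq> {0..b}" "finite (insert b J)" using J b insert.hyps(1) by auto
  show ?case
  proof (rule dual_law(2)[OF cyl_GG[OF J'(2,1)] b immersed_cyl[OF J'(2,1) b(1)] _ insert.prems(3,4)])
    fix y x assume "y \<le> d" "x \<le> d"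
    from insert.IH[OF J b(1) this]
    show "measure M (cyl (insert b J) S \<inter> lev (Xh b) y \<inter> lev (X b) x) = measure M (cyl (insert b J) S \<inter> lev (Xh b) y) * lam y x"
      unfolding cyl_insert_lev by simp
  qed
qed

abbreviation FH :: "real \<Rightarrow> 'a measure" where "FH t \<equiv> natural_filtration M Xh (ennreal t)"

definition cylinders :: "real \<Rightarrow> 'a set set" where
  "cylinders s = {cyl J S | J S. finite J \<and> J \<subseteq> {0..s}}"

lemma cylinders_Int_stable: "Int_stable (cylinders s)"
proof (rule Int_stableI)
  fix a b assume "a \<in> cylinders s" "b \<in> cylinders s"
  then obtain J S J' S' where "a = cyl J S" "b = cyl J' S'" "finite J" "finite J'" "J \<subseteq> {0..s}" "J' \<subseteq> {0..s}"
    unfolding cylinders_def by auto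
  then show "a \<inter> b \<in> cylinders s"
    unfolding cylinders_def cyl_Int[of J S J' S', symmetric] mem_Collect_eq
    by (intro exI[of _ "J \<union> J'"] exI[of _ "\<lambda>u. {n. (u \<in> J \<longrightarrow> n \<in> S u) \<and> (u \<in> J' \<longrightarrow> n \<in> S' u)}"]) (simp add: cyl_Int)
qed

lemma cylinders_M: "cylinders s \<subseteq> sets M"
  unfolding cylinders_def using cyl_M by blast

lemma sets_FH_cylinders:
  assumes "0 \<le> s" shows "sets (FH s) \<subseteq> sigma_sets (space M) (cylinders s)"
proof -
  have "sets (FH s) = sigma_sets (space M) {Xh u -` A \<inter> space M | u A. 0 \<le> u \<and> ennreal u \<le> ennreal s}"
    unfolding natural_filtration_def by (rule sets_measure_of) auto
  also have "\<dots> \<subseteq> sigma_sets (space M) (cylinders s)"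
  proof (rule sigma_sets_mono', safe)
    fix u A assume "0 \<le> u" "ennreal u \<le> ennreal s"
    then have "u \<in> {0..s}" using assms by (simp add: ennreal_le_iff)
    moreover have "Xh u -` A \<inter> space M = cyl {u} (\<lambda>_. A)" by (auto simp: cyl_def)
    ultimately show "Xh u -` A \<inter> space M \<in> cylinders s"
      unfolding cylinders_def by (intro CollectI exI[of _ "{u}"] exI[of _ "\<lambda>_. A"]) simp
  qed
  finally show ?thesis .
qed

lemma space_cylinders: "space M \<in> cylinders s"
  unfolding cylinders_def by (intro CollectI exI[of _ "{}"] exI[of _ "\<lambda>_. {}"]) (simp add: cyl_def)

lemma dual_markov:
  assumes A: "A \<in> sets (FH s)" and st: "0 \<le> s" "0 \<le> t" and j: "j \<le> d"
  shows "measure M (A \<inter> lev (Xh (s + t)) j) = (\<Sum>i\<le>d. measure M (A \<inter> lev (Xh s) i) * transition_prob Gh t i j)"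
proof -
  have base: "measure M (A \<inter> lev (Xh (s + t)) j) = (\<Sum>i\<le>d. measure M (A \<inter> lev (Xh s) i) * transition_prob Gh t i j)"
    if Ac: "A \<in> cylinders s" for A
  proof -
    obtain J S where A: "A = cyl J S" "finite J" "J \<subseteq> {0..s}" using Ac unfolding cylinders_def by blast
    have "s \<le> s + t" using st by simp
    from dual_law(1)[OF cyl_GG[OF A(2,3)] st(1) this immersed_cyl[OF A(2,3) st(1)] link_cyl[OF A(2,3) st(1)] j]
    show ?thesis unfolding A(1) by simp
  qed
  have sp: "space M \<inter> lev f y = lev f y" for f y by auto
  show ?thesis
  proof (rule pi_lambda_mixture[OF cylinders_Int_stable[of s] cylinders_M])
    show "A \<in> sigma_sets (space M) (cylinders s)" using A sets_FH_cylinders[OF st(1)] by blast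
    show "measure M (lev (Xh (s + t)) j) = (\<Sum>i\<le>d. measure M (lev (Xh s) i) * transition_prob Gh t i j)"
      using base[OF space_cylinders] unfolding sp .
  qed (use base in auto)
qed

lemma dual_link:
  assumes A: "A \<in> sets (FH s)" and s: "0 \<le> s" and yx: "y \<le> d" "x \<le> d"
  shows "measure M (A \<inter> lev (Xh s) y \<inter> lev (X s) x) = measure M (A \<inter> lev (Xh s) y) * lam y x"
proof -
  have sp: "space M \<inter> lev f y = lev f y" for f y by auto
  \<comment> \<open>A mixture with the single index \<open>()\<close> and weight
    \<open>lam y x\<close>.\<close>
  have base: "measure M (A \<inter> (lev (Xh s) y \<inter> lev (X s) x)) = (\<Sum>k\<in>{()}. measure M (A \<inter> lev (Xh s) y) * lam y x)"
    if A: "A \<in> cylinders s" for A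
  proof -
    obtain J S where A: "A = cyl J S" "finite J" "J \<subseteq> {0..s}" using A unfolding cylinders_def by blast
    show ?thesis unfolding A(1) using link_cyl[OF A(2,3) s yx] by (simp add: Int_assoc)
  qed
  have "measure M (A \<inter> (lev (Xh s) y \<inter> lev (X s) x)) = (\<Sum>k\<in>{()}. measure M (A \<inter> lev (Xh s) y) * lam y x)"
  proof (rule pi_lambda_mixture[OF cylinders_Int_stable[of s] cylinders_M])
    show "A \<in> sigma_sets (space M) (cylinders s)" using A sets_FH_cylinders[OF s] by blast
    show "measure M (lev (Xh s) y \<inter> lev (X s) x) = (\<Sum>k\<in>{()}. measure M (lev (Xh s) y) * lam y x)"
      using base[OF space_cylinders] by (simp add: sp Int_assoc[symmetric])
    show "lev (Xh s) y \<inter> lev (X s) x \<in> sets M" using s lev_M by auto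
  qed (use base in auto)
  then show ?thesis by (simp add: Int_assoc)
qed

lemma Xh_paths:
  assumes "\<omega> \<in> space M" "0 \<le> t"
  shows "continuous (at_right t) (\<lambda>s. Xh s \<omega>)" "\<exists>l. ((\<lambda>s. Xh s \<omega>) \<longlongrightarrow> l) (at_left t)"
  using driven_path.dual_process_rcont[OF path[OF assms(1)] assms(2)] driven_path.dual_process_llim[OF path[OF assms(1)]]
  by blast+

lemma natural_filtration_sets:
  "sets (natural_filtration M Z t) = sigma_sets (space M) {Z s -` A \<inter> space M | s A. 0 \<le> s \<and> ennreal s \<le> t}"
  unfolding natural_filtration_def by (rule sets_measure_of) auto

lemma natural_filtration_space: "space (natural_filtration M Z t) = space M"
  unfolding natural_filtration_def by (rule space_measure_of) auto

lemma markov_chain_dual: "markov_chain M d Gh Xh"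
  unfolding markov_chain_def markov_chain_wrt_def
proof (intro conjI allI impI ballI)
  show "prob_space M" by (rule prob_space_M)
  show "filtration (space M) (natural_filtration M Xh)"
  proof
    show "sets (natural_filtration M Xh i) \<le> sets (natural_filtration M Xh j)" if "i \<le> j" for i j
      unfolding natural_filtration_sets using that by (intro sigma_sets_mono') (blast intro: order.trans)
  qed (rule natural_filtration_space)
  show sub: "subalgebra M (natural_filtration M Xh t)" for t
    unfolding subalgebra_def natural_filtration_space natural_filtration_sets
    by (intro conjI refl sets.sigma_sets_subset) (auto intro!: measurable_sets[OF Xh_M])
  show meas: "Xh t \<in> FH t \<rightarrow>\<^sub>M count_space UNIV" if "0 \<le> t" for t
    using that by (intro measurableI) (simp_all add: natural_filtration_sets natural_filtration_space, rule sigma_sets.Basic, blast)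
  fix s t :: real and j assume st: "0 \<le> s" "0 \<le> t" and j: "j \<le> d"
  show "AE \<omega> in M. real_cond_exp M (FH s) (indicator (lev (Xh (s + t)) j)) \<omega> = transition_prob Gh t (Xh s \<omega>) j"
    by (rule markov_cond_exp[OF sub meas[OF st(1)] Xh_le Xh_M dual_markov[OF _ st j]])
qed (use Xh_le Xh_paths in auto)

text \<open>At a fixed time, a pair of states with link entry \<open>0\<close> has probability
  \<open>0\<close> by \<open>dual_link\<close>. Rational times suffice, because both paths rest for
  a while after every time. Having all times at once covers the random epochs.\<close>

lemma AE_link_pos: "AE \<omega> in M. \<forall>t\<ge>0. lam (Xh t \<omega>) (X t \<omega>) > 0 \<and> X t \<omega> \<le> Xh t \<omega>"
proof -
  have one: "AE \<omega> in M. lam (Xh q \<omega>) (X q \<omega>) > 0" if q: "0 \<le> q" for q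
  proof -
    have null: "AE \<omega> in M. \<not> (Xh q \<omega> = y \<and> X q \<omega> = x)" if "y \<le> d" "x \<le> d" "lam y x = 0" for y x
    proof -
      have "space M \<in> sets (FH q)" using sets.top[of "FH q"] by (simp add: natural_filtration_space)
      from dual_link[OF this q that(1,2)] have "measure M (space M \<inter> lev (Xh q) y \<inter> lev (X q) x) = 0"
        using that by simp
      then have "space M \<inter> lev (Xh q) y \<inter> lev (X q) x \<in> null_sets M"
        using q lev_M by (auto simp: null_sets_def emeasure_eq_measure)
      then show ?thesis by (rule AE_I') auto
    qed
    have "AE \<omega> in M. \<forall>y x. y \<le> d \<and> x \<le> d \<and> lam y x = 0 \<longrightarrow> \<not> (Xh q \<omega> = y \<and> X q \<omega> = x)"
    proof (intro AE_all_countable[THEN iffD2] allI)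
      fix y x
      show "AE \<omega> in M. y \<le> d \<and> x \<le> d \<and> lam y x = 0 \<longrightarrow> \<not> (Xh q \<omega> = y \<and> X q \<omega> = x)"
        using null[of y x] by (cases "y \<le> d \<and> x \<le> d \<and> lam y x = 0") auto
    qed
    with AE_space show ?thesis
    proof eventually_elim
      case (elim \<omega>)
      have "Xh q \<omega> \<le> d" "X q \<omega> \<le> d" using elim(1) Xh_le X_le q by auto
      then show ?case using elim(2) lam_nonneg[of "Xh q \<omega>" "X q \<omega>"] by (auto simp: less_le)
    qed
  qed
  have "AE \<omega> in M. \<forall>q\<in>{q \<in> \<rat>. 0 \<le> q}. lam (Xh q \<omega>) (X q \<omega>) > 0"
  proof (subst AE_ball_countable)
    show "countable {q \<in> \<rat>. 0 \<le> (q::real)}" by (rule countable_subset[OF _ countable_rat]) auto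
  qed (use one in auto)
  with AE_space show ?thesis
  proof eventually_elim
    case (elim \<omega>)
    interpret driven_path X \<omega> V d using path[OF elim(1)] .
    interpret Z: step_path Xh \<omega> by unfold_locales (use Xh_paths[OF elim(1)] in auto)
    have "lam (Xh t \<omega>) (X t \<omega>) > 0" if t: "0 \<le> t" for t
    proof -
      obtain e where e: "0 < e" "\<And>u. t \<le> u \<Longrightarrow> u < t + e \<Longrightarrow> X u \<omega> = X t \<omega>" by (rule const_right[OF t]) blast
      obtain e' where e': "0 < e'" "\<And>u. t \<le> u \<Longrightarrow> u < t + e' \<Longrightarrow> Xh u \<omega> = Xh t \<omega>" by (rule Z.const_right[OF t]) blast
      have "t < t + min e e'" using e(1) e'(1) by simp
      then obtain q where q: "q \<in> \<rat>" "t < q" "q < t + min e e'" using Rats_dense_in_real by blast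
      have "X q \<omega> = X t \<omega>" by (rule e(2)) (use q in auto)
      moreover have "Xh q \<omega> = Xh t \<omega>" by (rule e'(2)) (use q in auto)
      moreover have "lam (Xh q \<omega>) (X q \<omega>) > 0" using elim(2) q t by auto
      ultimately show ?thesis by simp
    qed
    moreover have "X t \<omega> \<le> Xh t \<omega>" if "0 \<le> t" "lam (Xh t \<omega>) (X t \<omega>) > 0" for t
    proof (rule ccontr)
      assume "\<not> X t \<omega> \<le> Xh t \<omega>"
      then have "lam (Xh t \<omega>) (X t \<omega>) = 0" using X_le[OF elim(1) that(1)] by (intro lam_zero) auto
      then show False using that by simp
    qed
    ultimately show ?case by blast
  qed
qed


section \<open>Immersion in the filtration of the pair\<close>

text \<open>The filtration of the pair: it decides when the dual is absorbed, and if
  \<open>X\<close> is still Markov in it, the absorption time is a randomized stopping time for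
  \<open>X\<close>.\<close>

definition FZ :: "ennreal \<Rightarrow> 'a measure" where
  "FZ t = sigma (space M) ({X u -` A \<inter> space M | u A. 0 \<le> u \<and> ennreal u \<le> t} \<union> {Xh u -` A \<inter> space M | u A. 0 \<le> u \<and> ennreal u \<le> t})"

lemma space_FZ: "space (FZ t) = space M"
  unfolding FZ_def by (rule space_measure_of) auto

lemma sets_FZ: "sets (FZ t) = sigma_sets (space M)
    ({X u -` A \<inter> space M | u A. 0 \<le> u \<and> ennreal u \<le> t} \<union> {Xh u -` A \<inter> space M | u A. 0 \<le> u \<and> ennreal u \<le> t})"
  unfolding FZ_def by (rule sets_measure_of) auto

text \<open>On an intersection of a cylinder of the dual with an event of \<open>X\<close> up to
  \<open>s\<close>, the claim is \<open>immersed_cyl\<close> summed over the dual state at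
  \<open>s\<close>; such intersections are closed under intersection and generate
  \<open>FZ\<close>.\<close>

lemma FZ_markov:
  assumes A: "A \<in> sets (FZ (ennreal s))" and st: "0 \<le> s" "0 \<le> t" and j: "j \<le> d"
  shows "measure M (A \<inter> lev (X (s + t)) j) = (\<Sum>i\<le>d. measure M (A \<inter> lev (X s) i) * transition_prob G t i j)"
proof -
  define P where "P = {B \<inter> C | B C. B \<in> cylinders s \<and> C \<in> sets (FX s)}"
  have FXM: "sets (FX s) \<subseteq> sets M" using FX_subalgebra by (auto simp: subalgebra_def)
  have spFX: "space M \<in> sets (FX s)" using sets.top[of "FX s"] by (simp add: natural_filtration_space)
  have base: "measure M (A \<inter> lev (X (s + t)) j) = (\<Sum>i\<le>d. measure M (A \<inter> lev (X s) i) * transition_prob G t i j)"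
    if "A \<in> P" for A
  proof -
    obtain J S C where A: "A = cyl J S \<inter> C" "finite J" "J \<subseteq> {0..s}" "C \<in> sets (FX s)"
      using \<open>A \<in> P\<close> unfolding P_def cylinders_def by blast
    have AM: "A \<in> sets M" unfolding A(1) using cyl_M[OF A(2,3)] A(4) FXM by auto
    have sp: "measure M (A \<inter> E) = (\<Sum>y\<le>d. measure M (cyl J S \<inter> lev (Xh s) y \<inter> C \<inter> E))" if "E \<in> sets M" for E
    proof -
      have "measure M (A \<inter> E) = (\<Sum>y\<le>d. measure M (A \<inter> E \<inter> lev (Xh s) y))"
        using AM that Xh_le sets.sets_into_space[OF AM] by (intro sum_over_states) auto
      then show ?thesis by (simp add: A(1) Int_ac)
    qed
    have "measure M (A \<inter> lev (X (s + t)) j) = (\<Sum>y\<le>d. measure M (cyl J S \<inter> lev (Xh s) y \<inter> C \<inter> lev (X (s + t)) j))"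
      using st lev_M by (intro sp) auto
    also have "\<dots> = (\<Sum>y\<le>d. \<Sum>i\<le>d. measure M (cyl J S \<inter> lev (Xh s) y \<inter> C \<inter> lev (X s) i) * transition_prob G t i j)"
      using immersed_cyl[OF A(2,3) st(1)] A(4) st j unfolding immersed_def by (intro sum.cong refl) auto
    also have "\<dots> = (\<Sum>i\<le>d. measure M (A \<inter> lev (X s) i) * transition_prob G t i j)"
      using st lev_M by (subst sum.swap) (simp add: sp sum_distrib_right)
    finally show ?thesis .
  qed
  have PM: "P \<subseteq> sets M" unfolding P_def using cylinders_M FXM by blast
  have stable: "Int_stable P"
  proof (rule Int_stableI)
    fix a b assume "a \<in> P" "b \<in> P"
    then obtain B C B' C' where "a = B \<inter> C" "b = B' \<inter> C'" "B \<in> cylinders s" "B' \<in> cylinders s" "C \<in> sets (FX s)" "C' \<in> sets (FX s)"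
      unfolding P_def by blast
    moreover from this have "B \<inter> B' \<in> cylinders s" using cylinders_Int_stable unfolding Int_stable_def by blast
    ultimately show "a \<inter> b \<in> P"
      unfolding P_def by (intro CollectI exI[of _ "B \<inter> B'"] exI[of _ "C \<inter> C'"]) auto
  qed
  have FZP: "sets (FZ (ennreal s)) \<subseteq> sigma_sets (space M) P"
    unfolding sets_FZ
  proof (rule sigma_sets_mono', safe)
    fix u A assume u: "0 \<le> u" "ennreal u \<le> ennreal s"
    then have us: "u \<in> {0..s}" using st by (simp add: ennreal_le_iff)
    have "X u -` A \<inter> space M \<in> sets (FX s)" unfolding sets_FX using u by (intro sigma_sets.Basic) blast
    then show "X u -` A \<inter> space M \<in> P"
      unfolding P_def using space_cylinders by (intro CollectI exI[of _ "space M"] exI[of _ "X u -` A \<inter> space M"]) auto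
    have "Xh u -` A \<inter> space M = cyl {u} (\<lambda>_. A)" by (auto simp: cyl_def)
    then have "Xh u -` A \<inter> space M \<in> cylinders s"
      unfolding cylinders_def using us by (intro CollectI exI[of _ "{u}"] exI[of _ "\<lambda>_. A"]) simp
    then show "Xh u -` A \<inter> space M \<in> P"
      unfolding P_def using spFX by (intro CollectI exI[of _ "Xh u -` A \<inter> space M"] exI[of _ "space M"]) auto
  qed
  have "space M \<in> P" unfolding P_def using space_cylinders spFX by blast
  from base[OF this] have top: "measure M (lev (X (s + t)) j) = (\<Sum>i\<le>d. measure M (lev (X s) i) * transition_prob G t i j)"
  proof -
    have sp: "space M \<inter> lev f y = lev f y" for f y by auto
    show ?thesis using base[OF \<open>space M \<in> P\<close>] unfolding sp .
  qed
  show ?thesis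
  proof (rule pi_lambda_mixture[OF stable PM])
    show "A \<in> sigma_sets (space M) P" using A FZP by blast
  qed (use base top st lev_M in auto)
qed

lemma markov_chain_FZ: "markov_chain_wrt M FZ d G X"
  unfolding markov_chain_wrt_def
proof (intro conjI allI impI ballI)
  show "prob_space M" by (rule prob_space_M)
  show "filtration (space M) FZ"
  proof
    show "sets (FZ i) \<le> sets (FZ j)" if "i \<le> j" for i j
      unfolding sets_FZ using that by (intro sigma_sets_mono' Un_mono) (blast intro: order.trans)+
  qed (rule space_FZ)
  show sub: "subalgebra M (FZ t)" for t
    unfolding subalgebra_def space_FZ sets_FZ
    by (intro conjI refl sets.sigma_sets_subset) (auto intro!: measurable_sets[OF Xh_M] measurable_sets[OF X_M])
  show meas: "X t \<in> FZ (ennreal t) \<rightarrow>\<^sub>M count_space UNIV" if "0 \<le> t" for t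
    using that by (intro measurableI) (simp_all add: sets_FZ space_FZ, rule sigma_sets.Basic, blast)
  fix s t :: real and j assume st: "0 \<le> s" "0 \<le> t" and j: "j \<le> d"
  show "AE \<omega> in M. real_cond_exp M (FZ (ennreal s)) (indicator (lev (X (s + t)) j)) \<omega> = transition_prob G t (X s \<omega>) j"
    by (rule markov_cond_exp[OF sub meas[OF st(1)] _ _ FZ_markov[OF _ st j]]) (use X_le st in auto)
qed (use X_le X_rcont X_llim in auto)

end

section \<open>Passage times of the dual chain\<close>

lemma (in prob_space) measure_tendsto_pointwise:
  assumes E[measurable]: "\<And>k. E k \<in> sets M" "E' \<in> sets M"
    and lim: "AE \<omega> in M. \<forall>\<^sub>F k in sequentially. \<omega> \<in> E k \<longleftrightarrow> \<omega> \<in> E'"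
  shows "(\<lambda>k. measure M (E k)) \<longlonglongrightarrow> measure M E'"
proof -
  have "(\<lambda>k. \<integral>\<omega>. indicator (E k) \<omega> \<partial>M) \<longlonglongrightarrow> (\<integral>\<omega>. indicator E' \<omega> \<partial>M :: real)"
  proof (rule integral_dominated_convergence[where w = "\<lambda>_. 1"])
    show "AE \<omega> in M. (\<lambda>k. indicator (E k) \<omega>) \<longlonglongrightarrow> (indicator E' \<omega> :: real)"
      using lim
    proof eventually_elim
      case (elim \<omega>)
      then have "\<forall>\<^sub>F k in sequentially. indicator (E k) \<omega> = (indicator E' \<omega> :: real)"
        by eventually_elim (simp add: indicator_def)
      then show ?case by (rule tendsto_eventually)
    qed
  qed (auto simp: indicator_def)
  then show ?thesis by simp
qed

context dual_construction
begin

text \<open>Level \<open>i\<close> or more, rather than exactly \<open>i\<close>: this is monotone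
  in \<open>i\<close>, and \<open>passage_le_iff\<close> holds on every path, whereas a level may be
  jumped over on a null set.\<close>

definition passage :: "nat \<Rightarrow> 'a \<Rightarrow> ennreal" where
  "passage i \<omega> = (INF t\<in>{t. 0 \<le> t \<and> i \<le> Xh t \<omega>}. ennreal t)"

lemma Xh_mono: "\<omega> \<in> space M \<Longrightarrow> s \<le> t \<Longrightarrow> Xh s \<omega> \<le> Xh t \<omega>"
  by (rule driven_path.dual_process_mono[OF path])

lemma Xh_const_right:
  assumes "\<omega> \<in> space M" "0 \<le> t"
  obtains e where "0 < e" "\<And>u. t \<le> u \<Longrightarrow> u < t + e \<Longrightarrow> Xh u \<omega> = Xh t \<omega>"
proof -
  interpret Z: step_path Xh \<omega> by unfold_locales (use Xh_paths[OF assms(1)] in auto)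
  show ?thesis by (rule Z.const_right[OF assms(2)]) (rule that)
qed

lemma passage_le_iff:
  assumes \<omega>: "\<omega> \<in> space M" and t: "0 \<le> t"
  shows "passage i \<omega> \<le> ennreal t \<longleftrightarrow> i \<le> Xh t \<omega>"
proof
  assume "i \<le> Xh t \<omega>"
  then show "passage i \<omega> \<le> ennreal t" unfolding passage_def using t by (intro INF_lower) simp
next
  assume L: "passage i \<omega> \<le> ennreal t"
  show "i \<le> Xh t \<omega>"
  proof (rule ccontr)
    assume n: "\<not> i \<le> Xh t \<omega>"
    obtain e where e: "0 < e" "\<And>u. t \<le> u \<Longrightarrow> u < t + e \<Longrightarrow> Xh u \<omega> = Xh t \<omega>" by (rule Xh_const_right[OF \<omega> t]) blast
    have "ennreal (t + e) \<le> passage i \<omega>"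
      unfolding passage_def
    proof (rule INF_greatest)
      fix u assume "u \<in> {t. 0 \<le> t \<and> i \<le> Xh t \<omega>}"
      then have u: "0 \<le> u" "i \<le> Xh u \<omega>" by auto
      have "t < u" using Xh_mono[OF \<omega>, of u t] u n by (cases "u \<le> t") auto
      then have "t + e \<le> u" using e(2)[of u] u n by (cases "u < t + e") auto
      then show "ennreal (t + e) \<le> ennreal u" by (rule ennreal_leI)
    qed
    also have "\<dots> \<le> ennreal t" by (rule L)
    finally show False using e(1) t by (simp add: ennreal_le_iff del: ennreal_plus)
  qed
qed

lemma passage_mono: "i \<le> j \<Longrightarrow> passage i \<omega> \<le> passage j \<omega>"
  unfolding passage_def by (intro INF_superset_mono) auto

lemma hitting_time_d: "\<omega> \<in> space M \<Longrightarrow> hitting_time Xh d \<omega> = passage d \<omega>"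
  unfolding hitting_time_def passage_def
  by (intro arg_cong[where f = "\<lambda>A. INF t\<in>A. ennreal t"]) (auto intro: antisym Xh_le)

lemma hitting_time_M[measurable]: "hitting_time Xh i \<in> borel_measurable M"
proof (rule borel_measurableI_less)
  fix y :: ennreal
  let ?Q = "{q \<in> \<rat>. 0 \<le> q \<and> ennreal q < y}"
  have "{\<omega> \<in> space M. hitting_time Xh i \<omega> < y} = (\<Union>q\<in>?Q. lev (Xh q) i)"
  proof (rule equalityI; rule subsetI)
    fix \<omega> assume "\<omega> \<in> {\<omega> \<in> space M. hitting_time Xh i \<omega> < y}"
    then obtain t where \<omega>: "\<omega> \<in> space M" and t: "0 \<le> t" "Xh t \<omega> = i" "ennreal t < y"
      by (auto simp: hitting_time_def INF_less_iff)
    obtain e where e: "0 < e" "\<And>u. t \<le> u \<Longrightarrow> u < t + e \<Longrightarrow> Xh u \<omega> = Xh t \<omega>" by (rule Xh_const_right[OF \<omega> t(1)]) blast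
    have "\<exists>b>t. ennreal b \<le> y"
    proof (cases y rule: ennreal_cases)
      case (real b)
      then have "t < b" using t(1,3) by (simp add: ennreal_less_iff)
      then show ?thesis using real by blast
    next
      case top
      then show ?thesis by (intro exI[of _ "t + 1"]) simp
    qed
    then obtain b where b: "t < b" "ennreal b \<le> y" by blast
    have "t < min (t + e) b" using e(1) b(1) by simp
    then obtain q where q: "q \<in> \<rat>" "t < q" "q < min (t + e) b" using Rats_dense_in_real by blast
    have "ennreal q < ennreal b" using q t by (simp add: ennreal_less_iff)
    then have "ennreal q < y" using b(2) by order
    moreover have "Xh q \<omega> = i" using e(2)[of q] q t(2) by simp
    ultimately show "\<omega> \<in> (\<Union>q\<in>?Q. lev (Xh q) i)" using q t \<omega> by auto
  next
    fix \<omega> assume "\<omega> \<in> (\<Union>q\<in>?Q. lev (Xh q) i)"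
    then show "\<omega> \<in> {\<omega> \<in> space M. hitting_time Xh i \<omega> < y}"
      by (auto simp: hitting_time_def INF_less_iff)
  qed
  also have "\<dots> \<in> sets M"
  proof (rule sets.countable_UN'')
    show "countable ?Q" by (rule countable_subset[OF _ countable_rat]) auto
  qed (rule lev_M)
  finally show "{\<omega> \<in> space M. hitting_time Xh i \<omega> < y} \<in> sets M" .
qed

lemma FH_mono: "s \<le> t \<Longrightarrow> A \<in> sets (FH s) \<Longrightarrow> A \<in> sets (FH t)"
proof -
  assume "s \<le> t"
  then have "sets (FH s) \<subseteq> sets (FH t)"
    unfolding natural_filtration_sets
  proof (intro sigma_sets_mono' subsetI)
    fix B assume "B \<in> {Xh u -` A \<inter> space M |u A. 0 \<le> u \<and> ennreal u \<le> ennreal s}"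
    then obtain u A where "B = Xh u -` A \<inter> space M" "0 \<le> u" "ennreal u \<le> ennreal s" by blast
    moreover from this(3) have "ennreal u \<le> ennreal t" using ennreal_leI[OF \<open>s \<le> t\<close>] by order
    ultimately show "B \<in> {Xh u -` A \<inter> space M |u A. 0 \<le> u \<and> ennreal u \<le> ennreal t}" by blast
  qed
  then show "A \<in> sets (FH s) \<Longrightarrow> A \<in> sets (FH t)" by blast
qed

lemma FH_ge: "0 \<le> u \<Longrightarrow> u \<le> s \<Longrightarrow> {\<omega> \<in> space M. i \<le> Xh u \<omega>} \<in> sets (FH s)"
proof -
  assume u: "0 \<le> u" "u \<le> s"
  have "{\<omega> \<in> space M. i \<le> Xh u \<omega>} = Xh u -` {i..} \<inter> space M" by auto
  also have "\<dots> \<in> sets (FH s)"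
    unfolding natural_filtration_sets using u ennreal_leI[OF u(2)] by (intro sigma_sets.Basic) blast
  finally show ?thesis .
qed

lemma FH_M: "A \<in> sets (FH s) \<Longrightarrow> A \<in> sets M"
proof -
  have "sets (FH s) \<subseteq> sets M"
    unfolding natural_filtration_sets by (rule sets.sigma_sets_subset) (auto intro!: measurable_sets[OF Xh_M])
  then show "A \<in> sets (FH s) \<Longrightarrow> A \<in> sets M" by blast
qed

text \<open>As the dual never goes down, a level reached before \<open>q\<close> is still exceeded
  or held at some rational time before \<open>q\<close>.\<close>

lemma passage_less_FH: "{\<omega> \<in> space M. passage i \<omega> < ennreal q} \<in> sets (FH q)"
proof -
  let ?Q = "{r \<in> \<rat>. 0 \<le> r \<and> r < q}"
  have "{\<omega> \<in> space M. passage i \<omega> < ennreal q} = (\<Union>r\<in>?Q. {\<omega> \<in> space M. i \<le> Xh r \<omega>})"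
  proof (rule equalityI; rule subsetI)
    fix \<omega> assume "\<omega> \<in> {\<omega> \<in> space M. passage i \<omega> < ennreal q}"
    then have \<omega>: "\<omega> \<in> space M" and lt: "passage i \<omega> < ennreal q" by auto
    then obtain p where p: "passage i \<omega> = ennreal p" "0 \<le> p" "p < q"
      by (cases "passage i \<omega>" rule: ennreal_cases) (auto simp: ennreal_less_iff)
    obtain r where r: "r \<in> \<rat>" "p < r" "r < q" using Rats_dense_in_real[OF p(3)] by blast
    have "passage i \<omega> \<le> ennreal r" unfolding p(1) using r by (intro ennreal_leI) simp
    then have "i \<le> Xh r \<omega>" using passage_le_iff[OF \<omega>, of r i] p r by simp
    then show "\<omega> \<in> (\<Union>r\<in>?Q. {\<omega> \<in> space M. i \<le> Xh r \<omega>})" using r p \<omega> by auto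
  next
    fix \<omega> assume "\<omega> \<in> (\<Union>r\<in>?Q. {\<omega> \<in> space M. i \<le> Xh r \<omega>})"
    then obtain r where r: "0 \<le> r" "r < q" and \<omega>: "\<omega> \<in> space M" "i \<le> Xh r \<omega>" by auto
    then have "passage i \<omega> \<le> ennreal r" using passage_le_iff by blast
    also have "\<dots> < ennreal q" using r by (simp add: ennreal_less_iff)
    finally show "\<omega> \<in> {\<omega> \<in> space M. passage i \<omega> < ennreal q}" using \<omega> by simp
  qed
  also have "\<dots> \<in> sets (FH q)"
  proof (rule sets.countable_UN'')
    show "countable ?Q" by (rule countable_subset[OF _ countable_rat]) auto
  qed (use FH_ge in auto)
  finally show ?thesis .
qed

lemma passage_M[measurable]: "passage i \<in> borel_measurable M"
proof (rule borel_measurableI_less)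
  fix y :: ennreal
  show "{\<omega> \<in> space M. passage i \<omega> < y} \<in> sets M"
  proof (cases y rule: ennreal_cases)
    case (real q)
    then show ?thesis using FH_M[OF passage_less_FH[of i q]] by (simp only:)
  next
    case top
    have "{\<omega> \<in> space M. passage i \<omega> < y} = (\<Union>n. {\<omega> \<in> space M. passage i \<omega> < ennreal (real n)})"
    proof (rule equalityI; rule subsetI)
      fix \<omega> assume "\<omega> \<in> {\<omega> \<in> space M. passage i \<omega> < y}"
      then have "passage i \<omega> < \<top>" "\<omega> \<in> space M" using top by auto
      then obtain p where p: "passage i \<omega> = ennreal p" "0 \<le> p" by (cases "passage i \<omega>" rule: ennreal_cases) auto
      obtain n where "p < real n" using reals_Archimedean2 by blast
      then have "passage i \<omega> < ennreal (real n)" using p by (simp add: ennreal_less_iff)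
      then show "\<omega> \<in> (\<Union>n. {\<omega> \<in> space M. passage i \<omega> < ennreal (real n)})" using \<open>\<omega> \<in> space M\<close> by blast
    next
      fix \<omega> assume "\<omega> \<in> (\<Union>n. {\<omega> \<in> space M. passage i \<omega> < ennreal (real n)})"
      then obtain n where "\<omega> \<in> space M" "passage i \<omega> < ennreal (real n)" by blast
      moreover have "ennreal (real n) < y" unfolding top by (rule ennreal_less_top)
      ultimately show "\<omega> \<in> {\<omega> \<in> space M. passage i \<omega> < y}" by (blast intro: less_trans)
    qed
    also have "\<dots> \<in> sets M" by (intro sets.countable_UN image_subsetI) (rule FH_M[OF passage_less_FH])
    finally show ?thesis .
  qed
qed

text \<open>Positive clocks make the epochs strictly increasing. The state held just before the
  passage is below \<open>i\<close>, and one transition raises the dual by at most one, so no level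
  is skipped.\<close>

lemma AE_passage:
  "AE \<omega> in M. Xh 0 \<omega> = 0 \<and> (\<forall>i\<le>d. passage i \<omega> \<noteq> \<infinity> \<longrightarrow> Xh (enn2real (passage i \<omega>)) \<omega> = i)"
  using AE_Xh_0 AE_clock_pos AE_space
proof eventually_elim
  case (elim \<omega>)
  then have \<omega>: "\<omega> \<in> space M" by simp
  interpret driven_path X \<omega> V d using path[OF \<omega>] .
  have pos: "0 < V (Suc n) \<omega>" if "\<tau> n \<noteq> \<infinity>" for n using elim(2) that by blast
  have "Xh (enn2real (passage i \<omega>)) \<omega> = i" if fin: "passage i \<omega> \<noteq> \<infinity>" for i
  proof -
    obtain r where r: "passage i \<omega> = ennreal r" "0 \<le> r" using fin by (cases "passage i \<omega>" rule: ennreal_cases) auto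
    have ge: "i \<le> Xh r \<omega>" using passage_le_iff[OF \<omega> r(2), of i] r(1) by simp
    have before: "Xh u \<omega> < i" if "0 \<le> u" "u < r" for u
    proof (rule ccontr)
      assume "\<not> Xh u \<omega> < i"
      then have "ennreal r \<le> ennreal u" using passage_le_iff[OF \<omega> that(1), of i] r(1) by simp
      then show False using that by (simp add: ennreal_le_iff)
    qed
    have "Xh r \<omega> \<le> i"
    proof (cases "r = 0")
      case True
      then show ?thesis using elim(1) by simp
    next
      case False
      define n where "n = N r"
      have n: "\<tau> n \<le> ennreal r" "Xh r \<omega> = Y n" using epoch_step_count_le[of r] by (simp_all add: n_def dual_process_eq)
      then obtain a where a: "\<tau> n = ennreal a" "0 \<le> a" "a \<le> r"
        using r(2) by (cases "\<tau> n" rule: ennreal_cases) (auto simp: ennreal_le_iff top_unique)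
      have "ennreal a < \<tau> (Suc n)"
        using less_epoch_step_count[of r] ennreal_leI[OF a(3)] unfolding n_def by order
      then have Na: "N a = n" using a by (intro step_count_eq) auto
      have "a = r"
      proof (rule ccontr)
        assume "a \<noteq> r"
        then have "Xh a \<omega> < i" using a by (intro before) auto
        then show False using ge n(2) Na by (simp add: dual_process_eq)
      qed
      then have "n \<noteq> 0" using a(1) False r(2) by (cases n) (auto simp: epoch_0 ennreal_eq_0_iff)
      then obtain k where k: "n = Suc k" by (cases n) auto
      have "\<tau> k \<le> \<tau> n" using k by (intro epoch_mono) simp
      then have kfin: "\<tau> k \<noteq> \<infinity>" using a(1) by (auto simp: top_unique)
      then have lt: "\<tau> k < \<tau> n" unfolding k using pos by (intro epoch_strict) auto
      then obtain c where c: "\<tau> k = ennreal c" "0 \<le> c" "c < r"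
        using a \<open>a = r\<close> by (cases "\<tau> k" rule: ennreal_cases) (auto simp: ennreal_less_iff)
      have "N c = k" using c lt k by (intro step_count_eq) auto
      then have "Y k < i" using before[OF c(2,3)] by (simp add: dual_process_eq)
      then show ?thesis using dual_state_step(2)[of k] n(2) k by simp
    qed
    then show ?thesis using ge r by simp
  qed
  then show ?case using elim(1) by blast
qed

lemma AE_hitting_time: "AE \<omega> in M. \<forall>i\<le>d. hitting_time Xh i \<omega> = passage i \<omega>"
  using AE_passage AE_space
proof eventually_elim
  case (elim \<omega>)
  show ?case
  proof (intro allI impI antisym)
    fix i assume i: "i \<le> d"
    show "passage i \<omega> \<le> hitting_time Xh i \<omega>"
      unfolding passage_def hitting_time_def by (intro INF_superset_mono) auto
    show "hitting_time Xh i \<omega> \<le> passage i \<omega>"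
    proof (cases "passage i \<omega>" rule: ennreal_cases)
      case (real r)
      then have "Xh r \<omega> = i" using elim(1) i by auto
      then show ?thesis unfolding hitting_time_def real(2) using real(1) by (intro INF_lower) simp
    qed simp
  qed
qed

text \<open>Events decided by the time of passage. The strict inequality suits approximation from
  the right by dyadic times, which are strictly later than the passage.\<close>

definition before_passage :: "nat \<Rightarrow> 'a set \<Rightarrow> bool" where
  "before_passage i B \<longleftrightarrow> B \<in> sets M \<and> (\<forall>q>0. B \<inter> {\<omega> \<in> space M. passage i \<omega> < ennreal q} \<in> sets (FH q))"

text \<open>On such a cell the passage time is replaced by the fixed time
  \<open>(n + 1) / 2 ^ k\<close>, where the Markov property at fixed times is available; the strong
  Markov property results from the limit in \<open>k\<close>.\<close>

definition dyadic_cell :: "nat \<Rightarrow> 'a set \<Rightarrow> nat \<Rightarrow> nat \<Rightarrow> 'a set" where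
  "dyadic_cell i B k n = {\<omega> \<in> B. passage i \<omega> < \<infinity> \<and> \<lfloor>2 ^ k * enn2real (passage i \<omega>)\<rfloor> = int n}"

lemma dyadic_cell_FH:
  assumes B: "before_passage i B" shows "dyadic_cell i B k n \<in> sets (FH ((real n + 1) / 2 ^ k))"
proof -
  let ?q = "(real n + 1) / 2 ^ k" and ?p = "real n / 2 ^ k"
  have BM: "B \<in> sets M" using B by (simp add: before_passage_def)
  have "dyadic_cell i B k n = (B \<inter> {\<omega> \<in> space M. passage i \<omega> < ennreal ?q}) - {\<omega> \<in> space M. passage i \<omega> < ennreal ?p}"
  proof -
    have "passage i \<omega> < \<infinity> \<and> \<lfloor>2 ^ k * enn2real (passage i \<omega>)\<rfloor> = int n \<longleftrightarrow> passage i \<omega> < ennreal ?q \<and> \<not> passage i \<omega> < ennreal ?p" for \<omega>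
    proof (cases "passage i \<omega>" rule: ennreal_cases)
      case (real r)
      have "\<lfloor>2 ^ k * r\<rfloor> = int n \<longleftrightarrow> ?p \<le> r \<and> r < ?q"
        by (simp add: floor_eq_iff field_simps)
      then show ?thesis using real by (auto simp: ennreal_less_iff)
    qed simp
    then show ?thesis using sets.sets_into_space[OF BM] unfolding dyadic_cell_def by blast
  qed
  moreover have "B \<inter> {\<omega> \<in> space M. passage i \<omega> < ennreal ?q} \<in> sets (FH ?q)"
    using B by (simp add: before_passage_def)
  moreover have "{\<omega> \<in> space M. passage i \<omega> < ennreal ?p} \<in> sets (FH ?q)"
    by (rule FH_mono[OF _ passage_less_FH]) (simp add: divide_right_mono)
  ultimately show ?thesis by (simp only: sets.Diff)
qed

text \<open>The event \<open>E n\<close> may vary with the cell; this expresses the state of a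
  process at the discretised passage time.\<close>

lemma dyadic_cell_sums:
  assumes B: "before_passage i B" and E: "\<And>n. E n \<in> sets M"
  shows "(\<lambda>n. measure M (dyadic_cell i B k n \<inter> E n)) sums
    measure M {\<omega> \<in> B. passage i \<omega> < \<infinity> \<and> \<omega> \<in> E (nat \<lfloor>2 ^ k * enn2real (passage i \<omega>)\<rfloor>)}"
proof -
  have "{\<omega> \<in> B. passage i \<omega> < \<infinity> \<and> \<omega> \<in> E (nat \<lfloor>2 ^ k * enn2real (passage i \<omega>)\<rfloor>)} = (\<Union>n. dyadic_cell i B k n \<inter> E n)"
  proof -
    have "0 \<le> \<lfloor>2 ^ k * enn2real (passage i \<omega>)\<rfloor>" for \<omega> by (simp add: zero_le_floor)
    then have "\<lfloor>2 ^ k * enn2real (passage i \<omega>)\<rfloor> = int n \<longleftrightarrow> n = nat \<lfloor>2 ^ k * enn2real (passage i \<omega>)\<rfloor>" for \<omega> n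
      by (metis nat_int nat_0_le)
    then show ?thesis unfolding dyadic_cell_def by (simp only:) blast
  qed
  moreover have "(\<lambda>n. measure M (dyadic_cell i B k n \<inter> E n)) sums measure M (\<Union>n. dyadic_cell i B k n \<inter> E n)"
  proof (rule finite_measure_UNION)
    show "range (\<lambda>n. dyadic_cell i B k n \<inter> E n) \<subseteq> sets M"
      using FH_M[OF dyadic_cell_FH[OF B]] E by auto
    show "disjoint_family (\<lambda>n. dyadic_cell i B k n \<inter> E n)"
      unfolding disjoint_family_on_def by (auto simp: dyadic_cell_def)
  qed
  ultimately show ?thesis by simp
qed

lemma dyadic_cell_end:
  assumes "\<omega> \<in> dyadic_cell i B k n"
  shows "dyadic_above k (enn2real (passage i \<omega>)) = (real n + 1) / 2 ^ k"
    and "\<omega> \<in> space M \<Longrightarrow> i \<le> Xh ((real n + 1) / 2 ^ k) \<omega>"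
proof -
  have fin: "passage i \<omega> < \<infinity>" and fl: "\<lfloor>2 ^ k * enn2real (passage i \<omega>)\<rfloor> = int n"
    using assms by (auto simp: dyadic_cell_def)
  show e: "dyadic_above k (enn2real (passage i \<omega>)) = (real n + 1) / 2 ^ k"
    by (simp add: dyadic_above_def fl)
  assume \<omega>: "\<omega> \<in> space M"
  have "passage i \<omega> = ennreal (enn2real (passage i \<omega>))" using fin by (simp add: ennreal_enn2real_if)
  also have "\<dots> \<le> ennreal ((real n + 1) / 2 ^ k)"
    unfolding e[symmetric] using dyadic_above_gt by (intro ennreal_leI less_imp_le)
  finally show "i \<le> Xh ((real n + 1) / 2 ^ k) \<omega>" using passage_le_iff[OF \<omega>, of "(real n + 1) / 2 ^ k" i] by simp
qed

lemma dual_stay: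
  assumes A: "A \<in> sets (FH q)" and q: "0 \<le> q" "0 \<le> u" and i: "i \<le> d"
  shows "measure M (A \<inter> (lev (Xh q) i \<inter> lev (Xh (q + u)) i)) = exp (- \<nu> i * u) * measure M (A \<inter> lev (Xh q) i)"
proof -
  have "lev (Xh q) i \<in> sets (FH q)"
    unfolding natural_filtration_sets using q by (intro sigma_sets.Basic) blast
  then have A': "A \<inter> lev (Xh q) i \<in> sets (FH q)" using A by blast
  have "measure M (A \<inter> lev (Xh q) i \<inter> lev (Xh (q + u)) i)
      = (\<Sum>k\<le>d. measure M (A \<inter> lev (Xh q) i \<inter> lev (Xh q) k) * transition_prob Gh u k i)"
    by (rule dual_markov[OF A' q i])
  also have "\<dots> = (\<Sum>k\<le>d. if k = i then measure M (A \<inter> lev (Xh q) i) * transition_prob Gh u i i else 0)"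
  proof (intro sum.cong refl)
    fix k
    have "A \<inter> lev (Xh q) i \<inter> lev (Xh q) k = (if k = i then A \<inter> lev (Xh q) i else {})" by auto
    then show "measure M (A \<inter> lev (Xh q) i \<inter> lev (Xh q) k) * transition_prob Gh u k i
      = (if k = i then measure M (A \<inter> lev (Xh q) i) * transition_prob Gh u i i else 0)" by simp
  qed
  also have "\<dots> = measure M (A \<inter> lev (Xh q) i) * transition_prob Gh u i i" using i by simp
  also have "transition_prob Gh u i i = exp (- \<nu> i * u)"
    using transition_prob_triangular_diag[OF Gh_carrier, of i u] i by (simp add: Gh_entry)
  finally show ?thesis by (simp add: Int_assoc mult.commute)
qed

text \<open>If the dual is still in \<open>i\<close> at the discretised passage time, it stays for a
  further time \<open>u\<close> with factor \<open>exp (- \<nu> i * u)\<close>. As the mesh shrinks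
  this becomes an identity at the passage itself, and level \<open>i + 1\<close> is almost surely
  reached later than level \<open>i\<close>.\<close>

lemma passage_wait:
  assumes B: "before_passage i B" and i: "i < d" and u: "0 \<le> u"
  shows "measure M {\<omega> \<in> B. passage i \<omega> < \<infinity> \<and> passage i \<omega> + ennreal u < passage (Suc i) \<omega>}
    = exp (- \<nu> i * u) * measure M {\<omega> \<in> B. passage i \<omega> < \<infinity>}"
proof -
  have BM[measurable]: "B \<in> sets M" using B by (simp add: before_passage_def)
  define q where "q k n = (real n + 1) / 2 ^ k" for k n :: nat
  define L where "L k c = {\<omega> \<in> B. passage i \<omega> < \<infinity> \<and> \<omega> \<in> lev (Xh (q k (nat \<lfloor>2 ^ k * enn2real (passage i \<omega>)\<rfloor>))) i
      \<inter> lev (Xh (q k (nat \<lfloor>2 ^ k * enn2real (passage i \<omega>)\<rfloor>) + c)) i}" for k c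
  have q0: "0 \<le> q k n" for k n by (simp add: q_def)
  have sums: "(\<lambda>n. measure M (dyadic_cell i B k n \<inter> (lev (Xh (q k n)) i \<inter> lev (Xh (q k n + c)) i))) sums measure M (L k c)" for k c
    unfolding L_def by (rule dyadic_cell_sums[OF B]) (intro sets.Int lev_M)
  have stay: "measure M (dyadic_cell i B k n \<inter> (lev (Xh (q k n)) i \<inter> lev (Xh (q k n + c)) i))
      = exp (- \<nu> i * c) * measure M (dyadic_cell i B k n \<inter> lev (Xh (q k n)) i)" if "0 \<le> c" for k n c
    using that i q0 dyadic_cell_FH[OF B, of k n] by (intro dual_stay) (auto simp: q_def)
  have disc: "measure M (L k u) = exp (- \<nu> i * u) * measure M (L k 0)" for k
  proof -
    have "(\<lambda>n. exp (- \<nu> i * u) * measure M (dyadic_cell i B k n \<inter> (lev (Xh (q k n)) i \<inter> lev (Xh (q k n + 0)) i)))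
        sums (exp (- \<nu> i * u) * measure M (L k 0))" by (intro sums_mult sums)
    then have "(\<lambda>n. exp (- \<nu> i * u) * measure M (dyadic_cell i B k n \<inter> lev (Xh (q k n)) i)) sums (exp (- \<nu> i * u) * measure M (L k 0))"
      by simp
    moreover have "(\<lambda>n. exp (- \<nu> i * u) * measure M (dyadic_cell i B k n \<inter> lev (Xh (q k n)) i)) sums measure M (L k u)"
      using sums[of k u] unfolding stay[OF u] .
    ultimately show ?thesis by (rule sums_unique2[symmetric])
  qed
  \<comment> \<open>At the right end of the cell the dual is at least in \<open>i\<close>; being in
    \<open>i\<close> both then and \<open>c\<close> later means that level \<open>i + 1\<close> is
    not reached by the later time.\<close>
  have L_eq: "L k c = {\<omega> \<in> B. passage i \<omega> < \<infinity> \<and> ennreal (dyadic_above k (enn2real (passage i \<omega>)) + c) < passage (Suc i) \<omega>}"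
    if c: "0 \<le> c" for k c
  proof -
    have "\<omega> \<in> lev (Xh (q k n)) i \<inter> lev (Xh (q k n + c)) i \<longleftrightarrow> ennreal (dyadic_above k (enn2real (passage i \<omega>)) + c) < passage (Suc i) \<omega>"
      if \<omega>: "\<omega> \<in> B" "passage i \<omega> < \<infinity>" and n: "n = nat \<lfloor>2 ^ k * enn2real (passage i \<omega>)\<rfloor>" for \<omega> n
    proof -
      have sp: "\<omega> \<in> space M" using \<omega>(1) sets.sets_into_space[OF BM] by blast
      have cell: "\<omega> \<in> dyadic_cell i B k n" using \<omega> n by (simp add: dyadic_cell_def)
      have e: "dyadic_above k (enn2real (passage i \<omega>)) = q k n" and ge: "i \<le> Xh (q k n) \<omega>"
        using dyadic_cell_end[OF cell] sp by (simp_all add: q_def)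
      have "ennreal (q k n + c) < passage (Suc i) \<omega> \<longleftrightarrow> \<not> Suc i \<le> Xh (q k n + c) \<omega>"
        using passage_le_iff[OF sp, of "q k n + c" "Suc i"] q0[of k n] c by (simp add: not_le[symmetric] del: ennreal_plus)
      then show ?thesis using e ge sp Xh_mono[OF sp, of "q k n" "q k n + c"] c by auto
    qed
    then show ?thesis unfolding L_def by blast
  qed
  have LM: "L k c \<in> sets M" if "0 \<le> c" for k c
  proof -
    have [measurable]: "dyadic_above k \<in> borel_measurable borel" unfolding dyadic_above_def[abs_def] by measurable
    have "L k c = B \<inter> {\<omega> \<in> space M. passage i \<omega> < \<infinity> \<and> ennreal (dyadic_above k (enn2real (passage i \<omega>)) + c) < passage (Suc i) \<omega>}"
      unfolding L_eq[OF that] using sets.sets_into_space[OF BM] by blast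
    also have "\<dots> \<in> sets M" by measurable
    finally show ?thesis .
  qed
  have EM: "{\<omega> \<in> B. passage i \<omega> < \<infinity> \<and> passage i \<omega> + ennreal c < passage (Suc i) \<omega>} \<in> sets M" for c
  proof -
    have "{\<omega> \<in> B. passage i \<omega> < \<infinity> \<and> passage i \<omega> + ennreal c < passage (Suc i) \<omega>}
        = B \<inter> {\<omega> \<in> space M. passage i \<omega> < \<infinity> \<and> passage i \<omega> + ennreal c < passage (Suc i) \<omega>}"
      using sets.sets_into_space[OF BM] by blast
    also have "\<dots> \<in> sets M" by measurable
    finally show ?thesis .
  qed
  have lim: "(\<lambda>k. measure M (L k c)) \<longlonglongrightarrow> measure M {\<omega> \<in> B. passage i \<omega> < \<infinity> \<and> passage i \<omega> + ennreal c < passage (Suc i) \<omega>}"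
    if c: "0 \<le> c" for c
  proof (rule measure_tendsto_pointwise[OF LM[OF c] EM], rule AE_I2)
    fix \<omega> assume "\<omega> \<in> space M"
    let ?p = "enn2real (passage i \<omega>)"
    show "\<forall>\<^sub>F k in sequentially. (\<omega> \<in> L k c) = (\<omega> \<in> {\<omega> \<in> B. passage i \<omega> < \<infinity> \<and> passage i \<omega> + ennreal c < passage (Suc i) \<omega>})"
    proof (cases "passage i \<omega> < \<infinity>")
      case True
      then have pe: "passage i \<omega> + ennreal c = ennreal (?p + c)" using c by (simp add: ennreal_enn2real_if)
      show ?thesis
      proof (cases "ennreal (?p + c) < passage (Suc i) \<omega>")
        case lt: True
        have "(\<lambda>k. ennreal (dyadic_above k ?p + c)) \<longlonglongrightarrow> ennreal (?p + c)"
          by (intro tendsto_ennrealI tendsto_add dyadic_above_LIMSEQ tendsto_const)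
        then have "\<forall>\<^sub>F k in sequentially. ennreal (dyadic_above k ?p + c) < passage (Suc i) \<omega>"
          using lt by (rule order_tendstoD(2))
        then show ?thesis by eventually_elim (use True lt in \<open>simp add: L_eq[OF c] pe del: ennreal_plus\<close>)
      next
        case ge: False
        have "\<not> ennreal (dyadic_above k ?p + c) < passage (Suc i) \<omega>" for k
        proof -
          have "ennreal (?p + c) \<le> ennreal (dyadic_above k ?p + c)"
            using dyadic_above_gt[of ?p k] by (intro ennreal_leI) simp
          then show ?thesis using ge by order
        qed
        then show ?thesis using ge by (intro always_eventually) (simp add: L_eq[OF c] pe del: ennreal_plus)
      qed
    qed (simp add: L_eq[OF c])
  qed
  have 1: "measure M {\<omega> \<in> B. passage i \<omega> < \<infinity> \<and> passage i \<omega> + ennreal u < passage (Suc i) \<omega>}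
      = exp (- \<nu> i * u) * measure M {\<omega> \<in> B. passage i \<omega> < \<infinity> \<and> passage i \<omega> + ennreal 0 < passage (Suc i) \<omega>}"
  proof (rule LIMSEQ_unique[OF lim[OF u]])
    show "(\<lambda>k. measure M (L k u)) \<longlonglongrightarrow> exp (- \<nu> i * u) * measure M {\<omega> \<in> B. passage i \<omega> < \<infinity> \<and> passage i \<omega> + ennreal 0 < passage (Suc i) \<omega>}"
      unfolding disc by (intro tendsto_mult_left lim) simp
  qed
  also have "measure M {\<omega> \<in> B. passage i \<omega> < \<infinity> \<and> passage i \<omega> + ennreal 0 < passage (Suc i) \<omega>} = measure M {\<omega> \<in> B. passage i \<omega> < \<infinity>}"
  proof (rule measure_eq_AE)
    show "AE \<omega> in M. \<omega> \<in> {\<omega> \<in> B. passage i \<omega> < \<infinity> \<and> passage i \<omega> + ennreal 0 < passage (Suc i) \<omega>} \<longleftrightarrow> \<omega> \<in> {\<omega> \<in> B. passage i \<omega> < \<infinity>}"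
      using AE_passage AE_space
    proof eventually_elim
      case (elim \<omega>)
      have "passage i \<omega> < passage (Suc i) \<omega>" if fin: "passage i \<omega> < \<infinity>"
      proof -
        have "Xh (enn2real (passage i \<omega>)) \<omega> = i" using elim(1) fin i by auto
        then have "\<not> passage (Suc i) \<omega> \<le> ennreal (enn2real (passage i \<omega>))"
          using passage_le_iff[OF elim(2), of "enn2real (passage i \<omega>)" "Suc i"] by simp
        then show ?thesis using fin by (simp add: ennreal_enn2real_if not_le split: if_splits)
      qed
      then show ?case by auto
    qed
    have "{\<omega> \<in> B. passage i \<omega> < \<infinity>} = B \<inter> {\<omega> \<in> space M. passage i \<omega> < \<infinity>}"
      using sets.sets_into_space[OF BM] by blast
    also have "\<dots> \<in> sets M" by measurable
    finally show "{\<omega> \<in> B. passage i \<omega> < \<infinity>} \<in> sets M" .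
  qed (rule EM)
  finally show ?thesis .
qed

lemma before_passage_space: "before_passage i (space M)"
  unfolding before_passage_def using passage_less_FH by (simp add: Int_absorb1 subset_iff)

text \<open>For \<open>u\<close> tending to infinity, \<open>passage_wait\<close> bounds the
  probability of never leaving \<open>i\<close> by \<open>0\<close>, since
  \<open>\<nu> i > 0\<close>.\<close>

lemma AE_passage_finite: "i \<le> d \<Longrightarrow> AE \<omega> in M. passage i \<omega> < \<infinity>"
proof (induction i)
  case 0
  show ?case
  proof (rule AE_I2)
    fix \<omega> assume "\<omega> \<in> space M"
    then have "passage 0 \<omega> \<le> ennreal 0" by (subst passage_le_iff) auto
    then show "passage 0 \<omega> < \<infinity>" by simp
  qed
next
  case (Suc i)
  have i: "i < d" using Suc.prems by simp
  have fin: "AE \<omega> in M. passage i \<omega> < \<infinity>" using Suc by simp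
  let ?E = "{\<omega> \<in> space M. passage (Suc i) \<omega> = \<infinity>}"
  have E: "?E \<in> sets M" by measurable
  have "measure M ?E \<le> exp (- \<nu> i * u)" if u: "0 \<le> u" for u
  proof -
    have "measure M ?E \<le> measure M {\<omega> \<in> space M. passage i \<omega> < \<infinity> \<and> passage i \<omega> + ennreal u < passage (Suc i) \<omega>}"
    proof (rule finite_measure_mono_AE)
      show "AE \<omega> in M. \<omega> \<in> ?E \<longrightarrow> \<omega> \<in> {\<omega> \<in> space M. passage i \<omega> < \<infinity> \<and> passage i \<omega> + ennreal u < passage (Suc i) \<omega>}"
        using fin by eventually_elim (auto simp: less_top)
    qed measurable
    also have "\<dots> = exp (- \<nu> i * u) * measure M {\<omega> \<in> space M. passage i \<omega> < \<infinity>}"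
      by (rule passage_wait[OF before_passage_space i u])
    also have "\<dots> \<le> exp (- \<nu> i * u) * 1" by (intro mult_left_mono) auto
    finally show ?thesis by simp
  qed
  moreover have "((\<lambda>u. exp (- \<nu> i * u)) \<longlongrightarrow> 0) at_top"
  proof -
    have "filterlim (\<lambda>u. \<nu> i * u) at_top at_top"
      by (rule filterlim_tendsto_pos_mult_at_top[OF tendsto_const \<nu>_pos[OF i] filterlim_ident])
    then have "filterlim (\<lambda>u. - (\<nu> i * u)) at_bot at_top" by (simp add: filterlim_uminus_at_bot)
    from filterlim_compose[OF exp_at_bot this] show ?thesis by simp
  qed
  ultimately have "measure M ?E \<le> 0"
    by (intro tendsto_lowerbound[where F = at_top]) (auto intro: eventually_at_top_linorderI)
  then have "?E \<in> null_sets M" using E by (auto simp: null_sets_def emeasure_eq_measure measure_le_0_iff)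
  then show ?case by (rule AE_I') (auto simp: less_top[symmetric])
qed

text \<open>At the discretised passage time the dual is in \<open>d\<close>, so by
  \<open>dual_link\<close> the chain \<open>X\<close> has the last row of the link as its law,
  whatever happened before. Right-continuity of \<open>X\<close> carries this to the passage
  time.\<close>

lemma passage_state:
  assumes B: "before_passage d B" and j: "j \<le> d"
  shows "measure M {\<omega> \<in> B. passage d \<omega> < \<infinity> \<and> X (enn2real (passage d \<omega>)) \<omega> = j}
    = measure M {\<omega> \<in> B. passage d \<omega> < \<infinity>} * pmf \<pi> j"
proof -
  have BM[measurable]: "B \<in> sets M" using B by (simp add: before_passage_def)
  define q where "q k n = (real n + 1) / 2 ^ k" for k n :: nat
  have q0: "0 \<le> q k n" for k n by (simp add: q_def)
  define L where "L k = {\<omega> \<in> B. passage d \<omega> < \<infinity> \<and> \<omega> \<in> lev (X (q k (nat \<lfloor>2 ^ k * enn2real (passage d \<omega>)\<rfloor>))) j}" for k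
  have L_eq: "L k = {\<omega> \<in> B. passage d \<omega> < \<infinity> \<and> X (dyadic_above k (enn2real (passage d \<omega>))) \<omega> = j}" for k
  proof -
    have "\<omega> \<in> lev (X (q k n)) j \<longleftrightarrow> X (dyadic_above k (enn2real (passage d \<omega>))) \<omega> = j"
      if \<omega>: "\<omega> \<in> B" "passage d \<omega> < \<infinity>" and n: "n = nat \<lfloor>2 ^ k * enn2real (passage d \<omega>)\<rfloor>" for \<omega> n
    proof -
      have sp: "\<omega> \<in> space M" using \<omega>(1) sets.sets_into_space[OF BM] by blast
      have cell: "\<omega> \<in> dyadic_cell d B k n" using \<omega> n by (simp add: dyadic_cell_def)
      show ?thesis using dyadic_cell_end(1)[OF cell] sp by (simp add: q_def)
    qed
    then show ?thesis unfolding L_def by blast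
  qed
  have sums_L: "(\<lambda>n. measure M (dyadic_cell d B k n \<inter> lev (X (q k n)) j)) sums measure M (L k)" for k
    unfolding L_def by (rule dyadic_cell_sums[OF B]) (rule lev_M(1)[OF q0])
  have cell: "measure M (dyadic_cell d B k n \<inter> lev (X (q k n)) j) = measure M (dyadic_cell d B k n \<inter> space M) * pmf \<pi> j" for k n
  proof -
    have D: "dyadic_cell d B k n \<in> sets (FH (q k n))" unfolding q_def by (rule dyadic_cell_FH[OF B])
    have sub: "dyadic_cell d B k n \<inter> lev (Xh (q k n)) d = dyadic_cell d B k n"
    proof (intro Int_absorb2 subsetI)
      fix \<omega> assume c: "\<omega> \<in> dyadic_cell d B k n"
      then have sp: "\<omega> \<in> space M" using sets.sets_into_space[OF FH_M[OF D]] by blast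
      have "d \<le> Xh (q k n) \<omega>" unfolding q_def by (rule dyadic_cell_end(2)[OF c sp])
      then show "\<omega> \<in> lev (Xh (q k n)) d" using sp Xh_le[OF sp, of "q k n"] by simp
    qed
    have "dyadic_cell d B k n \<inter> space M = dyadic_cell d B k n" using sets.sets_into_space[OF FH_M[OF D]] by blast
    then show ?thesis using dual_link[OF D q0 order_refl j] lam_d[OF j] unfolding sub by simp
  qed
  have sums_B: "(\<lambda>n. measure M (dyadic_cell d B k n \<inter> space M)) sums measure M {\<omega> \<in> B. passage d \<omega> < \<infinity> \<and> \<omega> \<in> space M}" for k
    by (rule dyadic_cell_sums[OF B]) simp
  have disc: "measure M (L k) = measure M {\<omega> \<in> B. passage d \<omega> < \<infinity> \<and> \<omega> \<in> space M} * pmf \<pi> j" for k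
    by (rule sums_unique2[OF sums_L]) (unfold cell, rule sums_mult2[OF sums_B])
  have space: "{\<omega> \<in> B. passage d \<omega> < \<infinity> \<and> \<omega> \<in> space M} = {\<omega> \<in> B. passage d \<omega> < \<infinity>}"
    using sets.sets_into_space[OF BM] by blast
  have [measurable]: "(\<lambda>\<omega>. X (enn2real (passage d \<omega>)) \<omega>) \<in> measurable M (count_space UNIV)"
    by (rule measurable_at_random_time) (auto intro: step_path)
  have LM: "L k \<in> sets M" for k
  proof -
    have [measurable]: "dyadic_above k \<in> borel_measurable borel" unfolding dyadic_above_def[abs_def] by measurable
    have [measurable]: "(\<lambda>\<omega>. X (dyadic_above k (enn2real (passage d \<omega>))) \<omega>) \<in> measurable M (count_space UNIV)"
      by (rule measurable_at_random_time) (auto intro: step_path less_imp_le[OF le_less_trans[OF enn2real_nonneg dyadic_above_gt]])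
    have "L k = B \<inter> {\<omega> \<in> space M. passage d \<omega> < \<infinity> \<and> X (dyadic_above k (enn2real (passage d \<omega>))) \<omega> = j}"
      unfolding L_eq using sets.sets_into_space[OF BM] by blast
    also have "\<dots> \<in> sets M" by measurable
    finally show ?thesis .
  qed
  have "(\<lambda>k. measure M (L k)) \<longlonglongrightarrow> measure M {\<omega> \<in> B. passage d \<omega> < \<infinity> \<and> X (enn2real (passage d \<omega>)) \<omega> = j}"
  proof (rule measure_tendsto_pointwise[OF LM _ AE_I2])
    have "{\<omega> \<in> B. passage d \<omega> < \<infinity> \<and> X (enn2real (passage d \<omega>)) \<omega> = j}
        = B \<inter> {\<omega> \<in> space M. passage d \<omega> < \<infinity> \<and> X (enn2real (passage d \<omega>)) \<omega> = j}"
      using sets.sets_into_space[OF BM] by blast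
    also have "\<dots> \<in> sets M" by measurable
    finally show "{\<omega> \<in> B. passage d \<omega> < \<infinity> \<and> X (enn2real (passage d \<omega>)) \<omega> = j} \<in> sets M" .
    fix \<omega> assume \<omega>: "\<omega> \<in> space M"
    interpret step_path X \<omega> using step_path[OF \<omega>] .
    let ?p = "enn2real (passage d \<omega>)"
    obtain e where e: "0 < e" "\<And>u. ?p \<le> u \<Longrightarrow> u < ?p + e \<Longrightarrow> X u \<omega> = X ?p \<omega>" by (rule const_right[OF enn2real_nonneg]) blast
    have "\<forall>\<^sub>F k in sequentially. dyadic_above k ?p < ?p + e" using e(1) by (intro eventually_dyadic_above) simp
    then show "\<forall>\<^sub>F k in sequentially. \<omega> \<in> L k \<longleftrightarrow> \<omega> \<in> {\<omega> \<in> B. passage d \<omega> < \<infinity> \<and> X (enn2real (passage d \<omega>)) \<omega> = j}"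
    proof eventually_elim
      case (elim k)
      have "X (dyadic_above k ?p) \<omega> = X ?p \<omega>"
        by (rule e(2)[OF less_imp_le[OF dyadic_above_gt] elim])
      then show ?case by (simp add: L_eq)
    qed
  qed
  then have "(\<lambda>k. measure M {\<omega> \<in> B. passage d \<omega> < \<infinity>} * pmf \<pi> j) \<longlonglongrightarrow> measure M {\<omega> \<in> B. passage d \<omega> < \<infinity> \<and> X (enn2real (passage d \<omega>)) \<omega> = j}"
    unfolding disc space .
  from LIMSEQ_unique[OF this tendsto_const] show ?thesis by simp
qed

end

section \<open>The absorption time is a fastest strong stationary time\<close>

text \<open>\<^const>\<open>prob_space.indep_var\<close> takes two variables with values in the same type; in
  \<^const>\<open>strong_stationary_time\<close> the state at time \<open>T\<close> is coerced to \<^typ>\<open>ennreal\<close>.\<close>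

lemma (in prob_space) strong_stationary_time_state_M:
  assumes "strong_stationary_time M d G \<pi> X T"
  shows "(\<lambda>\<omega>. X (enn2real (T \<omega>)) \<omega>) \<in> measurable M (count_space UNIV)"
proof (rule measurableI)
  fix A :: "nat set"
  let ?Z = "\<lambda>\<omega>. X (enn2real (T \<omega>)) \<omega>"
  have "(\<lambda>\<omega>. of_nat (?Z \<omega>) :: ennreal) \<in> measurable M (count_space UNIV)"
    using assms by (intro indep_var_rv2[of borel T]) (simp add: strong_stationary_time_def)
  then have "(\<lambda>\<omega>. of_nat (?Z \<omega>) :: ennreal) -` (of_nat ` A) \<inter> space M \<in> sets M" by (rule measurable_sets) simp
  also have "(\<lambda>\<omega>. of_nat (?Z \<omega>) :: ennreal) -` (of_nat ` A) \<inter> space M = ?Z -` A \<inter> space M" by auto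
  finally show "?Z -` A \<inter> space M \<in> sets M" .
qed simp

lemma (in prob_space) strong_stationary_time_mixture:
  assumes sst: "strong_stationary_time M d G \<pi> X T" and S: "S \<in> sets borel"
  shows "measure M {\<omega> \<in> space M. T \<omega> \<in> S \<and> X (enn2real (T \<omega>)) \<omega> = x} = measure M {\<omega> \<in> space M. T \<omega> \<in> S} * pmf \<pi> x"
proof -
  let ?Z = "\<lambda>\<omega>. X (enn2real (T \<omega>)) \<omega>"
  have ind: "indep_var borel T (count_space UNIV) (\<lambda>\<omega>. of_nat (?Z \<omega>))" and dis: "distr M (count_space UNIV) ?Z = measure_pmf \<pi>"
    using sst by (simp_all add: strong_stationary_time_def)
  have "measure M (?Z -` {x} \<inter> space M) = pmf \<pi> x"
    using measure_distr[OF strong_stationary_time_state_M[OF sst], of "{x}"] by (simp add: dis measure_pmf_single)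
  moreover have "(\<lambda>\<omega>. of_nat (?Z \<omega>) :: ennreal) -` {of_nat x} \<inter> space M = ?Z -` {x} \<inter> space M" by auto
  moreover have "measure M ((T -` S \<inter> space M) \<inter> ((\<lambda>\<omega>. of_nat (?Z \<omega>) :: ennreal) -` {of_nat x} \<inter> space M))
      = measure M (T -` S \<inter> space M) * measure M ((\<lambda>\<omega>. of_nat (?Z \<omega>) :: ennreal) -` {of_nat x} \<inter> space M)"
  proof -
    have "T -` S \<inter> space M \<in> sigma_sets (space M) {T -` A \<inter> space M | A. A \<in> sets borel}"
      using S by (intro sigma_sets.Basic) blast
    moreover have "(\<lambda>\<omega>. of_nat (?Z \<omega>) :: ennreal) -` {of_nat x} \<inter> space M
        \<in> sigma_sets (space M) {(\<lambda>\<omega>. of_nat (?Z \<omega>) :: ennreal) -` A \<inter> space M | A. A \<in> sets (count_space UNIV)}"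
      by (intro sigma_sets.Basic CollectI exI[of _ "{of_nat x}"]) simp
    ultimately show ?thesis
      by (rule ind[unfolded indep_var_eq indep_sets2_eq, THEN conjunct2, THEN conjunct2, THEN conjunct2, rule_format])
  qed
  moreover have "(T -` S \<inter> space M) \<inter> (?Z -` {x} \<inter> space M) = {\<omega> \<in> space M. T \<omega> \<in> S \<and> ?Z \<omega> = x}"
    "T -` S \<inter> space M = {\<omega> \<in> space M. T \<omega> \<in> S}" by auto
  ultimately show ?thesis by simp
qed

lemma (in prob_space) measure_diff_le_symdiff:
  assumes "A \<in> sets M" "B \<in> sets M" "C \<in> sets M" "A - B \<subseteq> C" "B - A \<subseteq> C"
  shows "\<bar>measure M A - measure M B\<bar> \<le> measure M C"
proof -
  have "measure M A \<le> measure M (B \<union> C)" "measure M B \<le> measure M (A \<union> C)"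
    using assms by (auto intro!: finite_measure_mono)
  moreover have "measure M (B \<union> C) \<le> measure M B + measure M C" "measure M (A \<union> C) \<le> measure M A + measure M C"
    using assms by (auto intro!: measure_Un_le)
  ultimately show ?thesis by linarith
qed

context birth_death
begin

text \<open>The Markov property is used on the cells \<open>q\<^sub>i\<^sub>-\<^sub>1 < T \<le> q\<^sub>i\<close> of a grid; the error is the probability
  that \<open>X\<close> moves between \<open>T\<close> and the next grid point.\<close>

lemma stationary_after_strong_stationary_time:
  fixes M' :: "'b measure"
  assumes sst: "strong_stationary_time M' d G \<pi> X T" and t: "0 \<le> t" and j: "j \<le> d"
  shows "measure M' {\<omega> \<in> space M'. T \<omega> \<le> ennreal t \<and> X t \<omega> = j} = measure M' {\<omega> \<in> space M'. T \<omega> \<le> ennreal t} * pmf \<pi> j"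
proof -
  obtain F where mc: "markov_chain_wrt M' F d G X" and st: "stopping_time F T"
    using sst by (auto simp: strong_stationary_time_def)
  interpret prob_space M' using mc by (simp add: markov_chain_wrt_def)
  have sub: "subalgebra M' (F u)" for u using mc by (simp add: markov_chain_wrt_def)
  have filt: "filtration (space M') F" using mc by (simp add: markov_chain_wrt_def)
  have Xm: "X u \<in> measurable M' (count_space UNIV)" if "0 \<le> u" for u
    using mc that by (intro measurable_from_subalg[OF sub[of "ennreal u"]]) (simp add: markov_chain_wrt_def)
  let ?Z = "\<lambda>\<omega>. X (enn2real (T \<omega>)) \<omega>"
  have Z[measurable]: "?Z \<in> measurable M' (count_space UNIV)" and T[measurable]: "T \<in> borel_measurable M'"
    using strong_stationary_time_state_M[OF sst] sst indep_var_rv1[of borel T] by (auto simp: strong_stationary_time_def)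
  define q where "q m i = t * real i / real (Suc m)" for m i
  \<comment> \<open>\<open>disjointed\<close> turns nested initial segments into the cells of the
    grid; the cell of index \<open>0\<close> is the single value \<open>0\<close>.\<close>
  define S where "S m = disjointed (\<lambda>i. {.. ennreal (q m i)})" for m
  define D where "D m i = {\<omega> \<in> space M'. T \<omega> \<in> S m i}" for m i
  have q0: "0 \<le> q m i" for m i using t by (simp add: q_def)
  have q_mono: "i \<le> i' \<Longrightarrow> q m i \<le> q m i'" for m i i'
    using t by (simp add: q_def divide_right_mono mult_left_mono)
  have q_end: "q m (Suc m) = t" for m by (simp add: q_def)
  have S: "S m i \<in> sets borel" for m i unfolding S_def disjointed_def by (intro sets.Diff sets.finite_UN) auto
  have DM: "D m i \<in> sets M'" for m i unfolding D_def using S[of m i] by measurable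
  have DF: "D m i \<in> sets (F (ennreal (q m i)))" for m i
  proof -
    have le: "{\<omega> \<in> space M'. T \<omega> \<le> ennreal (q m l)} \<in> sets (F (ennreal (q m i)))" if "l \<le> i" for l
    proof -
      have "{\<omega> \<in> space (F (ennreal (q m l))). T \<omega> \<le> ennreal (q m l)} \<in> sets (F (ennreal (q m l)))"
        using st by (auto simp: stopping_time_def pred_def)
      moreover have "space (F (ennreal (q m l))) = space M'" using sub by (simp add: subalgebra_def)
      moreover have "sets (F (ennreal (q m l))) \<subseteq> sets (F (ennreal (q m i)))"
        using filtration.sets_F_mono[OF filt ennreal_leI[OF q_mono[OF that]]] .
      ultimately show ?thesis by auto
    qed
    have "D m i = {\<omega> \<in> space M'. T \<omega> \<le> ennreal (q m i)} - (\<Union>l\<in>{0..<i}. {\<omega> \<in> space M'. T \<omega> \<le> ennreal (q m l)})"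
      unfolding D_def S_def disjointed_def by auto
    also have "\<dots> \<in> sets (F (ennreal (q m i)))" by (intro sets.Diff sets.finite_UN le) auto
    finally show ?thesis .
  qed
  have disj: "disjoint_family_on (D m) I" for m I
    unfolding disjoint_family_on_def D_def S_def using disjoint_family_disjointed[of "\<lambda>i. {.. ennreal (q m i)}"]
    by (auto simp: disjoint_family_on_def)
  have UD: "(\<Union>i\<in>{..Suc m}. D m i) = {\<omega> \<in> space M'. T \<omega> \<le> ennreal t}" for m
  proof -
    have "{..Suc m} = {0..<Suc (Suc m)}" by auto
    then have "(\<Union>i\<in>{..Suc m}. S m i) = (\<Union>i\<in>{0..<Suc (Suc m)}. S m i)" by (rule arg_cong)
    also have "\<dots> = (\<Union>i\<in>{0..<Suc (Suc m)}. {.. ennreal (q m i)})"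
      unfolding S_def by (rule finite_UN_disjointed_eq)
    also have "\<dots> = {.. ennreal t}"
    proof (rule antisym; rule subsetI)
      fix y assume "y \<in> (\<Union>i\<in>{0..<Suc (Suc m)}. {.. ennreal (q m i)})"
      then obtain i where i: "i \<le> Suc m" "y \<le> ennreal (q m i)" by (auto simp: less_Suc_eq_le)
      have "ennreal (q m i) \<le> ennreal t" using ennreal_leI[OF q_mono[OF i(1), of m]] by (simp add: q_end)
      then show "y \<in> {.. ennreal t}" using i(2) by simp
    next
      fix y assume "y \<in> {.. ennreal t}"
      then have "y \<in> {.. ennreal (q m (Suc m))}" by (simp add: q_end)
      then show "y \<in> (\<Union>i\<in>{0..<Suc (Suc m)}. {.. ennreal (q m i)})" by (rule UN_I[rotated]) simp
    qed
    finally show ?thesis unfolding D_def by blast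
  qed
  define L where "L u x = {\<omega> \<in> space M'. X u \<omega> = x}" for u x
  have LM: "0 \<le> u \<Longrightarrow> L u x \<in> sets M'" for u x unfolding L_def using Xm[of u] by measurable
  \<comment> \<open>Here \<open>X\<close> moves between \<open>T\<close> and the end of its cell.
    These events are disjoint over the cells, so the errors add up to one probability.\<close>
  define E where "E m i = D m i \<inter> {\<omega> \<in> space M'. X (q m i) \<omega> \<noteq> ?Z \<omega>}" for m i
  have EM: "E m i \<in> sets M'" for m i
  proof -
    have [measurable]: "X (q m i) \<in> measurable M' (count_space UNIV)" by (rule Xm[OF q0])
    have "{\<omega> \<in> space M'. X (q m i) \<omega> \<noteq> ?Z \<omega>} \<in> sets M'" by measurable
    then show ?thesis unfolding E_def using DM by blast
  qed
  \<comment> \<open>One term for each state, weighted by a transition probability that this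
    exponential bounds.\<close>
  define C where "C = real (d + 1) * exp (mat_bound d G * t)"
  have C0: "0 \<le> C" by (simp add: C_def)
  have cell: "\<bar>measure M' (D m i \<inter> L t j) - measure M' (D m i) * pmf \<pi> j\<bar> \<le> C * measure M' (E m i)" if i: "i \<le> Suc m" for m i
  proof -
    let ?P = "\<lambda>x. transition_prob G (t - q m i) x j"
    have qt: "0 \<le> t - q m i" "t - q m i \<le> t" using q_mono[OF i, of m] q0[of m i] by (simp_all add: q_end)
    have "measure M' (D m i \<inter> L t j) = (\<Sum>x\<le>d. measure M' (D m i \<inter> L (q m i) x) * ?P x)"
      using markov_chain_wrt_step[OF mc DF q0 qt(1) j, of m i] by (simp add: L_def)
    \<comment> \<open>Invariance rewrites \<open>\<pi>\<close> through the transitions over the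
      remaining time, so that both sides become sums over the state at the grid point and can be
      compared term by term.\<close>
    moreover have "measure M' (D m i) * pmf \<pi> j = (\<Sum>x\<le>d. measure M' (D m i) * pmf \<pi> x * ?P x)"
    proof -
      have "(\<Sum>x\<le>d. pmf \<pi> x * ?P x) = pmf \<pi> j"
        using stat by (intro transition_prob_invariant[OF G_carrier _ j]) (simp add: stationary_distribution_def)
      then show ?thesis by (simp add: mult.assoc flip: sum_distrib_left)
    qed
    ultimately have "\<bar>measure M' (D m i \<inter> L t j) - measure M' (D m i) * pmf \<pi> j\<bar>
        = \<bar>\<Sum>x\<le>d. (measure M' (D m i \<inter> L (q m i) x) - measure M' (D m i) * pmf \<pi> x) * ?P x\<bar>"
      by (simp add: sum_subtractf left_diff_distrib)
    also have "\<dots> \<le> (\<Sum>x\<le>d. measure M' (E m i) * exp (mat_bound d G * t))"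
    proof (rule order_trans[OF sum_abs sum_mono])
      fix x assume x: "x \<in> {..d}"
      have "measure M' (D m i) * pmf \<pi> x = measure M' {\<omega> \<in> space M'. T \<omega> \<in> S m i \<and> ?Z \<omega> = x}"
        unfolding D_def by (rule strong_stationary_time_mixture[OF sst S, symmetric])
      moreover have "{\<omega> \<in> space M'. T \<omega> \<in> S m i \<and> ?Z \<omega> = x} = D m i \<inter> {\<omega> \<in> space M'. ?Z \<omega> = x}"
        by (auto simp: D_def)
      moreover have ZM: "{\<omega> \<in> space M'. ?Z \<omega> = x} \<in> sets M'" by measurable
      moreover have "\<bar>measure M' (D m i \<inter> L (q m i) x) - measure M' (D m i \<inter> {\<omega> \<in> space M'. ?Z \<omega> = x})\<bar> \<le> measure M' (E m i)"
        by (rule measure_diff_le_symdiff[OF sets.Int[OF DM LM[OF q0]] sets.Int[OF DM ZM] EM]) (auto simp: E_def L_def)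
      ultimately have "\<bar>measure M' (D m i \<inter> L (q m i) x) - measure M' (D m i) * pmf \<pi> x\<bar> \<le> measure M' (E m i)"
        by simp
      moreover have "\<bar>?P x\<bar> \<le> exp (mat_bound d G * t)"
      proof -
        have "\<bar>?P x\<bar> \<le> exp (mat_bound d G * \<bar>t - q m i\<bar>)" using x by (intro transition_prob_bound[OF G_carrier] j) simp
        also have "\<dots> \<le> exp (mat_bound d G * t)" using qt by (simp add: mult_left_mono mat_bound_nonneg)
        finally show ?thesis .
      qed
      ultimately show "\<bar>(measure M' (D m i \<inter> L (q m i) x) - measure M' (D m i) * pmf \<pi> x) * ?P x\<bar>
          \<le> measure M' (E m i) * exp (mat_bound d G * t)"
        unfolding abs_mult by (intro mult_mono) auto
    qed
    also have "\<dots> = C * measure M' (E m i)" by (simp add: C_def)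
    finally show ?thesis .
  qed
  let ?A = "{\<omega> \<in> space M'. T \<omega> \<le> ennreal t}"
  define r where "r = \<bar>measure M' (?A \<inter> L t j) - measure M' ?A * pmf \<pi> j\<bar>"
  have bound: "r \<le> C * measure M' (\<Union>i\<in>{..Suc m}. E m i)" for m
  proof -
    have "measure M' (?A \<inter> L t j) = measure M' (\<Union>i\<in>{..Suc m}. D m i \<inter> L t j)"
      unfolding UD[of m, symmetric] by (intro arg_cong[where f = "measure M'"]) blast
    also have "\<dots> = (\<Sum>i\<le>Suc m. measure M' (D m i \<inter> L t j))"
    proof (rule finite_measure_finite_Union)
      show "disjoint_family_on (\<lambda>i. D m i \<inter> L t j) {..Suc m}"
        using disj[of m "{..Suc m}"] unfolding disjoint_family_on_def by fast
    qed (use DM LM[OF t] in auto)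
    finally have 1: "measure M' (?A \<inter> L t j) = (\<Sum>i\<le>Suc m. measure M' (D m i \<inter> L t j))" .
    have 2: "measure M' ?A = (\<Sum>i\<le>Suc m. measure M' (D m i))"
      unfolding UD[of m, symmetric] using DM disj by (intro finite_measure_finite_Union) auto
    have 3: "measure M' (\<Union>i\<in>{..Suc m}. E m i) = (\<Sum>i\<le>Suc m. measure M' (E m i))"
    proof (rule finite_measure_finite_Union)
      show "disjoint_family_on (E m) {..Suc m}"
        using disj[of m "{..Suc m}"] unfolding disjoint_family_on_def E_def by fast
    qed (use EM in auto)
    have "r = \<bar>\<Sum>i\<le>Suc m. measure M' (D m i \<inter> L t j) - measure M' (D m i) * pmf \<pi> j\<bar>"
      unfolding r_def 1 2 by (simp only: sum_subtractf sum_distrib_right)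
    also have "\<dots> \<le> (\<Sum>i\<le>Suc m. C * measure M' (E m i))"
      by (rule order_trans[OF sum_abs sum_mono]) (rule cell, simp)
    finally show ?thesis unfolding 3 by (simp only: sum_distrib_left)
  qed
  have "(\<lambda>m. measure M' (\<Union>i\<in>{..Suc m}. E m i)) \<longlonglongrightarrow> measure M' {}"
  proof (rule measure_tendsto_pointwise[OF _ _ AE_I2])
    show "(\<Union>i\<in>{..Suc m}. E m i) \<in> sets M'" for m using EM by (intro sets.finite_UN) auto
    fix \<omega> assume \<omega>: "\<omega> \<in> space M'"
    show "\<forall>\<^sub>F m in sequentially. \<omega> \<in> (\<Union>i\<in>{..Suc m}. E m i) \<longleftrightarrow> \<omega> \<in> {}"
    proof (cases "T \<omega>" rule: ennreal_cases)
      case top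
      have "\<omega> \<notin> E m i" for m i using top by (simp add: E_def D_def S_def disjointed_def top_unique)
      then show ?thesis by simp
    next
      case (real s)
      interpret Z: step_path X \<omega> using mc \<omega> by unfold_locales (auto simp: markov_chain_wrt_def)
      obtain e where e: "0 < e" "\<And>u. s \<le> u \<Longrightarrow> u < s + e \<Longrightarrow> X u \<omega> = X s \<omega>" by (rule Z.const_right[OF real(1)]) blast
      \<comment> \<open>For a small mesh the end of the cell of \<open>T\<close> falls into the
        interval after \<open>T\<close> on which \<open>X\<close> rests.\<close>
      have "(\<lambda>m. t / real (Suc m)) \<longlonglongrightarrow> 0" by real_asymp
      then have "\<forall>\<^sub>F m in sequentially. t / real (Suc m) < e" using e(1) by (rule order_tendstoD)
      then show ?thesis
      proof eventually_elim
        case (elim m)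
        have "\<omega> \<notin> E m i" for i
        proof
          assume "\<omega> \<in> E m i"
          then have ne: "X (q m i) \<omega> \<noteq> X s \<omega>" and in_S: "ennreal s \<in> S m i" using real by (auto simp: E_def D_def)
          have ge: "s \<le> q m i" using in_S q0[of m i] by (simp add: S_def disjointed_def ennreal_le_iff)
          have "q m i < s + e"
          proof (cases i)
            case 0
            then show ?thesis using real(1) e(1) by (simp add: q_def)
          next
            case (Suc l)
            have "\<not> ennreal s \<le> ennreal (q m l)" using in_S Suc by (auto simp: S_def disjointed_def)
            then have "q m l < s" using q0[of m l] by (simp add: ennreal_le_iff)
            moreover have "q m i = q m l + t / real (Suc m)" unfolding Suc q_def by (simp add: distrib_left add_divide_distrib)
            ultimately show ?thesis using elim by simp
          qed
          then show False using e(2)[OF ge] ne by simp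
        qed
        then show ?case by simp
      qed
    qed
  qed simp
  then have "(\<lambda>m. C * measure M' (\<Union>i\<in>{..Suc m}. E m i)) \<longlonglongrightarrow> C * 0" by (intro tendsto_mult_left) simp
  then have "r \<le> C * 0" by (rule LIMSEQ_le_const) (use bound in blast)
  then have "measure M' (?A \<inter> L t j) = measure M' ?A * pmf \<pi> j" by (simp add: r_def)
  moreover have "?A \<inter> L t j = {\<omega> \<in> space M'. T \<omega> \<le> ennreal t \<and> X t \<omega> = j}" by (auto simp: L_def)
  ultimately show ?thesis by simp
qed

lemma chain_law:
  fixes M' :: "'b measure"
  assumes mc: "markov_chain_wrt M' F d G X" and 0: "AE \<omega> in M'. X 0 \<omega> = 0" and t: "0 \<le> t" and j: "j \<le> d"
  shows "measure M' {\<omega> \<in> space M'. X t \<omega> = j} = transition_prob G t 0 j"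
proof -
  interpret prob_space M' using mc by (simp add: markov_chain_wrt_def)
  have sub: "subalgebra M' (F u)" for u using mc by (simp add: markov_chain_wrt_def)
  have [measurable]: "X 0 \<in> measurable M' (count_space UNIV)"
    using mc by (intro measurable_from_subalg[OF sub[of "ennreal 0"]]) (auto simp add: markov_chain_wrt_def)
  have start: "measure M' (space M' \<inter> {\<omega> \<in> space M'. X 0 \<omega> = i}) = (if i = 0 then 1 else 0)" for i
  proof -
    have "measure M' (space M' \<inter> {\<omega> \<in> space M'. X 0 \<omega> = i}) = measure M' (if i = 0 then space M' else {})"
      using 0 by (intro measure_eq_AE) (auto split: if_splits)
    then show ?thesis by (simp add: prob_space)
  qed
  have "space M' \<in> sets (F (ennreal 0))" using sub[of "ennreal 0"] sets.top[of "F (ennreal 0)"] by (simp add: subalgebra_def)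
  from markov_chain_wrt_step[OF mc this order_refl t j]
  have "measure M' (space M' \<inter> {\<omega> \<in> space M'. X t \<omega> = j})
      = (\<Sum>i\<le>d. (if i = 0 then 1 else 0) * transition_prob G t i j)" unfolding start by simp
  also have "\<dots> = (\<Sum>i\<le>d. if i = 0 then transition_prob G t 0 j else 0)" by (intro sum.cong) auto
  also have "\<dots> = transition_prob G t 0 j" by simp
  finally show ?thesis by (simp add: Int_def)
qed

end

section \<open>The absorption time and the state of the chain at that time\<close>

context dual_construction
begin

lemma hitting_time_le_iff:
  "\<omega> \<in> space M \<Longrightarrow> 0 \<le> t \<Longrightarrow> hitting_time Xh d \<omega> \<le> ennreal t \<longleftrightarrow> Xh t \<omega> = d"
  using passage_le_iff[of \<omega> t d] Xh_le[of \<omega> t] by (auto simp: hitting_time_d)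

lemma before_passage_less: "before_passage i {\<omega> \<in> space M. passage i \<omega> < a}"
  unfolding before_passage_def
proof (intro conjI allI impI)
  show "{\<omega> \<in> space M. passage i \<omega> < a} \<in> sets M" by measurable
  fix q :: real assume q: "0 < q"
  show "{\<omega> \<in> space M. passage i \<omega> < a} \<inter> {\<omega> \<in> space M. passage i \<omega> < ennreal q} \<in> sets (FH q)"
  proof (cases "ennreal q \<le> a")
    case True
    then have "{\<omega> \<in> space M. passage i \<omega> < a} \<inter> {\<omega> \<in> space M. passage i \<omega> < ennreal q} = {\<omega> \<in> space M. passage i \<omega> < ennreal q}"
      by (blast intro: less_le_trans)
    then show ?thesis using passage_less_FH by simp
  next
    case False
    then obtain c where c: "a = ennreal c" "0 \<le> c" "c \<le> q" by (cases a rule: ennreal_cases) (auto simp: ennreal_le_iff2)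
    have "ennreal c \<le> ennreal q" using c(3) by (rule ennreal_leI)
    then have "{\<omega> \<in> space M. passage i \<omega> < a} \<inter> {\<omega> \<in> space M. passage i \<omega> < ennreal q} = {\<omega> \<in> space M. passage i \<omega> < ennreal c}"
      unfolding c(1) by (blast intro: less_le_trans)
    then show ?thesis using FH_mono[OF c(3) passage_less_FH] by simp
  qed
qed

abbreviation final_state :: "'a \<Rightarrow> nat" where "final_state \<omega> \<equiv> X (enn2real (hitting_time Xh d \<omega>)) \<omega>"

lemma final_state_M[measurable]: "final_state \<in> measurable M (count_space UNIV)"
  by (rule measurable_at_random_time) (auto intro: step_path)

text \<open>The half-lines \<open>{..<a}\<close> generate the Borel sets of \<open>ennreal\<close>,
  so these events are enough for independence, and their strictness matches
  \<open>before_passage\<close>.\<close>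

lemma hitting_time_less_final_state:
  "measure M {\<omega> \<in> space M. hitting_time Xh d \<omega> < a \<and> final_state \<omega> = j} = measure M {\<omega> \<in> space M. hitting_time Xh d \<omega> < a} * pmf \<pi> j"
proof (cases "j \<le> d")
  case True
  let ?B = "{\<omega> \<in> space M. passage d \<omega> < a}"
  have "passage d \<omega> < \<infinity>" if "passage d \<omega> < a" for \<omega> using less_le_trans[OF that, of \<infinity>] by simp
  then have "{\<omega> \<in> space M. hitting_time Xh d \<omega> < a \<and> final_state \<omega> = j} = {\<omega> \<in> ?B. passage d \<omega> < \<infinity> \<and> X (enn2real (passage d \<omega>)) \<omega> = j}"
    and "{\<omega> \<in> space M. hitting_time Xh d \<omega> < a} = {\<omega> \<in> ?B. passage d \<omega> < \<infinity>}"
    by (auto simp: hitting_time_d)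
  then show ?thesis using passage_state[OF before_passage_less True, of a] by simp
next
  case False
  then have "j \<notin> set_pmf \<pi>" using stat by (auto simp: stationary_distribution_def)
  then have "pmf \<pi> j = 0" by (simp add: set_pmf_iff)
  moreover have "{\<omega> \<in> space M. hitting_time Xh d \<omega> < a \<and> final_state \<omega> = j} = {}"
    using False X_le[OF _ enn2real_nonneg] by fastforce
  ultimately show ?thesis by (simp only: measure_empty mult_zero_right)
qed

lemma AE_hitting_time_finite: "AE \<omega> in M. hitting_time Xh d \<omega> < \<infinity>"
  using AE_passage_finite[OF order_refl] AE_space by eventually_elim (simp add: hitting_time_d)

lemma final_state_law: "measure M {\<omega> \<in> space M. final_state \<omega> = j} = pmf \<pi> j"
proof -
  have "measure M {\<omega> \<in> space M. final_state \<omega> = j} = measure M {\<omega> \<in> space M. hitting_time Xh d \<omega> < \<infinity> \<and> final_state \<omega> = j}"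
    using AE_hitting_time_finite by (intro measure_eq_AE) auto
  also have "\<dots> = measure M {\<omega> \<in> space M. hitting_time Xh d \<omega> < \<infinity>} * pmf \<pi> j" by (rule hitting_time_less_final_state)
  also have "measure M {\<omega> \<in> space M. hitting_time Xh d \<omega> < \<infinity>} = 1"
    using AE_hitting_time_finite by (intro prob_eq_1[THEN iffD2]) auto
  finally show ?thesis by simp
qed

lemma indep_final_state: "indep_var borel (hitting_time Xh d) (count_space UNIV) (\<lambda>\<omega>. of_nat (final_state \<omega>))"
proof -
  let ?T = "hitting_time Xh d"
  let ?A = "{?T -` A \<inter> space M | A. A \<in> range lessThan}" and ?B = "{final_state -` A \<inter> space M | A. A \<in> UNIV}"
  have "indep_set ?A ?B"
    unfolding indep_sets2_eq
  proof (intro conjI ballI)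
    show "?A \<subseteq> events"
    proof
      fix x assume "x \<in> ?A"
      then obtain a where "x = ?T -` {..<a} \<inter> space M" by blast
      moreover have "?T -` {..<a} \<inter> space M \<in> events" by measurable
      ultimately show "x \<in> events" by simp
    qed
    show "?B \<subseteq> events" by (auto intro!: measurable_sets[OF final_state_M])
    fix x y assume "x \<in> ?A" "y \<in> ?B"
    then obtain a B where x: "x = {\<omega> \<in> space M. ?T \<omega> < a}" and y: "y = {\<omega> \<in> space M. final_state \<omega> \<in> B}"
      by (auto simp: vimage_def Int_def conj_commute)
    have xM: "x \<in> events" unfolding x by measurable
    have mix: "measure M (x \<inter> {\<omega> \<in> space M. final_state \<omega> = j}) = measure M x * pmf \<pi> j" for j
      using hitting_time_less_final_state[of a j] by (simp add: x Int_def conj_assoc conj_commute conj_left_commute)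
    have yM: "y \<in> events" unfolding y by measurable
    have split: "measure M (z \<inter> y) = (\<Sum>j\<le>d. if j \<in> B then measure M (z \<inter> {\<omega> \<in> space M. final_state \<omega> = j}) else 0)"
      if z: "z \<in> events" for z
    proof -
      have "measure M (z \<inter> y) = (\<Sum>j\<le>d. measure M (z \<inter> y \<inter> {\<omega> \<in> space M. final_state \<omega> = j}))"
        using z yM X_le[OF _ enn2real_nonneg] sets.sets_into_space[OF z] by (intro sum_over_states final_state_M) auto
      also have "\<dots> = (\<Sum>j\<le>d. if j \<in> B then measure M (z \<inter> {\<omega> \<in> space M. final_state \<omega> = j}) else 0)"
      proof (intro sum.cong refl)
        fix j
        have "z \<inter> y \<inter> {\<omega> \<in> space M. final_state \<omega> = j} = (if j \<in> B then z \<inter> {\<omega> \<in> space M. final_state \<omega> = j} else {})"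
          unfolding y by auto
        then show "measure M (z \<inter> y \<inter> {\<omega> \<in> space M. final_state \<omega> = j})
          = (if j \<in> B then measure M (z \<inter> {\<omega> \<in> space M. final_state \<omega> = j}) else 0)" by simp
      qed
      finally show ?thesis .
    qed
    have "measure M (x \<inter> y) = measure M x * (\<Sum>j\<le>d. if j \<in> B then pmf \<pi> j else 0)"
      unfolding split[OF xM] mix sum_distrib_left by (intro sum.cong) auto
    moreover have "measure M y = (\<Sum>j\<le>d. if j \<in> B then pmf \<pi> j else 0)"
    proof -
      have sp: "space M \<inter> {\<omega> \<in> space M. P \<omega>} = {\<omega> \<in> space M. P \<omega>}" for P by auto
      have "space M \<inter> y = y" unfolding y by auto
      then show ?thesis using split[OF sets.top] by (simp add: sp final_state_law cong: if_cong)
    qed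
    ultimately show "measure M (x \<inter> y) = measure M x * measure M y" by simp
  qed
  moreover have "Int_stable ?A"
  proof (rule Int_stableI)
    fix x y assume "x \<in> ?A" "y \<in> ?A"
    then obtain a b where "x = ?T -` {..<a} \<inter> space M" "y = ?T -` {..<b} \<inter> space M" by blast
    then have "x \<inter> y = ?T -` {..<min a b} \<inter> space M" by auto
    then show "x \<inter> y \<in> ?A" by blast
  qed
  moreover have "Int_stable ?B"
  proof (rule Int_stableI)
    fix x y assume "x \<in> ?B" "y \<in> ?B"
    then obtain a b where "x = final_state -` a \<inter> space M" "y = final_state -` b \<inter> space M" by blast
    then have "x \<inter> y = final_state -` (a \<inter> b) \<inter> space M" by auto
    then show "x \<inter> y \<in> ?B" by blast
  qed
  ultimately have "indep_set (sigma_sets (space M) ?A) (sigma_sets (space M) ?B)" by (rule indep_set_sigma_sets)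
  moreover have "sigma_sets (space M) {?T -` A \<inter> space M | A. A \<in> sets borel} = sigma_sets (space M) ?A"
  proof -
    have "sets (borel :: ennreal measure) = sigma_sets UNIV (range lessThan)" unfolding borel_Iio by simp
    then have "{?T -` A \<inter> space M | A. A \<in> sets borel} = sigma_sets (space M) ?A"
      using sigma_sets_vimage_commute[of ?T "space M" UNIV "range lessThan"] by simp
    then show ?thesis using sigma_sets_sigma_sets_eq[of ?A "space M"] by auto
  qed
  moreover have "{(\<lambda>\<omega>. of_nat (final_state \<omega>) :: ennreal) -` A \<inter> space M | A. A \<in> sets (count_space UNIV)} = ?B"
  proof (rule equalityI; rule subsetI)
    fix x assume "x \<in> {(\<lambda>\<omega>. of_nat (final_state \<omega>) :: ennreal) -` A \<inter> space M | A. A \<in> sets (count_space UNIV)}"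
    then obtain A where "x = (\<lambda>\<omega>. of_nat (final_state \<omega>) :: ennreal) -` A \<inter> space M" by blast
    then have "x = final_state -` (of_nat -` A) \<inter> space M" by auto
    then show "x \<in> ?B" by blast
  next
    fix x assume "x \<in> ?B"
    then obtain A where "x = final_state -` A \<inter> space M" by blast
    then have "x = (\<lambda>\<omega>. of_nat (final_state \<omega>) :: ennreal) -` (of_nat ` A) \<inter> space M" by auto
    then show "x \<in> {(\<lambda>\<omega>. of_nat (final_state \<omega>) :: ennreal) -` A \<inter> space M | A. A \<in> sets (count_space UNIV)}" by auto
  qed
  moreover have "random_variable (count_space UNIV) (\<lambda>\<omega>. of_nat (final_state \<omega>) :: ennreal)"
    by (rule measurable_compose[OF final_state_M]) simp
  ultimately show ?thesis unfolding indep_var_eq by (intro conjI) (simp_all only: hitting_time_M)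
qed

theorem strong_stationary: "strong_stationary_time M d G \<pi> X (hitting_time Xh d)"
  unfolding strong_stationary_time_def
proof (intro conjI exI[of _ FZ] markov_chain_FZ AE_hitting_time_finite indep_final_state)
  show "stopping_time FZ (hitting_time Xh d)"
  proof (rule stopping_timeI)
    fix t
    show "Measurable.pred (FZ t) (\<lambda>\<omega>. hitting_time Xh d \<omega> \<le> t)"
    proof (cases t rule: ennreal_cases)
      case (real c)
      have "{\<omega> \<in> space (FZ t). hitting_time Xh d \<omega> \<le> t} = Xh c -` {d} \<inter> space M"
        using hitting_time_le_iff[OF _ real(1)] by (auto simp: space_FZ real(2))
      also have "\<dots> \<in> sets (FZ t)" unfolding sets_FZ using real by (intro sigma_sets.Basic) blast
      finally show ?thesis by (simp add: pred_def)
    qed simp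
  qed
  show "distr M (count_space UNIV) final_state = measure_pmf \<pi>"
  proof (rule measure_eqI_countable[of _ UNIV])
    fix j
    have "emeasure (distr M (count_space UNIV) final_state) {j} = emeasure M (final_state -` {j} \<inter> space M)"
      by (rule emeasure_distr) auto
    also have "final_state -` {j} \<inter> space M = {\<omega> \<in> space M. final_state \<omega> = j}" by auto
    finally show "emeasure (distr M (count_space UNIV) final_state) {j} = emeasure (measure_pmf \<pi>) {j}"
      by (simp add: emeasure_eq_measure final_state_law emeasure_pmf_single)
  qed auto
qed

theorem fastest: "fastest_strong_stationary_time TYPE('b) M d G \<pi> X (hitting_time Xh d)"
  unfolding fastest_strong_stationary_time_def
proof (intro conjI strong_stationary allI impI)
  fix M' :: "'b measure" and X' T' and t :: real
  assume a: "strong_stationary_time M' d G \<pi> X' T' \<and> (AE \<omega> in M'. X' 0 \<omega> = 0)" and t: "0 \<le> t"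
  obtain F where mc: "markov_chain_wrt M' F d G X'" using a by (auto simp: strong_stationary_time_def)
  interpret P: prob_space M' using mc by (simp add: markov_chain_wrt_def)
  have [measurable]: "T' \<in> borel_measurable M'"
    using a P.indep_var_rv1[of borel T'] by (auto simp: strong_stationary_time_def)
  have sub: "subalgebra M' (F u)" for u using mc by (simp add: markov_chain_wrt_def)
  have [measurable]: "X' t \<in> measurable M' (count_space UNIV)"
    using mc t by (intro measurable_from_subalg[OF sub[of "ennreal t"]]) (simp add: markov_chain_wrt_def)
  have "measure M' {\<omega> \<in> space M'. T' \<omega> \<le> ennreal t} * pmf \<pi> d = measure M' {\<omega> \<in> space M'. T' \<omega> \<le> ennreal t \<and> X' t \<omega> = d}"
    using a t by (intro stationary_after_strong_stationary_time[symmetric]) auto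
  also have "\<dots> \<le> measure M' {\<omega> \<in> space M'. X' t \<omega> = d}" by (rule P.finite_measure_mono) auto
  also have "\<dots> = transition_prob G t 0 d" using a t by (intro chain_law[OF mc]) auto
  also have "\<dots> = measure M (lev (X t) d)"
    using chain start t by (intro chain_law[symmetric]) (auto simp: markov_chain_def)
  also have "\<dots> = measure M (space M \<inter> lev (Xh t) d \<inter> lev (X t) d)"
  proof (rule measure_eq_AE)
    show "AE \<omega> in M. \<omega> \<in> lev (X t) d \<longleftrightarrow> \<omega> \<in> space M \<inter> lev (Xh t) d \<inter> lev (X t) d"
      using AE_link_pos AE_space
    proof eventually_elim
      case (elim \<omega>)
      then have "X t \<omega> \<le> Xh t \<omega>" "Xh t \<omega> \<le> d" using t Xh_le by auto
      then show ?case using elim(2) by auto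
    qed
  qed (use t lev_M in auto)
  also have "\<dots> = measure M (space M \<inter> lev (Xh t) d) * pmf \<pi> d"
    using dual_link[OF _ t order_refl order_refl, of "space M"] sets.top[of "FH t"] by (simp add: natural_filtration_space lam_d)
  also have "space M \<inter> lev (Xh t) d = {\<omega> \<in> space M. hitting_time Xh d \<omega> \<le> ennreal t}"
    using hitting_time_le_iff[OF _ t] by auto
  \<comment> \<open>The factor \<open>pmf \<pi> d\<close> is a diagonal entry of the link, hence
    positive, and cancels.\<close>
  finally have le: "measure M' {\<omega> \<in> space M'. T' \<omega> \<le> ennreal t} \<le> measure M {\<omega> \<in> space M. hitting_time Xh d \<omega> \<le> ennreal t}"
    using pmf_\<pi>_pos by simp
  have "measure M {\<omega> \<in> space M. \<not> hitting_time Xh d \<omega> \<le> ennreal t} = 1 - measure M {\<omega> \<in> space M. hitting_time Xh d \<omega> \<le> ennreal t}"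
    by (rule prob_neg) measurable
  moreover have "measure M' {\<omega> \<in> space M'. \<not> T' \<omega> \<le> ennreal t} = 1 - measure M' {\<omega> \<in> space M'. T' \<omega> \<le> ennreal t}"
    by (rule P.prob_neg) measurable
  ultimately show "measure M {\<omega> \<in> space M. ennreal t < hitting_time Xh d \<omega>} \<le> measure M' {\<omega> \<in> space M'. ennreal t < T' \<omega>}"
    using le by (simp add: not_le)
qed

end

section \<open>Waiting times between births\<close>

context dual_construction
begin

text \<open>Written with sums instead of differences of passage times, so that infinite values need
  no separate treatment.\<close>

definition long_waits :: "(nat \<Rightarrow> real) \<Rightarrow> nat \<Rightarrow> 'a set" where
  "long_waits u n = {\<omega> \<in> space M. \<forall>j<n. passage j \<omega> + ennreal (u j) < passage (Suc j) \<omega>}"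

lemma long_waits_M: "long_waits u n \<in> sets M"
proof -
  have "long_waits u n = {\<omega> \<in> space M. \<forall>j\<in>{..<n}. passage j \<omega> + ennreal (u j) < passage (Suc j) \<omega>}"
    by (auto simp: long_waits_def)
  also have "\<dots> \<in> sets M" by measurable
  finally show ?thesis .
qed

text \<open>A rational \<open>r\<close> between \<open>passage j + u\<close> and the next passage
  witnesses the long wait through two earlier events: level \<open>j\<close> is reached before
  \<open>r - u\<close>, and level \<open>j + 1\<close> is not reached by \<open>r\<close>. As
  \<open>j < n\<close>, such an \<open>r\<close> lies below \<open>q\<close>.\<close>

lemma wait_before_passage:
  assumes u: "0 \<le> u" and j: "j < n" and q: "0 < q"
  shows "{\<omega> \<in> space M. passage j \<omega> + ennreal u < passage (Suc j) \<omega> \<and> passage n \<omega> < ennreal q} \<in> sets (FH q)"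
proof -
  let ?R = "{r \<in> \<rat>. u < r \<and> r < q}"
  let ?B = "\<lambda>r. {\<omega> \<in> space M. passage j \<omega> < ennreal (r - u)} \<inter> (space M - {\<omega> \<in> space M. Suc j \<le> Xh r \<omega>}) \<inter> {\<omega> \<in> space M. passage n \<omega> < ennreal q}"
  have "{\<omega> \<in> space M. passage j \<omega> + ennreal u < passage (Suc j) \<omega> \<and> passage n \<omega> < ennreal q} = (\<Union>r\<in>?R. ?B r)"
  proof (rule equalityI; rule subsetI)
    fix \<omega> assume "\<omega> \<in> {\<omega> \<in> space M. passage j \<omega> + ennreal u < passage (Suc j) \<omega> \<and> passage n \<omega> < ennreal q}"
    then have \<omega>: "\<omega> \<in> space M" and lt: "passage j \<omega> + ennreal u < passage (Suc j) \<omega>" and lq: "passage n \<omega> < ennreal q" by auto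
    have "passage (Suc j) \<omega> \<le> passage n \<omega>" using j by (intro passage_mono) simp
    then obtain b where b: "passage (Suc j) \<omega> = ennreal b" "0 \<le> b" "b < q"
      using lq by (cases "passage (Suc j) \<omega>" rule: ennreal_cases) (auto simp: ennreal_less_iff dest: le_less_trans)
    have "passage j \<omega> \<le> passage (Suc j) \<omega>" by (intro passage_mono) simp
    then obtain a where a: "passage j \<omega> = ennreal a" "0 \<le> a"
      using b(1) by (cases "passage j \<omega>" rule: ennreal_cases) (auto simp: top_unique)
    have "a + u < b" using lt u a b by (simp add: ennreal_less_iff flip: ennreal_plus)
    then obtain r where r: "r \<in> \<rat>" "a + u < r" "r < b" using Rats_dense_in_real by blast
    have "passage j \<omega> < ennreal (r - u)" using a r by (simp add: ennreal_less_iff)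
    moreover have "\<not> Suc j \<le> Xh r \<omega>"
      using passage_le_iff[OF \<omega>, of r "Suc j"] a u r b by (simp add: ennreal_le_iff)
    ultimately have "\<omega> \<in> ?B r" using \<omega> lq by blast
    moreover have "r \<in> ?R" using r a b by simp
    ultimately show "\<omega> \<in> (\<Union>r\<in>?R. ?B r)" by blast
  next
    fix \<omega> assume "\<omega> \<in> (\<Union>r\<in>?R. ?B r)"
    then obtain r where r: "u < r" and \<omega>: "\<omega> \<in> space M" and lt: "passage j \<omega> < ennreal (r - u)"
      and n: "\<not> Suc j \<le> Xh r \<omega>" and lq: "passage n \<omega> < ennreal q" by blast
    obtain p where p: "passage j \<omega> = ennreal p" "0 \<le> p" "p < r - u"
      using lt by (cases "passage j \<omega>" rule: ennreal_cases) (auto simp: ennreal_less_iff)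
    have "passage j \<omega> + ennreal u < ennreal r" using p u by (simp add: ennreal_less_iff flip: ennreal_plus)
    also have "\<dots> < passage (Suc j) \<omega>" using passage_le_iff[OF \<omega>, of r "Suc j"] r u n by (simp add: not_le)
    finally show "\<omega> \<in> {\<omega> \<in> space M. passage j \<omega> + ennreal u < passage (Suc j) \<omega> \<and> passage n \<omega> < ennreal q}"
      using \<omega> lq by simp
  qed
  also have "\<dots> \<in> sets (FH q)"
  proof (rule sets.countable_UN'')
    show "countable ?R" by (rule countable_subset[OF _ countable_rat]) auto
    fix r assume r: "r \<in> ?R"
    have "space M \<in> sets (FH q)" using sets.top[of "FH q"] by (simp add: natural_filtration_space)
    then show "?B r \<in> sets (FH q)"
      using r u by (intro sets.Int sets.Diff FH_mono[OF _ passage_less_FH, of "r - u" q] passage_less_FH FH_ge) auto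
  qed
  finally show ?thesis .
qed

lemma long_waits_before_passage:
  assumes "\<And>j. j < n \<Longrightarrow> 0 \<le> u j" shows "before_passage n (long_waits u n)"
  unfolding before_passage_def
proof (intro conjI long_waits_M allI impI)
  fix q :: real assume q: "0 < q"
  show "long_waits u n \<inter> {\<omega> \<in> space M. passage n \<omega> < ennreal q} \<in> sets (FH q)"
  proof (cases "n = 0")
    case True
    then have "long_waits u n \<inter> {\<omega> \<in> space M. passage n \<omega> < ennreal q} = {\<omega> \<in> space M. passage n \<omega> < ennreal q}"
      by (auto simp: long_waits_def)
    then show ?thesis using passage_less_FH by simp
  next
    case False
    then have "long_waits u n \<inter> {\<omega> \<in> space M. passage n \<omega> < ennreal q}
        = (\<Inter>j\<in>{..<n}. {\<omega> \<in> space M. passage j \<omega> + ennreal (u j) < passage (Suc j) \<omega> \<and> passage n \<omega> < ennreal q})"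
      by (auto simp: long_waits_def)
    also have "\<dots> \<in> sets (FH q)"
      using False assms q by (intro sets.finite_INT wait_before_passage) auto
    finally show ?thesis .
  qed
qed

text \<open>The first \<open>n\<close> waits are decided by the passage to \<open>n\<close>, so
  \<open>passage_wait\<close> contributes one more exponential factor at each step.\<close>

lemma long_waits_prob:
  assumes u: "\<And>j. 0 \<le> u j" shows "n \<le> d \<Longrightarrow> measure M (long_waits u n) = (\<Prod>j<n. exp (- \<nu> j * u j))"
proof (induction n)
  case 0
  show ?case by (simp add: long_waits_def prob_space)
next
  case (Suc n)
  have n: "n < d" using Suc.prems by simp
  have "long_waits u (Suc n) = {\<omega> \<in> long_waits u n. passage n \<omega> < \<infinity> \<and> passage n \<omega> + ennreal (u n) < passage (Suc n) \<omega>}"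
  proof -
    have "passage n \<omega> < \<infinity>" if "passage n \<omega> + c < y" for \<omega> c y
      using that by (cases "passage n \<omega>" rule: ennreal_cases) auto
    then show ?thesis by (auto simp: long_waits_def less_Suc_eq)
  qed
  then have "measure M (long_waits u (Suc n)) = exp (- \<nu> n * u n) * measure M {\<omega> \<in> long_waits u n. passage n \<omega> < \<infinity>}"
    using passage_wait[OF long_waits_before_passage n u] u by simp
  also have "measure M {\<omega> \<in> long_waits u n. passage n \<omega> < \<infinity>} = measure M (long_waits u n)"
  proof (rule measure_eq_AE)
    show "AE \<omega> in M. \<omega> \<in> {\<omega> \<in> long_waits u n. passage n \<omega> < \<infinity>} \<longleftrightarrow> \<omega> \<in> long_waits u n"
      using AE_passage_finite[of n] n by (auto elim: eventually_mono)
    have "{\<omega> \<in> long_waits u n. passage n \<omega> < \<infinity>} = long_waits u n \<inter> {\<omega> \<in> space M. passage n \<omega> < \<infinity>}"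
      by (auto simp: long_waits_def)
    also have "\<dots> \<in> sets M" by (intro sets.Int long_waits_M) measurable
    finally show "{\<omega> \<in> long_waits u n. passage n \<omega> < \<infinity>} \<in> sets M" .
  qed (rule long_waits_M)
  finally show ?case using Suc by simp
qed

abbreviation wait :: "nat \<Rightarrow> 'a \<Rightarrow> real" where "wait \<equiv> birth_wait Xh"

lemma wait_M[measurable]: "wait i \<in> borel_measurable M"
  unfolding birth_wait_def[abs_def] by measurable

lemma AE_wait:
  "AE \<omega> in M. \<forall>i<d. 0 < wait i \<omega> \<and> (\<forall>u\<ge>0. passage i \<omega> + ennreal u < passage (Suc i) \<omega> \<longleftrightarrow> u < wait i \<omega>)"
proof -
  have "AE \<omega> in M. \<forall>i\<in>{..d}. passage i \<omega> < \<infinity>" by (intro AE_finite_allI AE_passage_finite) auto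
  then show ?thesis
    using AE_passage AE_hitting_time AE_space
  proof eventually_elim
    case (elim \<omega>)
    show ?case
    proof (intro allI impI)
      fix i assume i: "i < d"
      obtain a where a: "passage i \<omega> = ennreal a" "0 \<le> a"
        using elim(1) i by (cases "passage i \<omega>" rule: ennreal_cases) (auto dest: bspec[of _ _ i])
      obtain b where b: "passage (Suc i) \<omega> = ennreal b" "0 \<le> b"
        using elim(1) i by (cases "passage (Suc i) \<omega>" rule: ennreal_cases) (auto dest: bspec[of _ _ "Suc i"])
      have w: "wait i \<omega> = b - a" using elim(3) i a b by (simp add: birth_wait_def)
      have "Xh a \<omega> = i" using elim(2)[THEN conjunct2, rule_format, of i] i a by simp
      then have "\<not> passage (Suc i) \<omega> \<le> ennreal a" using passage_le_iff[OF elim(4) a(2), of "Suc i"] by simp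
      then have "a < b" using a b by (simp add: not_le ennreal_less_iff)
      moreover have "passage i \<omega> + ennreal u < passage (Suc i) \<omega> \<longleftrightarrow> u < wait i \<omega>" if "0 \<le> u" for u
        unfolding a(1) b(1) w using that a(2) b(2) by (auto simp: ennreal_less_iff simp flip: ennreal_plus)
      ultimately show "0 < wait i \<omega> \<and> (\<forall>u\<ge>0. passage i \<omega> + ennreal u < passage (Suc i) \<omega> \<longleftrightarrow> u < wait i \<omega>)"
        using w by simp
    qed
  qed
qed

lemma joint_wait_tail:
  assumes J: "J \<subseteq> {..<d}"
  shows "measure M {\<omega> \<in> space M. \<forall>j\<in>J. u j < wait j \<omega>} = (\<Prod>j\<in>J. exp (- \<nu> j * max 0 (u j)))"
proof -
  \<comment> \<open>Waits are positive almost surely, so the threshold \<open>0\<close> costs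
    nothing; it replaces negative thresholds and fills the indices outside \<open>J\<close>.\<close>
  define v where "v j = (if j \<in> J then max 0 (u j) else 0)" for j
  have fin: "finite J" using J finite_subset by blast
  have M: "{\<omega> \<in> space M. \<forall>j\<in>J. u j < wait j \<omega>} \<in> sets M" using fin by measurable
  have "measure M {\<omega> \<in> space M. \<forall>j\<in>J. u j < wait j \<omega>} = measure M (long_waits v d)"
  proof (rule measure_eq_AE)
    show "AE \<omega> in M. \<omega> \<in> {\<omega> \<in> space M. \<forall>j\<in>J. u j < wait j \<omega>} \<longleftrightarrow> \<omega> \<in> long_waits v d"
      using AE_wait AE_space
    proof eventually_elim
      case (elim \<omega>)
      have "passage j \<omega> + ennreal (v j) < passage (Suc j) \<omega> \<longleftrightarrow> (j \<in> J \<longrightarrow> u j < wait j \<omega>)" if j: "j < d" for j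
      proof -
        have "0 \<le> v j" by (simp add: v_def)
        then have "passage j \<omega> + ennreal (v j) < passage (Suc j) \<omega> \<longleftrightarrow> v j < wait j \<omega>" using elim(1) j by blast
        then show ?thesis using elim(1) j by (auto simp: v_def)
      qed
      then show ?case using elim(2) J by (auto simp: long_waits_def)
    qed
  qed (rule M long_waits_M)+
  also have "\<dots> = (\<Prod>j<d. exp (- \<nu> j * v j))" by (rule long_waits_prob) (simp_all add: v_def)
  also have "\<dots> = (\<Prod>j\<in>J. exp (- \<nu> j * v j))"
    using J by (intro prod.mono_neutral_right) (auto simp: v_def)
  also have "\<dots> = (\<Prod>j\<in>J. exp (- \<nu> j * max 0 (u j)))" by (intro prod.cong) (auto simp: v_def)
  finally show ?thesis .
qed

lemma wait_tail: "i < d \<Longrightarrow> measure M {\<omega> \<in> space M. a < wait i \<omega>} = exp (- \<nu> i * max 0 a)"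
  using joint_wait_tail[of "{i}" "\<lambda>_. a"] by simp

text \<open>The joint tails factor over every set of indices, and the half-lines
  \<open>{a<..}\<close> form an intersection-stable generator of the Borel sets.\<close>

lemma indep_waits: "indep_vars (\<lambda>_. borel) wait {..<d}"
  unfolding indep_vars_def
proof (intro conjI ballI wait_M)
  let ?E = "\<lambda>i. {wait i -` A \<inter> space M | A. A \<in> range greaterThan}"
  have "indep_sets ?E {..<d}"
  proof (rule indep_setsI)
    fix i
    show "?E i \<subseteq> events"
    proof
      fix x assume "x \<in> ?E i"
      then obtain a where "x = wait i -` {a<..} \<inter> space M" by blast
      moreover have "wait i -` {a<..} \<inter> space M \<in> events" by measurable
      ultimately show "x \<in> events" by simp
    qed
  next
    fix A J assume J: "J \<noteq> {}" "J \<subseteq> {..<d}" "finite J" and A: "\<forall>j\<in>J. A j \<in> ?E j"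
    have "\<forall>j\<in>J. \<exists>a. A j = {\<omega> \<in> space M. a < wait j \<omega>}"
    proof
      fix j assume "j \<in> J"
      then obtain a where "A j = wait j -` {a<..} \<inter> space M" using A by blast
      then have "A j = {\<omega> \<in> space M. a < wait j \<omega>}" by auto
      then show "\<exists>a. A j = {\<omega> \<in> space M. a < wait j \<omega>}" ..
    qed
    then obtain u where u: "\<And>j. j \<in> J \<Longrightarrow> A j = {\<omega> \<in> space M. u j < wait j \<omega>}" by metis
    have "(\<Inter>j\<in>J. A j) = {\<omega> \<in> space M. \<forall>j\<in>J. u j < wait j \<omega>}" using J(1) u by auto
    then have "prob (\<Inter>j\<in>J. A j) = (\<Prod>j\<in>J. exp (- \<nu> j * max 0 (u j)))" using joint_wait_tail[OF J(2)] by simp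
    also have "\<dots> = (\<Prod>j\<in>J. prob (A j))"
    proof (rule prod.cong[OF refl])
      fix j assume j: "j \<in> J"
      then show "exp (- \<nu> j * max 0 (u j)) = prob (A j)" unfolding u[OF j] using J(2) by (subst wait_tail) auto
    qed
    finally show "prob (\<Inter>j\<in>J. A j) = (\<Prod>j\<in>J. prob (A j))" .
  qed
  then have "indep_sets (\<lambda>i. sigma_sets (space M) (?E i)) {..<d}"
  proof (rule indep_sets_sigma)
    fix i
    show "Int_stable (?E i)"
    proof (rule Int_stableI)
      fix x y assume "x \<in> ?E i" "y \<in> ?E i"
      then obtain a b where "x = wait i -` {a<..} \<inter> space M" "y = wait i -` {b<..} \<inter> space M" by blast
      then have "x \<inter> y = wait i -` {max a b<..} \<inter> space M" by auto
      then show "x \<inter> y \<in> ?E i" by blast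
    qed
  qed
  moreover have "sigma_sets (space M) {wait i -` A \<inter> space M | A. A \<in> sets borel} = sigma_sets (space M) (?E i)" for i
  proof -
    have "sets (borel :: real measure) = sigma_sets UNIV (range greaterThan)" unfolding borel_Ioi by simp
    then have "{wait i -` A \<inter> space M | A. A \<in> sets borel} = sigma_sets (space M) (?E i)"
      using sigma_sets_vimage_commute[of "wait i" "space M" UNIV "range greaterThan"] by simp
    then show ?thesis using sigma_sets_sigma_sets_eq[of "?E i" "space M"] by auto
  qed
  ultimately show "indep_sets (\<lambda>i. sigma_sets (space M) {wait i -` A \<inter> space M |A. A \<in> sets borel}) {..<d}"
    by simp
qed

lemma wait_exponential:
  assumes i: "i < d" shows "distributed M lborel (wait i) (exponential_density (\<nu> i))"
proof (subst exponential_distributed_iff[OF \<nu>_pos[OF i]], intro conjI wait_M allI impI)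
  fix a :: real assume a: "0 \<le> a"
  have "measure M {\<omega> \<in> space M. \<not> a < wait i \<omega>} = 1 - measure M {\<omega> \<in> space M. a < wait i \<omega>}"
    by (rule prob_neg) measurable
  then show "measure M {\<omega> \<in> space M. wait i \<omega> \<le> a} = 1 - exp (- a * \<nu> i)"
    using a by (simp add: wait_tail[OF i] not_less mult.commute)
qed

lemma AE_hitting_time_sum: "AE \<omega> in M. hitting_time Xh d \<omega> = ennreal (\<Sum>i<d. wait i \<omega>)"
  using AE_hitting_time_finite AE_hitting_time AE_space
proof eventually_elim
  case (elim \<omega>)
  have "passage 0 \<omega> \<le> ennreal 0" using passage_le_iff[OF elim(3), of 0 0] by simp
  then have "hitting_time Xh 0 \<omega> = 0" using elim(2) by simp
  moreover have "(\<Sum>i<d. wait i \<omega>) = enn2real (hitting_time Xh d \<omega>) - enn2real (hitting_time Xh 0 \<omega>)"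
    using sum_lessThan_telescope[of "\<lambda>i. enn2real (hitting_time Xh i \<omega>)" d] by (simp add: birth_wait_def)
  ultimately show ?case using elim(1) by (simp add: ennreal_enn2real_if)
qed

end

theorem mainTheorem5:
  fixes d :: nat and G :: "real mat" and \<pi> :: "nat pmf" and \<nu> :: "nat \<Rightarrow> real"
    and M :: "'a measure" and X :: "real \<Rightarrow> 'a \<Rightarrow> nat" and V :: "nat \<Rightarrow> 'a \<Rightarrow> ennreal"
  defines "Xhat \<equiv> dual_process X V"
    and "\<tau> \<equiv> epoch X V"
  assumes "bd_generator d G"
    and "irreducible_generator d G"
    and "stationary_distribution d G \<pi>"
    and "eigenvalue_listing d G \<nu>"
    and "markov_chain M d G X"
    and "AE \<omega> in M. X 0 \<omega> = 0"
    and "birth_clocks M d G \<nu> X V"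
  shows "(AE \<omega> in M. \<forall>n. \<tau> n \<omega> < \<infinity> \<longrightarrow>
            link d G \<nu> $$ (Xhat (enn2real (\<tau> n \<omega>)) \<omega>, X (enn2real (\<tau> n \<omega>)) \<omega>) > 0 \<and>
            X (enn2real (\<tau> n \<omega>)) \<omega> \<le> Xhat (enn2real (\<tau> n \<omega>)) \<omega>) \<and>
         markov_chain M d (pure_birth_generator d \<nu>) Xhat \<and>
         fastest_strong_stationary_time TYPE('b) M d G \<pi> X (hitting_time Xhat d) \<and>
         prob_space.indep_vars M (\<lambda>_. borel) (birth_wait Xhat) {..<d} \<and>
         (\<forall>i<d. distributed M lborel (birth_wait Xhat i) (exponential_density (\<nu> i))) \<and>
         (AE \<omega> in M. hitting_time Xhat d \<omega> = ennreal (\<Sum>i<d. birth_wait Xhat i \<omega>))"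
proof -
  interpret dual_construction d G \<nu> \<pi> M X V
    using assms by unfold_locales
  \<comment> \<open>Positivity holds at all times outside a single null set, hence also at the
    random epochs.\<close>
  have "AE \<omega> in M. \<forall>n. epoch X V n \<omega> < \<infinity> \<longrightarrow>
      link d G \<nu> $$ (dual_process X V (enn2real (epoch X V n \<omega>)) \<omega>, X (enn2real (epoch X V n \<omega>)) \<omega>) > 0 \<and>
      X (enn2real (epoch X V n \<omega>)) \<omega> \<le> dual_process X V (enn2real (epoch X V n \<omega>)) \<omega>"
    using AE_link_pos by eventually_elim (simp add: enn2real_nonneg)
  then show ?thesis
    unfolding Xhat_def \<tau>_def
    using markov_chain_dual fastest indep_waits wait_exponential AE_hitting_time_sum by blast
qed

end
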